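(* Let $p,q,m,n$ be positive odd integers with $\gcd(p,q)=1$, $q\mid p+m-1$ and $p\mid q+n-1$, and suppose that $r_1=(p+m-1)/q$ and $r_2=(q+n-1)/p$ are odd. Assume $r_1>r_2$ and $m>n$. Consider the system $$\frac{dx}{dt}=\sum_{i=0}^{[r_1/p]}a_ix^{iq}y^{r_1-ip},\qquad \frac{dy}{dt}=b_0x^{r_2}, \tag{A}$$ with real coefficients satisfying $a_0b_0<0$. Let $\kappa=[r_1/p]$ if $[r_1/p]$ is odd and $\kappa=[r_1/p]-1$ if $[r_1/p]$ is even. Then: (i) The origin is a center of (A) if and only if $a_1=a_3=\cdots=a_\kappa=0$. (ii) If $a_1=a_3=\cdots=a_{2i-3}=0$ and $a_{2i-1}\neq0$, where $2i-1\leq\kappa$, then the origin is a weak focus, and under perturbations inside the family (A) it can produce $i-1$ limit cycles. (iii) The cyclicity of the center (inside the family (A)) is $(\kappa-1)/2=\left[([r_1/p]-1)/2\right]$.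
   Context: $[\cdot]$ denotes the integer part (floor). A singular point $O$ is a center if it has a neighborhood $U$ such that $U\setminus\{O\}$ is filled with periodic orbits. A limit cycle is an isolated periodic orbit. A weak focus is a focus (nearby orbits spiral towards it or away from it) at which the eigenvalues of the linearization have zero real part; the linearization may be nilpotent or zero. The family (A) is parametrized by the real coefficients $a_i$ ($0\le i\le[r_1/p]$) and $b_0$, with $p,q,m,n$ fixed. The origin "can produce $k$ limit cycles under perturbations inside the family" if in every neighborhood of the origin there are $k$ limit cycles for some arbitrarily small perturbations of the coefficients. The cyclicity of the origin is the maximum number of limit cycles that can emerge from the origin in this sense (i.e. in arbitrarily small neighborhoods of the origin under arbitrarily small perturbations of the coefficients inside the family).
   Formalization: When [r1/p]=0 (e.g. p=5, q=3, m=5, n=3, so r1=3, r2=1), the formula in (iii) would give cyclicity −1, which is impossible; the formal statement takes the value 0 there, and agrees with the stated formula whenever [r1/p]≥1. *)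

theory Defs
  imports "HOL-Analysis.Analysis" "HOL-Library.Extended_Nat"
begin

definition periodic_orbit :: "(real^2 \<Rightarrow> real^2) \<Rightarrow> (real^2) set \<Rightarrow> bool" where
  "periodic_orbit f \<gamma> \<longleftrightarrow>
     (\<exists>\<phi> T. T > 0 \<and> (\<forall>t. (\<phi> has_vector_derivative f (\<phi> t)) (at t)) \<and>
        (\<forall>t. \<phi> (t + T) = \<phi> t) \<and> (\<exists>t. \<phi> t \<noteq> \<phi> 0) \<and> \<gamma> = range \<phi>)"

definition limit_cycle :: "(real^2 \<Rightarrow> real^2) \<Rightarrow> (real^2) set \<Rightarrow> bool" where
  "limit_cycle f \<gamma> \<longleftrightarrow> periodic_orbit f \<gamma> \<and>
     (\<exists>V. open V \<and> \<gamma> \<subseteq> V \<and> (\<forall>\<gamma>'. periodic_orbit f \<gamma>' \<and> \<gamma>' \<subseteq> V \<longrightarrow> \<gamma>' = \<gamma>))"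

definition is_center :: "(real^2 \<Rightarrow> real^2) \<Rightarrow> real^2 \<Rightarrow> bool" where
  "is_center f z0 \<longleftrightarrow> f z0 = 0 \<and>
     (\<exists>U G. open U \<and> z0 \<in> U \<and> (\<forall>\<gamma>\<in>G. periodic_orbit f \<gamma>) \<and> U - {z0} = \<Union>G)"

(* The forward solution tends to z0 while its polar angle around z0, taken as a
   continuous lift, is unbounded in the limit (infinitely many turns). *)
definition spirals_towards :: "(real^2 \<Rightarrow> real^2) \<Rightarrow> real^2 \<Rightarrow> (real \<Rightarrow> real^2) \<Rightarrow> bool" where
  "spirals_towards f z0 \<phi> \<longleftrightarrow>
     (\<forall>t\<ge>0. (\<phi> has_vector_derivative f (\<phi> t)) (at t within {0..})) \<and>
     (\<forall>t\<ge>0. \<phi> t \<noteq> z0) \<and> (\<phi> \<longlongrightarrow> z0) at_top \<and>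
     (\<exists>\<theta> :: real \<Rightarrow> real. continuous_on {0..} \<theta> \<and>
        (\<forall>t\<ge>0. \<phi> t - z0 = norm (\<phi> t - z0) *\<^sub>R vector [cos (\<theta> t), sin (\<theta> t)]) \<and>
        filterlim \<theta> at_infinity at_top)"

definition stable_focus :: "(real^2 \<Rightarrow> real^2) \<Rightarrow> real^2 \<Rightarrow> bool" where
  "stable_focus f z0 \<longleftrightarrow> f z0 = 0 \<and>
     (\<exists>U. open U \<and> z0 \<in> U \<and> (\<forall>z\<in>U - {z0}. \<exists>\<phi>. \<phi> 0 = z \<and> spirals_towards f z0 \<phi>))"

(* Spiralling away from z0 is spiralling towards z0 for the time-reversed field. *)
definition is_focus :: "(real^2 \<Rightarrow> real^2) \<Rightarrow> real^2 \<Rightarrow> bool" where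
  "is_focus f z0 \<longleftrightarrow> stable_focus f z0 \<or> stable_focus (\<lambda>z. - f z) z0"

definition complex_eigenvalue :: "real^'n^'n \<Rightarrow> complex \<Rightarrow> bool" where
  "complex_eigenvalue A \<mu> \<longleftrightarrow>
     (\<exists>v :: complex^'n. v \<noteq> 0 \<and> map_matrix complex_of_real A *v v = \<mu> *s v)"

definition weak_focus :: "(real^2 \<Rightarrow> real^2) \<Rightarrow> real^2 \<Rightarrow> bool" where
  "weak_focus f z0 \<longleftrightarrow> is_focus f z0 \<and>
     (\<forall>\<mu>. complex_eigenvalue (jacobian f (at z0)) \<mu> \<longrightarrow> Re \<mu> = 0)"

(* Only the coefficients a i with i \<le> r1 div p occur. *)
definition family_A ::
    "nat \<Rightarrow> nat \<Rightarrow> nat \<Rightarrow> nat \<Rightarrow> (nat \<Rightarrow> real) \<Rightarrow> real \<Rightarrow> real^2 \<Rightarrow> real^2" where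
  "family_A p q r1 r2 a b0 z =
     vector [\<Sum>i\<le>r1 div p. a i * (z $ 1) ^ (i * q) * (z $ 2) ^ (r1 - i * p),
             b0 * (z $ 1) ^ r2]"

definition can_produce_limit_cycles ::
    "nat \<Rightarrow> nat \<Rightarrow> nat \<Rightarrow> nat \<Rightarrow> (nat \<Rightarrow> real) \<Rightarrow> real \<Rightarrow> nat \<Rightarrow> bool" where
  "can_produce_limit_cycles p q r1 r2 a b0 k \<longleftrightarrow>
     (\<forall>U \<epsilon>. open U \<and> 0 \<in> U \<and> \<epsilon> > 0 \<longrightarrow>
        (\<exists>a' b0'. (\<forall>i\<le>r1 div p. \<bar>a' i - a i\<bar> < \<epsilon>) \<and> \<bar>b0' - b0\<bar> < \<epsilon> \<and>
           (\<exists>L. finite L \<and> card L = k \<and>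
              (\<forall>\<gamma>\<in>L. limit_cycle (family_A p q r1 r2 a' b0') \<gamma> \<and> \<gamma> \<subseteq> U))))"

(* The maximum of the attainable numbers of limit cycles, and infinity if they are
   unbounded; 0 is always attainable. *)
definition cyclicity ::
    "nat \<Rightarrow> nat \<Rightarrow> nat \<Rightarrow> nat \<Rightarrow> (nat \<Rightarrow> real) \<Rightarrow> real \<Rightarrow> enat" where
  "cyclicity p q r1 r2 a b0 = Sup (enat ` {k. can_produce_limit_cycles p q r1 r2 a b0 k})"

(* Truncated subtraction: for K = 0 this is 0 (not -1), so that (kappa K - 1) div 2
   and (K - 1) div 2 are 0 there as well. *)
definition kappa :: "nat \<Rightarrow> nat" where
  "kappa K = (if odd K then K else K - 1)"

end

theory Submission
  imports Defs "HOL-Complex_Analysis.Complex_Analysis"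
begin

text \<open>In generalized polar coordinates \<open>x = \<rho>^(r1+1) sin t\<close>, \<open>y = -
  \<rho>^(r2+1) cos t\<close> the terms with \<open>i = 0\<close> and \<open>b0\<close> are
  quasi-homogeneous of the same order, and the term with index \<open>i\<close> is smaller by a
  factor \<open>\<rho>^(i*(m-n))\<close>. Taking the first integral of the quasi-homogeneous part as
  radial variable turns the system into a scalar equation that depends holomorphically on the
  initial value \<open>s\<close>; the half-return map from \<open>t = 0\<close> to \<open>t =
  \<pi>\<close> is \<open>s * exp (V s)\<close>. All exponents of \<open>x\<close> and
  \<open>y\<close> in the terms with even \<open>i\<close> have the parity that makes the equation
  reversible, so they alone give \<open>V = 0\<close>, a center; in general \<open>V s\<close> is
  the sum of \<open>a j * s^j * \<psi> j s\<close> over the odd \<open>j\<close>, where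
  \<open>\<psi> j\<close> is holomorphic and \<open>\<psi> j 0\<close> a positive Wallis integral.
  The lowest nonzero odd coefficient thus decides stability. Repeated division and differentiation
  bounds the number of small positive zeros of \<open>V\<close> by the number of odd indices minus
  one, and coefficients of alternating signs and rapidly decreasing size realize the bound. As the
  system is odd, its small periodic orbits correspond to fixed points of the half-return
  map.\<close>

section \<open>Uniqueness of solutions\<close>

text \<open>The order of quantifiers shapes the proof. Cyclicity fixes a neighbourhood before the
  perturbation is chosen, whereas the functions \<psi> j change with all coefficients and are known
  only through bounds. Every radius is therefore computed from constants alone:
  \<open>unit_class\<close> records a disc, an upper bound and a lower bound at the origin, and zero
  counts hold for whole classes at once. The complex parameter makes this cheap: Cauchy's estimate
  bounds each derivative by the function itself, so the class survives repeated division and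
  differentiation, and division by \<open>s^j\<close> leaves a removable singularity. A second
  obstacle is that a periodic orbit is given merely as the range of a periodic solution, without an
  angle. It is located at its farthest crossing of the line \<open>x = 0\<close>, where maximality
  in both time directions forces a fixed point of the half-return map, so no angle has to be
  followed along an unknown orbit.\<close>

text \<open>The squared distance weighted by \<open>exp (c * t)\<close> is monotone:
  \<open>c = -2*L\<close> makes it nonincreasing after \<open>t0\<close>, \<open>c = 2*L\<close>
  nondecreasing before \<open>t0\<close>, and it vanishes at \<open>t0\<close>. The Lipschitz bound
  is asked only along the two given curves, so locally Lipschitz fields are covered.\<close>

lemma ode_unique:
  fixes x y :: "real \<Rightarrow> 'a::real_inner"
  assumes x: "\<And>t. t \<in> {a..b} \<Longrightarrow> (x has_vector_derivative f t (x t)) (at t within {a..b})"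
    and y: "\<And>t. t \<in> {a..b} \<Longrightarrow> (y has_vector_derivative f t (y t)) (at t within {a..b})"
    and L: "\<And>t. t \<in> {a..b} \<Longrightarrow> norm (f t (x t) - f t (y t)) \<le> L * norm (x t - y t)"
    and t0: "t0 \<in> {a..b}" "x t0 = y t0" and t: "t \<in> {a..b}"
  shows "x t = y t"
proof -
  define d where "d t = x t - y t" for t
  define d' where "d' t = f t (x t) - f t (y t)" for t
  have der: "(d has_vector_derivative d' t) (at t within {a..b})" if "t \<in> {a..b}" for t
    unfolding d_def d'_def using x[OF that] y[OF that] by (rule has_vector_derivative_diff)
  have inn: "\<bar>d t \<bullet> d' t\<bar> \<le> L * (d t \<bullet> d t)" if "t \<in> {a..b}" for t
  proof -
    have "\<bar>d t \<bullet> d' t\<bar> \<le> norm (d t) * norm (d' t)" by (rule Cauchy_Schwarz_ineq2)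
    also have "\<dots> \<le> norm (d t) * (L * norm (d t))"
      using L[OF that] by (intro mult_left_mono) (auto simp: d_def d'_def)
    also have "\<dots> = L * (d t \<bullet> d t)" by (simp add: power2_norm_eq_inner[symmetric] power2_eq_square)
    finally show ?thesis .
  qed
  define E where "E c t = exp (c * t) * (d t \<bullet> d t)" for c t :: real
  have Eder: "(E c has_real_derivative exp (c * t) * (c * (d t \<bullet> d t) + 2 * (d t \<bullet> d' t))) (at t within {a..b})"
    if "t \<in> {a..b}" for c t
  proof -
    have "((\<lambda>t. d t \<bullet> d t) has_vector_derivative d t \<bullet> d' t + d' t \<bullet> d t) (at t within {a..b})"
      using bounded_bilinear.has_vector_derivative[OF bounded_bilinear_inner der[OF that] der[OF that]] .
    then have "((\<lambda>t. d t \<bullet> d t) has_real_derivative d t \<bullet> d' t + d' t \<bullet> d t) (at t within {a..b})"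
      by (simp add: has_real_derivative_iff_has_vector_derivative)
    then show ?thesis unfolding E_def
      by (auto intro!: derivative_eq_intros simp: algebra_simps inner_commute)
  qed
  have Ed: "(E c has_derivative (\<lambda>h. exp (c * t) * (c * (d t \<bullet> d t) + 2 * (d t \<bullet> d' t)) * h)) (at t within S)"
    if "t \<in> S" "S \<subseteq> {a..b}" for c t S
    using has_derivative_subset[OF Eder[unfolded has_field_derivative_def] that(2)] that by auto
  have "d t \<bullet> d t \<le> 0"
  proof (cases "t0 \<le> t")
    case True
    have "\<exists>z\<in>{t0..t}. E (-2*L) t - E (-2*L) t0 = (t - t0) * (exp (-2*L*z) * (-2*L * (d z \<bullet> d z) + 2 * (d z \<bullet> d' z)))"
      if "t0 < t"
    proof -
      have "\<exists>z\<in>{t0<..<t}. E (-2*L) t - E (-2*L) t0 = (exp (-2*L*z) * (-2*L * (d z \<bullet> d z) + 2 * (d z \<bullet> d' z))) * (t - t0)"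
        by (rule mvt_simple[OF that])
           (rule Ed, use t0 t in auto)
      then show ?thesis by (auto simp: algebra_simps)
    qed
    moreover have "-2*L * (d z \<bullet> d z) + 2 * (d z \<bullet> d' z) \<le> 0" if "z \<in> {t0..t}" for z
      using inn[of z] that t0 t by auto
    ultimately have "E (-2*L) t - E (-2*L) t0 \<le> 0" if "t0 < t"
      using that by (metis True diff_ge_0_iff_ge exp_ge_zero mult_nonneg_nonpos)
    then have "E (-2*L) t \<le> E (-2*L) t0" using True by (cases "t0 = t") auto
    then show ?thesis using t0 by (simp add: E_def d_def mult_le_0_iff)
  next
    case False
    have "\<exists>z\<in>{t..t0}. E (2*L) t0 - E (2*L) t = (t0 - t) * (exp (2*L*z) * (2*L * (d z \<bullet> d z) + 2 * (d z \<bullet> d' z)))"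
    proof -
      have "\<exists>z\<in>{t<..<t0}. E (2*L) t0 - E (2*L) t = (exp (2*L*z) * (2*L * (d z \<bullet> d z) + 2 * (d z \<bullet> d' z))) * (t0 - t)"
        by (rule mvt_simple)
           (use False in simp, rule Ed, use t0 t in auto)
      then show ?thesis by (auto simp: algebra_simps)
    qed
    moreover have "2*L * (d z \<bullet> d z) + 2 * (d z \<bullet> d' z) \<ge> 0" if "z \<in> {t..t0}" for z
      using inn[of z] that t0 t by auto
    ultimately have "0 \<le> E (2*L) t0 - E (2*L) t"
      using False by (metis diff_ge_0_iff_ge exp_ge_zero linear mult_nonneg_nonneg)
    then have "E (2*L) t \<le> E (2*L) t0" by simp
    then show ?thesis using t0 by (simp add: E_def d_def mult_le_0_iff)
  qed
  then show ?thesis by (simp add: d_def flip: power2_norm_eq_inner)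
qed

section \<open>Counting zeros\<close>

text \<open>Induction adds the largest zero \<open>w\<close>; Rolle between the previous maximum and
  \<open>w\<close> gives one more critical point. The last conjunct keeps the earlier points below
  the previous maximum, which makes the new point distinct from them.\<close>

lemma rolle_count:
  fixes f f' :: "real \<Rightarrow> real"
  assumes "finite Z" "Z \<subseteq> {a<..<b}" "\<And>z. z \<in> Z \<Longrightarrow> f z = 0"
    and der: "\<And>x. x \<in> {a<..<b} \<Longrightarrow> (f has_real_derivative f' x) (at x)"
  shows "\<exists>Z'. finite Z' \<and> card Z' = card Z - 1 \<and> Z' \<subseteq> {a<..<b} \<and> (\<forall>z\<in>Z'. f' z = 0) \<and> (\<forall>z\<in>Z'. \<exists>w\<in>Z. z < w)"
  using assms(1-3)
proof (induction Z rule: finite_linorder_max_induct)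
  case empty
  then show ?case by auto
next
  case (insert w Z)
  then obtain Z' where Z': "finite Z'" "card Z' = card Z - 1" "Z' \<subseteq> {a<..<b}" "\<forall>z\<in>Z'. f' z = 0"
    "\<forall>z\<in>Z'. \<exists>w\<in>Z. z < w" by auto
  show ?case
  proof (cases "Z = {}")
    case True
    then show ?thesis by (intro exI[of _ "{}"]) auto
  next
    case False
    define y where "y = Max Z"
    have y: "y \<in> Z" "\<And>z. z \<in> Z \<Longrightarrow> z \<le> y" using False insert by (auto simp: y_def)
    have yw: "y < w" "y > a" "w < b" using y insert by auto
    have "\<exists>z. y < z \<and> z < w \<and> f' z = 0"
    proof -
      have "continuous_on {y..w} f"
        using yw by (intro continuous_at_imp_continuous_on ballI DERIV_isCont[OF der]) auto
      moreover have "(f has_derivative (\<lambda>h. f' z * h)) (at z)" if "y < z" "z < w" for z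
        using der[of z] that yw by (auto simp: has_field_derivative_def)
      moreover have "f y = f w" using y insert.prems by auto
      ultimately obtain z where "y < z" "z < w" "(\<lambda>h. f' z * h) = (\<lambda>h. 0)"
        using Rolle_deriv[of y w f "\<lambda>z h. f' z * h"] yw by blast
      then show ?thesis by (intro exI[of _ z]) (auto dest: fun_cong[of "(*) (f' z)" "\<lambda>h. 0" 1])
    qed
    then obtain z where z: "y < z" "z < w" "f' z = 0" by auto
    have "z \<notin> Z'" using Z'(5) y z by force
    show ?thesis
    proof (intro exI[of _ "insert z Z'"] conjI)
      have "card Z > 0" using False insert by (simp add: card_gt_0_iff)
      moreover have "w \<notin> Z" using insert by blast
      ultimately show "card (insert z Z') = card (insert w Z) - 1"
        using \<open>z \<notin> Z'\<close> Z' insert by simp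
    qed (use Z' z yw insert in \<open>auto intro: less_trans\<close>)
  qed
qed

section \<open>Holomorphic units at the origin with uniform bounds\<close>

text \<open>A quantitative form of being nonzero at the origin. Consequences drawn from membership
  depend on \<open>r\<close>, \<open>C\<close>, \<open>c\<close> only and hence hold for all
  perturbed systems simultaneously. Reality on the real axis lets Rolle's theorem apply to the
  restrictions.\<close>

definition unit_class :: "real \<Rightarrow> real \<Rightarrow> real \<Rightarrow> (complex \<Rightarrow> complex) set" where
  "unit_class r C c = {\<psi>. \<psi> holomorphic_on ball 0 r \<and> (\<forall>z\<in>ball 0 r. norm (\<psi> z) \<le> C) \<and>
     (\<forall>x. \<bar>x\<bar> < r \<longrightarrow> \<psi> (of_real x) \<in> \<real>) \<and> Re (\<psi> 0) \<ge> c}"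

lemma unit_class_mono:
  assumes "\<psi> \<in> unit_class r C c" "r' \<le> r" "C \<le> C'" "c' \<le> c"
  shows "\<psi> \<in> unit_class r' C' c'"
proof -
  have "ball (0::complex) r' \<subseteq> ball 0 r" using assms by auto
  then have "\<psi> holomorphic_on ball 0 r'" "\<forall>z\<in>ball 0 r'. norm (\<psi> z) \<le> C'"
    using assms unfolding unit_class_def by (blast intro: holomorphic_on_subset order_trans)+
  then show ?thesis using assms by (simp add: unit_class_def)
qed

text \<open>Cauchy's estimate on the circle of radius \<open>r/2\<close> about \<open>z\<close>,
  which stays inside the disc.\<close>

lemma holomorphic_deriv_bound:
  assumes "\<psi> holomorphic_on ball 0 r" "\<And>z. z \<in> ball 0 r \<Longrightarrow> norm (\<psi> z) \<le> C" "r > 0"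
    and z: "z \<in> ball 0 (r/2)"
  shows "norm (deriv \<psi> z) \<le> 2 * C / r"
proof -
  have sub: "cball z (r/2) \<subseteq> ball 0 r"
  proof
    fix w assume "w \<in> cball z (r/2)"
    then have "dist 0 w \<le> dist 0 z + r/2" using dist_triangle[of 0 w z] by simp
    then show "w \<in> ball 0 r" using z by simp
  qed
  have "norm ((deriv ^^ 1) \<psi> z) \<le> fact 1 * C / (r/2) ^ 1"
  proof (rule Cauchy_inequality)
    show "\<psi> holomorphic_on ball z (r/2)" using assms(1) sub ball_subset_cball
      by (blast intro: holomorphic_on_subset)
    show "continuous_on (cball z (r/2)) \<psi>"
      using assms(1) sub holomorphic_on_imp_continuous_on holomorphic_on_subset by blast
    fix x assume "norm (z - x) = r/2"
    then show "norm (\<psi> x) \<le> C" using sub by (intro assms) (auto simp: dist_norm)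
  qed (use assms in auto)
  then show ?thesis by (simp add: mult.commute)
qed

lemma holomorphic_lipschitz:
  assumes "\<psi> holomorphic_on ball 0 r" "\<And>z. z \<in> ball 0 r \<Longrightarrow> norm (\<psi> z) \<le> C" "r > 0"
    and "z \<in> ball 0 (r/2)" "w \<in> ball 0 (r/2)"
  shows "norm (\<psi> z - \<psi> w) \<le> 2 * C / r * norm (z - w)"
proof (rule field_differentiable_bound[where S = "ball 0 (r/2)" and f' = "deriv \<psi>"])
  fix u :: complex assume u: "u \<in> ball 0 (r/2)"
  then have "u \<in> ball 0 r" using \<open>r > 0\<close> by simp
  then show "(\<psi> has_field_derivative deriv \<psi> u) (at u within ball 0 (r / 2))"
    using holomorphic_derivI[OF assms(1) open_ball] has_field_derivative_at_within by blast
  show "norm (deriv \<psi> u) \<le> 2 * C / r" using holomorphic_deriv_bound assms(1-3) u by blast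
qed (use assms in auto)


text \<open>On half the disc the Lipschitz constant is \<open>2*C/r\<close>; within distance
  \<open>r*c/(4*C)\<close> of the origin the value therefore moves by at most \<open>c/2\<close>,
  away from a value of modulus at least \<open>c\<close>.\<close>

lemma unit_class_lower:
  assumes \<psi>: "\<psi> \<in> unit_class r C c" and "0 < r" "0 < c" "c \<le> C"
    and z: "norm z < r * c / (4 * C)"
  shows "norm (\<psi> z) \<ge> c / 2"
proof -
  have "C > 0" using assms by simp
  have "r * c / (4 * C) \<le> r / 4" using assms by (simp add: field_simps)
  then have "norm z < r / 4" using z by (rule less_le_trans[rotated])
  then have z': "z \<in> ball 0 (r/2)" using \<open>0 < r\<close> by simp
  have "norm (\<psi> z - \<psi> 0) \<le> 2 * C / r * norm (z - 0)"
    by (rule holomorphic_lipschitz) (use \<psi> z' \<open>0 < r\<close> in \<open>auto simp: unit_class_def\<close>)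
  also have "\<dots> \<le> 2 * C / r * (r * c / (4 * C))"
    using z \<open>C > 0\<close> \<open>0 < r\<close> by (intro mult_left_mono) auto
  also have "\<dots> = c / 2" using \<open>C > 0\<close> \<open>0 < r\<close> by (simp add: field_simps)
  finally have "norm (\<psi> z - \<psi> 0) \<le> c / 2" .
  moreover have "norm (\<psi> 0) \<ge> c" using \<psi> complex_Re_le_cmod[of "\<psi> 0"] by (auto simp: unit_class_def)
  ultimately show ?thesis using norm_triangle_ineq2[of "\<psi> 0" "\<psi> 0 - \<psi> z"]
    by (simp add: norm_minus_commute)
qed

text \<open>The function is the derivative of \<open>z^k * (\<phi> z / \<psi> z)\<close> with the
  factor \<open>z^(k-1)\<close> removed, that is, what is left of a summand after division by the
  leading one and differentiation. Its value at 0 is \<open>k * \<phi> 0 / \<psi> 0\<close>, so the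
  lower bound survives as \<open>c / C\<close>.\<close>

lemma unit_class_deriv_quotient:
  assumes "0 < r" "0 < c" "c \<le> C" "(k::nat) \<ge> 1"
  defines "r' \<equiv> r * c / (4 * C)"
  assumes \<phi>: "\<phi> \<in> unit_class r C c" and \<psi>: "\<psi> \<in> unit_class r C c"
  shows "(\<lambda>z. of_nat k * (\<phi> z / \<psi> z) + z * deriv (\<lambda>z. \<phi> z / \<psi> z) z)
           \<in> unit_class (r'/2) (of_nat k * (2 * C / c) + 2 * C / c) (c / C)"
proof -
  have "C > 0" using assms by simp
  have r': "0 < r'" "r' \<le> r" using assms by (auto simp: field_simps)
  have low: "norm (\<psi> z) \<ge> c / 2" if "norm z < r'" for z
    using unit_class_lower[OF \<psi>] assms that by (simp add: r'_def)
  define Q where "Q z = \<phi> z / \<psi> z" for z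
  have hol: "Q holomorphic_on ball 0 r'"
    unfolding Q_def
  proof (intro holomorphic_on_divide)
    show "\<phi> holomorphic_on ball 0 r'" "\<psi> holomorphic_on ball 0 r'"
      using \<phi> \<psi> r' by (auto simp: unit_class_def intro: holomorphic_on_subset)
    show "\<psi> z \<noteq> 0" if "z \<in> ball 0 r'" for z
      using low[of z] that \<open>0 < c\<close> by auto
  qed
  have bd: "norm (Q z) \<le> 2 * C / c" if "z \<in> ball 0 r'" for z
  proof -
    have "norm (Q z) \<le> C / (c / 2)" unfolding Q_def norm_divide
      by (rule frac_le) (use \<phi> that low[of z] r' \<open>C > 0\<close> \<open>0 < c\<close> in \<open>auto simp: unit_class_def\<close>)
    then show ?thesis by (simp add: mult.commute)
  qed
  have dbd: "norm (deriv Q z) \<le> 2 * (2 * C / c) / r'" if "z \<in> ball 0 (r'/2)" for z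
    by (rule holomorphic_deriv_bound[OF hol bd]) (use r' that in auto)
  have Qreal: "Q (of_real x) \<in> \<real>" if "\<bar>x\<bar> < r'" for x
    using that r' \<phi> \<psi> unfolding Q_def by (auto simp: unit_class_def intro!: Reals_divide)
  \<comment> \<open>The imaginary part of \<open>Q\<close> vanishes along the real axis, so its
    derivative in the real direction, which is \<open>Im (deriv Q)\<close>, vanishes as
    well.\<close>
  have dreal: "deriv Q (of_real x) \<in> \<real>" if x: "\<bar>x\<bar> < r'" for x
  proof -
    have d: "(Q has_field_derivative deriv Q (of_real x)) (at (of_real x))"
      by (rule holomorphic_derivI[OF hol open_ball]) (use x in auto)
    have "((\<lambda>t. Q (of_real t)) has_vector_derivative deriv Q (of_real x)) (at x)"
      using has_vector_derivative_real_field[OF d] by (simp add: o_def)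
    then have "((\<lambda>t. Im (Q (of_real t))) has_vector_derivative Im (deriv Q (of_real x))) (at x)"
      by (rule bounded_linear.has_vector_derivative[OF bounded_linear_Im])
    then have "((\<lambda>t. Im (Q (of_real t))) has_real_derivative Im (deriv Q (of_real x))) (at x)"
      by (simp add: has_real_derivative_iff_has_vector_derivative)
    moreover have "((\<lambda>t. Im (Q (of_real t))) has_real_derivative 0) (at x)"
    proof (rule has_field_derivative_transform_within_open[of "\<lambda>_. 0"])
      show "open {-r'<..<r'}" "x \<in> {-r'<..<r'}" using x by auto
      show "0 = Im (Q (of_real t))" if "t \<in> {-r'<..<r'}" for t
        using Qreal[of t] that by (auto simp: complex_is_Real_iff abs_less_iff)
    qed simp
    ultimately show ?thesis using DERIV_unique by (auto simp: complex_is_Real_iff)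
  qed
  have sub: "ball (0::complex) (r'/2) \<subseteq> ball 0 r'" using r' by auto
  show ?thesis
    unfolding unit_class_def mem_Collect_eq Q_def[symmetric]
  proof (intro conjI ballI allI impI)
    show "(\<lambda>z. of_nat k * Q z + z * deriv Q z) holomorphic_on ball 0 (r'/2)"
      using hol sub by (intro holomorphic_intros holomorphic_deriv) (auto intro: holomorphic_on_subset)
    show "norm (of_nat k * Q z + z * deriv Q z) \<le> of_nat k * (2 * C / c) + 2 * C / c"
      if z: "z \<in> ball 0 (r'/2)" for z
    proof -
      have "norm (of_nat k * Q z + z * deriv Q z) \<le> of_nat k * norm (Q z) + norm z * norm (deriv Q z)"
        by (rule order_trans[OF norm_triangle_ineq]) (simp add: norm_mult)
      also have "norm z * norm (deriv Q z) \<le> (r'/2) * (2 * (2 * C / c) / r')"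
        using z dbd[OF z] r' by (intro mult_mono) auto
      also have "\<dots> = 2 * C / c" using r' by (simp add: field_simps)
      also have "of_nat k * norm (Q z) \<le> of_nat k * (2 * C / c)"
        using bd[of z] z sub by (intro mult_left_mono) auto
      finally show ?thesis by simp
    qed
    show "of_nat k * Q (of_real x) + of_real x * deriv Q (of_real x) \<in> \<real>" if "\<bar>x\<bar> < r'/2" for x
      using Qreal[of x] dreal[of x] that r' by (intro Reals_add Reals_mult) auto
    have reals: "\<phi> 0 \<in> \<real>" "\<psi> 0 \<in> \<real>"
      using \<phi> \<psi> \<open>0 < r\<close> unfolding unit_class_def by (force dest: spec[of _ 0])+
    then have "\<phi> 0 = of_real (Re (\<phi> 0))" "\<psi> 0 = of_real (Re (\<psi> 0))" by auto
    then have "Re (Q 0) = Re (\<phi> 0) / Re (\<psi> 0)" unfolding Q_def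
      by (metis Re_complex_of_real of_real_divide)
    moreover have "Re (\<phi> 0) \<ge> c" "Re (\<psi> 0) \<ge> c" "Re (\<psi> 0) \<le> C"
      using \<phi> \<psi> complex_Re_le_cmod[of "\<psi> 0"] \<open>0 < r\<close> by (auto simp: unit_class_def intro: order_trans)
    ultimately have "Re (Q 0) \<ge> c / C" using \<open>0 < c\<close> by (auto intro!: frac_le)
    moreover have "of_nat k * Re (Q 0) \<ge> 1 * Re (Q 0)"
      using \<open>k \<ge> 1\<close> calculation \<open>0 < c\<close> \<open>C > 0\<close>
      by (intro mult_right_mono) (auto intro: order_trans[rotated])
    ultimately show "c / C \<le> Re (of_nat k * Q 0 + 0 * deriv Q 0)"
      by simp
  qed
qed

text \<open>Division by the leading term followed by differentiation removes one summand and, by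
  Rolle, at most one zero; the remaining summands keep their shape.\<close>

lemma generalized_descartes:
  fixes e :: "nat \<Rightarrow> nat"
  assumes "0 < r" "0 < c" "strict_mono e"
  shows "\<exists>s0. 0 < s0 \<and> s0 \<le> r \<and> (\<forall>(\<alpha>::nat \<Rightarrow> real) \<psi> Z.
     (\<forall>l\<le>N. \<psi> l \<in> unit_class r C c) \<and> (\<exists>l\<le>N. \<alpha> l \<noteq> 0) \<and> finite Z \<and> Z \<subseteq> {0<..<s0} \<and>
     (\<forall>s\<in>Z. (\<Sum>l\<le>N. of_real (\<alpha> l) * of_real s ^ e l * \<psi> l (of_real s)) = 0) \<longrightarrow> card Z \<le> N)"
  using assms
proof (induction N arbitrary: r C c e)
  case (0 r C c e)
  show ?case
  proof (cases "c \<le> C")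
    case cC: True
    show ?thesis
    proof (intro exI[of _ "min r (r * c / (4 * C))"] conjI allI impI)
      show "0 < min r (r * c / (4 * C))" using 0 cC by auto
      fix \<alpha> :: "nat \<Rightarrow> real" and \<psi> and Z
      assume asm: "(\<forall>l\<le>0. \<psi> l \<in> unit_class r C c) \<and> (\<exists>l\<le>0. \<alpha> l \<noteq> 0) \<and> finite Z \<and>
        Z \<subseteq> {0<..<min r (r * c / (4 * C))} \<and>
        (\<forall>s\<in>Z. (\<Sum>l\<le>0. of_real (\<alpha> l) * of_real s ^ e l * \<psi> l (of_real s)) = 0)"
      have "s \<notin> Z" for s
      proof
        assume "s \<in> Z"
        then have "0 < s" "s < r * c / (4 * C)" "\<psi> 0 (of_real s) = 0" using asm by auto
        moreover have "norm (\<psi> 0 (of_real s)) \<ge> c / 2"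
          by (rule unit_class_lower) (use asm 0 cC calculation in auto)
        ultimately show False using \<open>0 < c\<close> by simp
      qed
      then have "Z = {}" by auto
      then show "card Z \<le> 0" by simp
    qed simp
  next
    case False
    \<comment> \<open>For \<open>C < c\<close> the class is empty, because
      \<open>Re (\<psi> 0) \<le> norm (\<psi> 0) \<le> C\<close>; the claim is then vacuous.\<close>
    have "unit_class r C c = {}"
    proof (rule equals0I)
      fix \<psi> assume "\<psi> \<in> unit_class r C c"
      then show False using False \<open>0 < r\<close> complex_Re_le_cmod[of "\<psi> 0"]
        by (auto simp: unit_class_def dest!: bspec[of _ _ 0])
    qed
    then show ?thesis using \<open>0 < r\<close> by auto
  qed
next
  case (Suc N r C c e)
  show ?case
  proof (cases "c \<le> C")
    case cC: True
    define r' where "r' = r * c / (4 * C)"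
    have "C > 0" using cC Suc by simp
    have r': "0 < r'" "r' \<le> r" using Suc cC \<open>C > 0\<close> by (auto simp: r'_def field_simps)
    \<comment> \<open>Exponents after division by \<open>s ^ e 0\<close> and one differentiation.
      Strict monotonicity of \<open>e\<close> keeps the truncated subtractions exact.\<close>
    define e' where "e' l = e (Suc l) - e 0 - 1" for l
    have e0: "e (Suc l) \<ge> e 0 + 1" for l
      using strict_monoD[OF Suc.prems(3), of 0 "Suc l"] by simp
    have e': "strict_mono e'"
    proof (rule strict_monoI)
      fix x y :: nat assume "x < y"
      then show "e' x < e' y" using strict_monoD[OF Suc.prems(3), of "Suc x" "Suc y"] e0[of x] e0[of y]
        by (simp add: e'_def)
    qed
    \<comment> \<open>One bound for all summands: the factor \<open>e (Suc l) - e 0\<close> produced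
      by differentiation never exceeds \<open>e (Suc N)\<close>.\<close>
    define C' where "C' = real (e (Suc N)) * (2 * C / c) + 2 * C / c"
    have "0 < r'/2" "0 < c/C" using r' \<open>C > 0\<close> Suc.prems by auto
    from Suc.IH[OF this e', of C'] obtain s0 where s0: "0 < s0" "s0 \<le> r'/2" and
      IH0: "\<forall>(\<alpha>::nat \<Rightarrow> real) \<psi> Z.
        (\<forall>l\<le>N. \<psi> l \<in> unit_class (r'/2) C' (c/C)) \<and> (\<exists>l\<le>N. \<alpha> l \<noteq> 0) \<and> finite Z \<and> Z \<subseteq> {0<..<s0} \<and>
        (\<forall>s\<in>Z. (\<Sum>l\<le>N. of_real (\<alpha> l) * of_real s ^ e' l * \<psi> l (of_real s)) = 0) \<longrightarrow> card Z \<le> N"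
      by (elim exE conjE) (rule that)
    note IH = IH0[rule_format, OF conjI, OF _ conjI, OF _ _ conjI, OF _ _ _ conjI]
    show ?thesis
    proof (intro exI[of _ s0] conjI allI impI)
      fix \<alpha> :: "nat \<Rightarrow> real" and \<psi> and Z
      assume asm: "(\<forall>l\<le>Suc N. \<psi> l \<in> unit_class r C c) \<and> (\<exists>l\<le>Suc N. \<alpha> l \<noteq> 0) \<and> finite Z \<and>
        Z \<subseteq> {0<..<s0} \<and>
        (\<forall>s\<in>Z. (\<Sum>l\<le>Suc N. of_real (\<alpha> l) * of_real s ^ e l * \<psi> l (of_real s)) = 0)"
      define Q where "Q l z = \<psi> l z / \<psi> 0 z" for l z
      define \<xi> where "\<xi> l z = of_nat (e (Suc l) - e 0) * Q (Suc l) z + z * deriv (Q (Suc l)) z" for l z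
      have \<psi>: "\<psi> l \<in> unit_class r C c" if "l \<le> Suc N" for l using asm that by auto
      have low: "norm (\<psi> 0 z) \<ge> c / 2" if "norm z < r'" for z
        using unit_class_lower[OF \<psi>] Suc.prems cC that by (simp add: r'_def)
      then have nz: "\<psi> 0 z \<noteq> 0" if "norm z < r'" for z
        using that \<open>0 < c\<close> by force
      have \<xi>: "\<xi> l \<in> unit_class (r'/2) C' (c/C)" if "l \<le> N" for l
      proof -
        have "\<xi> l \<in> unit_class (r'/2) (real (e (Suc l) - e 0) * (2 * C / c) + 2 * C / c) (c / C)"
          using unit_class_deriv_quotient[OF Suc.prems(1,2) cC _ \<psi>[of "Suc l"] \<psi>[of 0], of "e (Suc l) - e 0"]
            that e0[of l] unfolding \<xi>_def Q_def r'_def by auto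
        moreover have "e (Suc l) - e 0 \<le> e (Suc N)"
          using that Suc.prems(3) by (simp add: strict_mono_less_eq le_diff_conv trans_le_add1)
        then have "real (e (Suc l) - e 0) * (2 * C / c) + 2 * C / c \<le> C'"
          unfolding C'_def using \<open>0 < c\<close> \<open>C > 0\<close> by (intro add_right_mono mult_right_mono) auto
        ultimately show ?thesis using unit_class_mono by blast
      qed
      \<comment> \<open>The sum divided by its leading monomial and by \<open>\<psi> 0\<close>. It
        vanishes on \<open>Z\<close>, and its derivative \<open>F'\<close> has one summand
        fewer.\<close>
      define F where "F z = of_real (\<alpha> 0) + (\<Sum>l\<le>N. of_real (\<alpha> (Suc l)) * z ^ (e (Suc l) - e 0) * Q (Suc l) z)" for z :: complex
      define F' where "F' z = (\<Sum>l\<le>N. of_real (\<alpha> (Suc l)) * z ^ e' l * \<xi> l z)" for z :: complex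
      have Qhol: "Q l holomorphic_on ball 0 r'" if "l \<le> Suc N" for l
        unfolding Q_def
      proof (intro holomorphic_on_divide)
        show "\<psi> l holomorphic_on ball 0 r'" "\<psi> 0 holomorphic_on ball 0 r'"
          using \<psi>[OF that] \<psi>[of 0] r' by (auto simp: unit_class_def intro: holomorphic_on_subset)
      qed (use nz in auto)
      have Fder: "(F has_field_derivative F' z) (at z)" if z: "norm z < r'" for z
      proof -
        have "((\<lambda>z. of_real (\<alpha> (Suc l)) * z ^ (e (Suc l) - e 0) * Q (Suc l) z) has_field_derivative
            of_real (\<alpha> (Suc l)) * z ^ e' l * \<xi> l z) (at z)" if "l \<le> N" for l
        proof -
          have "(Q (Suc l) has_field_derivative deriv (Q (Suc l)) z) (at z)"
            by (rule holomorphic_derivI[OF Qhol open_ball]) (use that z in auto)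
          note [derivative_intros] = this
          have k: "e (Suc l) - e 0 = Suc (e' l)" using e0[of l] by (simp add: e'_def)
          have "((\<lambda>z. z ^ (e (Suc l) - e 0)) has_field_derivative of_nat (e (Suc l) - e 0) * z ^ e' l) (at z)"
            unfolding k by (rule derivative_eq_intros | simp)+
          note [derivative_intros] = this
          show ?thesis
            by (rule derivative_eq_intros refl)+ (simp add: k \<xi>_def algebra_simps)
        qed
        then have "((\<lambda>z. \<Sum>l\<le>N. of_real (\<alpha> (Suc l)) * z ^ (e (Suc l) - e 0) * Q (Suc l) z) has_field_derivative F' z) (at z)"
          unfolding F'_def by (intro DERIV_sum) auto
        from DERIV_add[OF DERIV_const this] show ?thesis unfolding F_def by simp
      qed
      have Z: "finite Z" "Z \<subseteq> {0<..<s0}" using asm by auto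
      have Fz: "F (of_real s) = 0" if "s \<in> Z" for s
      proof -
        have s: "s > 0" "s < s0" using Z that by auto
        have n: "norm (of_real s :: complex) < r'" using s s0 r' by simp
        have "0 = (\<Sum>l\<le>Suc N. of_real (\<alpha> l) * of_real s ^ e l * \<psi> l (of_real s))" using asm that by simp
        also have "\<dots> = of_real s ^ e 0 * \<psi> 0 (of_real s) * F (of_real s)"
          unfolding sum.atMost_Suc_shift F_def distrib_left sum_distrib_left
        proof (intro arg_cong2[where f = "(+)"] sum.cong refl)
          fix l
          have "of_real s ^ e (Suc l) = (of_real s ^ e 0 * of_real s ^ (e (Suc l) - e 0) :: complex)"
            using e0[of l] by (simp flip: power_add)
          then show "of_real (\<alpha> (Suc l)) * of_real s ^ e (Suc l) * \<psi> (Suc l) (of_real s) =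
             of_real s ^ e 0 * \<psi> 0 (of_real s) * (of_real (\<alpha> (Suc l)) * of_real s ^ (e (Suc l) - e 0) * Q (Suc l) (of_real s))"
            using nz[OF n] by (simp add: Q_def)
        qed simp
        finally show ?thesis using nz[OF n] s by simp
      qed
      show "card Z \<le> Suc N"
      proof (cases "\<exists>l\<le>N. \<alpha> (Suc l) \<noteq> 0")
        case True
        have real': "F' (of_real x) \<in> \<real>" if "\<bar>x\<bar> < r'/2" for x
          unfolding F'_def using \<xi> that
          by (intro sum_in_Reals Reals_mult Reals_power Reals_of_real) (auto simp: unit_class_def)
        have "((\<lambda>x. Re (F (of_real x))) has_real_derivative Re (F' (of_real x))) (at x)" if "x \<in> {0<..<s0}" for x
        proof -
          have "((\<lambda>t. F (of_real t)) has_vector_derivative F' (of_real x)) (at x)"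
            using has_vector_derivative_real_field[OF Fder[of "of_real x"]] that s0 r' by (simp add: o_def)
          then have "((\<lambda>t. Re (F (of_real t))) has_vector_derivative Re (F' (of_real x))) (at x)"
            by (rule bounded_linear.has_vector_derivative[OF bounded_linear_Re])
          then show ?thesis by (simp add: has_real_derivative_iff_has_vector_derivative)
        qed
        then obtain Z' where Z': "finite Z'" "card Z' = card Z - 1" "Z' \<subseteq> {0<..<s0}"
            "\<forall>z\<in>Z'. Re (F' (of_real z)) = 0"
          using rolle_count[OF Z, of "\<lambda>x. Re (F (of_real x))" "\<lambda>x. Re (F' (of_real x))"] Fz by auto
        have "card Z' \<le> N"
        proof (rule IH[OF _ _ Z'(1,3)])
          show "\<forall>l\<le>N. \<xi> l \<in> unit_class (r'/2) C' (c/C)" using \<xi> by auto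
          show "\<exists>l\<le>N. \<alpha> (Suc l) \<noteq> 0" by (rule True)
          show "\<forall>s\<in>Z'. (\<Sum>l\<le>N. of_real (\<alpha> (Suc l)) * of_real s ^ e' l * \<xi> l (of_real s)) = 0"
          proof
          fix s assume "s \<in> Z'"
          then have "\<bar>s\<bar> < r'/2" "Re (F' (of_real s)) = 0" using Z' s0 by auto
          then have "F' (of_real s) = 0" using real'[of s] by (simp add: complex_eq_iff complex_is_Real_iff)
          then show "(\<Sum>l\<le>N. of_real (\<alpha> (Suc l)) * of_real s ^ e' l * \<xi> l (of_real s)) = 0"
            by (simp add: F'_def)
          qed
        qed
        then show ?thesis using Z' by simp
      next
        case False
        \<comment> \<open>All later coefficients vanish, so the induction hypothesis has no nonzero
          coefficient to work with; but then \<open>F\<close> is a nonzero constant.\<close>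
        then have F0: "F z = of_real (\<alpha> 0)" for z by (simp add: F_def)
        have "\<alpha> 0 \<noteq> 0"
        proof -
          obtain l where l: "l \<le> Suc N" "\<alpha> l \<noteq> 0" using asm by auto
          then show ?thesis using False by (cases l) auto
        qed
        then have "Z = {}" using Fz F0 by auto
        then show ?thesis by simp
      qed
    qed (use s0 r' in auto)
  next
    case False
    have "unit_class r C c = {}"
    proof (rule equals0I)
      fix \<psi> assume "\<psi> \<in> unit_class r C c"
      then show False using False \<open>0 < r\<close> complex_Re_le_cmod[of "\<psi> 0"]
        by (auto simp: unit_class_def dest!: bspec[of _ _ 0])
    qed
    then show ?thesis using \<open>0 < r\<close> by auto
  qed
qed

section \<open>A scalar equation depending holomorphically on a parameter\<close>

text \<open>Joint continuity of the function and of its parameter derivative is a property that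
  integration in \<open>t\<close> preserves: it permits differentiation under the integral sign and
  returns a jointly continuous derivative.\<close>

definition param_holo :: "real \<Rightarrow> real \<Rightarrow> (complex \<Rightarrow> real \<Rightarrow> complex) \<Rightarrow> bool" where
  "param_holo r b f \<longleftrightarrow> (\<exists>f'. continuous_on (ball 0 r \<times> {0..b}) (\<lambda>(s, t). f s t) \<and>
     continuous_on (ball 0 r \<times> {0..b}) (\<lambda>(s, t). f' s t) \<and>
     (\<forall>s\<in>ball 0 r. \<forall>t\<in>{0..b}. ((\<lambda>s. f s t) has_field_derivative f' s t) (at s)))"

lemma param_holo_const:
  assumes "continuous_on {0..b} f"
  shows "param_holo r b (\<lambda>s t. of_real (f t))"
proof -
  have "continuous_on (ball (0::complex) r \<times> {0..b}) (\<lambda>p. complex_of_real (f (snd p)))"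
    by (intro continuous_intros continuous_on_compose2[OF assms]) auto
  then show ?thesis unfolding param_holo_def
    by (intro exI[of _ "\<lambda>s t. 0"]) (auto simp: case_prod_unfold)
qed

lemma param_holo_const': "param_holo r b (\<lambda>s t. c)"
  unfolding param_holo_def by (intro exI[of _ "\<lambda>s t. 0"]) (auto simp: case_prod_unfold)

lemma param_holo_id: "param_holo r b (\<lambda>s t. s)"
  unfolding param_holo_def by (intro exI[of _ "\<lambda>s t. 1"]) (auto simp: case_prod_unfold intro!: continuous_intros)

lemma param_holo_add:
  assumes "param_holo r b f" "param_holo r b g"
  shows "param_holo r b (\<lambda>s t. f s t + g s t)"
proof -
  obtain f' g' where "continuous_on (ball 0 r \<times> {0..b}) (\<lambda>(s, t). f s t)" "continuous_on (ball 0 r \<times> {0..b}) (\<lambda>(s, t). f' s t)"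
    "\<forall>s\<in>ball 0 r. \<forall>t\<in>{0..b}. ((\<lambda>s. f s t) has_field_derivative f' s t) (at s)"
    "continuous_on (ball 0 r \<times> {0..b}) (\<lambda>(s, t). g s t)" "continuous_on (ball 0 r \<times> {0..b}) (\<lambda>(s, t). g' s t)"
    "\<forall>s\<in>ball 0 r. \<forall>t\<in>{0..b}. ((\<lambda>s. g s t) has_field_derivative g' s t) (at s)"
    using assms unfolding param_holo_def by blast
  then show ?thesis unfolding param_holo_def
    by (intro exI[of _ "\<lambda>s t. f' s t + g' s t"]) (auto simp: case_prod_unfold intro!: continuous_intros derivative_intros)
qed

lemma param_holo_mult:
  assumes "param_holo r b f" "param_holo r b g"
  shows "param_holo r b (\<lambda>s t. f s t * g s t)"
proof -
  obtain f' g' where "continuous_on (ball 0 r \<times> {0..b}) (\<lambda>(s, t). f s t)" "continuous_on (ball 0 r \<times> {0..b}) (\<lambda>(s, t). f' s t)"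
    "\<forall>s\<in>ball 0 r. \<forall>t\<in>{0..b}. ((\<lambda>s. f s t) has_field_derivative f' s t) (at s)"
    "continuous_on (ball 0 r \<times> {0..b}) (\<lambda>(s, t). g s t)" "continuous_on (ball 0 r \<times> {0..b}) (\<lambda>(s, t). g' s t)"
    "\<forall>s\<in>ball 0 r. \<forall>t\<in>{0..b}. ((\<lambda>s. g s t) has_field_derivative g' s t) (at s)"
    using assms unfolding param_holo_def by blast
  then show ?thesis unfolding param_holo_def
    by (intro exI[of _ "\<lambda>s t. f' s t * g s t + g' s t * f s t"])
       (auto simp: case_prod_unfold intro!: continuous_intros derivative_intros DERIV_mult)
qed

lemma param_holo_sum:
  assumes "\<And>i. i \<in> A \<Longrightarrow> param_holo r b (f i)"
  shows "param_holo r b (\<lambda>s t. \<Sum>i\<in>A. f i s t)"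
  using assms
proof (induction A rule: infinite_finite_induct)
  case (insert x A)
  then show ?case using param_holo_add[of r b "f x" "\<lambda>s t. \<Sum>i\<in>A. f i s t"] by simp
qed (auto simp: param_holo_const')

lemma param_holo_power:
  assumes "param_holo r b f"
  shows "param_holo r b (\<lambda>s t. f s t ^ n)"
  by (induction n) (auto intro: param_holo_const' param_holo_mult assms)

lemma param_holo_exp:
  assumes "param_holo r b f"
  shows "param_holo r b (\<lambda>s t. exp (f s t))"
proof -
  obtain f' where "continuous_on (ball 0 r \<times> {0..b}) (\<lambda>(s, t). f s t)" "continuous_on (ball 0 r \<times> {0..b}) (\<lambda>(s, t). f' s t)"
    "\<forall>s\<in>ball 0 r. \<forall>t\<in>{0..b}. ((\<lambda>s. f s t) has_field_derivative f' s t) (at s)"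
    using assms unfolding param_holo_def by blast
  then show ?thesis unfolding param_holo_def
    by (intro exI[of _ "\<lambda>s t. exp (f s t) * f' s t"])
       (auto simp: case_prod_unfold intro!: continuous_intros derivative_intros DERIV_fun_exp)
qed

lemma param_holo_inverse:
  assumes "param_holo r b f" and nz: "\<And>s t. s \<in> ball 0 r \<Longrightarrow> t \<in> {0..b} \<Longrightarrow> f s t \<noteq> 0"
  shows "param_holo r b (\<lambda>s t. inverse (f s t))"
proof -
  obtain f' where "continuous_on (ball 0 r \<times> {0..b}) (\<lambda>(s, t). f s t)" "continuous_on (ball 0 r \<times> {0..b}) (\<lambda>(s, t). f' s t)"
    "\<forall>s\<in>ball 0 r. \<forall>t\<in>{0..b}. ((\<lambda>s. f s t) has_field_derivative f' s t) (at s)"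
    using assms unfolding param_holo_def by blast
  then show ?thesis unfolding param_holo_def using nz
    by (intro exI[of _ "\<lambda>s t. - (inverse (f s t) * f' s t * inverse (f s t))"])
       (auto simp: case_prod_unfold intro!: continuous_intros DERIV_inverse')
qed

text \<open>Moves the variable upper limit into the integrand, so that joint continuity follows from
  the continuity of a parameter integral over a fixed interval.\<close>

lemma integral_rescale_unit:
  fixes f :: "real \<Rightarrow> complex"
  assumes "continuous_on {0..t} f" "t \<ge> 0"
  shows "integral {0..t} f = of_real t * integral {0..1} (\<lambda>\<tau>. f (t * \<tau>))"
proof (cases "t = 0")
  case False
  have "(f has_integral integral {0..t} f) {0..t}"
    using assms by (auto intro!: integrable_integral integrable_continuous_interval)
  from has_integral_stretch_real[OF this, of t] False assms
  have "((\<lambda>x. f (t * x)) has_integral (1 / t) *\<^sub>R integral {0..t} f) ((\<lambda>x. x / t) ` {0..t})"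
    by (simp add: cbox_interval)
  also have "(\<lambda>x. x / t) ` {0..t} = {0..1}" using False assms
    by (auto simp: image_iff field_simps intro!: bexI[of _ "_ * t"])
  finally show ?thesis using False by (simp add: integral_unique scaleR_conv_of_real)
qed simp

lemma param_holo_integral:
  assumes "param_holo r b f"
  shows "param_holo r b (\<lambda>s t. integral {0..t} (f s))"
proof -
  obtain f' where f': "continuous_on (ball 0 r \<times> {0..b}) (\<lambda>(s, t). f s t)" "continuous_on (ball 0 r \<times> {0..b}) (\<lambda>(s, t). f' s t)"
    "\<forall>s\<in>ball 0 r. \<forall>t\<in>{0..b}. ((\<lambda>s. f s t) has_field_derivative f' s t) (at s)"
    using assms unfolding param_holo_def by blast
  have mult_le: "t * \<tau> \<le> b" if "t \<le> b" "0 \<le> t" "0 \<le> \<tau>" "\<tau> \<le> 1" for t \<tau> :: real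
    using mult_left_le[of \<tau> t] that by linarith
  have slice: "continuous_on {0..t} (h s)" if "continuous_on (ball 0 r \<times> {0..b}) (\<lambda>(s, t). h s t)" "s \<in> ball 0 r" "t \<in> {0..b}"
    for h :: "complex \<Rightarrow> real \<Rightarrow> complex" and s t
  proof -
    have "Pair s ` {0..t} \<subseteq> ball 0 r \<times> {0..b}" using that by auto
    from continuous_on_compose2[OF that(1) _ this] show ?thesis
      using continuous_on_Pair[OF continuous_on_const continuous_on_id, of "{0..t}" s] by simp
  qed
  have cont: "continuous_on (ball 0 r \<times> {0..b}) (\<lambda>(s, t). integral {0..t} (h s))"
    if h: "continuous_on (ball 0 r \<times> {0..b}) (\<lambda>(s, t). h s t)" for h :: "complex \<Rightarrow> real \<Rightarrow> complex"
  proof -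
    have "continuous_on ((ball 0 r \<times> {0..b}) \<times> cbox 0 1) (\<lambda>(p, \<tau>). h (fst p) (snd p * \<tau>))"
    proof -
      have "(\<lambda>q. (fst (fst q), snd (fst q) * snd q)) ` ((ball 0 r \<times> {0..b}) \<times> cbox 0 1) \<subseteq> ball (0::complex) r \<times> {0..b}"
        using mult_le by auto
      moreover have "continuous_on ((ball 0 r \<times> {0..b}) \<times> cbox 0 1) (\<lambda>q. (fst (fst q), snd (fst q) * snd q))"
        by (intro continuous_intros)
      ultimately show ?thesis
        using continuous_on_compose2[OF h] by (fastforce simp: case_prod_unfold)
    qed
    then have "continuous_on (ball 0 r \<times> {0..b}) (\<lambda>p. integral (cbox 0 1) (\<lambda>\<tau>. h (fst p) (snd p * \<tau>)))"
      by (rule integral_continuous_on_param)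
    then have "continuous_on (ball 0 r \<times> {0..b}) (\<lambda>p. of_real (snd p) * integral {0..1} (\<lambda>\<tau>. h (fst p) (snd p * \<tau>)))"
      by (auto simp: cbox_interval intro!: continuous_intros)
    then show ?thesis
      by (rule continuous_on_eq) (auto simp: integral_rescale_unit[OF slice[OF h]])
  qed
  show ?thesis unfolding param_holo_def
  proof (intro exI[of _ "\<lambda>s t. integral {0..t} (f' s)"] conjI ballI cont f'(1,2))
    fix s :: complex and t assume s: "s \<in> ball 0 r" and t: "t \<in> {0..b}"
    have "((\<lambda>x. integral (cbox 0 t) (f x)) has_field_derivative integral (cbox 0 t) (f' s)) (at s within ball 0 r)"
    proof (rule leibniz_rule_field_derivative)
      show "((\<lambda>x. f x u) has_field_derivative f' x u) (at x within ball 0 r)" if "x \<in> ball 0 r" "u \<in> cbox 0 t" for x u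
        using f'(3) that t by (auto intro: has_field_derivative_at_within)
      show "f x integrable_on cbox 0 t" if "x \<in> ball 0 r" for x
        using slice[OF f'(1) that t] by (auto intro: integrable_continuous_interval simp: cbox_interval)
      show "continuous_on (ball 0 r \<times> cbox 0 t) (\<lambda>(x, t). f' x t)"
        by (rule continuous_on_subset[OF f'(2)]) (use t in auto)
    qed (use s in auto)
    then show "((\<lambda>s. integral {0..t} (f s)) has_field_derivative integral {0..t} (f' s)) (at s)"
      using s by (simp add: at_within_open[OF _ open_ball])
  qed
qed

lemma exp_lipschitz_ball:
  fixes x y :: complex
  assumes "norm x \<le> R" "norm y \<le> R"
  shows "norm (exp x - exp y) \<le> exp R * norm (x - y)"
proof (rule field_differentiable_bound[where S = "cball 0 R" and f' = exp])
  show "norm (exp z) \<le> exp R" if "z \<in> cball 0 R" for z :: complex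
    using that abs_Re_le_cmod[of z] by (auto simp: norm_exp_eq_Re)
qed (use assms in \<open>auto intro!: derivative_eq_intros\<close>)

section \<open>Picard iteration and holomorphic dependence on the initial value\<close>

text \<open>Dominates, per unit of \<open>norm s\<close>, both the size
  \<open>K * C^2 * exp K\<close> of \<open>T\<close> and its Lipschitz constant
  \<open>K^2 * C^2 * exp K\<close> in \<open>v\<close>. The summand 1 makes it at least 1 even for
  \<open>K = 0\<close>.\<close>

definition Qc :: "nat \<Rightarrow> real \<Rightarrow> real" where
  "Qc K C = real K * (real K + 1) * C\<^sup>2 * exp (real K) + 1"

text \<open>Chosen so that \<open>C*Q*norm s\<close> and \<open>b*C*Q*norm s\<close> are at most
  1/8: the denominators keep modulus at least 1/2, the Picard iterates stay in the unit disc and the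
  iteration contracts by 1/2. Only \<open>K\<close>, \<open>b\<close>, \<open>C\<close> enter, so
  one radius serves all equations with these bounds.\<close>

definition rad :: "nat \<Rightarrow> real \<Rightarrow> real \<Rightarrow> real" where
  "rad K b C = 1 / (8 * (b + 1) * C * Qc K C)"

text \<open>The equation is \<open>v' = M * T / (1 + N * T)\<close>, where \<open>T\<close> sums
  \<open>a i * s^i * exp (i * v) * w i\<close> and the radial variable is
  \<open>u = s * exp v\<close>. Passing from \<open>u\<close> to \<open>v = ln (u / s)\<close>, with
  initial value 0, makes the equation regular at \<open>s = 0\<close>.\<close>

locale scalar_ode =
  fixes M N :: "real \<Rightarrow> real" and w :: "nat \<Rightarrow> real \<Rightarrow> real" and K :: nat and b C :: real
  assumes contM: "continuous_on {0..b} M" and contN: "continuous_on {0..b} N"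
    and contw: "\<And>i. continuous_on {0..b} (w i)"
    and bdM: "\<And>t. t \<in> {0..b} \<Longrightarrow> \<bar>M t\<bar> \<le> C" and bdN: "\<And>t. t \<in> {0..b} \<Longrightarrow> \<bar>N t\<bar> \<le> C"
    and bdw: "\<And>i t. i \<in> {1..K} \<Longrightarrow> t \<in> {0..b} \<Longrightarrow> \<bar>w i t\<bar> \<le> C"
    and b: "b > 0" and C: "C \<ge> 1"
begin

abbreviation "Q \<equiv> Qc K C"
abbreviation "r \<equiv> rad K b C"

lemma Q1: "Q \<ge> 1" using C by (simp add: Qc_def)

lemma r_pos: "r > 0" using Q1 b C by (simp add: rad_def)

lemma r_bound: "norm s < r \<Longrightarrow> C * Q * norm s \<le> 1/8 \<and> b * (C * Q * norm s) \<le> 1/8 \<and> norm s \<le> 1"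
  for s :: complex
proof -
  assume "norm s < r"
  moreover have "0 < 8 * (b + 1) * C * Q" using Q1 b C by auto
  ultimately have "norm s * (8 * (b + 1) * C * Q) < 1"
    unfolding rad_def by (subst (asm) pos_less_divide_eq) auto
  then have *: "8 * (C * Q * norm s) + 8 * (b * (C * Q * norm s)) < 1" by (simp add: algebra_simps)
  have nn: "C * Q * norm s \<ge> 0" "b * (C * Q * norm s) \<ge> 0" using Q1 b C by auto
  have "C * Q \<ge> 1 * 1" using Q1 C by (intro mult_mono) auto
  then have "1 * norm s \<le> C * Q * norm s" by (intro mult_right_mono) auto
  then show ?thesis using * nn by linarith
qed

definition T :: "(nat \<Rightarrow> real) \<Rightarrow> complex \<Rightarrow> complex \<Rightarrow> real \<Rightarrow> complex" where
  "T a s v t = (\<Sum>i\<in>{1..K}. of_real (a i) * s ^ i * exp (of_nat i * v) * of_real (w i t))"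

definition F :: "(nat \<Rightarrow> real) \<Rightarrow> complex \<Rightarrow> complex \<Rightarrow> real \<Rightarrow> complex" where
  "F a s v t = of_real (M t) * T a s v t * inverse (1 + of_real (N t) * T a s v t)"

definition ok :: "(nat \<Rightarrow> real) \<Rightarrow> bool" where
  "ok a \<longleftrightarrow> (\<forall>i\<in>{1..K}. \<bar>a i\<bar> \<le> C)"

context
  fixes a :: "nat \<Rightarrow> real" and s :: complex and t :: real
  assumes a: "ok a" and s: "norm s < r" and t: "t \<in> {0..b}"
begin

lemma pow_le: "i \<in> {1..K} \<Longrightarrow> norm s ^ i \<le> norm s"
  using power_decreasing[of 1 i "norm s"] r_bound[OF s] by auto

lemma T_bound:
  assumes "norm v \<le> 1"
  shows "norm (T a s v t) \<le> Q * norm s"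
proof -
  have "norm (T a s v t) \<le> (\<Sum>i\<in>{1..K}. C * norm s * exp (real K) * C)"
    unfolding T_def
  proof (rule sum_norm_le)
    fix i assume i: "i \<in> {1..K}"
    have "norm (exp (of_nat i * v)) \<le> exp (real K)"
    proof -
      have "Re (of_nat i * v) \<le> norm (of_nat i * v)" by (rule complex_Re_le_cmod)
      also have "\<dots> \<le> real K * 1" unfolding norm_mult norm_of_nat using i assms by (intro mult_mono) auto
      finally show ?thesis by (simp add: norm_exp_eq_Re)
    qed
    then show "norm (of_real (a i) * s ^ i * exp (of_nat i * v) * of_real (w i t)) \<le> C * norm s * exp (real K) * C"
      using i a bdw[OF i t] pow_le[OF i] C unfolding norm_mult ok_def norm_power norm_of_real
      by (intro mult_mono) auto
  qed
  also have "\<dots> = real K * C\<^sup>2 * exp (real K) * norm s" by (simp add: power2_eq_square)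
  also have "\<dots> \<le> Q * norm s"
  proof (intro mult_right_mono)
    have "real K * C\<^sup>2 * exp (real K) * 1 \<le> real K * C\<^sup>2 * exp (real K) * (real K + 1)"
      by (intro mult_left_mono) auto
    then show "real K * C\<^sup>2 * exp (real K) \<le> Q" by (simp add: Qc_def algebra_simps)
  qed simp
  finally show ?thesis .
qed

lemma T_lip:
  assumes "norm v \<le> 1" "norm v' \<le> 1"
  shows "norm (T a s v t - T a s v' t) \<le> Q * norm s * norm (v - v')"
proof -
  have "norm (T a s v t - T a s v' t) \<le> (\<Sum>i\<in>{1..K}. C * norm s * (exp (real K) * (real K * norm (v - v'))) * C)"
    unfolding T_def sum_subtractf[symmetric]
  proof (rule sum_norm_le)
    fix i assume i: "i \<in> {1..K}"
    have bd: "norm (of_nat i * u) \<le> real K" if "norm u \<le> 1" for u :: complex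
    proof -
      have "real i * norm u \<le> real K * 1" using i that by (intro mult_mono) auto
      then show ?thesis by (simp only: norm_mult norm_of_nat mult_1_right)
    qed
    have "norm (exp (of_nat i * v) - exp (of_nat i * v')) \<le> exp (real K) * norm (of_nat i * v - of_nat i * v')"
      by (rule exp_lipschitz_ball) (use bd assms in auto)
    also have "norm (of_nat i * v - of_nat i * v') = real i * norm (v - v')"
      by (simp add: norm_mult flip: right_diff_distrib)
    also have "exp (real K) * \<dots> \<le> exp (real K) * (real K * norm (v - v'))"
      using i by (intro mult_left_mono mult_right_mono) auto
    finally have e: "norm (exp (of_nat i * v) - exp (of_nat i * v')) \<le> exp (real K) * (real K * norm (v - v'))" .
    have "norm (of_real (a i) * s ^ i * (exp (of_nat i * v) - exp (of_nat i * v')) * of_real (w i t)) \<le>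
      C * norm s * (exp (real K) * (real K * norm (v - v'))) * C"
      using i a bdw[OF i t] pow_le[OF i] C e unfolding norm_mult ok_def norm_power norm_of_real
      by (intro mult_mono) auto
    then show "norm (of_real (a i) * s ^ i * exp (of_nat i * v) * of_real (w i t) - of_real (a i) * s ^ i * exp (of_nat i * v') * of_real (w i t))
        \<le> C * norm s * (exp (real K) * (real K * norm (v - v'))) * C"
      by (simp add: algebra_simps)
  qed
  also have "\<dots> = real K * C\<^sup>2 * exp (real K) * real K * (norm s * norm (v - v'))" by (simp add: power2_eq_square)
  also have "\<dots> \<le> Q * (norm s * norm (v - v'))"
    using C by (intro mult_right_mono) (auto simp: Qc_def algebra_simps)
  finally show ?thesis by (simp add: mult.assoc)
qed

lemma den_bound:
  assumes "norm v \<le> 1"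
  shows "norm (of_real (N t) * T a s v t) \<le> C * Q * norm s" "norm (inverse (1 + of_real (N t) * T a s v t)) \<le> 2"
    "1 + of_real (N t) * T a s v t \<noteq> 0"
proof -
  show *: "norm (of_real (N t) * T a s v t) \<le> C * Q * norm s"
    using mult_mono[OF bdN[OF t] T_bound[OF assms]] C by (simp add: norm_mult mult.assoc)
  then have le: "norm (of_real (N t) * T a s v t) \<le> 1/2" using r_bound[OF s] by linarith
  then have "norm (1 + of_real (N t) * T a s v t) \<ge> 1/2"
    using norm_diff_ineq[of 1 "of_real (N t) * T a s v t"] by simp
  then show "1 + of_real (N t) * T a s v t \<noteq> 0" "norm (inverse (1 + of_real (N t) * T a s v t)) \<le> 2"
    using le_imp_inverse_le[of "1/2" "norm (1 + of_real (N t) * T a s v t)"] by (auto simp: norm_inverse)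
qed

lemma F_bound:
  assumes "norm v \<le> 1"
  shows "norm (F a s v t) \<le> 2 * C * Q * norm s"
proof -
  have "norm (F a s v t) \<le> C * (Q * norm s) * 2" unfolding F_def norm_mult
    using bdM[OF t] T_bound[OF assms] den_bound[OF assms] C Q1 by (intro mult_mono) auto
  then show ?thesis by simp
qed

end

text \<open>For \<open>x / (1 + n * x)\<close> a difference of values is the difference of the
  arguments over the product of the two denominators. Both inverses have modulus at most 2, whence
  the factor 4.\<close>

lemma F_diff:
  assumes "ok a" "ok a'" "norm s < r" "t \<in> {0..b}" "norm v \<le> 1" "norm v' \<le> 1"
  shows "F a s v t - F a' s v' t = of_real (M t) * (T a s v t - T a' s v' t) *
     (inverse (1 + of_real (N t) * T a s v t) * inverse (1 + of_real (N t) * T a' s v' t))"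
    "norm (F a s v t - F a' s v' t) \<le> 4 * C * norm (T a s v t - T a' s v' t)"
proof -
  define D D' where "D = 1 + of_real (N t) * T a s v t" "D' = 1 + of_real (N t) * T a' s v' t"
  note d = den_bound[OF assms(1,3,4,5)] and d' = den_bound[OF assms(2,3,4,6)]
  have nz: "D \<noteq> 0" "D' \<noteq> 0" using d(3) d'(3) by (auto simp: D_D'_def)
  have "T a s v t * D' - T a' s v' t * D = T a s v t - T a' s v' t" by (simp add: D_D'_def algebra_simps)
  then have "of_real (M t) * (T a s v t - T a' s v' t) * (inverse D * inverse D') =
      of_real (M t) * (T a s v t * D' - T a' s v' t * D) * (inverse D * inverse D')" by simp
  also have "\<dots> = F a s v t - F a' s v' t"
    unfolding F_def D_D'_def[symmetric] using nz by (simp add: field_simps)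
  finally show eq: "F a s v t - F a' s v' t = of_real (M t) * (T a s v t - T a' s v' t) *
     (inverse (1 + of_real (N t) * T a s v t) * inverse (1 + of_real (N t) * T a' s v' t))"
    by (simp add: D_D'_def)
  have "norm (F a s v t - F a' s v' t) \<le> C * norm (T a s v t - T a' s v' t) * (2 * 2)"
    unfolding eq norm_mult using d(2) d'(2) bdM[OF assms(4)] C by (intro mult_mono) auto
  then show "norm (F a s v t - F a' s v' t) \<le> 4 * C * norm (T a s v t - T a' s v' t)" by simp
qed

lemma F_lip:
  assumes "ok a" "norm s < r" "t \<in> {0..b}" "norm v \<le> 1" "norm v' \<le> 1"
  shows "norm (F a s v t - F a s v' t) \<le> 4 * C * Q * norm s * norm (v - v')"
proof -
  have "norm (F a s v t - F a s v' t) \<le> 4 * C * norm (T a s v t - T a s v' t)"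
    using F_diff(2)[OF assms(1,1,2-)] .
  also have "\<dots> \<le> 4 * C * (Q * norm s * norm (v - v'))"
    using T_lip[OF assms] C by (intro mult_left_mono) auto
  finally show ?thesis by (simp add: mult.assoc)
qed

fun picard :: "(nat \<Rightarrow> real) \<Rightarrow> nat \<Rightarrow> complex \<Rightarrow> real \<Rightarrow> complex" where
  "picard a 0 s t = 0"
| "picard a (Suc n) s t = integral {0..t} (\<lambda>\<tau>. F a s (picard a n s \<tau>) \<tau>)"

lemma integral_bound_b:
  fixes f :: "real \<Rightarrow> complex"
  assumes "t \<in> {0..b}" "continuous_on {0..t} f" "\<And>\<tau>. \<tau> \<in> {0..t} \<Longrightarrow> norm (f \<tau>) \<le> B"
  shows "norm (integral {0..t} f) \<le> b * B"
proof -
  have "B \<ge> 0" using assms(3)[of 0] assms(1) by (intro order_trans[OF norm_ge_zero[of "f 0"]]) auto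
  have "norm (integral {0..t} f) \<le> B * (t - 0)"
    by (rule integral_bound) (use assms in auto)
  also have "\<dots> \<le> B * b" using assms(1) \<open>B \<ge> 0\<close> by (intro mult_left_mono) auto
  also have "\<dots> = b * B" by simp
  finally show ?thesis .
qed

lemma param_holo_F:
  assumes a: "ok a" and v: "param_holo r b v" "\<And>s t. s \<in> ball 0 r \<Longrightarrow> t \<in> {0..b} \<Longrightarrow> norm (v s t) \<le> 1"
  shows "param_holo r b (\<lambda>s t. F a s (v s t) t)"
proof -
  have T: "param_holo r b (\<lambda>s t. T a s (v s t) t)" unfolding T_def
    by (intro param_holo_sum param_holo_mult param_holo_const param_holo_const' param_holo_power param_holo_id
        param_holo_exp v contw)
  have "param_holo r b (\<lambda>s t. of_real (M t) * T a s (v s t) t * inverse (1 + of_real (N t) * T a s (v s t) t))"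
    by (intro param_holo_mult param_holo_inverse param_holo_add param_holo_const param_holo_const' T contM contN)
       (use den_bound(3)[OF a] v in auto)
  then show ?thesis by (simp add: F_def)
qed

lemma param_holo_slice:
  assumes "param_holo r b f" "norm s < r" "t \<le> b"
  shows "continuous_on {0..t} (f s)"
proof -
  have "continuous_on (ball 0 r \<times> {0..b}) (\<lambda>(s, t). f s t)" using assms by (auto simp: param_holo_def)
  moreover have "Pair s ` {0..t} \<subseteq> ball 0 r \<times> {0..b}" using assms by auto
  ultimately show ?thesis using continuous_on_compose2[of "ball 0 r \<times> {0..b}" "\<lambda>(s, t). f s t" "{0..t}" "Pair s"]
    continuous_on_Pair[OF continuous_on_const continuous_on_id, of "{0..t}" s] by simp
qed

lemma picard_props:
  assumes a: "ok a"
  shows "param_holo r b (picard a n) \<and> (\<forall>s\<in>ball 0 r. \<forall>t\<in>{0..b}. norm (picard a n s t) \<le> 1)"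
proof (induction n)
  case 0
  have "picard a 0 = (\<lambda>s t. 0)" by (intro ext) simp
  then show ?case by (simp add: param_holo_const')
next
  case (Suc n)
  have F: "param_holo r b (\<lambda>s t. F a s (picard a n s t) t)"
    using Suc by (intro param_holo_F a) auto
  have "picard a (Suc n) = (\<lambda>s t. integral {0..t} (\<lambda>\<tau>. F a s (picard a n s \<tau>) \<tau>))"
    by (intro ext) simp
  moreover have "norm (picard a (Suc n) s t) \<le> 1" if "s \<in> ball 0 r" "t \<in> {0..b}" for s t
  proof -
    have "norm (picard a (Suc n) s t) \<le> b * (2 * C * Q * norm s)"
      unfolding picard.simps
      by (rule integral_bound_b) (use that Suc F_bound[OF a] param_holo_slice[OF F] in auto)
    then show ?thesis using r_bound[of s] that by auto
  qed
  ultimately show ?case using param_holo_integral[OF F] by simp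
qed

text \<open>The Lipschitz constant \<open>4*C*Q*norm s\<close> of \<open>F\<close> times the length
  \<open>b\<close> is at most 1/2 inside the radius.\<close>

lemma picard_step:
  assumes a: "ok a" and s: "norm s < r" and t: "t \<in> {0..b}"
  shows "norm (picard a (Suc n) s t - picard a n s t) \<le> (1/2) ^ n"
  using t
proof (induction n arbitrary: t)
  case 0
  then show ?case using picard_props[OF a, of 1] s by auto
next
  case (Suc n)
  have ph: "param_holo r b (\<lambda>s t. F a s (picard a n s t) t)" for n
    using picard_props[OF a, of n] by (intro param_holo_F a) auto
  have c: "continuous_on {0..t} (\<lambda>\<tau>. F a s (picard a n s \<tau>) \<tau>)" for n
    using param_holo_slice[OF ph s] Suc.prems by auto
  have "picard a (Suc (Suc n)) s t - picard a (Suc n) s t =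
     integral {0..t} (\<lambda>\<tau>. F a s (picard a (Suc n) s \<tau>) \<tau> - F a s (picard a n s \<tau>) \<tau>)"
    unfolding picard.simps(2)[of _ "Suc n"] picard.simps(2)[of _ n s t]
    by (rule integral_diff[symmetric]) (intro integrable_continuous_interval c)+
  also have "norm \<dots> \<le> b * (4 * C * Q * norm s * (1/2) ^ n)"
  proof (rule integral_bound_b)
    fix \<tau> assume \<tau>: "\<tau> \<in> {0..t}"
    then have \<tau>b: "\<tau> \<in> {0..b}" using Suc.prems by auto
    have "norm (F a s (picard a (Suc n) s \<tau>) \<tau> - F a s (picard a n s \<tau>) \<tau>) \<le>
       4 * C * Q * norm s * norm (picard a (Suc n) s \<tau> - picard a n s \<tau>)"
      using picard_props[OF a, of n] picard_props[OF a, of "Suc n"] s \<tau>b by (intro F_lip a) (auto simp del: picard.simps)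
    also have "\<dots> \<le> 4 * C * Q * norm s * (1/2) ^ n"
      using Suc.IH[OF \<tau>b] C Q1 by (intro mult_left_mono) auto
    finally show "norm (F a s (picard a (Suc n) s \<tau>) \<tau> - F a s (picard a n s \<tau>) \<tau>) \<le> 4 * C * Q * norm s * (1/2) ^ n" .
  qed (use Suc.prems c in \<open>auto intro!: continuous_intros simp del: picard.simps\<close>)
  also have "\<dots> = 4 * (b * (C * Q * norm s)) * (1/2) ^ n" by simp
  also have "\<dots> \<le> 1/2 * (1/2) ^ n" using r_bound[OF s] by (intro mult_right_mono) auto
  finally show ?case by simp
qed

text \<open>The limit of the Picard iterates, written as a telescoping series so that the
  Weierstrass test gives uniform convergence on the whole parameter disc.\<close>

definition sol :: "(nat \<Rightarrow> real) \<Rightarrow> complex \<Rightarrow> real \<Rightarrow> complex" where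
  "sol a s t = (\<Sum>n. picard a (Suc n) s t - picard a n s t)"

lemma sol_limit:
  assumes a: "ok a"
  shows "uniform_limit (ball 0 r \<times> {0..b}) (\<lambda>n (s, t). picard a n s t) (\<lambda>(s, t). sol a s t) sequentially"
proof -
  have "uniform_limit (ball 0 r \<times> {0..b}) (\<lambda>n x. \<Sum>i<n. (\<lambda>(s, t). picard a (Suc i) s t - picard a i s t) x)
      (\<lambda>x. suminf (\<lambda>i. (\<lambda>(s, t). picard a (Suc i) s t - picard a i s t) x)) sequentially"
  proof (rule Weierstrass_m_test)
    show "norm ((\<lambda>(s, t). picard a (Suc n) s t - picard a n s t) x) \<le> (1/2) ^ n"
      if "x \<in> ball 0 r \<times> {0..b}" for n x
      using that picard_step[OF a, of "fst x" "snd x" n] by (auto simp: case_prod_unfold simp del: picard.simps)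
  qed (simp add: summable_geometric)
  moreover have "(\<Sum>i<n. picard a (Suc i) s t - picard a i s t) = picard a n s t" for n s t
    by (subst sum_lessThan_telescope) simp
  ultimately show ?thesis by (simp add: sol_def case_prod_unfold del: picard.simps)
qed

lemma picard_error:
  assumes a: "ok a" and \<epsilon>: "\<epsilon> > 0"
  shows "\<exists>n0. \<forall>n\<ge>n0. \<forall>s\<in>ball 0 r. \<forall>t\<in>{0..b}. norm (picard a n s t - sol a s t) < \<epsilon>"
  using uniform_limitD[OF sol_limit[OF a] \<epsilon>] by (auto simp: eventually_sequentially dist_norm)

lemma sol_continuous:
  assumes a: "ok a"
  shows "continuous_on (ball 0 r \<times> {0..b}) (\<lambda>(s, t). sol a s t)"
  by (rule uniform_limit_theorem[OF _ sol_limit[OF a]]) (use picard_props[OF a] in \<open>auto simp: param_holo_def\<close>)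

lemma sol_slice: "ok a \<Longrightarrow> norm s < r \<Longrightarrow> t \<le> b \<Longrightarrow> continuous_on {0..t} (sol a s)"
proof -
  assume *: "ok a" "norm s < r" "t \<le> b"
  then have "Pair s ` {0..t} \<subseteq> ball 0 r \<times> {0..b}" by auto
  from continuous_on_compose2[OF sol_continuous _ this] * show ?thesis
    using continuous_on_Pair[OF continuous_on_const continuous_on_id, of "{0..t}" s] by simp
qed

lemma sol_pointwise:
  assumes "ok a" "norm s < r" "t \<in> {0..b}"
  shows "(\<lambda>n. picard a n s t) \<longlonglongrightarrow> sol a s t"
  using tendsto_uniform_limitI[OF sol_limit[OF assms(1)], of "(s, t)"] assms by auto

lemma sol_le_1:
  assumes "ok a" "norm s < r" "t \<in> {0..b}"
  shows "norm (sol a s t) \<le> 1"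
proof (rule tendsto_upperbound[OF tendsto_norm[OF sol_pointwise[OF assms]]])
  show "\<forall>\<^sub>F n in sequentially. norm (picard a n s t) \<le> 1"
    using picard_props[OF assms(1)] assms(2,3) by (auto simp del: picard.simps)
qed simp

lemma F_slice:
  assumes a: "ok a" and s: "norm s < r" and t: "t \<le> b"
    and v: "continuous_on {0..t} v" "\<And>\<tau>. \<tau> \<in> {0..t} \<Longrightarrow> norm (v \<tau>) \<le> 1"
  shows "continuous_on {0..t} (\<lambda>\<tau>. F a s (v \<tau>) \<tau>)"
proof -
  have sub: "{0..t} \<subseteq> {0..b}" using t by auto
  have T: "continuous_on {0..t} (\<lambda>\<tau>. T a s (v \<tau>) \<tau>)"
    unfolding T_def by (intro continuous_intros v continuous_on_subset[OF contw sub])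
  show ?thesis unfolding F_def
    by (intro continuous_intros T continuous_on_subset[OF contM sub] continuous_on_subset[OF contN sub])
       (use den_bound(3)[OF a s] v sub in auto)
qed

lemma sol_integral:
  assumes a: "ok a" and s: "norm s < r" and t: "t \<in> {0..b}"
  shows "sol a s t = integral {0..t} (\<lambda>\<tau>. F a s (sol a s \<tau>) \<tau>)"
proof -
  have "norm (sol a s t - integral {0..t} (\<lambda>\<tau>. F a s (sol a s \<tau>) \<tau>)) \<le> \<epsilon>" if \<epsilon>: "\<epsilon> > 0" for \<epsilon>
  proof -
    obtain n0 where n0: "\<forall>n\<ge>n0. \<forall>s\<in>ball 0 r. \<forall>t\<in>{0..b}. norm (picard a n s t - sol a s t) < \<epsilon>/2"
      using picard_error[OF a, of "\<epsilon>/2"] \<epsilon> by auto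
    have ph: "param_holo r b (picard a n0)" "\<And>s t. s \<in> ball 0 r \<Longrightarrow> t \<in> {0..b} \<Longrightarrow> norm (picard a n0 s t) \<le> 1"
      using picard_props[OF a, of n0] by auto
    have c1: "continuous_on {0..t} (\<lambda>\<tau>. F a s (picard a n0 s \<tau>) \<tau>)"
      using t s by (intro F_slice a param_holo_slice[OF ph(1)] ph) auto
    have c2: "continuous_on {0..t} (\<lambda>\<tau>. F a s (sol a s \<tau>) \<tau>)"
      using t s by (intro F_slice a sol_slice sol_le_1) auto
    have "picard a (Suc n0) s t - integral {0..t} (\<lambda>\<tau>. F a s (sol a s \<tau>) \<tau>) =
        integral {0..t} (\<lambda>\<tau>. F a s (picard a n0 s \<tau>) \<tau> - F a s (sol a s \<tau>) \<tau>)"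
      unfolding picard.simps by (rule integral_diff[symmetric]) (intro integrable_continuous_interval c1 c2)+
    also have "norm \<dots> \<le> b * (4 * C * Q * norm s * (\<epsilon>/2))"
    proof (rule integral_bound_b)
      fix \<tau> assume "\<tau> \<in> {0..t}"
      then have \<tau>: "\<tau> \<in> {0..b}" using t by auto
      have "norm (F a s (picard a n0 s \<tau>) \<tau> - F a s (sol a s \<tau>) \<tau>) \<le> 4 * C * Q * norm s * norm (picard a n0 s \<tau> - sol a s \<tau>)"
        using s \<tau> by (intro F_lip a ph sol_le_1) auto
      also have "\<dots> \<le> 4 * C * Q * norm s * (\<epsilon>/2)"
        using n0 s \<tau> C Q1 by (intro mult_left_mono less_imp_le[of _ "\<epsilon>/2"]) auto
      finally show "norm (F a s (picard a n0 s \<tau>) \<tau> - F a s (sol a s \<tau>) \<tau>) \<le> 4 * C * Q * norm s * (\<epsilon>/2)" .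
    qed (use t c1 c2 in \<open>auto intro!: continuous_intros\<close>)
    also have "\<dots> = 4 * (b * (C * Q * norm s)) * (\<epsilon>/2)" by simp
    also have "\<dots> \<le> 1/2 * (\<epsilon>/2)" using r_bound[OF s] \<epsilon> by (intro mult_right_mono) auto
    finally have 1: "norm (picard a (Suc n0) s t - integral {0..t} (\<lambda>\<tau>. F a s (sol a s \<tau>) \<tau>)) \<le> \<epsilon>/4" by simp
    have 2: "norm (sol a s t - picard a (Suc n0) s t) < \<epsilon>/2"
      using n0[rule_format, of "Suc n0" s t] s t by (simp add: norm_minus_commute del: picard.simps)
    show ?thesis
      using norm_triangle_ineq[of "sol a s t - picard a (Suc n0) s t" "picard a (Suc n0) s t - integral {0..t} (\<lambda>\<tau>. F a s (sol a s \<tau>) \<tau>)"]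
        1 2 \<epsilon> by (simp del: picard.simps)
  qed
  then have "norm (sol a s t - integral {0..t} (\<lambda>\<tau>. F a s (sol a s \<tau>) \<tau>)) \<le> 0" by (rule field_le_epsilon[of _ 0, simplified])
  then show ?thesis by simp
qed

lemma sol_bound:
  assumes "ok a" "norm s < r" "t \<in> {0..b}"
  shows "norm (sol a s t) \<le> 2 * b * C * Q * norm s"
proof -
  have "norm (sol a s t) \<le> b * (2 * C * Q * norm s)"
    unfolding sol_integral[OF assms]
    using assms by (intro integral_bound_b F_slice F_bound sol_slice sol_le_1) auto
  then show ?thesis by (simp add: mult_ac)
qed

lemma sol_0: "sol a s 0 = 0" if "ok a" "norm s < r"
  using sol_integral[OF that, of 0] b by simp

lemma sol_derivative:
  assumes a: "ok a" and s: "norm s < r" and t: "t \<in> {0..b}"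
  shows "(sol a s has_vector_derivative F a s (sol a s t) t) (at t within {0..b})"
proof -
  have "((\<lambda>u. integral {0..u} (\<lambda>\<tau>. F a s (sol a s \<tau>) \<tau>)) has_vector_derivative F a s (sol a s t) t) (at t within {0..b})"
    using s t by (intro integral_has_vector_derivative F_slice a sol_slice sol_le_1) auto
  then show ?thesis
    by (rule has_vector_derivative_transform[OF t, rotated]) (simp add: sol_integral[OF a s])
qed

lemma sol_holomorphic:
  assumes a: "ok a" and t: "t \<in> {0..b}"
  shows "(\<lambda>s. sol a s t) holomorphic_on ball 0 r"
proof (rule holomorphic_uniform_sequence[OF open_ball])
  fix n
  have "param_holo r b (picard a n)" using picard_props[OF a] by blast
  then show "(\<lambda>s. picard a n s t) holomorphic_on ball 0 r"
    using t unfolding param_holo_def holomorphic_on_def field_differentiable_def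
    by (blast intro: has_field_derivative_at_within)
next
  fix x :: complex assume "x \<in> ball 0 r"
  then obtain d where d: "d > 0" "cball x d \<subseteq> ball 0 r" using open_contains_cball_eq[OF open_ball] by blast
  have "uniform_limit (ball 0 r) (\<lambda>n s. picard a n s t) (\<lambda>s. sol a s t) sequentially"
  proof (rule uniform_limitI)
    fix e :: real assume "e > 0"
    then obtain n0 where "\<forall>n\<ge>n0. \<forall>s\<in>ball 0 r. \<forall>t\<in>{0..b}. norm (picard a n s t - sol a s t) < e"
      using picard_error[OF a] by blast
    then show "\<forall>\<^sub>F n in sequentially. \<forall>x\<in>ball 0 r. dist (picard a n x t) (sol a x t) < e"
      using t unfolding eventually_sequentially dist_norm by blast
  qed
  then show "\<exists>d>0. cball x d \<subseteq> ball 0 r \<and> uniform_limit (cball x d) (\<lambda>n s. picard a n s t) (\<lambda>s. sol a s t) sequentially"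
    using d uniform_limit_on_subset by blast
qed

definition T_re :: "(nat \<Rightarrow> real) \<Rightarrow> real \<Rightarrow> real \<Rightarrow> real \<Rightarrow> real" where
  "T_re a s v t = (\<Sum>i\<in>{1..K}. a i * s ^ i * exp (real i * v) * w i t)"

lemma T_of_real: "T a (of_real s) (of_real v) t = of_real (T_re a s v t)"
proof -
  have "exp (of_nat i * of_real v) = (of_real (exp (real i * v)) :: complex)" for i
    by (metis exp_of_real of_real_mult of_real_of_nat_eq)
  then show ?thesis by (simp add: T_def T_re_def)
qed

lemma F_of_real: "F a (of_real s) (of_real v) t = of_real (M t * T_re a s v t / (1 + N t * T_re a s v t))"
  unfolding F_def T_of_real by (simp add: divide_inverse)

lemma F_real: "v \<in> \<real> \<Longrightarrow> F a (of_real s) v t \<in> \<real>"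
  by (metis F_of_real Reals_cases Reals_of_real)

lemma picard_real: "picard a n (of_real s) t \<in> \<real>"
proof (induction n arbitrary: t)
  case (Suc n)
  have "(\<lambda>\<tau>. F a (of_real s) (picard a n (of_real s) \<tau>) \<tau>) =
     (\<lambda>\<tau>. of_real (Re (F a (of_real s) (picard a n (of_real s) \<tau>) \<tau>)))"
    using F_real[OF Suc] by auto
  then have "picard a (Suc n) (of_real s) t = integral {0..t} (\<lambda>\<tau>. of_real (Re (F a (of_real s) (picard a n (of_real s) \<tau>) \<tau>)))"
    by simp
  also have "\<dots> \<in> \<real>"
  proof (cases "(\<lambda>\<tau>. complex_of_real (Re (F a (of_real s) (picard a n (of_real s) \<tau>) \<tau>))) integrable_on {0..t}")
    case True
    from integral_linear[OF True bounded_linear_Im]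
    show ?thesis by (simp add: complex_is_Real_iff o_def)
  \<comment> \<open>Without integrability the integral has its default value 0, which is real
    too.\<close>
  qed (simp add: not_integrable_integral)
  finally show ?case .
qed simp

lemma sol_real:
  assumes "ok a" "\<bar>s\<bar> < r" "t \<in> {0..b}"
  shows "sol a (of_real s) t \<in> \<real>"
proof (rule closed_sequentially[OF closed_complex_Reals])
  show "\<And>n. picard a n (of_real s) t \<in> \<real>" by (rule picard_real)
  show "(\<lambda>n. picard a n (of_real s) t) \<longlonglongrightarrow> sol a (of_real s) t"
    using assms by (intro sol_pointwise) auto
qed

end

section \<open>The effect of a single coefficient on the solution\<close>

text \<open>\<open>lipc\<close> bounds the change of the solution per unit of
  \<open>norm (a j * s^j)\<close>, and \<open>asyc\<close> the remainder of its first-order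
  expansion relative to \<open>norm s\<close>. Both stand outside the locale because they must not
  depend on the functions of the equation.\<close>

definition lipc :: "nat \<Rightarrow> real \<Rightarrow> real \<Rightarrow> real" where
  "lipc K b C = 8 * b * C\<^sup>2 * exp (real K)"

definition asyc :: "nat \<Rightarrow> real \<Rightarrow> real \<Rightarrow> real" where
  "asyc K b C = b * (4 * C * (C * (exp (real K) * real K * (2 * b * C * Qc K C) + 3 * (C * Qc K C)) + Qc K C * lipc K b C))"

context scalar_ode
begin

context
  fixes a a' :: "nat \<Rightarrow> real" and j :: nat and s :: complex
  assumes a: "ok a" and j: "j \<in> {1..K}" and a': "a' = a(j := 0)" and s: "norm s < r"
begin

lemma ok': "ok a'" using a C by (auto simp: ok_def a')

lemma T_split: "T a s v t = of_real (a j) * s ^ j * exp (of_nat j * v) * of_real (w j t) + T a' s v t"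
proof -
  have "T a s v t = of_real (a j) * s ^ j * exp (of_nat j * v) * of_real (w j t) +
     (\<Sum>i\<in>{1..K} - {j}. of_real (a i) * s ^ i * exp (of_nat i * v) * of_real (w i t))"
    unfolding T_def using j by (intro sum.remove) auto
  moreover have "T a' s v t = (\<Sum>i\<in>{1..K} - {j}. of_real (a i) * s ^ i * exp (of_nat i * v) * of_real (w i t))"
    unfolding T_def using j by (subst sum.remove[of _ j]) (auto simp: a')
  ultimately show ?thesis by simp
qed

lemma exp_j_bound:
  fixes v :: complex
  assumes "norm v \<le> 1"
  shows "norm (exp (of_nat j * v)) \<le> exp (real K)"
proof -
  have "Re (of_nat j * v) \<le> norm (of_nat j * v)" by (rule complex_Re_le_cmod)
  also have "\<dots> \<le> real K * 1" unfolding norm_mult norm_of_nat using j assms by (intro mult_mono) auto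
  finally show ?thesis by (simp add: norm_exp_eq_Re)
qed

lemma sol_diff_eq:
  assumes t: "t \<in> {0..b}"
  shows "sol a s t - sol a' s t = integral {0..t} (\<lambda>\<tau>. F a s (sol a s \<tau>) \<tau> - F a' s (sol a' s \<tau>) \<tau>)"
  unfolding sol_integral[OF a s t] sol_integral[OF ok' s t]
  using t s by (intro integral_diff[symmetric] integrable_continuous_interval F_slice a ok' sol_slice sol_le_1) auto

text \<open>At the time where the two solutions differ most, the direct effect of the coefficient is
  a constant times \<open>X\<close>, and the feedback through the solution is at most half of the
  maximum, so it can be absorbed on the left.\<close>

lemma sol_lipschitz:
  assumes t: "t \<in> {0..b}"
  shows "norm (sol a s t - sol a' s t) \<le> lipc K b C * (\<bar>a j\<bar> * norm s ^ j)"
proof -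
  define X where "X = \<bar>a j\<bar> * norm s ^ j"
  define z where "z t = norm (sol a s t - sol a' s t)" for t
  have "continuous_on {0..b} z"
    unfolding z_def using s by (intro continuous_intros sol_slice a ok') auto
  then obtain tm where tm: "tm \<in> {0..b}" "\<And>t. t \<in> {0..b} \<Longrightarrow> z t \<le> z tm"
    using continuous_attains_sup[of "{0..b}" z] b by auto
  define m where "m = z tm"
  have "norm (integral {0..tm} (\<lambda>\<tau>. F a s (sol a s \<tau>) \<tau> - F a' s (sol a' s \<tau>) \<tau>))
     \<le> b * (4 * C * (X * (exp (real K) * C) + Q * norm s * m))"
  proof (rule integral_bound_b)
      fix \<tau> assume "\<tau> \<in> {0..tm}"
      then have \<tau>: "\<tau> \<in> {0..b}" using tm(1) by auto
      have v: "norm (sol a s \<tau>) \<le> 1" "norm (sol a' s \<tau>) \<le> 1" using sol_le_1 a ok' s \<tau> by blast+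
      have "norm (T a s (sol a s \<tau>) \<tau> - T a' s (sol a' s \<tau>) \<tau>) \<le>
         norm (of_real (a j) * s ^ j * exp (of_nat j * sol a s \<tau>) * of_real (w j \<tau>)) +
         norm (T a' s (sol a s \<tau>) \<tau> - T a' s (sol a' s \<tau>) \<tau>)"
        unfolding T_split by (rule order_trans[OF _ norm_triangle_ineq]) (simp add: algebra_simps)
      also have "norm (of_real (a j) * s ^ j * exp (of_nat j * sol a s \<tau>) * of_real (w j \<tau>)) \<le> X * exp (real K) * C"
        unfolding norm_mult norm_power norm_of_real X_def
        using exp_j_bound[OF v(1)] bdw[OF j \<tau>] C by (intro mult_mono) auto
      also have "norm (T a' s (sol a s \<tau>) \<tau> - T a' s (sol a' s \<tau>) \<tau>) \<le> Q * norm s * z \<tau>"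
        unfolding z_def by (rule T_lip[OF ok' s \<tau> v])
      also have "\<dots> \<le> Q * norm s * z tm" using tm(2)[OF \<tau>] Q1 by (intro mult_left_mono) auto
      finally have Tb: "norm (T a s (sol a s \<tau>) \<tau> - T a' s (sol a' s \<tau>) \<tau>) \<le> X * (exp (real K) * C) + Q * norm s * z tm"
        by (simp add: mult.assoc)
      have "norm (F a s (sol a s \<tau>) \<tau> - F a' s (sol a' s \<tau>) \<tau>) \<le> 4 * C * norm (T a s (sol a s \<tau>) \<tau> - T a' s (sol a' s \<tau>) \<tau>)"
        by (rule F_diff(2)[OF a ok' s \<tau> v])
      also have "\<dots> \<le> 4 * C * (X * (exp (real K) * C) + Q * norm s * z tm)"
        using Tb C by (intro mult_left_mono) auto
      finally show "norm (F a s (sol a s \<tau>) \<tau> - F a' s (sol a' s \<tau>) \<tau>) \<le> 4 * C * (X * (exp (real K) * C) + Q * norm s * m)"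
        by (simp add: m_def)
  qed (use tm(1) s in \<open>auto intro!: continuous_intros F_slice a ok' sol_slice sol_le_1\<close>)
  then have "z tm \<le> b * (4 * C * (X * (exp (real K) * C) + Q * norm s * m))"
    by (simp only: z_def sol_diff_eq[OF tm(1)])
  also have "\<dots> = (4 * b * C\<^sup>2 * exp (real K)) * X + 4 * (b * (C * Q * norm s)) * z tm"
    by (simp add: m_def power2_eq_square algebra_simps)
  also have "4 * (b * (C * Q * norm s)) * z tm \<le> 1/2 * z tm"
    using r_bound[OF s] by (intro mult_right_mono) (auto simp: z_def)
  finally have "z tm \<le> lipc K b C * X" by (simp add: lipc_def)
  then show ?thesis using tm(2)[OF t] by (simp add: z_def X_def)
qed

text \<open>First-order expansion in the coefficient: the direct term is \<open>a j * s^j\<close>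
  times the integral of \<open>M * w j\<close>; the exponential factor, the denominators and the
  feedback each cost a further factor \<open>norm s\<close>.\<close>

lemma sol_asymptotic:
  "norm (sol a s b - sol a' s b - of_real (a j) * s ^ j * of_real (integral {0..b} (\<lambda>t. M t * w j t)))
     \<le> asyc K b C * norm s * (\<bar>a j\<bar> * norm s ^ j)"
proof -
  define X where "X = of_real (a j) * s ^ j"
  have nX: "norm X = \<bar>a j\<bar> * norm s ^ j" by (simp add: X_def norm_mult norm_power)
  have bb: "b \<in> {0..b}" using b by auto
  have cF: "continuous_on {0..b} (\<lambda>\<tau>. F a s (sol a s \<tau>) \<tau> - F a' s (sol a' s \<tau>) \<tau>)"
    using s by (auto intro!: continuous_intros F_slice a ok' sol_slice sol_le_1)
  have cM: "continuous_on {0..b} (\<lambda>t. M t * w j t)" by (intro continuous_intros contM contw)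
  have "((\<lambda>t. M t * w j t) has_integral integral {0..b} (\<lambda>t. M t * w j t)) {0..b}"
    by (intro integrable_integral integrable_continuous_interval cM)
  from has_integral_linear[OF this bounded_linear_of_real[where ?'a = complex]]
  have "integral {0..b} (\<lambda>t. of_real (M t * w j t)) = complex_of_real (integral {0..b} (\<lambda>t. M t * w j t))"
    by (auto simp: o_def intro: integral_unique)
  then have "sol a s b - sol a' s b - X * of_real (integral {0..b} (\<lambda>t. M t * w j t)) =
     integral {0..b} (\<lambda>\<tau>. F a s (sol a s \<tau>) \<tau> - F a' s (sol a' s \<tau>) \<tau>) - integral {0..b} (\<lambda>t. X * of_real (M t * w j t))"
    by (simp add: sol_diff_eq[OF bb])
  also have "\<dots> = integral {0..b} (\<lambda>\<tau>. (F a s (sol a s \<tau>) \<tau> - F a' s (sol a' s \<tau>) \<tau>) - X * of_real (M \<tau> * w j \<tau>))"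
    by (intro integral_diff[symmetric] integrable_continuous_interval cF continuous_on_mult continuous_on_const continuous_on_of_real cM)
  also have "norm \<dots> \<le> b * (4 * C * (C * (norm X * ((exp (real K) * real K * (2 * b * C * Q) + 3 * (C * Q)) * norm s)) + Q * norm s * (lipc K b C * norm X)))"
  proof (rule integral_bound_b[OF bb])
    show "continuous_on {0..b} (\<lambda>\<tau>. (F a s (sol a s \<tau>) \<tau> - F a' s (sol a' s \<tau>) \<tau>) - X * of_real (M \<tau> * w j \<tau>))"
      by (intro continuous_on_diff[OF cF] continuous_on_mult continuous_on_const continuous_on_of_real cM)
    fix \<tau> assume \<tau>: "\<tau> \<in> {0..b}"
    define v v' where "v = sol a s \<tau>" and "v' = sol a' s \<tau>"
    have v: "norm v \<le> 1" "norm v' \<le> 1" using sol_le_1 a ok' s \<tau> unfolding v_def v'_def by blast+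
    define d d' where "d = of_real (N \<tau>) * T a s v \<tau>" and "d' = of_real (N \<tau>) * T a' s v' \<tau>"
    define \<delta> where "\<delta> = T a' s v \<tau> - T a' s v' \<tau>"
    define e where "e = exp (of_nat j * v)"
    \<comment> \<open>The factor shared by the difference of the two right-hand sides. Multiplying
      the leading term by \<open>(1 + d) * (1 + d') * I = 1\<close> puts everything over the same
      denominator.\<close>
    define I where "I = inverse (1 + d) * inverse (1 + d')"
    have nz: "1 + d \<noteq> 0" "1 + d' \<noteq> 0" using den_bound(3)[OF a s \<tau> v(1)] den_bound(3)[OF ok' s \<tau> v(2)] by (auto simp: d_def d'_def)
    have "norm I \<le> 2 * 2"
      unfolding I_def norm_mult
      using den_bound(2)[OF a s \<tau> v(1)] den_bound(2)[OF ok' s \<tau> v(2)]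
      by (intro mult_mono) (auto simp: d_def d'_def)
    moreover have "(1 + d) * (1 + d') * I = ((1 + d) * inverse (1 + d)) * ((1 + d') * inverse (1 + d'))"
      unfolding I_def by (simp only: mult_ac)
    then have "(1 + d) * (1 + d') * I = 1" using nz by simp
    ultimately have I: "norm I \<le> 2 * 2" "(1 + d) * (1 + d') * I = 1" .
    have "F a s v \<tau> - F a' s v' \<tau> = of_real (M \<tau>) * (X * e * of_real (w j \<tau>) + \<delta>) * I"
      unfolding F_diff(1)[OF a ok' s \<tau> v] I_def d_def d'_def \<delta>_def e_def X_def by (simp add: T_split algebra_simps)
    moreover have "X * of_real (M \<tau> * w j \<tau>) = of_real (M \<tau>) * (X * of_real (w j \<tau>)) * ((1 + d) * (1 + d') * I)"
      unfolding I(2) by simp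
    ultimately have eq: "F a s v \<tau> - F a' s v' \<tau> - X * of_real (M \<tau> * w j \<tau>) =
       of_real (M \<tau>) * (of_real (w j \<tau>) * (X * ((e - 1) - (d + d' + d * d'))) + \<delta>) * I"
      by (simp add: algebra_simps)
    have nd: "norm d \<le> C * Q * norm s" "norm d' \<le> C * Q * norm s"
      using den_bound(1)[OF a s \<tau> v(1)] den_bound(1)[OF ok' s \<tau> v(2)] by (auto simp: d_def d'_def)
    have "norm d * norm d' \<le> (C * Q * norm s) * 1"
      using nd r_bound[OF s] C Q1 by (intro mult_mono) auto
    then have dd: "norm (d + d' + d * d') \<le> 3 * (C * Q) * norm s"
      using norm_triangle_ineq[of "d + d'" "d * d'"] norm_triangle_ineq[of d d'] nd by (simp add: norm_mult)
    have "norm (e - 1) \<le> exp (real K) * norm (of_nat j * v - 0)"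
      unfolding e_def exp_zero[symmetric]
    proof (rule exp_lipschitz_ball)
      show "norm (of_nat j * v) \<le> real K"
        using mult_mono[of "real j" "real K" "norm v" 1] j v by (simp add: norm_mult)
    qed simp
    also have "norm (of_nat j * v - 0) \<le> real K * (2 * b * C * Q * norm s)"
      using sol_bound[OF a s \<tau>] j by (auto simp: norm_mult v_def intro!: mult_mono)
    finally have e: "norm (e - 1) \<le> exp (real K) * real K * (2 * b * C * Q) * norm s" by (simp add: mult_ac)
    have \<delta>: "norm \<delta> \<le> Q * norm s * (lipc K b C * norm X)"
    proof -
      have "norm \<delta> \<le> Q * norm s * norm (v - v')" unfolding \<delta>_def by (rule T_lip[OF ok' s \<tau> v])
      also have "\<dots> \<le> Q * norm s * (lipc K b C * norm X)"
        using sol_lipschitz[OF \<tau>] Q1 by (intro mult_left_mono) (auto simp: nX v_def v'_def)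
      finally show ?thesis .
    qed
    have X_bd: "norm (X * ((e - 1) - (d + d' + d * d'))) \<le> norm X * ((exp (real K) * real K * (2 * b * C * Q) + 3 * (C * Q)) * norm s)"
      unfolding norm_mult[of X] using norm_triangle_ineq4[of "e - 1" "d + d' + d * d'"] e dd
      by (intro mult_left_mono) (auto simp: algebra_simps)
    define B where "B = C * (norm X * ((exp (real K) * real K * (2 * b * C * Q) + 3 * (C * Q)) * norm s)) + Q * norm s * (lipc K b C * norm X)"
    have "norm (of_real (w j \<tau>) * (X * ((e - 1) - (d + d' + d * d'))) + \<delta>) \<le> B"
      unfolding B_def using \<delta> bdw[OF j \<tau>] C X_bd
      by (intro order_trans[OF norm_triangle_ineq] add_mono) (auto simp: norm_mult intro!: mult_mono)
    moreover from order_trans[OF norm_ge_zero this] have "B \<ge> 0" .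
    ultimately have "norm (F a s v \<tau> - F a' s v' \<tau> - X * of_real (M \<tau> * w j \<tau>)) \<le> C * B * (2 * 2)"
      unfolding eq norm_mult[of _ I] norm_mult[of "of_real (M \<tau>)"]
      using I(1) bdM[OF \<tau>] C by (intro mult_mono) auto
    then have "norm (F a s v \<tau> - F a' s v' \<tau> - X * of_real (M \<tau> * w j \<tau>)) \<le> 4 * C * B" by simp
    then show "norm (F a s (sol a s \<tau>) \<tau> - F a' s (sol a' s \<tau>) \<tau> - X * of_real (M \<tau> * w j \<tau>)) \<le>
      4 * C * (C * (norm X * ((exp (real K) * real K * (2 * b * C * Q) + 3 * (C * Q)) * norm s)) + Q * norm s * (lipc K b C * norm X))"
      unfolding v_def v'_def B_def .
  qed
  also have "\<dots> = asyc K b C * norm s * norm X"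
    unfolding asyc_def by (simp add: algebra_simps)
  finally show ?thesis unfolding nX by (simp add: X_def)
qed

end

text \<open>The Melnikov-type integral that measures the first-order effect of coefficient
  \<open>j\<close> at the end point.\<close>

definition cj :: "nat \<Rightarrow> real" where "cj j = integral {0..b} (\<lambda>t. M t * w j t)"

text \<open>\<open>cj j\<close> becomes the value at the origin of a unit whose upper bound is
  \<open>lipc\<close>, so it has to obey the same bound.\<close>

lemma abs_cj_le:
  assumes j: "j \<in> {1..K}"
  shows "\<bar>cj j\<bar> \<le> lipc K b C"
proof -
  have "norm (cj j) \<le> C * C * (b - 0)"
    unfolding cj_def
  proof (rule integral_bound)
    show "norm (M t * w j t) \<le> C * C" if "t \<in> {0..b}" for t
      using bdM[OF that] bdw[OF j that] C by (auto simp: abs_mult intro!: mult_mono)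
  qed (use b in \<open>auto intro!: continuous_intros contM contw\<close>)
  also have "\<dots> = (b * C\<^sup>2) * 1" by (simp add: power2_eq_square)
  also have "\<dots> \<le> (b * C\<^sup>2) * (8 * exp (real K))"
  proof (rule mult_left_mono)
    have "1 \<le> exp (real K)" by simp
    then show "1 \<le> 8 * exp (real K)" by linarith
  qed (use b in auto)
  finally show ?thesis by (simp add: lipc_def mult_ac)
qed

text \<open>Switching off a single coefficient changes the solution at the end point by the
  corresponding monomial times a holomorphic function that does not vanish at the origin.\<close>

lemma sol_diff_unit:
  assumes a: "ok a" and j: "j \<in> {1..K}" and c: "cj j \<ge> c"
  shows "\<exists>\<psi>\<in>unit_class r (lipc K b C) c. \<forall>s\<in>ball 0 r.
     sol a s b - sol (a(j := 0)) s b = of_real (a j) * s ^ j * \<psi> s"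
proof (cases "a j = 0")
  case True
  then have "a(j := 0) = a" by auto
  \<comment> \<open>With \<open>a j = 0\<close> the equation leaves the factor free, and the
    constant \<open>cj j\<close> serves.\<close>
  moreover have "(\<lambda>_. of_real (cj j)) \<in> unit_class r (lipc K b C) c"
    using c abs_cj_le[OF j] by (auto simp: unit_class_def)
  ultimately show ?thesis using True by (intro bexI[of _ "\<lambda>_. of_real (cj j)"]) auto
next
  case False
  define a' where "a' = a(j := 0)"
  note ctx = a j a'_def
  have a': "ok a'" using ok'[OF ctx] r_pos by (metis norm_zero)
  define \<psi> where "\<psi> s = (if s = 0 then of_real (cj j) else (sol a s b - sol a' s b) / (of_real (a j) * s ^ j))" for s :: complex
  have bb: "b \<in> {0..b}" using b by auto
  have lim: "(\<psi> \<longlongrightarrow> \<psi> 0) (at 0)"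
  proof (rule LIM_I)
    fix e :: real assume e: "e > 0"
    define D where "D = \<bar>asyc K b C\<bar> + 1"
    have bd: "norm (\<psi> s - \<psi> 0) \<le> D * norm s" if s: "s \<noteq> 0" "norm s < r" for s
    proof -
      define X where "X = of_real (a j) * s ^ j"
      have X: "X \<noteq> 0" "norm X = \<bar>a j\<bar> * norm s ^ j" using s False by (auto simp: X_def norm_mult norm_power)
      have "norm (sol a s b - sol a' s b - X * of_real (cj j)) \<le> asyc K b C * norm s * norm X"
        using sol_asymptotic[OF ctx s(2)] unfolding X(2) by (simp add: X_def cj_def)
      moreover have "\<psi> s - \<psi> 0 = (sol a s b - sol a' s b - X * of_real (cj j)) / X"
        using s X by (simp add: \<psi>_def X_def[symmetric] diff_divide_distrib)
      ultimately have "norm (\<psi> s - \<psi> 0) \<le> asyc K b C * norm s"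
        using X(1) by (metis norm_divide pos_divide_le_eq zero_less_norm_iff)
      also have "\<dots> \<le> D * norm s" by (intro mult_right_mono) (auto simp: D_def)
      finally show ?thesis .
    qed
    have "D > 0" by (simp add: D_def add_pos_nonneg)
    show "\<exists>d>0. \<forall>x. x \<noteq> 0 \<and> norm (x - 0) < d \<longrightarrow> norm (\<psi> x - \<psi> 0) < e"
    proof (intro exI[of _ "min r (e / D)"] conjI allI impI)
      show "0 < min r (e / D)" using e \<open>D > 0\<close> r_pos by simp
      fix x :: complex assume x: "x \<noteq> 0 \<and> norm (x - 0) < min r (e / D)"
      then have "norm (\<psi> x - \<psi> 0) \<le> D * norm x" by (intro bd) auto
      also have "\<dots> < e" using x \<open>D > 0\<close> by (simp add: field_simps)
      finally show "norm (\<psi> x - \<psi> 0) < e" .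
    qed
  qed
  have "\<psi> holomorphic_on ball 0 r"
  \<comment> \<open>The quotient is holomorphic off the origin and, by the first-order expansion,
    continuous at it; the singularity is removable.\<close>
  proof (rule no_isolated_singularity'[where K = "{0}"])
    show "(\<psi> \<longlongrightarrow> \<psi> z) (at z within ball 0 r)" if "z \<in> {0}" for z
      using lim that by (auto intro: tendsto_within_subset)
    have "(\<lambda>s. (sol a s b - sol a' s b) / (of_real (a j) * s ^ j)) holomorphic_on ball 0 r - {0}"
      using False by (intro holomorphic_intros holomorphic_on_subset[OF sol_holomorphic[OF _ bb]] a a') auto
    then show "\<psi> holomorphic_on ball 0 r - {0}"
      by (rule holomorphic_transform) (auto simp: \<psi>_def)
  qed auto
  moreover have "norm (\<psi> s) \<le> lipc K b C" if "s \<in> ball 0 r" for s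
  proof (cases "s = 0")
    case True
    show ?thesis using True abs_cj_le[OF j] by (simp add: \<psi>_def)
  next
    case s0: False
    have "norm (sol a s b - sol a' s b) \<le> lipc K b C * (\<bar>a j\<bar> * norm s ^ j)"
      using sol_lipschitz[OF ctx _ bb] that by auto
    then show ?thesis using s0 False
      by (simp add: \<psi>_def norm_divide norm_mult norm_power pos_divide_le_eq)
  qed
  moreover have "\<psi> (of_real x) \<in> \<real>" if "\<bar>x\<bar> < r" for x
    unfolding \<psi>_def using sol_real[OF a that bb] sol_real[OF a' that bb]
    by (auto intro!: Reals_divide Reals_diff Reals_mult Reals_power)
  moreover have "Re (\<psi> 0) \<ge> c" using c by (simp add: \<psi>_def)
  ultimately have "\<psi> \<in> unit_class r (lipc K b C) c" by (simp add: unit_class_def)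
  moreover have "sol a s b - sol a' s b = of_real (a j) * s ^ j * \<psi> s" if "s \<in> ball 0 r" for s
    using False j sol_bound[OF a _ bb, of 0] sol_bound[OF a' _ bb, of 0] r_pos by (cases "s = 0") (auto simp: \<psi>_def)
  ultimately show ?thesis by (auto simp: a'_def)
qed

end

lemma unit_class_Re_bounds:
  assumes \<psi>: "\<psi> \<in> unit_class r C c" and "0 < r" "0 < c" "c \<le> C" and x: "\<bar>x\<bar> < r * c / (4 * C)"
  shows "c / 2 \<le> Re (\<psi> (of_real x))" "Re (\<psi> (of_real x)) \<le> C"
proof -
  have "C > 0" using assms by simp
  have "r * c / (4 * C) \<le> r / 4" using assms by (simp add: field_simps)
  then have xr: "\<bar>x\<bar> < r / 4" using x by (rule less_le_trans[rotated])
  then have z': "complex_of_real x \<in> ball 0 (r/2)" using \<open>0 < r\<close> by simp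
  have "norm (\<psi> (of_real x) - \<psi> 0) \<le> 2 * C / r * norm (complex_of_real x - 0)"
    by (rule holomorphic_lipschitz) (use \<psi> z' \<open>0 < r\<close> in \<open>auto simp: unit_class_def\<close>)
  also have "\<dots> \<le> 2 * C / r * (r * c / (4 * C))"
    using x \<open>C > 0\<close> \<open>0 < r\<close> by (intro mult_left_mono) auto
  also have "\<dots> = c / 2" using \<open>C > 0\<close> \<open>0 < r\<close> by (simp add: field_simps)
  finally have "\<bar>Re (\<psi> (of_real x)) - Re (\<psi> 0)\<bar> \<le> c / 2"
    using abs_Re_le_cmod[of "\<psi> (of_real x) - \<psi> 0"] by simp
  moreover have "Re (\<psi> 0) \<ge> c" using \<psi> by (simp add: unit_class_def)
  ultimately show "c / 2 \<le> Re (\<psi> (of_real x))" by linarith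
  have "norm (\<psi> (of_real x)) \<le> C" using \<psi> xr \<open>0 < r\<close> by (auto simp: unit_class_def)
  then show "Re (\<psi> (of_real x)) \<le> C" using complex_Re_le_cmod order_trans by blast
qed

context scalar_ode
begin

text \<open>Odd coefficients are switched on one at a time. Without any, the end value is 0 by
  \<open>sym\<close>; each step contributes one monomial times a unit. The units depend on the
  coefficients themselves, and only their class is under control.\<close>

lemma sol_odd_expansion:
  assumes a: "ok a" and K: "K \<ge> 1"
    and sym: "\<And>a s. ok a \<Longrightarrow> (\<forall>i\<in>{1..K}. odd i \<longrightarrow> a i = 0) \<Longrightarrow> norm s < r \<Longrightarrow> sol a s b = 0"
    and c: "\<And>j. j \<in> {1..K} \<Longrightarrow> odd j \<Longrightarrow> c \<le> cj j"
  shows "\<exists>\<psi>. (\<forall>l\<le>(K-1) div 2. \<psi> l \<in> unit_class r (lipc K b C) c) \<and>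
     (\<forall>s\<in>ball 0 r. sol a s b = (\<Sum>l\<le>(K-1) div 2. of_real (a (2*l+1)) * s ^ (2*l+1) * \<psi> l s))"
proof -
  \<comment> \<open>\<open>A n\<close> retains the odd indices below \<open>2*n\<close> and all even
    ones. Thus \<open>A l\<close> and \<open>A (Suc l)\<close> can differ at \<open>2*l+1\<close>
    only, and \<open>A (Suc N')\<close> is \<open>a\<close>.\<close>
  define A where "A n i = (if odd i \<and> 2 * n < i \<and> i \<le> K then 0 else a i)" for n i :: nat
  have okA: "ok (A n)" for n using a C by (auto simp: ok_def A_def)
  define N' where "N' = (K-1) div 2"
  have idx: "2 * l + 1 \<in> {1..K}" if "l \<le> N'" for l using that K by (auto simp: N'_def)
  have "\<exists>\<psi>\<in>unit_class r (lipc K b C) c. \<forall>s\<in>ball 0 r.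
     sol (A (Suc l)) s b - sol (A l) s b = of_real (a (2*l+1)) * s ^ (2*l+1) * \<psi> s" if l: "l \<le> N'" for l
  proof -
    have "A l = (A (Suc l))(2*l+1 := 0)"
    proof
      fix i show "A l i = ((A (Suc l))(2*l+1 := 0)) i"
        using idx[OF l] by (cases "i = 2*l+1"; cases "i = 2*l+2") (auto simp: A_def)
    qed
    moreover have "A (Suc l) (2*l+1) = a (2*l+1)" by (simp add: A_def)
    ultimately show ?thesis
      using sol_diff_unit[OF okA[of "Suc l"] idx[OF l], of c] c idx[OF l] by auto
  qed
  then obtain \<psi> where \<psi>: "\<And>l. l \<le> N' \<Longrightarrow> \<psi> l \<in> unit_class r (lipc K b C) c"
    "\<And>l s. l \<le> N' \<Longrightarrow> s \<in> ball 0 r \<Longrightarrow>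
     sol (A (Suc l)) s b - sol (A l) s b = of_real (a (2*l+1)) * s ^ (2*l+1) * \<psi> l s" by metis
  have "sol a s b = (\<Sum>l\<le>N'. of_real (a (2*l+1)) * s ^ (2*l+1) * \<psi> l s)" if s: "s \<in> ball 0 r" for s
  proof -
    have "A (Suc N') = a"
    proof
      fix i show "A (Suc N') i = a i" by (auto simp: A_def N'_def elim!: oddE)
    qed
    moreover have "sol (A 0) s b = 0" using s by (intro sym okA) (auto simp: A_def)
    moreover have "(\<Sum>l\<le>N'. sol (A (Suc l)) s b - sol (A l) s b) = sol (A (Suc N')) s b - sol (A 0) s b"
      by (induction N') auto
    ultimately show ?thesis using \<psi>(2)[OF _ s] by simp
  qed
  then show ?thesis using \<psi>(1) unfolding N'_def[symmetric] by blast
qed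

section \<open>The real solution and the radial variable as a function of its initial value\<close>

definition v :: "(nat \<Rightarrow> real) \<Rightarrow> real \<Rightarrow> real \<Rightarrow> real" where "v a s t = Re (sol a (of_real s) t)"

definition Tu :: "(nat \<Rightarrow> real) \<Rightarrow> real \<Rightarrow> real \<Rightarrow> real" where
  "Tu a u t = (\<Sum>i\<in>{1..K}. a i * u ^ i * w i t)"

context
  fixes a :: "nat \<Rightarrow> real"
  assumes a: "ok a"
begin

lemma sol_v: "\<bar>s\<bar> < r \<Longrightarrow> t \<in> {0..b} \<Longrightarrow> sol a (of_real s) t = of_real (v a s t)"
  using sol_real[OF a] by (simp add: v_def)

lemma T_re_Tu: "T_re a s x t = Tu a (s * exp x) t"
  unfolding T_re_def Tu_def exp_of_nat_mult by (simp add: power_mult_distrib mult_ac)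

lemma v_0: "\<bar>s\<bar> < r \<Longrightarrow> v a s 0 = 0"
  using sol_0[OF a] by (simp add: v_def)

lemma v_le_1: "\<bar>s\<bar> < r \<Longrightarrow> t \<in> {0..b} \<Longrightarrow> \<bar>v a s t\<bar> \<le> 1"
  using sol_le_1[OF a, of "of_real s" t] abs_Re_le_cmod[of "sol a (of_real s) t"] by (simp add: v_def)

lemma NT_small: "\<bar>s\<bar> < r \<Longrightarrow> t \<in> {0..b} \<Longrightarrow> \<bar>x\<bar> \<le> 1 \<Longrightarrow> \<bar>N t * Tu a (s * exp x) t\<bar> \<le> 1/2"
  using den_bound(1)[OF a, of "of_real s" t "of_real x"] r_bound[of "of_real s"]
  by (simp add: T_of_real T_re_Tu norm_mult abs_mult)

lemma v_derivative:
  assumes "\<bar>s\<bar> < r" "t \<in> {0..b}"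
  shows "(v a s has_real_derivative M t * Tu a (s * exp (v a s t)) t / (1 + N t * Tu a (s * exp (v a s t)) t)) (at t within {0..b})"
proof -
  have "(sol a (of_real s) has_vector_derivative F a (of_real s) (sol a (of_real s) t) t) (at t within {0..b})"
    by (rule sol_derivative[OF a]) (use assms in auto)
  then have "((\<lambda>t. Re (sol a (of_real s) t)) has_vector_derivative Re (F a (of_real s) (sol a (of_real s) t) t)) (at t within {0..b})"
    by (rule bounded_linear.has_vector_derivative[OF bounded_linear_Re])
  moreover have "Re (F a (of_real s) (sol a (of_real s) t) t) = M t * Tu a (s * exp (v a s t)) t / (1 + N t * Tu a (s * exp (v a s t)) t)"
    unfolding sol_v[OF assms] F_of_real T_re_Tu by simp
  ultimately show ?thesis by (simp add: v_def[abs_def] has_real_derivative_iff_has_vector_derivative)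
qed

lemma v_lipschitz:
  assumes "\<bar>s\<bar> < r/2" "\<bar>s'\<bar> < r/2" "t \<in> {0..b}"
  shows "\<bar>v a s t - v a s' t\<bar> \<le> 2 / r * \<bar>s - s'\<bar>"
proof -
  have "norm (sol a (of_real s) t - sol a (of_real s') t) \<le> 2 * 1 / r * norm (complex_of_real s - of_real s')"
    by (rule holomorphic_lipschitz[OF sol_holomorphic[OF a assms(3)]]) (use assms sol_le_1[OF a] r_pos in auto)
  moreover have "norm (complex_of_real s - of_real s') = \<bar>s - s'\<bar>" by (simp flip: of_real_diff)
  ultimately show ?thesis using abs_Re_le_cmod[of "sol a (of_real s) t - sol a (of_real s') t"] by (simp add: v_def)
qed

text \<open>In logarithms: \<open>ln s' - ln s\<close> is at least \<open>(s' - s) / s'\<close>, and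
  for \<open>s' < r/2\<close> this exceeds \<open>2 / r * (s' - s)\<close>, the most that
  \<open>v\<close> can lose.\<close>

lemma u_strict_mono:
  assumes "0 < s" "s < s'" "s' < r/2" "t \<in> {0..b}"
  shows "s * exp (v a s t) < s' * exp (v a s' t)"
proof -
  have "v a s t - v a s' t \<le> 2 / r * (s' - s)" using v_lipschitz[of s s' t] assms by auto
  also have "\<dots> < (s' - s) / s'"
  proof -
    have "2 / r < 1 / s'" using assms r_pos by (simp add: field_simps)
    then show ?thesis using mult_strict_right_mono[of "2 / r" "1 / s'" "s' - s"] assms by simp
  qed
  also have "\<dots> \<le> ln s' - ln s"
    using ln_diff_le[of s s'] assms by (simp add: field_simps)
  finally have "ln s + v a s t < ln s' + v a s' t" by simp
  then have "exp (ln s + v a s t) < exp (ln s' + v a s' t)" by simp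
  then show ?thesis using assms by (simp add: exp_add)
qed

lemma v_continuous_s:
  assumes "t \<in> {0..b}"
  shows "continuous_on {-r<..<r} (\<lambda>s. v a s t)"
proof -
  have "continuous_on (ball 0 r) (\<lambda>s. sol a s t)"
    using sol_holomorphic[OF a assms] holomorphic_on_imp_continuous_on by blast
  moreover have "complex_of_real ` {-r<..<r} \<subseteq> ball 0 r" by auto
  ultimately have "continuous_on {-r<..<r} (\<lambda>s. sol a (of_real s) t)"
    using continuous_on_compose2[of "ball 0 r" "\<lambda>s. sol a s t" "{-r<..<r}" complex_of_real] continuous_on_of_real[OF continuous_on_id]
    by blast
  then show ?thesis unfolding v_def by (auto intro!: continuous_intros)
qed

lemma u_onto:
  assumes "t \<in> {0..b}" "0 < u" "u < s1 / 3" "s1 < r"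
  shows "\<exists>s. 0 < s \<and> s < s1 \<and> s * exp (v a s t) = u"
proof -
  define f where "f s = s * exp (v a s t)" for s
  have s1: "s1 > 0" using assms by auto
  have "continuous_on {0..s1} f" unfolding f_def
    by (intro continuous_intros continuous_on_subset[OF v_continuous_s[OF assms(1)]]) (use assms s1 r_pos in auto)
  moreover have "f 0 \<le> u" using assms by (simp add: f_def)
  moreover have "u < f s1"
  proof -
    have "1 / 3 \<le> inverse (exp (1::real))" using exp_le by (simp add: field_simps)
    then have "s1 / 3 \<le> s1 * exp (-1)" using mult_left_mono[of "1/3" "inverse (exp 1)" s1] s1 by (simp add: exp_minus)
    also have "\<dots> \<le> f s1" unfolding f_def using v_le_1[of s1 t] assms s1 by (intro mult_left_mono) auto
    finally show ?thesis using assms by simp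
  qed
  ultimately obtain s where s: "0 \<le> s" "s \<le> s1" "f s = u" using IVT'[of f 0 u s1] s1 by auto
  have "s \<noteq> 0" "s \<noteq> s1" using s \<open>u < f s1\<close> assms by (auto simp: f_def)
  then show ?thesis using s unfolding f_def by (intro exI[of _ s]) auto
qed

end

end

text \<open>The radius is chosen before the functions and the coefficients and depends on
  \<open>K\<close>, \<open>b\<close>, \<open>C\<close>, \<open>c\<close> alone. This is the
  uniformity that lets one neighbourhood serve all perturbed systems.\<close>

lemma scalar_ode_zero_count:
  assumes b: "b > 0" and C: "C \<ge> 1" and c: "c > 0"
  shows "\<exists>s0. 0 < s0 \<and> s0 \<le> rad K b C \<and> (\<forall>M N w a Z. scalar_ode M N w K b C \<longrightarrow>
     (\<forall>a s. scalar_ode.ok K C a \<longrightarrow> (\<forall>i\<in>{1..K}. odd i \<longrightarrow> a i = 0) \<longrightarrow> norm s < rad K b C \<longrightarrow> scalar_ode.sol M N w K a s b = 0) \<longrightarrow>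
     (\<forall>j\<in>{1..K}. odd j \<longrightarrow> c \<le> scalar_ode.cj M w b j) \<longrightarrow>
     scalar_ode.ok K C a \<longrightarrow> (\<exists>i\<in>{1..K}. odd i \<and> a i \<noteq> 0) \<longrightarrow>
     finite Z \<longrightarrow> Z \<subseteq> {0<..<s0} \<longrightarrow> (\<forall>s\<in>Z. scalar_ode.v M N w K a s b = 0) \<longrightarrow> card Z \<le> (K - 1) div 2)"
proof -
  define r where "r = rad K b C"
  have r: "r > 0" using b C unfolding r_def rad_def Qc_def by (auto intro!: divide_pos_pos mult_pos_pos add_nonneg_pos)
  have sm: "strict_mono (\<lambda>l::nat. 2*l+1)" by (auto intro: strict_monoI)
  obtain s0 where s0: "0 < s0" "s0 \<le> r" and cnt: "\<forall>(\<alpha>::nat \<Rightarrow> real) \<psi> Z.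
     (\<forall>l\<le>(K-1) div 2. \<psi> l \<in> unit_class r (lipc K b C) c) \<and> (\<exists>l\<le>(K-1) div 2. \<alpha> l \<noteq> 0) \<and> finite Z \<and> Z \<subseteq> {0<..<s0} \<and>
     (\<forall>s\<in>Z. (\<Sum>l\<le>(K-1) div 2. of_real (\<alpha> l) * of_real s ^ (2*l+1) * \<psi> l (of_real s)) = 0) \<longrightarrow> card Z \<le> (K-1) div 2"
    using generalized_descartes[OF r c sm, of "(K-1) div 2" "lipc K b C"] by (elim exE conjE) (rule that)
  show ?thesis unfolding r_def[symmetric]
  proof (intro exI[of _ s0] conjI allI impI s0)
    fix M N w a Z
    assume loc: "scalar_ode M N w K b C"
      and sym: "\<forall>a s. scalar_ode.ok K C a \<longrightarrow> (\<forall>i\<in>{1..K}. odd i \<longrightarrow> a i = 0) \<longrightarrow> norm s < r \<longrightarrow> scalar_ode.sol M N w K a s b = 0"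
      and cc: "\<forall>j\<in>{1..K}. odd j \<longrightarrow> c \<le> scalar_ode.cj M w b j"
      and a: "scalar_ode.ok K C a" and ex: "\<exists>i\<in>{1..K}. odd i \<and> a i \<noteq> 0"
      and Z: "finite Z" "Z \<subseteq> {0<..<s0}" "\<forall>s\<in>Z. scalar_ode.v M N w K a s b = 0"
    interpret scalar_ode M N w K b C by (rule loc)
    have K: "K \<ge> 1" using ex by auto
    obtain \<psi> where \<psi>: "\<forall>l\<le>(K-1) div 2. \<psi> l \<in> unit_class r (lipc K b C) c"
      "\<forall>s\<in>ball 0 r. sol a s b = (\<Sum>l\<le>(K-1) div 2. of_real (a (2*l+1)) * s ^ (2*l+1) * \<psi> l s)"
      using sol_odd_expansion[OF a K, of c] sym cc unfolding r_def by blast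
    show "card Z \<le> (K - 1) div 2"
    proof (rule cnt[rule_format, of \<psi> "\<lambda>l. a (2*l+1)"], intro conjI)
      show "\<forall>l\<le>(K-1) div 2. \<psi> l \<in> unit_class r (lipc K b C) c" by (rule \<psi>)
      obtain i where i: "i \<in> {1..K}" "odd i" "a i \<noteq> 0" using ex by auto
      then show "\<exists>l\<le>(K-1) div 2. a (2*l+1) \<noteq> 0" by (intro exI[of _ "i div 2"]) (auto elim!: oddE)
      show "\<forall>s\<in>Z. (\<Sum>l\<le>(K-1) div 2. of_real (a (2*l+1)) * of_real s ^ (2*l+1) * \<psi> l (of_real s)) = 0"
      proof
        fix s assume s: "s \<in> Z"
        then have sr: "\<bar>s\<bar> < r" using Z s0 by auto
        have "sol a (of_real s) b = 0"
          using sol_v[OF a] sr Z s b by (auto simp: r_def)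
        then show "(\<Sum>l\<le>(K-1) div 2. of_real (a (2*l+1)) * of_real s ^ (2*l+1) * \<psi> l (of_real s)) = 0"
          using \<psi>(2) sr by (simp add: dist_norm)
      qed
    qed (use Z in auto)
  qed
qed

context scalar_ode
begin

text \<open>The real form used for sign arguments: positive factors between \<open>c/2\<close> and
  \<open>lipc K b C\<close>, on an interval determined by the constants.\<close>

lemma v_odd_expansion:
  assumes a: "ok a" and K: "K \<ge> 1"
    and sym: "\<And>a s. ok a \<Longrightarrow> (\<forall>i\<in>{1..K}. odd i \<longrightarrow> a i = 0) \<Longrightarrow> norm s < r \<Longrightarrow> sol a s b = 0"
    and c: "\<And>j. j \<in> {1..K} \<Longrightarrow> odd j \<Longrightarrow> c \<le> cj j" "c > 0"
  shows "\<exists>\<phi>. (\<forall>l\<le>(K-1) div 2. \<forall>s. 0 < s \<and> s < r * c / (4 * lipc K b C) \<longrightarrow> c / 2 \<le> \<phi> l s \<and> \<phi> l s \<le> lipc K b C) \<and>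
     (\<forall>s. 0 < s \<and> s < r * c / (4 * lipc K b C) \<longrightarrow> v a s b = (\<Sum>l\<le>(K-1) div 2. a (2*l+1) * s ^ (2*l+1) * \<phi> l s))"
proof -
  have "1 \<in> {1..K}" using K by auto
  then have cl: "c \<le> lipc K b C" using c(1)[of 1] abs_cj_le[of 1] by simp
  obtain \<psi> where \<psi>: "\<forall>l\<le>(K-1) div 2. \<psi> l \<in> unit_class r (lipc K b C) c"
      "\<forall>s\<in>ball 0 r. sol a s b = (\<Sum>l\<le>(K-1) div 2. of_real (a (2*l+1)) * s ^ (2*l+1) * \<psi> l s)"
    using sol_odd_expansion[OF a K sym c(1)] by blast
  have le: "r * c / (4 * lipc K b C) \<le> r"
    using cl c r_pos by (simp add: field_simps)
  show ?thesis
  proof (intro exI[of _ "\<lambda>l s. Re (\<psi> l (of_real s))"] conjI allI impI)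
    fix l s assume "l \<le> (K-1) div 2" "0 < s \<and> s < r * c / (4 * lipc K b C)"
    then show "c / 2 \<le> Re (\<psi> l (of_real s))" "Re (\<psi> l (of_real s)) \<le> lipc K b C"
      using unit_class_Re_bounds[of "\<psi> l" r "lipc K b C" c s] \<psi>(1) r_pos c(2) cl by auto
  next
    fix s assume s: "0 < s \<and> s < r * c / (4 * lipc K b C)"
    then have "of_real s \<in> ball (0::complex) r" using le by auto
    then have "v a s b = Re (\<Sum>l\<le>(K-1) div 2. of_real (a (2*l+1)) * of_real s ^ (2*l+1) * \<psi> l (of_real s))"
      using \<psi>(2) by (simp add: v_def)
    also have "\<dots> = (\<Sum>l\<le>(K-1) div 2. a (2*l+1) * s ^ (2*l+1) * Re (\<psi> l (of_real s)))"
      unfolding Re_sum by (intro sum.cong refl) (simp flip: of_real_power of_real_mult del: of_real_power of_real_mult power_Suc)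
    finally show "v a s b = (\<Sum>l\<le>(K-1) div 2. a (2*l+1) * s ^ (2*l+1) * Re (\<psi> l (of_real s)))" .
  qed
qed

end


section \<open>Producing zeros by small alternating coefficients\<close>

text \<open>Signs alternate along the decreasing points, so each gap contains a zero. As the sign
  conditions are strict, the zeros lie inside the disjoint open gaps and are distinct.
  \<open>\<tau>\<close> carries the overall sign.\<close>

lemma zeros_from_sign_changes:
  fixes S :: "real \<Rightarrow> real" and x :: "nat \<Rightarrow> real"
  assumes cont: "continuous_on {0<..<\<delta>} S" and x: "\<And>d. d \<le> n \<Longrightarrow> 0 < x d \<and> x d < \<delta>"
    and dec: "\<And>d. d < n \<Longrightarrow> x (Suc d) < x d"
    and sgn: "\<And>d. d \<le> n \<Longrightarrow> (-1) ^ d * \<tau> * S (x d) > 0"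
  shows "\<exists>Z. finite Z \<and> card Z = n \<and> Z \<subseteq> {0<..<\<delta>} \<and> (\<forall>z\<in>Z. S z = 0)"
proof -
  have "\<exists>z. x (Suc d) < z \<and> z < x d \<and> S z = 0" if d: "d < n" for d
  proof -
    have lt: "x (Suc d) < x d" by (rule dec[OF d])
    have c: "continuous_on {x (Suc d)..x d} S"
      by (rule continuous_on_subset[OF cont]) (use x[of d] x[of "Suc d"] d in auto)
    have s1: "((-1) ^ d * \<tau>) * S (x d) > 0" "((-1) ^ d * \<tau>) * S (x (Suc d)) < 0"
      using sgn[of d] sgn[of "Suc d"] d by auto
    have "\<exists>z\<ge>x (Suc d). z \<le> x d \<and> S z = 0"
    proof (cases "(-1) ^ d * \<tau> > 0")
      case True
      then have "S (x d) > 0" "S (x (Suc d)) < 0" using s1 by (auto simp: zero_less_mult_iff mult_less_0_iff)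
      then show ?thesis using IVT'[of S "x (Suc d)" 0 "x d"] lt c by auto
    next
      case False
      then have "S (x d) < 0" "S (x (Suc d)) > 0" using s1 by (auto simp: zero_less_mult_iff mult_less_0_iff)
      then show ?thesis using IVT2'[of S "x d" 0 "x (Suc d)"] lt c by auto
    qed
    then obtain z where z: "x (Suc d) \<le> z" "z \<le> x d" "S z = 0" by auto
    moreover have "z \<noteq> x d" "z \<noteq> x (Suc d)" using s1 z(3) by auto
    ultimately show ?thesis by (intro exI[of _ z]) auto
  qed
  then obtain z where z: "\<And>d. d < n \<Longrightarrow> x (Suc d) < z d \<and> z d < x d \<and> S (z d) = 0" by metis
  have mono: "x d' \<le> x d" if "d \<le> d'" "d' \<le> n" for d d'
    using that by (induction d' rule: dec_induct) (auto dest!: dec simp: Suc_le_eq)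
  have lt: "z d' < z d" if "d < d'" "d' < n" for d d'
    using z[of d] z[of d'] mono[of "Suc d" d'] that by auto
  have "inj_on z {..<n}"
  proof (rule inj_onI)
    fix d d' assume "d \<in> {..<n}" "d' \<in> {..<n}" "z d = z d'"
    then show "d = d'" using lt[of d d'] lt[of d' d] by (cases d d' rule: linorder_cases) auto
  qed
  then have "card (z ` {..<n}) = n" by (simp add: card_image)
  moreover have "z ` {..<n} \<subseteq> {0<..<\<delta>}"
  proof
    fix y assume "y \<in> z ` {..<n}"
    then obtain d where "d < n" "y = z d" by auto
    then show "y \<in> {0<..<\<delta>}" using z[of d] x[of d] x[of "Suc d"] by auto
  qed
  ultimately show ?thesis using z by (intro exI[of _ "z ` {..<n}"]) auto
qed

text \<open>At \<open>s = \<mu>^(d+1)\<close> the summand with index \<open>k - d'\<close> has, apart from bounded factors and a common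
  power of \<open>\<mu>\<close>, the order \<open>\<mu>^((d - d')^2)\<close>, so the summand \<open>k - d\<close> dominates for small \<open>\<mu>\<close>.\<close>

lemma alternating_perturbation:
  fixes \<alpha> :: "nat \<Rightarrow> real"
  assumes k: "k \<le> N" and zero: "\<And>l. l < k \<Longrightarrow> \<alpha> l = 0" and nz: "\<alpha> k \<noteq> 0" and "\<delta> > 0" "c > 0"
  shows "\<exists>\<alpha>' x. (\<forall>l. \<bar>\<alpha>' l - \<alpha> l\<bar> < \<delta>) \<and> (\<forall>l\<ge>k. \<alpha>' l = \<alpha> l) \<and>
     (\<forall>d\<le>k. 0 < x d \<and> x d < \<delta>) \<and> (\<forall>d<k. x (Suc d) < x d) \<and>
     (\<forall>\<phi>. (\<forall>l\<le>N. \<forall>s. 0 < s \<and> s < \<delta> \<longrightarrow> c \<le> \<phi> l s \<and> \<phi> l s \<le> P) \<longrightarrow>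
        (\<forall>d\<le>k. (-1) ^ d * \<alpha> k * (\<Sum>l\<le>N. \<alpha>' l * x d ^ (2*l+1) * \<phi> l (x d)) > 0))"
proof -
  \<comment> \<open>Bounds all coefficients relative to \<open>\<alpha> k\<close>, so that every
    estimate carries the common factor \<open>\<bar>\<alpha> k\<bar>\<close>.\<close>
  define \<Lambda> where "\<Lambda> = 1 + (\<Sum>l\<le>N. \<bar>\<alpha> l\<bar>) / \<bar>\<alpha> k\<bar>"
  have "\<Lambda> \<ge> 1" by (simp add: \<Lambda>_def sum_nonneg)
  have \<alpha>\<Lambda>: "\<bar>\<alpha> l\<bar> \<le> \<Lambda> * \<bar>\<alpha> k\<bar>" if "l \<le> N" for l
  proof -
    have "\<bar>\<alpha> l\<bar> \<le> (\<Sum>l\<le>N. \<bar>\<alpha> l\<bar>)" using that by (intro member_le_sum) auto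
    also have "\<dots> \<le> \<Lambda> * \<bar>\<alpha> k\<bar>" using nz by (simp add: \<Lambda>_def field_simps)
    finally show ?thesis .
  qed
  define D where "D = (real N + 1) * (\<Lambda> * (\<bar>P\<bar> + 1))"
  have D: "D > 0" using \<open>\<Lambda> \<ge> 1\<close> by (auto simp: D_def intro!: mult_pos_pos add_nonneg_pos)
  \<comment> \<open>Powers of \<mu> must decrease, the points and the changed coefficients must stay
    within \<delta>, and \<open>\<mu> * D < c\<close> ensures that one extra power of \<mu>
    outweighs all nondominant summands together.\<close>
  define \<mu> where "\<mu> = Min {1/2, \<delta>/2, \<delta> / (2 * \<bar>\<alpha> k\<bar>), c / (2 * D)}"
  have \<mu>: "\<mu> > 0" "\<mu> < 1" "\<mu> < \<delta>" "\<mu> * \<bar>\<alpha> k\<bar> < \<delta>" "\<mu> * D < c"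
  proof -
    show "\<mu> > 0" unfolding \<mu>_def using \<open>\<delta> > 0\<close> nz \<open>c > 0\<close> D by simp
    have le: "\<mu> \<le> 1/2" "\<mu> \<le> \<delta>/2" "\<mu> \<le> \<delta> / (2 * \<bar>\<alpha> k\<bar>)" "\<mu> \<le> c / (2 * D)"
      unfolding \<mu>_def by (intro Min_le; simp)+
    show "\<mu> < 1" using le by simp
    show "\<mu> < \<delta>" using le \<open>\<delta> > 0\<close> by simp
    have "\<mu> * \<bar>\<alpha> k\<bar> \<le> \<delta> / 2" using le(3) nz by (simp add: field_simps)
    then show "\<mu> * \<bar>\<alpha> k\<bar> < \<delta>" using \<open>\<delta> > 0\<close> by simp
    have "\<mu> * D \<le> c / 2" using le(4) D by (simp add: field_simps)
    then show "\<mu> * D < c" using \<open>c > 0\<close> by simp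
  qed
  have \<mu>pow: "\<mu> ^ Suc n \<le> \<mu>" for n using \<mu> by (simp add: power_le_one mult_left_le)
  \<comment> \<open>With \<open>n = k - l\<close> the exponent is \<open>n^2 + 2*n\<close>: the
    square separates the orders, and the linear part compensates the shift by one in the points
    \<open>\<mu>^(d+1)\<close>.\<close>
  define \<alpha>' where "\<alpha>' l = (if l < k then (-1) ^ (k - l) * \<alpha> k * \<mu> ^ ((k-l)\<^sup>2 + 2*(k-l)) else \<alpha> l)" for l
  define x where "x d = \<mu> ^ Suc d" for d :: nat
  have "\<bar>\<alpha>' l - \<alpha> l\<bar> < \<delta>" for l
  proof (cases "l < k")
    case True
    define n where "n = (k-l)\<^sup>2 + 2*(k-l) - 1"
    have n: "(k-l)\<^sup>2 + 2*(k-l) = Suc n" using True by (simp add: n_def)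
    have "\<bar>\<alpha>' l - \<alpha> l\<bar> = \<bar>\<alpha> k\<bar> * \<mu> ^ Suc n" using True zero[of l] \<mu> n
      by (simp add: \<alpha>'_def abs_mult power_abs)
    also have "\<dots> \<le> \<bar>\<alpha> k\<bar> * \<mu>" using \<mu>pow by (intro mult_left_mono) auto
    finally show ?thesis using \<mu> by (simp add: mult.commute)
  qed (use \<open>\<delta> > 0\<close> in \<open>simp add: \<alpha>'_def\<close>)
  moreover have "\<forall>l\<ge>k. \<alpha>' l = \<alpha> l" by (simp add: \<alpha>'_def)
  moreover have xx: "0 < x d" "x d < \<delta>" for d
    using \<mu> le_less_trans[OF \<mu>pow[of d] \<mu>(3)] by (auto simp: x_def)
  moreover have "x (Suc d) < x d" for d using \<mu> by (simp add: x_def)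
  moreover have "(-1) ^ d * \<alpha> k * (\<Sum>l\<le>N. \<alpha>' l * x d ^ (2*l+1) * \<phi> l (x d)) > 0"
    if \<phi>: "\<forall>l\<le>N. \<forall>s. 0 < s \<and> s < \<delta> \<longrightarrow> c \<le> \<phi> l s \<and> \<phi> l s \<le> P" and d: "d \<le> k" for \<phi> d
  proof -
    define trm where "trm l = \<alpha>' l * x d ^ (2*l+1) * \<phi> l (x d)" for l
    define ex where "ex d' = d'\<^sup>2 + 2*d' + Suc d * (2*(k-d')+1)" for d'
    define X where "X = \<bar>\<alpha> k\<bar> * \<mu> ^ ex d"
    have X: "X > 0" using nz \<mu> by (simp add: X_def)
    have ph: "c \<le> \<phi> l (x d)" "\<phi> l (x d) \<le> P" "\<bar>\<phi> l (x d)\<bar> \<le> \<bar>P\<bar> + 1" if "l \<le> N" for l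
    proof -
      show *: "c \<le> \<phi> l (x d)" "\<phi> l (x d) \<le> P" using \<phi> that xx[of d] by auto
      show "\<bar>\<phi> l (x d)\<bar> \<le> \<bar>P\<bar> + 1" using * \<open>c > 0\<close> by linarith
    qed
    have exd: "ex d + 1 \<le> ex d'" if "d' \<le> k" "d' \<noteq> d" for d'
    proof -
      define D' where "D' = int d' - int d"
      have eq: "int (ex d'') = (int d'')\<^sup>2 + 2 * int d'' + (int d + 1) * (2 * (int k - int d'') + 1)" if "d'' \<le> k" for d''
      proof -
        obtain n where "k = d'' + n" using \<open>d'' \<le> k\<close> le_Suc_ex by blast
        then show ?thesis by (simp add: ex_def algebra_simps)
      qed
      have "int (ex d') - int (ex d) = D'\<^sup>2" unfolding eq[OF that(1)] eq[OF d] D'_def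
        by (simp add: power2_eq_square algebra_simps)
      moreover have "D'\<^sup>2 \<ge> 1" using that(2) by (simp add: D'_def int_one_le_iff_zero_less)
      ultimately show ?thesis by linarith
    qed
    have low: "\<alpha>' (k - d') * x d ^ (2*(k-d')+1) = (-1) ^ d' * \<alpha> k * \<mu> ^ ex d'" if "d' \<le> k" for d'
    proof -
      have "\<alpha>' (k - d') = (-1) ^ d' * \<alpha> k * \<mu> ^ (d'\<^sup>2 + 2*d')"
        using that by (cases "d' = 0") (auto simp: \<alpha>'_def)
      moreover have "x d ^ (2*(k-d')+1) = \<mu> ^ (Suc d * (2*(k-d')+1))"
        by (simp only: x_def power_mult)
      moreover have "\<mu> ^ ex d' = \<mu> ^ (d'\<^sup>2 + 2*d') * \<mu> ^ (Suc d * (2*(k-d')+1))"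
        by (simp only: ex_def power_add[of \<mu> "d'\<^sup>2 + 2*d'" "Suc d * (2*(k-d')+1)"])
      ultimately show ?thesis by (simp only: mult.assoc)
    qed
    have small: "\<bar>trm l\<bar> \<le> X * (\<mu> * (\<Lambda> * (\<bar>P\<bar> + 1)))" if l: "l \<le> N" "l \<noteq> k - d" for l
    proof -
      have "\<bar>\<alpha>' l * x d ^ (2*l+1)\<bar> \<le> \<bar>\<alpha> k\<bar> * \<Lambda> * \<mu> ^ Suc (ex d)"
      proof (cases "l \<le> k")
        case True
        then obtain d' where d': "d' \<le> k" "l = k - d'" by (metis diff_diff_cancel diff_le_self)
        have "\<bar>\<alpha>' l * x d ^ (2*l+1)\<bar> = \<bar>\<alpha> k\<bar> * 1 * \<mu> ^ ex d'"
          unfolding d'(2) low[OF d'(1)] using \<mu> by (simp add: abs_mult power_abs)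
        also have "\<dots> \<le> \<bar>\<alpha> k\<bar> * \<Lambda> * \<mu> ^ Suc (ex d)"
          using \<mu> \<open>\<Lambda> \<ge> 1\<close> exd[OF d'(1)] l d' by (intro mult_mono power_decreasing) auto
        finally show ?thesis .
      next
        case False
        \<comment> \<open>Indices above \<open>k\<close> keep their coefficients. The power of
          \<open>x d\<close> alone makes them smaller than the summand \<open>k\<close>, which in
          turn is no larger in order than the dominant one.\<close>
        have e0: "ex d \<le> ex 0" using exd[of 0] by (cases "d = 0") auto
        have "\<bar>\<alpha>' l * x d ^ (2*l+1)\<bar> = \<bar>\<alpha> l\<bar> * \<mu> ^ (Suc d * (2*l+1))"
        proof -
          have "x d ^ (2*l+1) = \<mu> ^ (Suc d * (2*l+1))" by (simp only: x_def power_mult)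
          moreover have "\<alpha>' l = \<alpha> l" "\<mu> ^ (Suc d * (2*l+1)) \<ge> 0" using False \<mu> by (auto simp: \<alpha>'_def)
          ultimately show ?thesis by (simp only: abs_mult abs_of_nonneg)
        qed
        also have "\<dots> \<le> (\<Lambda> * \<bar>\<alpha> k\<bar>) * \<mu> ^ Suc (ex d)"
        proof (intro mult_mono power_decreasing \<alpha>\<Lambda> l(1))
          have "ex 0 + 1 \<le> Suc d * (2*k+1) + Suc d * 2" by (simp add: ex_def)
          also have "\<dots> = Suc d * (2*(k+1)+1)" by (simp add: algebra_simps)
          also have "\<dots> \<le> Suc d * (2*l+1)" using False by (intro mult_le_mono) auto
          finally show "Suc (ex d) \<le> Suc d * (2*l+1)" using e0 by simp
        qed (use \<mu> \<open>\<Lambda> \<ge> 1\<close> in auto)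
        finally show ?thesis by (simp add: mult.commute)
      qed
      then have "\<bar>\<alpha>' l * x d ^ (2*l+1)\<bar> * \<bar>\<phi> l (x d)\<bar> \<le> (\<bar>\<alpha> k\<bar> * \<Lambda> * \<mu> ^ Suc (ex d)) * (\<bar>P\<bar> + 1)"
        using ph(3)[OF l(1)] \<mu> \<open>\<Lambda> \<ge> 1\<close> by (intro mult_mono) auto
      then show ?thesis by (simp add: trm_def X_def abs_mult mult_ac)
    qed
    have kd: "k - d \<le> N" using k by simp
    have main: "(-1) ^ d * sgn (\<alpha> k) * trm (k - d) \<ge> X * c"
    proof -
      have "(-1) ^ d * sgn (\<alpha> k) * trm (k - d) = ((-1) ^ d * (-1) ^ d) * (sgn (\<alpha> k) * \<alpha> k) * \<mu> ^ ex d * \<phi> (k - d) (x d)"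
        unfolding trm_def low[OF d] by (simp only: mult_ac)
      also have "(-1) ^ d * (-1) ^ d = (1::real)" by (simp flip: power_mult_distrib)
      also have "sgn (\<alpha> k) * \<alpha> k = \<bar>\<alpha> k\<bar>" by (simp add: abs_sgn mult.commute)
      also have "1 * \<bar>\<alpha> k\<bar> * \<mu> ^ ex d * \<phi> (k - d) (x d) = X * \<phi> (k - d) (x d)"
        by (simp add: X_def)
      finally show ?thesis using ph(1)[OF kd] X by (simp add: mult_left_mono)
    qed
    have "(\<Sum>l\<le>N. trm l) = trm (k - d) + (\<Sum>l\<in>{..N} - {k - d}. trm l)"
      using kd by (intro sum.remove) auto
    moreover have "\<bar>\<Sum>l\<in>{..N} - {k - d}. trm l\<bar> \<le> (\<Sum>l\<in>{..N} - {k - d}. X * (\<mu> * (\<Lambda> * (\<bar>P\<bar> + 1))))"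
      using small by (intro order_trans[OF sum_abs sum_mono]) auto
    moreover have "\<dots> \<le> X * (\<mu> * D)"
    proof -
      have "real (card ({..N} - {k - d})) * (X * (\<mu> * (\<Lambda> * (\<bar>P\<bar> + 1)))) \<le> (real N + 1) * (X * (\<mu> * (\<Lambda> * (\<bar>P\<bar> + 1))))"
        using X \<mu> \<open>\<Lambda> \<ge> 1\<close> kd by (intro mult_right_mono) auto
      then show ?thesis by (simp add: D_def mult_ac)
    qed
    moreover have "X * (\<mu> * D) < X * c" using X \<mu> by simp
    moreover have "\<bar>(-1) ^ d * sgn (\<alpha> k) * y\<bar> = \<bar>y\<bar>" for y :: real using nz by (simp add: abs_mult power_abs abs_sgn_eq)
    from this[of "\<Sum>l\<in>{..N} - {k - d}. trm l"]
    have "(-1) ^ d * sgn (\<alpha> k) * (\<Sum>l\<in>{..N} - {k - d}. trm l) \<ge> - \<bar>\<Sum>l\<in>{..N} - {k - d}. trm l\<bar>" by linarith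
    ultimately have "(-1) ^ d * sgn (\<alpha> k) * (\<Sum>l\<le>N. trm l) > 0"
      using main by (simp add: distrib_left)
    then have "((-1) ^ d * sgn (\<alpha> k) * (\<Sum>l\<le>N. trm l)) * \<bar>\<alpha> k\<bar> > 0" using nz by (metis mult_pos_pos zero_less_abs_iff)
    also have "((-1) ^ d * sgn (\<alpha> k) * (\<Sum>l\<le>N. trm l)) * \<bar>\<alpha> k\<bar> = (-1) ^ d * (sgn (\<alpha> k) * \<bar>\<alpha> k\<bar>) * (\<Sum>l\<le>N. trm l)"
      by (simp only: mult_ac)
    finally show ?thesis by (simp add: trm_def sgn_mult_abs)
  qed
  ultimately show ?thesis by (intro exI[of _ \<alpha>'] exI[of _ x]) blast
qed

section \<open>Planar vector fields\<close>

lemma vec2_eq: "vector [x, y] = x *\<^sub>R axis 1 1 + y *\<^sub>R (axis 2 1 :: real^2)"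
  by (simp add: vec_eq_iff forall_2 axis_def)

lemma vec2_cong_iff: "(z::real^2) = w \<longleftrightarrow> z $ 1 = w $ 1 \<and> z $ 2 = w $ 2"
  by (simp add: vec_eq_iff forall_2)

lemma norm_vec2: "norm (z::real^2) = sqrt ((z $ 1)\<^sup>2 + (z $ 2)\<^sup>2)"
  by (simp add: norm_vec_def L2_set_def sum_2)

lemma norm_vec2_le: "norm (z::real^2) \<le> \<bar>z $ 1\<bar> + \<bar>z $ 2\<bar>"
  using norm_le_l1_cart[of z] by (simp add: sum_2)

lemma has_vector_derivative_vec2:
  assumes "(X has_real_derivative x') F" "(Y has_real_derivative y') F"
  shows "((\<lambda>t. vector [X t, Y t] :: real^2) has_vector_derivative vector [x', y']) F"
proof -
  have "((\<lambda>t. X t *\<^sub>R axis 1 1 + Y t *\<^sub>R (axis 2 1 :: real^2)) has_vector_derivative (x' *\<^sub>R axis 1 1 + y' *\<^sub>R axis 2 1)) F"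
    using assms unfolding has_real_derivative_iff_has_vector_derivative
    by (intro has_vector_derivative_add bounded_linear.has_vector_derivative[OF bounded_linear_scaleR_left])
  then show ?thesis by (simp only: vec2_eq)
qed

lemma has_vector_derivative_nth:
  fixes \<phi> :: "real \<Rightarrow> real^'n"
  assumes "(\<phi> has_vector_derivative d) F"
  shows "((\<lambda>t. \<phi> t $ i) has_real_derivative (d $ i)) F"
  using bounded_linear.has_vector_derivative[OF bounded_linear_vec_nth assms]
  by (simp add: has_real_derivative_iff_has_vector_derivative)

section \<open>Locally Lipschitz fields and their periodic orbits\<close>

text \<open>Lipschitz on every ball. Unlike a global Lipschitz condition this is preserved by
  products of real functions, so polynomial fields satisfy it.\<close>

definition lip_bdd :: "('a::real_normed_vector \<Rightarrow> 'b::real_normed_vector) \<Rightarrow> bool" where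
  "lip_bdd f \<longleftrightarrow> (\<forall>R. \<exists>L. \<forall>x y. norm x \<le> R \<longrightarrow> norm y \<le> R \<longrightarrow> norm (f x - f y) \<le> L * norm (x - y))"

lemma lip_bddD:
  assumes "lip_bdd f"
  obtains L where "L \<ge> 0" "\<And>x y. norm x \<le> R \<Longrightarrow> norm y \<le> R \<Longrightarrow> norm (f x - f y) \<le> L * norm (x - y)"
proof -
  obtain L where L: "\<And>x y. norm x \<le> R \<Longrightarrow> norm y \<le> R \<Longrightarrow> norm (f x - f y) \<le> L * norm (x - y)"
    using assms unfolding lip_bdd_def by blast
  have "norm (f x - f y) \<le> max 0 L * norm (x - y)" if "norm x \<le> R" "norm y \<le> R" for x y
    by (rule order_trans[OF L[OF that] mult_right_mono]) auto
  then show ?thesis using that[of "max 0 L"] by auto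
qed

lemma lip_bdd_const: "lip_bdd (\<lambda>x. c)"
  unfolding lip_bdd_def by (intro allI exI[of _ 0]) auto

lemma lip_bdd_nth: "lip_bdd (\<lambda>x::real^'n::finite. x $ i)"
  unfolding lip_bdd_def
  by (intro allI exI[of _ 1]) (metis component_le_norm_cart mult_1 real_norm_def vector_minus_component)

lemma lip_bdd_add: "lip_bdd f \<Longrightarrow> lip_bdd g \<Longrightarrow> lip_bdd (\<lambda>x. f x + g x)"
  unfolding lip_bdd_def
proof
  fix R
  assume "\<forall>R. \<exists>L. \<forall>x y. norm x \<le> R \<longrightarrow> norm y \<le> R \<longrightarrow> norm (f x - f y) \<le> L * norm (x - y)"
    "\<forall>R. \<exists>L. \<forall>x y. norm x \<le> R \<longrightarrow> norm y \<le> R \<longrightarrow> norm (g x - g y) \<le> L * norm (x - y)"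
  then obtain L L' where L: "\<And>x y. norm x \<le> R \<Longrightarrow> norm y \<le> R \<Longrightarrow> norm (f x - f y) \<le> L * norm (x - y)"
    "\<And>x y. norm x \<le> R \<Longrightarrow> norm y \<le> R \<Longrightarrow> norm (g x - g y) \<le> L' * norm (x - y)" by metis
  have "norm (f x + g x - (f y + g y)) \<le> (L + L') * norm (x - y)" if "norm x \<le> R" "norm y \<le> R" for x y
    using norm_triangle_ineq[of "f x - f y" "g x - g y"] L(1)[OF that] L(2)[OF that] by (simp add: algebra_simps)
  then show "\<exists>L. \<forall>x y. norm x \<le> R \<longrightarrow> norm y \<le> R \<longrightarrow> norm (f x + g x - (f y + g y)) \<le> L * norm (x - y)" by blast
qed

lemma lip_bdd_mult:
  fixes f g :: "'a::real_normed_vector \<Rightarrow> real"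
  assumes "lip_bdd f" "lip_bdd g"
  shows "lip_bdd (\<lambda>x. f x * g x)"
  unfolding lip_bdd_def
proof
  fix R
  show "\<exists>L. \<forall>x y. norm x \<le> R \<longrightarrow> norm y \<le> R \<longrightarrow> norm (f x * g x - f y * g y) \<le> L * norm (x - y)"
  proof (cases "R \<ge> 0")
    case True
    obtain L where L: "L \<ge> 0" "\<And>x y. norm x \<le> R \<Longrightarrow> norm y \<le> R \<Longrightarrow> norm (f x - f y) \<le> L * norm (x - y)"
      using lip_bddD[OF assms(1)] by blast
    obtain L' where L': "L' \<ge> 0" "\<And>x y. norm x \<le> R \<Longrightarrow> norm y \<le> R \<Longrightarrow> norm (g x - g y) \<le> L' * norm (x - y)"
      using lip_bddD[OF assms(2)] by blast
    have bd: "\<bar>h x\<bar> \<le> \<bar>h 0\<bar> + L * R" if "norm x \<le> R" "L \<ge> 0" "\<And>x y. norm x \<le> R \<Longrightarrow> norm y \<le> R \<Longrightarrow> norm (h x - h y) \<le> L * norm (x - y)"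
      for h :: "'a \<Rightarrow> real" and x L
    proof -
      have "\<bar>h x - h 0\<bar> \<le> L * norm x" using that(3)[of x 0] that(1) True by simp
      also have "\<dots> \<le> L * R" using that by (intro mult_left_mono) auto
      finally show ?thesis by linarith
    qed
    define Bf where "Bf = \<bar>f 0\<bar> + L * R" define Bg where "Bg = \<bar>g 0\<bar> + L' * R"
    have "norm (f x * g x - f y * g y) \<le> (Bf * L' + Bg * L) * norm (x - y)" if "norm x \<le> R" "norm y \<le> R" for x y
    proof -
      have "f x * g x - f y * g y = f x * (g x - g y) + g y * (f x - f y)" by (simp add: algebra_simps)
      then have "norm (f x * g x - f y * g y) \<le> \<bar>f x\<bar> * norm (g x - g y) + \<bar>g y\<bar> * norm (f x - f y)"
        using norm_triangle_ineq[of "f x * (g x - g y)" "g y * (f x - f y)"] by (simp add: abs_mult)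
      also have "\<dots> \<le> Bf * (L' * norm (x - y)) + Bg * (L * norm (x - y))"
        using bd[OF that(1) L] bd[OF that(2) L'] L(2)[OF that] L'(2)[OF that] True L(1) L'(1) unfolding Bf_def Bg_def
        by (intro add_mono mult_mono) auto
      finally show ?thesis by (simp add: algebra_simps)
    qed
    then show ?thesis by blast
  next
    case False
    then show ?thesis using norm_ge_zero order_trans by blast
  qed
qed

lemma lip_bdd_sum: "(\<And>i. i \<in> A \<Longrightarrow> lip_bdd (f i)) \<Longrightarrow> lip_bdd (\<lambda>x. \<Sum>i\<in>A. f i x)"
  by (induction A rule: infinite_finite_induct) (auto intro: lip_bdd_const lip_bdd_add)

lemma lip_bdd_power: "lip_bdd f \<Longrightarrow> lip_bdd (\<lambda>x. f x ^ n :: real)"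
  by (induction n) (auto intro: lip_bdd_const lip_bdd_mult)

lemma lip_bdd_vec2:
  fixes f g :: "'a::real_normed_vector \<Rightarrow> real"
  assumes "lip_bdd f" "lip_bdd g"
  shows "lip_bdd (\<lambda>x. vector [f x, g x] :: real^2)"
  unfolding lip_bdd_def
proof
  fix R
  obtain L where L: "\<And>x y. norm x \<le> R \<Longrightarrow> norm y \<le> R \<Longrightarrow> norm (f x - f y) \<le> L * norm (x - y)"
    using lip_bddD[OF assms(1)] by blast
  obtain L' where L': "\<And>x y. norm x \<le> R \<Longrightarrow> norm y \<le> R \<Longrightarrow> norm (g x - g y) \<le> L' * norm (x - y)"
    using lip_bddD[OF assms(2)] by blast
  have "norm (vector [f x, g x] - vector [f y, g y] :: real^2) \<le> (L + L') * norm (x - y)" if "norm x \<le> R" "norm y \<le> R" for x y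
    using norm_vec2_le[of "vector [f x, g x] - vector [f y, g y]"] L[OF that] L'[OF that] by (simp add: algebra_simps)
  then show "\<exists>L. \<forall>x y. norm x \<le> R \<longrightarrow> norm y \<le> R \<longrightarrow> norm (vector [f x, g x] - vector [f y, g y] :: real^2) \<le> L * norm (x - y)"
    by blast
qed

lemma family_A_lip: "lip_bdd (family_A p q r1 r2 a b0)"
proof -
  have "lip_bdd (\<lambda>z. vector [\<Sum>i\<le>r1 div p. a i * (z $ 1) ^ (i * q) * (z $ 2) ^ (r1 - i * p), b0 * (z $ 1) ^ r2] :: real^2)"
    for z
    by (intro lip_bdd_vec2 lip_bdd_sum lip_bdd_mult lip_bdd_power lip_bdd_const lip_bdd_nth)
  then show ?thesis by (simp add: family_A_def[abs_def])
qed

text \<open>On a compact interval both solutions stay in a common ball, on which the field has a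
  Lipschitz constant.\<close>

lemma solution_unique:
  fixes \<phi> \<psi> :: "real \<Rightarrow> 'a::real_inner"
  assumes f: "lip_bdd f"
    and \<phi>: "\<And>t. t \<in> {a..b} \<Longrightarrow> (\<phi> has_vector_derivative f (\<phi> t)) (at t within {a..b})"
    and \<psi>: "\<And>t. t \<in> {a..b} \<Longrightarrow> (\<psi> has_vector_derivative f (\<psi> t)) (at t within {a..b})"
    and t0: "t0 \<in> {a..b}" "\<phi> t0 = \<psi> t0" and t: "t \<in> {a..b}"
  shows "\<phi> t = \<psi> t"
proof -
  have c: "continuous_on {a..b} \<phi>" "continuous_on {a..b} \<psi>"
    using \<phi> \<psi> has_vector_derivative_continuous continuous_on_eq_continuous_within by blast+
  then have "bounded (\<phi> ` {a..b} \<union> \<psi> ` {a..b})"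
    by (simp add: compact_continuous_image compact_imp_bounded)
  then obtain R where R: "\<And>z. z \<in> \<phi> ` {a..b} \<union> \<psi> ` {a..b} \<Longrightarrow> norm z \<le> R" by (auto simp: bounded_iff)
  obtain L where L: "\<And>x y. norm x \<le> R \<Longrightarrow> norm y \<le> R \<Longrightarrow> norm (f x - f y) \<le> L * norm (x - y)"
    using lip_bddD[OF f] by blast
  show ?thesis
    by (rule ode_unique[where f = "\<lambda>_. f" and L = L, OF \<phi> \<psi> _ t0 t]) (auto intro!: L R)
qed

lemma solution_unique_global:
  fixes \<phi> \<psi> :: "real \<Rightarrow> 'a::real_inner"
  assumes f: "lip_bdd f"
    and \<phi>: "\<And>t. (\<phi> has_vector_derivative f (\<phi> t)) (at t)"
    and \<psi>: "\<And>t. (\<psi> has_vector_derivative f (\<psi> t)) (at t)"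
    and eq: "\<phi> t0 = \<psi> t1"
  shows "\<phi> (t0 + t) = \<psi> (t1 + t)"
proof -
  have shift: "((\<lambda>u. \<phi> (t0 + u)) has_vector_derivative f (\<phi> (t0 + u))) (at u)"
    if "\<And>t. (\<phi> has_vector_derivative f (\<phi> t)) (at t)" for \<phi> t0 u
  proof -
    have "((\<lambda>u. t0 + u) has_vector_derivative 1) (at u)" by (auto intro!: derivative_eq_intros)
    from vector_diff_chain_at[OF this that] show ?thesis by (simp add: o_def)
  qed
  show ?thesis
  proof (rule solution_unique[OF f, of "- \<bar>t\<bar>" "\<bar>t\<bar>" "\<lambda>u. \<phi> (t0 + u)" "\<lambda>u. \<psi> (t1 + u)" 0])
  qed (use eq shift[OF \<phi>] shift[OF \<psi>] in \<open>auto intro: has_vector_derivative_at_within\<close>)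
qed

lemma periodic_orbits_disjoint:
  assumes f: "lip_bdd f" and "periodic_orbit f \<gamma>" "periodic_orbit f \<gamma>'" "z \<in> \<gamma>" "z \<in> \<gamma>'"
  shows "\<gamma> = \<gamma>'"
proof -
  obtain \<phi> where \<phi>: "\<And>t. (\<phi> has_vector_derivative f (\<phi> t)) (at t)" "\<gamma> = range \<phi>"
    using assms(2) by (auto simp: periodic_orbit_def)
  obtain \<psi> where \<psi>: "\<And>t. (\<psi> has_vector_derivative f (\<psi> t)) (at t)" "\<gamma>' = range \<psi>"
    using assms(3) by (auto simp: periodic_orbit_def)
  obtain t0 t1 where t: "\<phi> t0 = z" "\<psi> t1 = z" using assms(4,5) \<phi> \<psi> by auto
  have *: "\<phi> (t0 + t) = \<psi> (t1 + t)" for t by (rule solution_unique_global[OF f \<phi>(1) \<psi>(1)]) (use t in simp)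
  show ?thesis unfolding \<phi> \<psi>
  proof (intro equalityI subsetI; elim rangeE)
    fix x t assume "x = \<phi> t" then show "x \<in> range \<psi>" using *[of "t - t0"] by simp
  next
    fix x t assume "x = \<psi> t" then show "x \<in> range \<phi>" using *[of "t - t1"] by (metis add.commute diff_add_cancel rangeI)
  qed
qed

lemma zero_not_in_periodic_orbit:
  fixes f :: "real^2 \<Rightarrow> real^2"
  assumes f: "lip_bdd f" "f 0 = 0" and "periodic_orbit f \<gamma>"
  shows "0 \<notin> \<gamma>"
proof
  assume "0 \<in> \<gamma>"
  obtain \<phi> where \<phi>: "\<And>t. (\<phi> has_vector_derivative f (\<phi> t)) (at t)" "\<gamma> = range \<phi>" "\<exists>t. \<phi> t \<noteq> \<phi> 0"
    using assms(3) by (auto simp: periodic_orbit_def)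
  obtain t0 where "\<phi> t0 = 0" using \<open>0 \<in> \<gamma>\<close> \<phi> by auto
  then have "\<phi> (t0 + t) = (\<lambda>_. 0) (0 + t)" for t
    using f by (intro solution_unique_global[OF f(1) \<phi>(1)]) auto
  then have "\<phi> t = 0" for t by (metis add.commute diff_add_cancel)
  then show False using \<phi>(3) by auto
qed

text \<open>Isolation concerns only orbits contained in the neighbourhood. It is therefore enough to
  delete from \<open>U\<close> one point of each of the finitely many other orbits; distinct orbits
  are disjoint, so none of these points lies on \<gamma>.\<close>

lemma limit_cycle_of_finite:
  fixes f :: "real^2 \<Rightarrow> real^2"
  assumes f: "lip_bdd f" and U: "open U" and fin: "finite {\<gamma>. periodic_orbit f \<gamma> \<and> \<gamma> \<subseteq> U}"
    and \<gamma>: "periodic_orbit f \<gamma>" "\<gamma> \<subseteq> U"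
  shows "limit_cycle f \<gamma>"
  unfolding limit_cycle_def
proof (intro conjI \<gamma>(1))
  define S where "S = {\<gamma>. periodic_orbit f \<gamma> \<and> \<gamma> \<subseteq> U} - {\<gamma>}"
  define pick where "pick \<gamma>' = (SOME z. z \<in> \<gamma>')" for \<gamma>' :: "(real^2) set"
  have pick: "pick \<gamma>' \<in> \<gamma>'" if per: "periodic_orbit f \<gamma>'" for \<gamma>'
  proof -
    obtain \<phi> :: "real \<Rightarrow> real^2" where "\<gamma>' = range \<phi>" using per unfolding periodic_orbit_def by blast
    then have "\<phi> 0 \<in> \<gamma>'" by simp
    then show ?thesis unfolding pick_def by (rule someI)
  qed
  show "\<exists>V. open V \<and> \<gamma> \<subseteq> V \<and> (\<forall>\<gamma>'. periodic_orbit f \<gamma>' \<and> \<gamma>' \<subseteq> V \<longrightarrow> \<gamma>' = \<gamma>)"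
  proof (intro exI[of _ "U - pick ` S"] conjI allI impI)
    show "open (U - pick ` S)"
      using U fin by (intro open_Diff finite_imp_closed) (auto simp: S_def)
    have "pick \<gamma>' \<notin> \<gamma>" if "\<gamma>' \<in> S" for \<gamma>'
    proof
      assume "pick \<gamma>' \<in> \<gamma>"
      moreover have "periodic_orbit f \<gamma>'" "\<gamma>' \<noteq> \<gamma>" using that by (auto simp: S_def)
      ultimately show False using periodic_orbits_disjoint[OF f \<gamma>(1)] pick by metis
    qed
    then show "\<gamma> \<subseteq> U - pick ` S" using \<gamma>(2) by auto
    fix \<gamma>' assume *: "periodic_orbit f \<gamma>' \<and> \<gamma>' \<subseteq> U - pick ` S"
    show "\<gamma>' = \<gamma>"
    proof (rule ccontr)
      assume "\<gamma>' \<noteq> \<gamma>"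
      then have "\<gamma>' \<in> S" using * by (auto simp: S_def)
      then show False using pick[of \<gamma>'] * by auto
    qed
  qed
qed

section \<open>Behaviour under scaling of the field and under reflection\<close>

lemma periodic_orbit_scale:
  assumes "periodic_orbit f \<gamma>" "c \<noteq> 0"
  shows "periodic_orbit (\<lambda>z. c *\<^sub>R f z) \<gamma>"
proof -
  obtain \<phi> T where \<phi>: "T > 0" "\<And>t. (\<phi> has_vector_derivative f (\<phi> t)) (at t)" "\<And>t. \<phi> (t + T) = \<phi> t"
    "\<exists>t. \<phi> t \<noteq> \<phi> 0" "\<gamma> = range \<phi>"
    using assms(1) by (auto simp: periodic_orbit_def)
  have per': "\<phi> (t - T) = \<phi> t" for t using \<phi>(3)[of "t - T"] by simp
  show ?thesis unfolding periodic_orbit_def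
  proof (rule exI[of _ "\<lambda>t. \<phi> (c * t)"], rule exI[of _ "T / \<bar>c\<bar>"], intro conjI allI)
    show "T / \<bar>c\<bar> > 0" using \<phi> assms by simp
    show "((\<lambda>t. \<phi> (c * t)) has_vector_derivative c *\<^sub>R f (\<phi> (c * t))) (at t)" for t
    proof -
      have "((\<lambda>u. c * u) has_vector_derivative c) (at t)" by (auto intro!: derivative_eq_intros)
      from vector_diff_chain_at[OF this \<phi>(2)] show ?thesis by (simp add: o_def)
    qed
    show "\<phi> (c * (t + T / \<bar>c\<bar>)) = \<phi> (c * t)" for t
    proof (cases "c > 0")
      case True
      then have "c * (t + T / \<bar>c\<bar>) = c * t + T" by (simp add: field_simps)
      then show ?thesis using \<phi>(3) by simp
    next
      case False
      then have "c * (t + T / \<bar>c\<bar>) = c * t - T" using assms by (simp add: field_simps)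
      then show ?thesis using per' by simp
    qed
    obtain t where "\<phi> t \<noteq> \<phi> 0" using \<phi> by auto
    then show "\<exists>t. \<phi> (c * t) \<noteq> \<phi> (c * 0)" using assms by (intro exI[of _ "t / c"]) simp
    show "\<gamma> = range (\<lambda>t. \<phi> (c * t))" unfolding \<phi>(5)
    proof (intro equalityI subsetI; elim rangeE)
      fix x t assume "x = \<phi> t"
      then have "x = \<phi> (c * (t / c))" using assms by simp
      then show "x \<in> range (\<lambda>t. \<phi> (c * t))" by blast
    qed auto
  qed
qed

lemma periodic_orbit_scale_iff: "c \<noteq> 0 \<Longrightarrow> periodic_orbit (\<lambda>z. c *\<^sub>R f z) \<gamma> \<longleftrightarrow> periodic_orbit f \<gamma>"
  using periodic_orbit_scale[of f \<gamma> c] periodic_orbit_scale[of "\<lambda>z. c *\<^sub>R f z" \<gamma> "1 / c"] by auto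

lemma limit_cycle_scale_iff: "c \<noteq> 0 \<Longrightarrow> limit_cycle (\<lambda>z. c *\<^sub>R f z) \<gamma> \<longleftrightarrow> limit_cycle f \<gamma>"
  by (simp add: limit_cycle_def periodic_orbit_scale_iff)

lemma is_center_scale_iff: "c \<noteq> 0 \<Longrightarrow> is_center (\<lambda>z. c *\<^sub>R f z) z0 \<longleftrightarrow> is_center f z0"
  by (simp add: is_center_def periodic_orbit_scale_iff)

lemma stable_focus_scale:
  assumes "stable_focus f z0" "c > 0"
  shows "stable_focus (\<lambda>z. c *\<^sub>R f z) z0"
proof -
  have "\<exists>\<psi>. \<psi> 0 = z \<and> spirals_towards (\<lambda>z. c *\<^sub>R f z) z0 \<psi>" if \<phi>0: "\<phi> 0 = z" and sp: "spirals_towards f z0 \<phi>" for z \<phi>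
  proof -
    obtain \<theta> :: "real \<Rightarrow> real" where s: "\<And>t. t\<ge>0 \<Longrightarrow> (\<phi> has_vector_derivative f (\<phi> t)) (at t within {0..})"
      "\<And>t. t\<ge>0 \<Longrightarrow> \<phi> t \<noteq> z0" "(\<phi> \<longlongrightarrow> z0) at_top" "continuous_on {0..} \<theta>"
      "\<And>t. t\<ge>0 \<Longrightarrow> \<phi> t - z0 = norm (\<phi> t - z0) *\<^sub>R vector [cos (\<theta> t), sin (\<theta> t)]" "filterlim \<theta> at_infinity at_top"
      using sp unfolding spirals_towards_def by blast
    have img: "(\<lambda>t. c * t) ` {0..} = {0..}" using \<open>c > 0\<close> 
      by (auto simp: image_iff intro!: bexI[of _ "_ / c"])
    have lim: "filterlim (\<lambda>t. c * t) at_top at_top"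
      using \<open>c > 0\<close> by (intro filterlim_tendsto_pos_mult_at_top[OF tendsto_const _ filterlim_ident])
    have "spirals_towards (\<lambda>z. c *\<^sub>R f z) z0 (\<lambda>t. \<phi> (c * t))"
      unfolding spirals_towards_def
    proof (intro conjI allI impI exI[of _ "\<lambda>t. \<theta> (c * t)"])
      fix t :: real assume t: "t \<ge> 0"
      have "((\<lambda>u. c * u) has_vector_derivative c) (at t within {0..})" by (auto intro!: derivative_eq_intros)
      from vector_diff_chain_within[OF this, of \<phi> "f (\<phi> (c * t))"] s(1)[of "c * t"] t \<open>c > 0\<close>
      show "((\<lambda>t. \<phi> (c * t)) has_vector_derivative c *\<^sub>R f (\<phi> (c * t))) (at t within {0..})"
        by (simp add: o_def img)
      show "\<phi> (c * t) \<noteq> z0" using s(2) t \<open>c > 0\<close> by simp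
      show "\<phi> (c * t) - z0 = norm (\<phi> (c * t) - z0) *\<^sub>R vector [cos (\<theta> (c * t)), sin (\<theta> (c * t))]"
        using s(5)[of "c * t"] t \<open>c > 0\<close> by simp
    next
      show "((\<lambda>t. \<phi> (c * t)) \<longlongrightarrow> z0) at_top" by (rule filterlim_compose[OF s(3) lim])
      show "filterlim (\<lambda>t. \<theta> (c * t)) at_infinity at_top" by (rule filterlim_compose[OF s(6) lim])
      show "continuous_on {0..} (\<lambda>t. \<theta> (c * t))"
        by (rule continuous_on_compose2[OF s(4)]) (use img in \<open>auto intro!: continuous_intros\<close>)
    qed
    then show ?thesis using \<phi>0 by (intro exI[of _ "\<lambda>t. \<phi> (c * t)"]) auto
  qed
  then show ?thesis using assms unfolding stable_focus_def by (auto; metis)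
qed

lemma is_focus_scale:
  assumes "is_focus f z0" "c \<noteq> 0"
  shows "is_focus (\<lambda>z. c *\<^sub>R f z) z0"
proof (cases "c > 0")
  case True
  then show ?thesis using assms stable_focus_scale[of f z0 c] stable_focus_scale[of "\<lambda>z. - f z" z0 c]
    unfolding is_focus_def by auto
next
  case False
  then show ?thesis using assms stable_focus_scale[of f z0 "-c"] stable_focus_scale[of "\<lambda>z. - f z" z0 "-c"]
    unfolding is_focus_def by auto
qed

text \<open>The mirror of the first coordinate carries spirals to spirals, with angle
  \<open>pi - \<theta>\<close>. Combined with time reversal it will reduce a repelling focus of the
  family to an attracting one.\<close>

lemma stable_focus_reflect:
  fixes f f' :: "real^2 \<Rightarrow> real^2"
  assumes "stable_focus f 0" and ff': "\<And>z. f' z = vector [- f (vector [- (z $ 1), z $ 2]) $ 1, f (vector [- (z $ 1), z $ 2]) $ 2]"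
  shows "stable_focus f' 0"
proof -
  define R where "R z = (vector [- (z $ 1), z $ 2] :: real^2)" for z :: "real^2"
  have RR: "R (R z) = z" and R0: "R 0 = 0" and Rn: "norm (R z) = norm z" for z
    by (simp_all add: R_def vec2_cong_iff norm_vec2)
  have Rlin: "bounded_linear R"
    by (rule bounded_linear_intro[of _ 1]) (auto simp: R_def vec2_cong_iff norm_vec2)
  have f'R: "f' z = R (f (R z))" for z by (simp add: ff' R_def)
  obtain U where U: "f 0 = 0" "open U" "0 \<in> U" "\<And>z. z \<in> U - {0} \<Longrightarrow> \<exists>\<phi>. \<phi> 0 = z \<and> spirals_towards f 0 \<phi>"
    using assms(1) unfolding stable_focus_def by blast
  show ?thesis unfolding stable_focus_def
  proof (intro conjI exI[of _ "R -` U"] ballI)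
    show "f' 0 = 0" by (simp add: f'R R0 U)
    show "open (R -` U)" by (rule open_vimage[OF U(2)]) (use Rlin linear_continuous_on in blast)
    show "0 \<in> R -` U" using U R0 by simp
    fix z assume z: "z \<in> R -` U - {0}"
    then have "R z \<in> U - {0}" using RR R0 by (metis DiffD1 DiffD2 DiffI singletonD singletonI vimageE)
    then obtain \<phi> \<theta> where s: "\<phi> 0 = R z" "\<And>t. t\<ge>0 \<Longrightarrow> (\<phi> has_vector_derivative f (\<phi> t)) (at t within {0..})"
      "\<And>t. t\<ge>0 \<Longrightarrow> \<phi> t \<noteq> 0" "(\<phi> \<longlongrightarrow> 0) at_top" "continuous_on {0..} (\<theta>::real \<Rightarrow> real)"
      "\<And>t. t\<ge>0 \<Longrightarrow> \<phi> t - 0 = norm (\<phi> t - 0) *\<^sub>R vector [cos (\<theta> t), sin (\<theta> t)]" "filterlim \<theta> at_infinity at_top"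
      using U(4) unfolding spirals_towards_def by blast
    have "spirals_towards f' 0 (\<lambda>t. R (\<phi> t))"
      unfolding spirals_towards_def
    proof (intro conjI allI impI exI[of _ "\<lambda>t. pi - \<theta> t"])
      fix t :: real assume t: "t \<ge> 0"
      show "((\<lambda>t. R (\<phi> t)) has_vector_derivative f' (R (\<phi> t))) (at t within {0..})"
        using bounded_linear.has_vector_derivative[OF Rlin s(2)[OF t]] by (simp add: f'R RR)
      show "R (\<phi> t) \<noteq> 0" using s(3)[OF t] RR R0 by metis
      have "\<phi> t $ 1 = norm (\<phi> t) * cos (\<theta> t)" "\<phi> t $ 2 = norm (\<phi> t) * sin (\<theta> t)"
        using arg_cong[OF s(6)[OF t], of "\<lambda>z::real^2. z $ 1"] arg_cong[OF s(6)[OF t], of "\<lambda>z::real^2. z $ 2"] by auto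
      then show "R (\<phi> t) - 0 = norm (R (\<phi> t) - 0) *\<^sub>R vector [cos (pi - \<theta> t), sin (pi - \<theta> t)]"
        by (simp add: Rn vec2_cong_iff) (simp add: R_def)
    next
      show "((\<lambda>t. R (\<phi> t)) \<longlongrightarrow> 0) at_top"
        using bounded_linear.tendsto[OF Rlin s(4)] R0 by simp
      show "continuous_on {0..} (\<lambda>t. pi - \<theta> t)" using s(5) by (intro continuous_intros)
      have "filterlim (\<lambda>t. - \<theta> t) at_infinity at_top"
        using s(7) by (simp add: filterlim_at_infinity_conv_norm_at_top)
      from tendsto_add_filterlim_at_infinity[OF tendsto_const[of pi] this]
      show "filterlim (\<lambda>t. pi - \<theta> t) at_infinity at_top" by simp
    qed
    then show "\<exists>\<psi>. \<psi> 0 = z \<and> spirals_towards f' 0 \<psi>" using s(1) RR by (intro exI[of _ "\<lambda>t. R (\<phi> t)"]) simp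
  qed
qed

text \<open>The solution on a periodic orbit is back at its starting point at all multiples of the
  period, which is incompatible with convergence to the origin.\<close>

lemma stable_focus_not_center:
  fixes f :: "real^2 \<Rightarrow> real^2"
  assumes f: "lip_bdd f" and foc: "stable_focus f 0" and cen: "is_center f 0"
  shows False
proof -
  obtain U where U: "f 0 = 0" "open U" "0 \<in> U" "\<And>z. z \<in> U - {0} \<Longrightarrow> \<exists>\<phi>. \<phi> 0 = z \<and> spirals_towards f 0 \<phi>"
    using foc unfolding stable_focus_def by blast
  obtain V G where V: "open V" "0 \<in> V" "\<forall>\<gamma>\<in>G. periodic_orbit f \<gamma>" "V - {0} = \<Union>G"
    using cen unfolding is_center_def by blast
  have "open (U \<inter> V)" "0 \<in> U \<inter> V" using U V by auto
  then obtain e where e: "e > 0" "ball 0 e \<subseteq> U \<inter> V" using open_contains_ball by blast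
  define z :: "real^2" where "z = axis 1 (e/2)"
  have "norm z < e" using e by (simp add: z_def norm_vec2 axis_def)
  then have z: "z \<in> U" "z \<in> V" "z \<noteq> 0"
    using e by (auto simp: z_def axis_eq_0_iff subset_iff)
  then obtain \<gamma> where \<gamma>: "periodic_orbit f \<gamma>" "z \<in> \<gamma>" using V by blast
  obtain \<phi> T where \<phi>: "T > 0" "\<And>t. (\<phi> has_vector_derivative f (\<phi> t)) (at t)" "\<And>t. \<phi> (t + T) = \<phi> t" "\<gamma> = range \<phi>"
    using \<gamma>(1) by (auto simp: periodic_orbit_def)
  obtain t0 where t0: "\<phi> t0 = z" using \<gamma> \<phi> by auto
  obtain \<psi> where \<psi>: "\<psi> 0 = z" "\<And>t. t\<ge>0 \<Longrightarrow> (\<psi> has_vector_derivative f (\<psi> t)) (at t within {0..})" "(\<psi> \<longlongrightarrow> 0) at_top"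
    using U(4)[of z] z unfolding spirals_towards_def by blast
  have "\<phi> (t0 + real n * T) = z" for n
  proof (induction n)
    case (Suc n)
    have "t0 + real (Suc n) * T = t0 + real n * T + T" by (simp add: algebra_simps)
    then show ?case using Suc \<phi>(3)[of "t0 + real n * T"] by (simp only:)
  qed (simp add: t0)
  moreover have "\<phi> (t0 + t) = \<psi> t" if "t \<ge> 0" for t
  proof (rule solution_unique[OF f, of 0 t "\<lambda>u. \<phi> (t0 + u)" \<psi> 0])
    fix u assume u: "u \<in> {0..t}"
    have "((\<lambda>u. t0 + u) has_vector_derivative 1) (at u)" by (auto intro!: derivative_eq_intros)
    from vector_diff_chain_at[OF this \<phi>(2)]
    show "((\<lambda>u. \<phi> (t0 + u)) has_vector_derivative f (\<phi> (t0 + u))) (at u within {0..t})"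
      by (auto simp: o_def intro: has_vector_derivative_at_within)
    show "(\<psi> has_vector_derivative f (\<psi> u)) (at u within {0..t})"
      by (rule has_vector_derivative_within_subset[OF \<psi>(2)]) (use u in auto)
  qed (use that t0 \<psi> in auto)
  ultimately have "\<psi> (real n * T) = z" for n using \<phi>(1) by (metis less_imp_le mult_nonneg_nonneg of_nat_0_le_iff)
  moreover have "filterlim (\<lambda>n. real n * T) at_top sequentially"
    using \<phi>(1) by (intro filterlim_at_top_mult_tendsto_pos[OF tendsto_const _ filterlim_real_sequentially])
  then have "(\<lambda>n. \<psi> (real n * T)) \<longlonglongrightarrow> 0" by (rule filterlim_compose[OF \<psi>(3)])
  ultimately show False using z by (simp add: LIMSEQ_const_iff)
qed

lemma focus_not_center:
  fixes f :: "real^2 \<Rightarrow> real^2"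
  assumes f: "lip_bdd f" and foc: "is_focus f 0"
  shows "\<not> is_center f 0"
proof
  assume cen: "is_center f 0"
  have "lip_bdd (\<lambda>z. - f z)" using f unfolding lip_bdd_def by (simp add: norm_minus_commute)
  moreover have "is_center (\<lambda>z. - f z) 0" using cen is_center_scale_iff[of "-1" f 0] by simp
  ultimately show False using stable_focus_not_center f foc cen unfolding is_focus_def by blast
qed

text \<open>\<open>\<tau>\<close> is an antiderivative of \<Lambda>. The lower bound
  \<open>m\<close> makes it grow at least linearly, hence a bijection of the real line, and
  \<open>\<Theta>\<close> is its inverse; solutions reparametrized this way exist for all
  time.\<close>

lemma time_change:
  fixes \<Lambda> :: "real \<Rightarrow> real"
  assumes cont: "continuous_on UNIV \<Lambda>" and m: "m > 0" "\<And>x. \<Lambda> x \<ge> m"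
  obtains \<tau> \<Theta> :: "real \<Rightarrow> real" where
    "\<tau> 0 = 0" "\<And>x. (\<tau> has_real_derivative \<Lambda> x) (at x)" "strict_mono \<tau>"
    "\<And>x. \<Theta> (\<tau> x) = x" "\<And>t. \<tau> (\<Theta> t) = t" "\<And>t. (\<Theta> has_real_derivative 1 / \<Lambda> (\<Theta> t)) (at t)"
    "strict_mono \<Theta>" "filterlim \<Theta> at_top at_top"
proof -
  have "\<exists>F. \<forall>x. -\<infinity> < ereal x \<longrightarrow> ereal x < \<infinity> \<longrightarrow> (F has_vector_derivative \<Lambda> x) (at x)"
    by (rule einterval_antiderivative) (use cont in \<open>auto simp: continuous_on_eq_continuous_at\<close>)
  then obtain F where F: "\<And>x. (F has_real_derivative \<Lambda> x) (at x)"
    by (auto simp: has_real_derivative_iff_has_vector_derivative)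
  define \<tau> where "\<tau> x = F x - F 0" for x
  have \<tau>: "(\<tau> has_real_derivative \<Lambda> x) (at x)" for x
    unfolding \<tau>_def using F by (auto intro!: derivative_eq_intros)
  have grow: "\<tau> y - \<tau> x \<ge> m * (y - x)" if "x \<le> y" for x y
  proof (cases "x < y")
    case True
    then obtain z where "\<tau> y - \<tau> x = (y - x) * \<Lambda> z" using MVT2[of x y \<tau> \<Lambda>] \<tau> by blast
    then show ?thesis using mult_left_mono[OF m(2)[of z], of "y - x"] True by (simp add: mult.commute)
  qed (use that in simp)
  have mono: "strict_mono \<tau>"
  proof (rule strict_monoI)
    fix x y :: real assume "x < y"
    then have "m * (y - x) > 0" using m by simp
    then show "\<tau> x < \<tau> y" using grow[of x y] \<open>x < y\<close> by simp
  qed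
  have ct: "continuous_on S \<tau>" for S
    using \<tau> by (intro continuous_at_imp_continuous_on) (blast intro: DERIV_isCont)
  have "\<exists>x. \<tau> x = t" for t
  proof -
    define M where "M = \<bar>t\<bar> / m"
    have M: "M \<ge> 0" "m * M = \<bar>t\<bar>" using m by (auto simp: M_def)
    have "\<tau> 0 = 0" by (simp add: \<tau>_def)
    then have "\<tau> (- M) \<le> t" "t \<le> \<tau> M" using grow[of "-M" 0] grow[of 0 M] M by auto
    then show ?thesis using IVT'[of \<tau> "-M" t M] ct M by auto
  qed
  then obtain \<Theta> where \<Theta>: "\<And>t. \<tau> (\<Theta> t) = t" by metis
  have inv: "\<Theta> (\<tau> x) = x" for x using \<Theta>[of "\<tau> x"] strict_mono_eq[OF mono] by blast
  have mono': "strict_mono \<Theta>"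
  proof (rule strict_monoI)
    fix x y :: real assume "x < y"
    then show "\<Theta> x < \<Theta> y" using \<Theta>[of x] \<Theta>[of y] strict_mono_less[OF mono] by metis
  qed
  have "isCont \<Theta> t" for t
  proof -
    have "isCont \<Theta> (\<tau> (\<Theta> t))"
      by (rule isCont_inverse_function[of 1]) (use inv \<tau> in \<open>auto intro: DERIV_isCont\<close>)
    then show ?thesis by (simp add: \<Theta>)
  qed
  then have "(\<Theta> has_real_derivative inverse (\<Lambda> (\<Theta> t))) (at t)" for t
    using m(2)[of "\<Theta> t"] m(1) \<Theta>
    by (intro DERIV_inverse_function[of \<tau> _ _ _ "t - 1" "t + 1"] \<tau>) auto
  moreover have "filterlim \<Theta> at_top at_top"
    unfolding filterlim_at_top
  proof
    fix Z :: real
    show "\<forall>\<^sub>F x in at_top. Z \<le> \<Theta> x"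
    proof (rule eventually_at_top_linorderI[of "\<tau> Z"])
      fix x assume "\<tau> Z \<le> x"
      then show "Z \<le> \<Theta> x" using strict_mono_less_eq[OF mono'] inv by metis
    qed
  qed
  ultimately show ?thesis using that[of \<tau> \<Theta>] \<tau> mono inv \<Theta> mono' by (simp add: \<tau>_def divide_inverse)
qed

section \<open>Generalized polar coordinates\<close>

text \<open>To be read with \<open>S = sin t\<close>, \<open>C = cos t\<close>,
  \<open>s2 = sin t ^ r2\<close>, \<open>c1 = cos t ^ r1\<close>, \<open>A = r1 + 1\<close>,
  \<open>B = r2 + 1\<close>. \<eta> is the logarithmic derivative of \<rho> with respect to the
  angle. The conclusions say that, up to powers of \<rho>, the angular derivative of
  \<open>(x, y)\<close> is \<open>D / Z\<close> times the field in both components.\<close>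

lemma polar_algebra:
  fixes A B E Z S C s2 c1 \<alpha> T D X \<eta> :: real
  assumes E: "E = A * S * s2 + B * \<alpha> * C * c1" "E \<noteq> 0" and Z: "Z = E + B * C * T" "Z \<noteq> 0"
    and D: "D = A * S\<^sup>2 + B * C\<^sup>2" and X: "X = s2 * C - \<alpha> * c1 * S"
    and \<eta>: "\<eta> = s2 * D * T / (E * Z) - X / E"
  shows "A * \<eta> * S + C = D * (\<alpha> * c1 + T) / Z" "S - B * \<eta> * C = D * s2 / Z"
proof -
  have "s2 * D * T - X * Z = E * (S * T - X)"
    unfolding E(1) Z(1) D X by (simp add: power2_eq_square algebra_simps)
  moreover have "\<eta> * (E * Z) = s2 * D * T - X * Z" using E(2) Z(2) unfolding \<eta> by (simp add: left_diff_distrib)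
  ultimately have "\<eta> * (E * Z) = E * (S * T - X)" by simp
  then have \<eta>Z: "\<eta> * Z = S * T - X" using E(2) by (simp add: mult.left_commute[of \<eta> E Z])
  have "(A * \<eta> * S + C) * Z = A * S * (\<eta> * Z) + C * Z" by (simp add: algebra_simps)
  also have "\<dots> = D * (\<alpha> * c1 + T)"
    unfolding \<eta>Z unfolding Z(1) E(1) D X by (simp add: power2_eq_square algebra_simps)
  finally show "A * \<eta> * S + C = D * (\<alpha> * c1 + T) / Z" using Z(2) by (simp add: field_simps)
  have "(S - B * \<eta> * C) * Z = S * Z - B * C * (\<eta> * Z)" by (simp add: algebra_simps)
  also have "\<dots> = D * s2"
    unfolding \<eta>Z unfolding Z(1) E(1) D X by (simp add: power2_eq_square algebra_simps)
  finally show "S - B * \<eta> * C = D * s2 / Z" using Z(2) by (simp add: field_simps)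
qed

text \<open>With weights \<open>r1 + 1\<close> for \<open>x\<close> and \<open>r2 + 1\<close> for
  \<open>y\<close>, the monomial \<open>x^q\<close> exceeds \<open>y^p\<close> by \<open>g\<close>
  in order. Raising the index by one replaces \<open>y^p\<close> by \<open>x^q\<close> and thus
  raises the order by \<open>g\<close>.\<close>

locale qh =
  fixes p q r1 r2 g :: nat
  assumes odd: "odd p" "odd q" "odd r1" "odd r2" and g: "g > 0"
    and weights: "q * (r1 + 1) = p * (r2 + 1) + g"
begin

abbreviation "KK \<equiv> r1 div p"

text \<open>\<open>\<rho>^((r1+1)*(r2+1)) * E \<alpha> t\<close> is the first integral
  \<open>(r1+1) * x^(r2+1) + (r2+1) * \<alpha> * y^(r1+1)\<close> of the system
  \<open>x' = -\<alpha> * y^r1\<close>, \<open>y' = x^r2\<close>.\<close>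

definition E :: "real \<Rightarrow> real \<Rightarrow> real" where
  "E \<alpha> t = real (r1 + 1) * sin t ^ (r2 + 1) + real (r2 + 1) * \<alpha> * cos t ^ (r1 + 1)"

definition Dl :: "real \<Rightarrow> real" where "Dl t = real (r1 + 1) * (sin t)\<^sup>2 + real (r2 + 1) * (cos t)\<^sup>2"

text \<open>The power of the first integral that has order \<open>g\<close> in \<rho>. With it the
  summand of index \<open>i\<close> carries exactly \<open>u^i\<close>.\<close>

definition kk :: real where "kk = real g / (real (r1 + 1) * real (r2 + 1))"

definition om :: "real \<Rightarrow> nat \<Rightarrow> real \<Rightarrow> real" where
  "om \<alpha> i t = sin t ^ (i * q) * (- cos t) ^ (r1 - i * p) * exp (- (kk * i) * ln (E \<alpha> t))"

definition MM :: "real \<Rightarrow> real \<Rightarrow> real" where "MM \<alpha> t = real g * sin t ^ r2 * Dl t / (E \<alpha> t)\<^sup>2"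

definition NN :: "real \<Rightarrow> real \<Rightarrow> real" where "NN \<alpha> t = real (r2 + 1) * cos t / E \<alpha> t"

text \<open>The radial variable \<open>u = \<rho>^g * E powr kk\<close> is constant along the orbits of the quasi-homogeneous part.\<close>

definition rho :: "real \<Rightarrow> real \<Rightarrow> real \<Rightarrow> real" where
  "rho \<alpha> u t = exp ((ln u - kk * ln (E \<alpha> t)) / g)"

definition G :: "real \<Rightarrow> real \<Rightarrow> real \<Rightarrow> real^2" where
  "G \<alpha> u t = vector [rho \<alpha> u t ^ (r1 + 1) * sin t, - (rho \<alpha> u t ^ (r2 + 1) * cos t)]"

definition TT :: "(nat \<Rightarrow> real) \<Rightarrow> real \<Rightarrow> real \<Rightarrow> real" where
  "TT a u t = (\<Sum>i\<in>{1..KK}. a i * u ^ i * om (- a 0) i t)"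

text \<open>The derivative of time with respect to the angle; it is positive as long as
  \<open>1 + NN * TT\<close> is, so the angle then increases along orbits.\<close>

definition lam :: "(nat \<Rightarrow> real) \<Rightarrow> real \<Rightarrow> real \<Rightarrow> real" where
  "lam a u t = Dl t / (rho (- a 0) u t ^ (r1 * r2 - 1) * (E (- a 0) t * (1 + NN (- a 0) t * TT a u t)))"

lemma q_pos: "q > 0" and r1_pos: "r1 > 0" and r2_pos: "r2 > 0"
  using odd odd_pos by auto

lemma Dl_ge_1: "Dl t \<ge> 1"
proof -
  have "1 * (sin t)\<^sup>2 + 1 * (cos t)\<^sup>2 \<le> Dl t"
    unfolding Dl_def by (intro add_mono mult_right_mono) auto
  then show ?thesis by simp
qed

lemma Dl_le: "Dl t \<le> real (r1 + r2 + 2)"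
proof -
  have "Dl t \<le> real (r1 + 1) * 1 + real (r2 + 1) * 1"
    unfolding Dl_def by (intro add_mono mult_left_mono) (auto simp: abs_square_le_1)
  then show ?thesis by simp
qed

lemma E_pos: "\<alpha> > 0 \<Longrightarrow> E \<alpha> t > 0"
proof -
  assume \<alpha>: "\<alpha> > 0"
  have ev: "even (r2 + 1)" "even (r1 + 1)" using odd by auto
  have nn: "real (r1 + 1) * sin t ^ (r2 + 1) \<ge> 0" "real (r2 + 1) * \<alpha> * cos t ^ (r1 + 1) \<ge> 0"
    using \<alpha> by (intro mult_nonneg_nonneg zero_le_even_power ev; simp)+
  have "sin t \<noteq> 0 \<or> cos t \<noteq> 0" by (metis sin_cos_squared_add power_zero_numeral add_0 zero_neq_one)
  then have "real (r1 + 1) * sin t ^ (r2 + 1) > 0 \<or> real (r2 + 1) * \<alpha> * cos t ^ (r1 + 1) > 0"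
    using \<alpha> ev by (metis mult_pos_pos of_nat_0_less_iff zero_less_power_eq add_gr_0 zero_less_one)
  then show ?thesis using nn unfolding E_def by auto
qed

lemma E_pi: "E \<alpha> (t + pi) = E \<alpha> t" and Dl_pi: "Dl (t + pi) = Dl t"
  using odd by (auto simp: E_def Dl_def)

lemma MM_pi: "MM \<alpha> (t + pi) = - MM \<alpha> t" and NN_pi: "NN \<alpha> (t + pi) = - NN \<alpha> t"
  using odd by (auto simp: MM_def NN_def E_pi Dl_pi)

lemma idx_le: "i \<le> KK \<Longrightarrow> i * p \<le> r1"
  by (metis div_times_less_eq_dividend mult_le_mono1 order_trans)

text \<open>The total exponent \<open>i*q + (r1 - i*p)\<close> is odd for every \<open>i\<close>, as
  \<open>p\<close>, \<open>q\<close>, \<open>r1\<close> are odd. This is the oddness of the field,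
  and it lets every half-turn obey the same equation.\<close>

lemma om_pi:
  assumes "i \<le> KK"
  shows "om \<alpha> i (t + pi) = - om \<alpha> i t"
proof (cases "even i")
  case True
  then show ?thesis using odd idx_le[OF assms] by (simp add: om_def E_pi)
next
  case False
  then show ?thesis using odd idx_le[OF assms] by (simp add: om_def E_pi)
qed

lemma TT_pi: "TT a u (t + pi) = - TT a u t"
  unfolding TT_def sum_negf[symmetric] by (intro sum.cong refl) (simp add: om_pi)

lemma rho_pos: "rho \<alpha> u t > 0" by (simp add: rho_def)

lemma rho_pi: "rho \<alpha> u (t + pi) = rho \<alpha> u t" by (simp add: rho_def E_pi)

text \<open>The reflection changes only the sign of the cosine, whose exponent
  \<open>r1 - i*p\<close> is odd for even \<open>i\<close>. This is the reversibility of the even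
  terms.\<close>

lemma om_reflect_even:
  assumes "i \<le> KK" "even i"
  shows "om \<alpha> i (pi - t) = - om \<alpha> i t"
proof -
  have "odd (r1 - i * p)" using assms odd idx_le[OF assms(1)] by simp
  moreover have "E \<alpha> (pi - t) = E \<alpha> t" using odd by (simp add: E_def)
  ultimately show ?thesis by (simp add: om_def)
qed

lemma E_reflect: "E \<alpha> (pi - t) = E \<alpha> t" using odd by (simp add: E_def)

lemma MM_reflect: "MM \<alpha> (pi - t) = MM \<alpha> t" and NN_reflect: "NN \<alpha> (pi - t) = - NN \<alpha> t"
  by (simp_all add: MM_def NN_def E_reflect Dl_def)

text \<open>The weighted degree of the monomial of index \<open>i\<close> is that of index 0 plus
  \<open>g * i\<close>.\<close>

lemma exponent: "i \<le> KK \<Longrightarrow> (r1 + 1) * (i * q) + (r2 + 1) * (r1 - i * p) = (r2 + 1) * r1 + g * i"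
proof -
  assume "i \<le> KK"
  then have le: "i * p \<le> r1" by (rule idx_le)
  have "i * (q * (r1 + 1)) = i * (p * (r2 + 1)) + i * g" using weights by (simp add: distrib_left)
  then have "(r1 + 1) * (i * q) = (r2 + 1) * (i * p) + g * i" by (simp add: algebra_simps)
  moreover have "(r2 + 1) * (i * p) + (r2 + 1) * (r1 - i * p) = (r2 + 1) * r1"
    using le by (metis add_diff_inverse_nat distrib_left not_less)
  ultimately show ?thesis by simp
qed

lemma rho_pow:
  assumes "u > 0"
  shows "rho \<alpha> u t ^ (g * i) = u ^ i * exp (- (kk * i) * ln (E \<alpha> t))"
proof -
  have "rho \<alpha> u t ^ (g * i) = exp (real (g * i) * ((ln u - kk * ln (E \<alpha> t)) / g))"
    unfolding rho_def by (rule exp_of_nat_mult[symmetric])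
  also have "real (g * i) * ((ln u - kk * ln (E \<alpha> t)) / g) = real i * ln u + (- (kk * i) * ln (E \<alpha> t))"
    using g by (simp add: field_simps)
  also have "exp \<dots> = exp (ln u) ^ i * exp (- (kk * i) * ln (E \<alpha> t))"
    unfolding exp_add exp_of_nat_mult ..
  finally show ?thesis using assms by simp
qed

lemma field_on_G:
  fixes a :: "nat \<Rightarrow> real"
  assumes u: "u > 0"
  defines "\<alpha> \<equiv> - a 0"
  shows "family_A p q r1 r2 a 1 (G \<alpha> u t) =
    vector [rho \<alpha> u t ^ ((r2 + 1) * r1) * (\<alpha> * cos t ^ r1 + TT a u t), rho \<alpha> u t ^ ((r1 + 1) * r2) * sin t ^ r2]"
proof -
  define \<rho> where "\<rho> = rho \<alpha> u t"
  have sum: "(\<Sum>i\<le>KK. a i * (\<rho> ^ (r1 + 1) * sin t) ^ (i * q) * (- (\<rho> ^ (r2 + 1) * cos t)) ^ (r1 - i * p)) =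
     (\<Sum>i\<le>KK. \<rho> ^ ((r2 + 1) * r1) * (a i * \<rho> ^ (g * i) * (sin t ^ (i * q) * (- cos t) ^ (r1 - i * p))))"
  proof (intro sum.cong refl)
    fix i assume "i \<in> {..KK}"
    then have i: "i \<le> KK" by simp
    have "(\<rho> ^ (r1 + 1) * sin t) ^ (i * q) * (- (\<rho> ^ (r2 + 1) * cos t)) ^ (r1 - i * p) =
       (\<rho> ^ (r1 + 1) * sin t) ^ (i * q) * (\<rho> ^ (r2 + 1) * (- cos t)) ^ (r1 - i * p)"
      by simp
    also have "\<dots> = \<rho> ^ ((r1 + 1) * (i * q)) * \<rho> ^ ((r2 + 1) * (r1 - i * p)) * (sin t ^ (i * q) * (- cos t) ^ (r1 - i * p))"
      unfolding power_mult_distrib power_mult[symmetric] by (simp only: mult_ac)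
    also have "\<rho> ^ ((r1 + 1) * (i * q)) * \<rho> ^ ((r2 + 1) * (r1 - i * p)) = \<rho> ^ ((r2 + 1) * r1) * \<rho> ^ (g * i)"
      unfolding power_add[symmetric] exponent[OF i] ..
    finally show "a i * (\<rho> ^ (r1 + 1) * sin t) ^ (i * q) * (- (\<rho> ^ (r2 + 1) * cos t)) ^ (r1 - i * p) =
      \<rho> ^ ((r2 + 1) * r1) * (a i * \<rho> ^ (g * i) * (sin t ^ (i * q) * (- cos t) ^ (r1 - i * p)))"
      by (simp only: mult_ac)
  qed
  also have "\<dots> = \<rho> ^ ((r2 + 1) * r1) * (\<Sum>i\<le>KK. a i * \<rho> ^ (g * i) * (sin t ^ (i * q) * (- cos t) ^ (r1 - i * p)))"
    by (rule sum_distrib_left[symmetric])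
  also have "(\<Sum>i\<le>KK. a i * \<rho> ^ (g * i) * (sin t ^ (i * q) * (- cos t) ^ (r1 - i * p))) =
     \<alpha> * cos t ^ r1 + (\<Sum>i\<in>{1..KK}. a i * \<rho> ^ (g * i) * (sin t ^ (i * q) * (- cos t) ^ (r1 - i * p)))"
    using odd by (simp add: \<alpha>_def atMost_atLeast0 sum.atLeast_Suc_atMost)
  also have "(\<Sum>i\<in>{1..KK}. a i * \<rho> ^ (g * i) * (sin t ^ (i * q) * (- cos t) ^ (r1 - i * p))) = TT a u t"
    unfolding TT_def \<rho>_def rho_pow[OF u] \<alpha>_def om_def by (intro sum.cong refl) (simp only: mult_ac)
  finally have 1: "(\<Sum>i\<le>KK. a i * (\<rho> ^ (r1 + 1) * sin t) ^ (i * q) * (- (\<rho> ^ (r2 + 1) * cos t)) ^ (r1 - i * p)) =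
     \<rho> ^ ((r2 + 1) * r1) * (\<alpha> * cos t ^ r1 + TT a u t)" .
  have 2: "(\<rho> ^ (r1 + 1) * sin t) ^ r2 = \<rho> ^ ((r1 + 1) * r2) * sin t ^ r2"
    by (simp only: power_mult_distrib power_mult)
  have 3: "G \<alpha> u t $ 1 = \<rho> ^ (r1 + 1) * sin t" "G \<alpha> u t $ 2 = - (\<rho> ^ (r2 + 1) * cos t)"
    by (simp_all only: G_def \<rho>_def vector_2)
  show ?thesis
    unfolding family_A_def 3 1 2 mult_1 by (simp only: \<rho>_def)
qed

lemma E_deriv:
  "(E \<alpha> has_real_derivative real (r1 + 1) * real (r2 + 1) * (sin t ^ r2 * cos t - \<alpha> * cos t ^ r1 * sin t)) (at t within S)"
  unfolding E_def by (rule derivative_eq_intros refl | simp)+ (simp add: algebra_simps)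

text \<open>Logarithmic differentiation of \<open>rho\<close> gives \<eta>, and
  \<open>polar_algebra\<close> then matches both components of the velocity with the same factor
  \<open>lam\<close>. Thus solutions of the scalar equation trace orbits of the planar
  field.\<close>

lemma G_deriv:
  assumes u: "(u has_real_derivative u t * (MM \<alpha> t * TT a (u t) t / (1 + NN \<alpha> t * TT a (u t) t))) (at t within S)"
    and upos: "u t > 0" and \<alpha>: "\<alpha> = - a 0" "\<alpha> > 0" and nz: "1 + NN \<alpha> t * TT a (u t) t \<noteq> 0"
  shows "((\<lambda>t. G \<alpha> (u t) t) has_vector_derivative lam a (u t) t *\<^sub>R family_A p q r1 r2 a 1 (G \<alpha> (u t) t)) (at t within S)"
proof -
  define T where "T = TT a (u t) t"
  define A B where "A = real (r1 + 1)" and "B = real (r2 + 1)"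
  define Z where "Z = E \<alpha> t * (1 + NN \<alpha> t * T)"
  define X where "X = sin t ^ r2 * cos t - \<alpha> * cos t ^ r1 * sin t"
  define \<eta> where "\<eta> = sin t ^ r2 * Dl t * T / (E \<alpha> t * Z) - X / E \<alpha> t"
  define \<rho> where "\<rho> = rho \<alpha> (u t) t"
  have Ep: "E \<alpha> t > 0" by (rule E_pos[OF \<alpha>(2)])
  have AB: "A > 0" "B > 0" by (auto simp: A_def B_def)
  have Z: "Z = E \<alpha> t + B * cos t * T" unfolding Z_def NN_def B_def[symmetric] using Ep by (simp add: distrib_left)
  have Znz: "Z \<noteq> 0" using nz Ep by (simp add: Z_def T_def)
  have dln: "((\<lambda>t. (ln (u t) - kk * ln (E \<alpha> t)) / g) has_real_derivative \<eta>) (at t within S)"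
  proof -
    have "((\<lambda>t. (ln (u t) - kk * ln (E \<alpha> t)) / g) has_real_derivative
       (1 / u t * (u t * (MM \<alpha> t * T / (1 + NN \<alpha> t * T))) - kk * (1 / E \<alpha> t * (A * B * X))) / g) (at t within S)"
      unfolding T_def A_def B_def X_def using upos Ep g
      by (intro DERIV_cdivide DERIV_diff DERIV_cmult DERIV_chain'[OF u DERIV_ln_divide] DERIV_chain'[OF E_deriv DERIV_ln_divide] | simp)+
    also have "(1 / u t * (u t * (MM \<alpha> t * T / (1 + NN \<alpha> t * T))) - kk * (1 / E \<alpha> t * (A * B * X))) / g = \<eta>"
    proof -
      have "1 + NN \<alpha> t * T \<noteq> 0" using nz by (simp add: T_def)
      have "(MM \<alpha> t * T / (1 + NN \<alpha> t * T)) / g = sin t ^ r2 * Dl t * T / (E \<alpha> t * Z)"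
        using g Ep unfolding MM_def Z_def by (simp add: power2_eq_square)
      moreover have "kk * (1 / E \<alpha> t * (A * B * X)) / g = X / E \<alpha> t"
        using g AB unfolding kk_def A_def[symmetric] B_def[symmetric]
        by (simp add: A_def[symmetric] B_def[symmetric] del: of_nat_add of_nat_Suc)
      ultimately show ?thesis using upos by (simp add: \<eta>_def diff_divide_distrib)
    qed
    finally show ?thesis .
  qed
  have d\<rho>: "((\<lambda>t. rho \<alpha> (u t) t) has_real_derivative \<rho> * \<eta>) (at t within S)"
    unfolding rho_def \<rho>_def by (rule DERIV_chain'[OF dln DERIV_exp])
  have E_eq: "E \<alpha> t = A * sin t * sin t ^ r2 + B * \<alpha> * cos t * cos t ^ r1"
    by (simp add: E_def A_def B_def)
  have D_eq: "Dl t = A * (sin t)\<^sup>2 + B * (cos t)\<^sup>2" by (simp add: Dl_def A_def B_def)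
  note alg = polar_algebra[OF E_eq _ Z Znz D_eq X_def \<eta>_def]
  have ab: "A * \<eta> * sin t + cos t = Dl t * (\<alpha> * cos t ^ r1 + T) / Z" "sin t - B * \<eta> * cos t = Dl t * sin t ^ r2 / Z"
    using alg Ep by auto
  have \<rho>: "\<rho> > 0" by (simp add: \<rho>_def rho_pos)
  have e: "r1 * r2 \<ge> 1" using r1_pos r2_pos by simp
  have lam: "lam a (u t) t = Dl t / (\<rho> ^ (r1 * r2 - 1) * Z)"
    by (simp add: lam_def \<rho>_def \<alpha>(1) Z_def T_def)
  have pw1: "\<rho> ^ ((r2 + 1) * r1) = \<rho> ^ (r1 * r2 - 1) * \<rho> ^ (r1 + 1)"
    unfolding power_add[symmetric] using e by (intro arg_cong[of _ _ "\<lambda>n. \<rho> ^ n"]) (simp add: algebra_simps)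
  have pw2: "\<rho> ^ ((r1 + 1) * r2) = \<rho> ^ (r1 * r2 - 1) * \<rho> ^ (r2 + 1)"
    unfolding power_add[symmetric] using e by (intro arg_cong[of _ _ "\<lambda>n. \<rho> ^ n"]) (simp add: algebra_simps)
  have dpow: "((\<lambda>t. rho \<alpha> (u t) t ^ Suc n) has_real_derivative real (Suc n) * \<eta> * \<rho> ^ Suc n) (at t within S)" for n
    using DERIV_power[OF d\<rho>, of "Suc n"] by (simp add: \<rho>_def mult_ac)
  have dx: "((\<lambda>t. rho \<alpha> (u t) t ^ (r1 + 1) * sin t) has_real_derivative
      lam a (u t) t * (\<rho> ^ ((r2 + 1) * r1) * (\<alpha> * cos t ^ r1 + T))) (at t within S)"
  proof -
    have "((\<lambda>t. rho \<alpha> (u t) t ^ (r1 + 1) * sin t) has_real_derivative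
      real (Suc r1) * \<eta> * \<rho> ^ Suc r1 * sin t + cos t * \<rho> ^ Suc r1) (at t within S)"
      unfolding \<rho>_def using DERIV_mult[OF dpow[of r1] DERIV_sin[THEN has_field_derivative_at_within, of t S]]
      by (simp add: \<rho>_def)
    also have "real (Suc r1) * \<eta> * \<rho> ^ Suc r1 * sin t + cos t * \<rho> ^ Suc r1 = \<rho> ^ (r1 + 1) * (A * \<eta> * sin t + cos t)"
      by (simp add: A_def algebra_simps)
    also have "\<dots> = lam a (u t) t * (\<rho> ^ ((r2 + 1) * r1) * (\<alpha> * cos t ^ r1 + T))"
      unfolding ab lam pw1 using \<rho> Znz by (simp add: field_simps)
    finally show ?thesis .
  qed
  have dy: "((\<lambda>t. - (rho \<alpha> (u t) t ^ (r2 + 1) * cos t)) has_real_derivative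
      lam a (u t) t * (\<rho> ^ ((r1 + 1) * r2) * sin t ^ r2)) (at t within S)"
  proof -
    have "((\<lambda>t. - (rho \<alpha> (u t) t ^ (r2 + 1) * cos t)) has_real_derivative
      - (real (Suc r2) * \<eta> * \<rho> ^ Suc r2 * cos t + (- sin t) * \<rho> ^ Suc r2)) (at t within S)"
      unfolding \<rho>_def using DERIV_minus[OF DERIV_mult[OF dpow[of r2] DERIV_cos[THEN has_field_derivative_at_within, of t S]]]
      by (simp add: \<rho>_def)
    also have "- (real (Suc r2) * \<eta> * \<rho> ^ Suc r2 * cos t + (- sin t) * \<rho> ^ Suc r2) = \<rho> ^ (r2 + 1) * (sin t - B * \<eta> * cos t)"
      by (simp add: B_def algebra_simps)
    also have "\<dots> = lam a (u t) t * (\<rho> ^ ((r1 + 1) * r2) * sin t ^ r2)"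
      unfolding ab lam pw2 using \<rho> Znz by (simp add: field_simps)
    finally show ?thesis .
  qed
  have "((\<lambda>t. G \<alpha> (u t) t) has_vector_derivative vector [lam a (u t) t * (\<rho> ^ ((r2 + 1) * r1) * (\<alpha> * cos t ^ r1 + T)),
     lam a (u t) t * (\<rho> ^ ((r1 + 1) * r2) * sin t ^ r2)]) (at t within S)"
    unfolding G_def by (rule has_vector_derivative_vec2[OF dx dy])
  also have "vector [lam a (u t) t * (\<rho> ^ ((r2 + 1) * r1) * (\<alpha> * cos t ^ r1 + T)),
     lam a (u t) t * (\<rho> ^ ((r1 + 1) * r2) * sin t ^ r2)] = lam a (u t) t *\<^sub>R family_A p q r1 r2 a 1 (G \<alpha> (u t) t)"
    unfolding field_on_G[OF upos, of a t, folded \<alpha>(1)] by (simp add: vec2_cong_iff \<rho>_def T_def)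
  finally show ?thesis .
qed

text \<open>Compactness in \<alpha> and in one period of \<open>t\<close>; the uniformity in
  \<alpha> is needed when \<open>a 0\<close> is perturbed.\<close>

lemma E_bounds:
  assumes "0 < \<alpha>1" "\<alpha>1 \<le> \<alpha>2"
  shows "\<exists>\<Lambda>\<ge>0. \<forall>\<alpha>\<in>{\<alpha>1..\<alpha>2}. \<forall>t. \<bar>ln (E \<alpha> t)\<bar> \<le> \<Lambda>"
proof -
  define D where "D = {\<alpha>1..\<alpha>2} \<times> {0..2*pi}"
  have "compact D" by (simp add: D_def compact_Times)
  moreover have "continuous_on D (\<lambda>x. ln (E (fst x) (snd x)))"
  proof (intro continuous_on_ln)
    show "continuous_on D (\<lambda>x. E (fst x) (snd x))" unfolding E_def by (intro continuous_intros)
    show "\<forall>x\<in>D. E (fst x) (snd x) \<noteq> 0"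
      using E_pos assms unfolding D_def by (metis SigmaE atLeastAtMost_iff fst_conv less_irrefl less_le_trans)
  qed
  ultimately have "bounded ((\<lambda>x. ln (E (fst x) (snd x))) ` D)"
    by (intro compact_imp_bounded compact_continuous_image)
  then obtain \<Lambda> where \<Lambda>: "\<And>x. x \<in> D \<Longrightarrow> \<bar>ln (E (fst x) (snd x))\<bar> \<le> \<Lambda>" by (auto simp: bounded_iff)
  have "\<bar>ln (E \<alpha> t)\<bar> \<le> \<Lambda>" if "\<alpha> \<in> {\<alpha>1..\<alpha>2}" for \<alpha> t
  proof -
    obtain t' where t': "0 \<le> t'" "t' < 2*pi" "sin t = sin t'" "cos t = cos t'"
      using sincos_total_2pi[of "cos t" "sin t"] by (metis sin_cos_squared_add2)
    then have "E \<alpha> t = E \<alpha> t'" by (simp add: E_def)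
    then show ?thesis using \<Lambda>[of "(\<alpha>, t')"] that t' by (simp add: D_def)
  qed
  moreover from this[of \<alpha>1 0] have "\<Lambda> \<ge> 0" using assms by (auto intro: order_trans[OF abs_ge_zero])
  ultimately show ?thesis by blast
qed

end

text \<open>Turns a curve whose velocity is a positive multiple of the field into a solution in
  time. The curve satisfies its equation on \<open>S\<close> only, while the multiplier must be
  defined and bounded below on the whole line.\<close>

lemma reparametrize:
  fixes \<Gamma> :: "real \<Rightarrow> 'a::real_normed_vector"
  assumes cont: "continuous_on UNIV \<Lambda>" and m: "m > 0" "\<And>x. \<Lambda> x \<ge> m"
    and \<Gamma>: "\<And>x. x \<in> S \<Longrightarrow> (\<Gamma> has_vector_derivative \<Lambda> x *\<^sub>R f (\<Gamma> x)) (at x within S)"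
  obtains \<tau> \<Theta> :: "real \<Rightarrow> real" where
    "\<tau> 0 = 0" "\<And>x. (\<tau> has_real_derivative \<Lambda> x) (at x)" "strict_mono \<tau>"
    "\<And>x. \<Theta> (\<tau> x) = x" "\<And>t. \<tau> (\<Theta> t) = t" "strict_mono \<Theta>" "filterlim \<Theta> at_top at_top"
    "\<And>t. isCont \<Theta> t"
    "\<And>t. \<Theta> t \<in> S \<Longrightarrow> ((\<lambda>t. \<Gamma> (\<Theta> t)) has_vector_derivative f (\<Gamma> (\<Theta> t))) (at t within \<Theta> -` S)"
proof -
  obtain \<tau> \<Theta> where tc: "\<tau> 0 = 0" "\<And>x. (\<tau> has_real_derivative \<Lambda> x) (at x)" "strict_mono \<tau>"
    "\<And>x. \<Theta> (\<tau> x) = x" "\<And>t. \<tau> (\<Theta> t) = t" "\<And>t. (\<Theta> has_real_derivative 1 / \<Lambda> (\<Theta> t)) (at t)"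
    "strict_mono \<Theta>" "filterlim \<Theta> at_top at_top"
    using time_change[OF cont m] by metis
  have "((\<lambda>t. \<Gamma> (\<Theta> t)) has_vector_derivative f (\<Gamma> (\<Theta> t))) (at t within \<Theta> -` S)" if t: "\<Theta> t \<in> S" for t
  proof -
    have "\<Lambda> (\<Theta> t) \<noteq> 0" using m by (metis less_le_trans less_irrefl)
    moreover have "(\<Theta> has_vector_derivative 1 / \<Lambda> (\<Theta> t)) (at t within \<Theta> -` S)"
      using tc(6)[of t] by (simp add: has_real_derivative_iff_has_vector_derivative has_vector_derivative_at_within)
    moreover have "(\<Gamma> has_vector_derivative \<Lambda> (\<Theta> t) *\<^sub>R f (\<Gamma> (\<Theta> t))) (at (\<Theta> t) within \<Theta> ` (\<Theta> -` S))"
      by (rule has_vector_derivative_within_subset[OF \<Gamma>[OF t]]) auto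
    ultimately have "((\<Gamma> \<circ> \<Theta>) has_vector_derivative (1 / \<Lambda> (\<Theta> t)) *\<^sub>R (\<Lambda> (\<Theta> t) *\<^sub>R f (\<Gamma> (\<Theta> t)))) (at t within \<Theta> -` S)"
      by (intro vector_diff_chain_within)
    then show ?thesis using \<open>\<Lambda> (\<Theta> t) \<noteq> 0\<close> by (simp add: o_def)
  qed
  then show ?thesis using that tc DERIV_isCont by blast
qed

text \<open>The vector has a positive component in direction \<psi>, so its polar angle is \<psi>
  plus an arctangent. An approximate angle accurate to less than a quarter turn thus yields a
  continuous lift by a formula.\<close>

lemma polar_lift:
  assumes c: "x * cos \<psi> + y * sin \<psi> > 0"
  defines "w \<equiv> (y * cos \<psi> - x * sin \<psi>) / (x * cos \<psi> + y * sin \<psi>)"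
  shows "(vector [x, y] :: real^2) = norm (vector [x, y] :: real^2) *\<^sub>R vector [cos (\<psi> + arctan w), sin (\<psi> + arctan w)]"
proof -
  define R I where "R = x * cos \<psi> + y * sin \<psi>" and "I = y * cos \<psi> - x * sin \<psi>"
  have R: "R > 0" using c by (simp add: R_def)
  have x: "x = R * cos \<psi> - I * sin \<psi>" and y: "y = R * sin \<psi> + I * cos \<psi>"
  proof -
    have "R * cos \<psi> - I * sin \<psi> = x * ((sin \<psi>)\<^sup>2 + (cos \<psi>)\<^sup>2)" "R * sin \<psi> + I * cos \<psi> = y * ((sin \<psi>)\<^sup>2 + (cos \<psi>)\<^sup>2)"
      unfolding R_def I_def by algebra+
    then show "x = R * cos \<psi> - I * sin \<psi>" "y = R * sin \<psi> + I * cos \<psi>" by simp_all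
  qed
  have "x\<^sup>2 + y\<^sup>2 = (R\<^sup>2 + I\<^sup>2) * ((sin \<psi>)\<^sup>2 + (cos \<psi>)\<^sup>2)"
    unfolding x y by algebra
  then have "x\<^sup>2 + y\<^sup>2 = R\<^sup>2 * (1 + w\<^sup>2)"
    using R by (simp add: w_def R_def[symmetric] I_def[symmetric] field_simps)
  then have n: "norm (vector [x, y] :: real^2) = R * sqrt (1 + w\<^sup>2)"
    using R by (simp add: norm_vec2 real_sqrt_mult)
  have sq: "sqrt (1 + w\<^sup>2) > 0" by (simp add: add_pos_nonneg)
  have Iw: "I = R * w" using R by (simp add: w_def R_def[symmetric] I_def[symmetric])
  have "R * sqrt (1 + w\<^sup>2) * cos (\<psi> + arctan w) = x" "R * sqrt (1 + w\<^sup>2) * sin (\<psi> + arctan w) = y"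
    unfolding cos_add sin_add cos_arctan sin_arctan x y Iw using sq by (simp_all add: field_simps)
  then show ?thesis unfolding n by (simp add: vec2_cong_iff)
qed

text \<open>Generalized polar coordinates reach every nonzero point: \<open>F\<close> passes from at
  least 1 for small \<rho> to at most 1 for large \<rho>, and where \<open>F \<rho> = 1\<close> the
  rescaled point lies on the unit circle.\<close>

lemma ex_gauge_root:
  fixes A B :: nat and x y :: real
  assumes "A > 0" "B > 0" "x \<noteq> 0 \<or> y \<noteq> 0"
  shows "\<exists>\<rho>>0. \<exists>t. 0 \<le> t \<and> t < 2 * pi \<and> x = \<rho> ^ A * sin t \<and> y = - (\<rho> ^ B * cos t)"
proof -
  define F where "F \<rho> = (x / \<rho> ^ A)\<^sup>2 + (y / \<rho> ^ B)\<^sup>2" for \<rho> :: real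
  define R where "R = 1 + \<bar>x\<bar> + \<bar>y\<bar>"
  have R: "R \<ge> 1" by (simp add: R_def)
  have big: "F (2 * R) \<le> 1"
  proof -
    have "\<bar>z / (2 * R) ^ n\<bar> \<le> 1/2" if "\<bar>z\<bar> \<le> R" "n > 0" for z and n :: nat
    proof -
      have "(2 * R) ^ n \<ge> (2 * R) ^ 1" using that R by (intro power_increasing) auto
      then have "2 * \<bar>z\<bar> \<le> (2 * R) ^ n" using that by simp
      then show ?thesis using R by (simp add: abs_divide power_abs field_simps)
    qed
    then have "(x / (2*R)^A)\<^sup>2 \<le> (1/2)\<^sup>2" "(y / (2*R)^B)\<^sup>2 \<le> (1/2)\<^sup>2"
      using assms R by (auto intro!: abs_le_square_iff[THEN iffD1] simp: R_def)
    moreover have "(1/2)\<^sup>2 = (1/4::real)" by (simp add: power2_eq_square)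
    ultimately show ?thesis unfolding F_def by linarith
  qed
  have "\<exists>\<rho>0. 0 < \<rho>0 \<and> \<rho>0 \<le> 1 \<and> F \<rho>0 \<ge> 1"
  proof -
    have sm: "\<exists>\<rho>0. 0 < \<rho>0 \<and> \<rho>0 \<le> 1 \<and> 1 \<le> (z / \<rho>0 ^ n)\<^sup>2" if "z \<noteq> 0" "n > 0" for z :: real and n :: nat
    proof (intro exI[of _ "min 1 \<bar>z\<bar>"] conjI)
      have "min 1 \<bar>z\<bar> ^ n \<le> min 1 \<bar>z\<bar> ^ 1" using that by (intro power_decreasing) auto
      then have "min 1 \<bar>z\<bar> ^ n \<le> \<bar>z\<bar>" by simp
      then have "1 \<le> \<bar>z / min 1 \<bar>z\<bar> ^ n\<bar>" using that by (simp add: abs_divide power_abs)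
      then show "1 \<le> (z / min 1 \<bar>z\<bar> ^ n)\<^sup>2" using abs_le_square_iff[of 1 "z / min 1 \<bar>z\<bar> ^ n"] by simp
    qed (use that in auto)
    show ?thesis
    proof (cases "x = 0")
      case False
      then obtain \<rho>0 where "0 < \<rho>0" "\<rho>0 \<le> 1" "1 \<le> (x / \<rho>0 ^ A)\<^sup>2" using sm[of x A] assms by auto
      then show ?thesis unfolding F_def by (intro exI[of _ \<rho>0]) (auto intro: add_increasing2)
    next
      case True
      then obtain \<rho>0 where "0 < \<rho>0" "\<rho>0 \<le> 1" "1 \<le> (y / \<rho>0 ^ B)\<^sup>2" using sm[of y B] assms by auto
      then show ?thesis unfolding F_def by (intro exI[of _ \<rho>0]) (auto intro: add_increasing)
    qed
  qed
  then obtain \<rho>0 where \<rho>0: "0 < \<rho>0" "\<rho>0 \<le> 1" "F \<rho>0 \<ge> 1" by auto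
  have "continuous_on {\<rho>0..2*R} F" unfolding F_def using \<rho>0 by (intro continuous_intros) auto
  then obtain \<rho> where \<rho>: "\<rho>0 \<le> \<rho>" "F \<rho> = 1" using IVT2'[of F "2*R" 1 \<rho>0] big \<rho>0 R by auto
  then have "\<rho> > 0" using \<rho>0 by simp
  obtain t where t: "0 \<le> t" "t < 2*pi" "- (y / \<rho> ^ B) = cos t" "x / \<rho> ^ A = sin t"
    using sincos_total_2pi[of "- (y / \<rho> ^ B)" "x / \<rho> ^ A"] \<rho>(2) by (auto simp: F_def add.commute)
  then have "x = \<rho> ^ A * sin t" "y = - (\<rho> ^ B * cos t)" using \<open>\<rho> > 0\<close> by (auto simp: field_simps)
  then show ?thesis using \<open>\<rho> > 0\<close> t by blast
qed

section \<open>Half-turns of a fixed system and their gluing\<close>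

text \<open>\<open>\<Lambda>\<close> and \<open>C\<close> are parameters of the locale so that one
  choice can be shared by all nearby coefficient vectors.\<close>

locale qh_sys = qh +
  fixes a :: "nat \<Rightarrow> real" and \<Lambda> C :: real
  assumes a0: "a 0 < 0" and lnE: "\<And>t. \<bar>ln (E (- a 0) t)\<bar> \<le> \<Lambda>"
    and sc: "scalar_ode (MM (- a 0)) (NN (- a 0)) (om (- a 0)) KK pi C"
    and ok: "scalar_ode.ok KK C a"
begin

abbreviation "\<alpha> \<equiv> - a 0"

sublocale S: scalar_ode "MM (- a 0)" "NN (- a 0)" "om (- a 0)" KK pi C by (rule sc)

abbreviation "r \<equiv> rad KK pi C"
abbreviation "f \<equiv> family_A p q r1 r2 a 1"

definition V :: "real \<Rightarrow> real" where "V s = S.v a s pi"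
definition u :: "real \<Rightarrow> real \<Rightarrow> real" where "u s t = s * exp (S.v a s t)"
definition h :: "real \<Rightarrow> real" where "h s = u s pi"
definition \<Xi> :: "real \<Rightarrow> real \<Rightarrow> real" where
  "\<Xi> x t = x * (MM \<alpha> t * TT a x t / (1 + NN \<alpha> t * TT a x t))"

lemma ok': "S.ok a" using ok .

lemma Tu_TT: "S.Tu a x t = TT a x t" by (simp add: S.Tu_def TT_def)

lemma r_pos: "r > 0" by (rule S.r_pos)

lemma u_0: "0 < s \<Longrightarrow> s < r \<Longrightarrow> u s 0 = s" using S.v_0[OF ok'] by (simp add: u_def)

lemma u_pos: "0 < s \<Longrightarrow> u s t > 0" by (simp add: u_def)

lemma u_le: "0 < s \<Longrightarrow> s < r \<Longrightarrow> t \<in> {0..pi} \<Longrightarrow> u s t \<le> 3 * s"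
proof -
  assume s: "0 < s" "s < r" "t \<in> {0..pi}"
  have "exp (S.v a s t) \<le> exp 1" using S.v_le_1[OF ok', of s t] s by auto
  also have "\<dots> \<le> 3" by (rule exp_le)
  finally show ?thesis using s by (simp add: u_def mult.commute)
qed

lemma h_eq_iff: "0 < s \<Longrightarrow> h s = s \<longleftrightarrow> V s = 0"
  by (simp add: h_def u_def V_def)

lemma h_less_iff: "0 < s \<Longrightarrow> h s < s \<longleftrightarrow> V s < 0"
  by (simp add: h_def u_def V_def)

lemma h_pos: "0 < s \<Longrightarrow> h s > 0" by (simp add: h_def u_pos)

lemma h_strict_mono: "0 < s \<Longrightarrow> s < s' \<Longrightarrow> s' < r/2 \<Longrightarrow> h s < h s'"
  unfolding h_def u_def by (rule S.u_strict_mono[OF ok']) auto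

lemma NT_small: "0 < s \<Longrightarrow> s < r \<Longrightarrow> t \<in> {0..pi} \<Longrightarrow> \<bar>NN \<alpha> t * TT a (u s t) t\<bar> \<le> 1/2"
  using S.NT_small[OF ok', of s t "S.v a s t"] S.v_le_1[OF ok', of s t] by (simp add: Tu_TT u_def)

lemma u_deriv:
  assumes "0 < s" "s < r" "t \<in> {0..pi}"
  shows "(u s has_real_derivative \<Xi> (u s t) t) (at t within {0..pi})"
proof -
  have "(S.v a s has_real_derivative MM \<alpha> t * TT a (u s t) t / (1 + NN \<alpha> t * TT a (u s t) t)) (at t within {0..pi})"
    using S.v_derivative[OF ok', of s t] assms by (simp add: Tu_TT u_def)
  from DERIV_cmult[OF DERIV_chain'[OF this DERIV_exp], of s]
  moreover have "u s = (\<lambda>t. s * exp (S.v a s t))" by (simp add: u_def fun_eq_iff)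
  ultimately show ?thesis by (simp add: \<Xi>_def mult_ac)
qed

lemma u_onto:
  assumes "t \<in> {0..pi}" "0 < x" "x < s1 / 3" "s1 < r"
  shows "\<exists>s. 0 < s \<and> s < s1 \<and> u s t = x"
  using S.u_onto[OF ok' assms] by (simp add: u_def)

lemma MT_pi: "\<Xi> x (t + pi) = \<Xi> x t" "NN \<alpha> (t + pi) * TT a x (t + pi) = NN \<alpha> t * TT a x t"
  by (simp_all add: \<Xi>_def MM_pi NN_pi TT_pi)

lemma lam_pi: "lam a x (t + pi) = lam a x t"
  by (simp add: lam_def Dl_pi rho_pi E_pi NN_pi TT_pi)

lemma shift_int:
  fixes F :: "real \<Rightarrow> 'b"
  assumes "\<And>t. F (t + c) = F t"
  shows "F (t + of_int k * c) = F t"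
proof (induction k rule: int_induct[of _ 0])
  case (step1 i)
  have "t + of_int (i + 1) * c = (t + of_int i * c) + c" by (simp add: algebra_simps)
  then show ?case using assms[of "t + of_int i * c"] step1 by metis
next
  case (step2 i)
  have "t + of_int i * c = (t + of_int (i - 1) * c) + c" by (simp add: algebra_simps)
  then show ?case using assms[of "t + of_int (i - 1) * c"] step2 by metis
qed simp

lemma Xi_shift: "\<Xi> x (t + of_int k * pi) = \<Xi> x t" and
  NT_shift: "NN \<alpha> (t + of_int k * pi) * TT a x (t + of_int k * pi) = NN \<alpha> t * TT a x t"
  using shift_int[of "\<Xi> x" pi, OF MT_pi(1)] shift_int[of "\<lambda>t. NN \<alpha> t * TT a x t" pi, OF MT_pi(2)] by auto

text \<open>\<open>s k\<close> prescribes the value of the radial variable at \<open>t = k * \<pi>\<close>; half-turns are glued along \<open>link\<close>.\<close>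

definition ug :: "(int \<Rightarrow> real) \<Rightarrow> real \<Rightarrow> real" where
  "ug s t = u (s \<lfloor>t / pi\<rfloor>) (t - of_int \<lfloor>t / pi\<rfloor> * pi)"

definition link :: "(int \<Rightarrow> real) \<Rightarrow> int \<Rightarrow> bool" where
  "link s k \<longleftrightarrow> 0 < s k \<and> s k < r \<and> 0 < s (k + 1) \<and> s (k + 1) < r \<and> s (k + 1) = h (s k)"

lemma floor_eq_on:
  assumes "of_int k * pi \<le> t" "t < (of_int k + 1) * pi"
  shows "\<lfloor>t / pi\<rfloor> = k"
  using assms by (intro floor_unique) (auto simp: field_simps)

lemma ug_on:
  assumes "link s k" "t \<in> {of_int k * pi..(of_int k + 1) * pi}"
  shows "ug s t = u (s k) (t - of_int k * pi)"
proof (cases "t = (of_int k + 1) * pi")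
  case True
  have "\<lfloor>t / pi\<rfloor> = k + 1" using True by (intro floor_eq_on) (auto simp: algebra_simps)
  moreover have "t - of_int k * pi = pi" using True by (simp add: algebra_simps)
  ultimately show ?thesis using assms(1) u_0[of "s (k+1)"] True
    by (simp add: ug_def link_def h_def algebra_simps)
next
  case False
  then have "\<lfloor>t / pi\<rfloor> = k" using assms(2) by (intro floor_eq_on) auto
  then show ?thesis by (simp add: ug_def)
qed

lemma ug_deriv_piece:
  assumes k: "link s k" and t: "t \<in> {of_int k * pi..(of_int k + 1) * pi}"
  shows "(ug s has_real_derivative \<Xi> (ug s t) t) (at t within {of_int k * pi..(of_int k + 1) * pi})"
proof -
  define I where "I = {of_int k * pi..(of_int k + 1) * pi}"
  have sub: "(\<lambda>t. t - of_int k * pi) ` I \<subseteq> {0..pi}" by (auto simp: I_def algebra_simps)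
  have t': "t - of_int k * pi \<in> {0..pi}" using t by (auto simp: algebra_simps)
  have s: "0 < s k" "s k < r" using k by (auto simp: link_def)
  have "((\<lambda>t. t - of_int k * pi) has_real_derivative 1) (at t within I)" by (auto intro!: derivative_eq_intros)
  from DERIV_image_chain[OF has_field_derivative_subset[OF u_deriv[OF s t'] sub] this]
  have "((\<lambda>t. u (s k) (t - of_int k * pi)) has_real_derivative \<Xi> (u (s k) (t - of_int k * pi)) (t - of_int k * pi)) (at t within I)"
    by (simp add: o_def)
  moreover have "\<Xi> x (t - of_int k * pi) = \<Xi> x t" for x using Xi_shift[of x "t - of_int k * pi" k] by simp
  ultimately have "((\<lambda>t. u (s k) (t - of_int k * pi)) has_real_derivative \<Xi> (ug s t) t) (at t within I)"
    using ug_on[OF k t] by simp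
  then show ?thesis unfolding I_def[symmetric]
    by (rule has_field_derivative_transform_within[OF _ zero_less_one]) (use t ug_on[OF k] in \<open>auto simp: I_def\<close>)
qed

lemma floor_mem: "t \<in> {of_int \<lfloor>t / pi\<rfloor> * pi..<(of_int \<lfloor>t / pi\<rfloor> + 1) * pi}"
proof -
  have "of_int \<lfloor>t / pi\<rfloor> \<le> t / pi" "t / pi < of_int \<lfloor>t / pi\<rfloor> + 1" by linarith+
  then show ?thesis by (simp only: pos_le_divide_eq[OF pi_gt_zero] pos_divide_less_eq[OF pi_gt_zero] atLeastLessThan_iff)
qed

lemma ug_deriv:
  assumes link: "\<And>k. k \<ge> k0 \<Longrightarrow> link s k" and t: "t \<ge> of_int k0 * pi"
  shows "(ug s has_real_derivative \<Xi> (ug s t) t) (at t within {of_int k0 * pi..})"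
proof -
  define k where "k = \<lfloor>t / pi\<rfloor>"
  have tk: "t \<in> {of_int k * pi..<(of_int k + 1) * pi}" unfolding k_def by (rule floor_mem)
  have "k \<ge> k0" unfolding k_def using t by (simp add: le_floor_iff field_simps)
  have d: "(ug s has_real_derivative \<Xi> (ug s t) t) (at t within {of_int k * pi..(of_int k + 1) * pi})"
    using ug_deriv_piece[OF link[OF \<open>k \<ge> k0\<close>], of t] tk by auto
  consider "t > of_int k * pi" | "t = of_int k * pi" "k = k0" | "t = of_int k * pi" "k > k0"
    using tk \<open>k \<ge> k0\<close> by fastforce
  then show ?thesis
  proof cases
    case 1
    then have "t \<in> interior {of_int k * pi..(of_int k + 1) * pi}" using tk by simp
    then show ?thesis using d by (metis at_within_interior has_field_derivative_at_within)
  next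
    case 2
    have "at t within {of_int k * pi..(of_int k + 1) * pi} = at t within {of_int k0 * pi..}"
      by (rule at_within_nhd[of _ "{..<(of_int k + 1) * pi}"]) (use tk 2 in auto)
    then show ?thesis using d by simp
  next
    case 3
    \<comment> \<open>At a point where two half-turns are glued the one-sided derivatives agree,
      because both are given by the same \<open>pi\<close>-periodic right-hand side; together they
      form the full derivative.\<close>
    have eq: "(of_int (k - 1) + 1) * pi = of_int k * pi" by simp
    have lt: "of_int (k - 1) * pi < of_int k * pi" "of_int k * pi < (of_int k + 1) * pi" by (auto simp: algebra_simps)
    have "(ug s has_real_derivative \<Xi> (ug s t) t) (at t within {of_int (k - 1) * pi..(of_int (k - 1) + 1) * pi})"
      using ug_deriv_piece[OF link, of "k - 1" t] 3 lt by (auto simp: eq)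
    with d have "(ug s has_real_derivative \<Xi> (ug s t) t)
        (at t within ({of_int (k - 1) * pi..of_int k * pi} \<union> {of_int k * pi..(of_int k + 1) * pi}))"
      unfolding eq has_field_derivative_iff unfolding at_within_union by (intro filterlim_sup)
    also have "{of_int (k - 1) * pi..of_int k * pi} \<union> {of_int k * pi..(of_int k + 1) * pi} = {of_int (k - 1) * pi..(of_int k + 1) * pi}"
      by (rule ivl_disj_un_two_touch(4)[OF less_imp_le[OF lt(1)] less_imp_le[OF lt(2)]])
    finally have D: "(ug s has_real_derivative \<Xi> (ug s t) t) (at t within {of_int (k - 1) * pi..(of_int k + 1) * pi})" .
    have "t \<in> interior {of_int (k - 1) * pi..(of_int k + 1) * pi}" using 3 lt by simp
    then show ?thesis using D by (metis at_within_interior has_field_derivative_at_within)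
  qed
qed

definition Gam :: "(int \<Rightarrow> real) \<Rightarrow> real \<Rightarrow> real^2" where "Gam s t = G \<alpha> (ug s t) t"

lemma \<alpha>_pos: "\<alpha> > 0" using a0 by simp

lemma ug_props:
  assumes link: "link s \<lfloor>t / pi\<rfloor>"
  shows "0 < ug s t" "ug s t \<le> 3 * s \<lfloor>t / pi\<rfloor>" "\<bar>NN \<alpha> t * TT a (ug s t) t\<bar> \<le> 1/2"
proof -
  define k where "k = \<lfloor>t / pi\<rfloor>"
  have tk: "t - of_int k * pi \<in> {0..pi}" using floor_mem[of t] by (auto simp: k_def algebra_simps)
  have s: "0 < s k" "s k < r" using link by (auto simp: link_def k_def)
  have eq: "ug s t = u (s k) (t - of_int k * pi)" by (simp add: ug_def k_def)
  show "0 < ug s t" "ug s t \<le> 3 * s \<lfloor>t / pi\<rfloor>"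
    unfolding eq k_def[symmetric] using u_pos[OF s(1)] u_le[OF s tk] by auto
  show "\<bar>NN \<alpha> t * TT a (ug s t) t\<bar> \<le> 1/2"
    using NT_small[OF s tk] NT_shift[of "t - of_int k * pi" k "ug s t"] eq by simp
qed

text \<open>\<rho> stands in the denominator of \<open>lam\<close>, so an upper bound on the radial
  variable keeps \<open>lam\<close> away from zero, as the change of time requires.\<close>

lemma lam_bound:
  assumes "0 < x" "x \<le> X" "\<bar>NN \<alpha> t * TT a x t\<bar> \<le> 1/2"
  shows "lam a x t \<ge> 1 / (exp (real (r1 * r2 - 1) * ((ln X + kk * \<Lambda>) / g)) * (exp \<Lambda> * (3/2)))"
proof -
  define e where "e = r1 * r2 - 1"
  define Z where "Z = E \<alpha> t * (1 + NN \<alpha> t * TT a x t)"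
  have E: "0 < E \<alpha> t" "E \<alpha> t \<le> exp \<Lambda>"
  proof -
    show E: "0 < E \<alpha> t" by (rule E_pos[OF \<alpha>_pos])
    have "ln (E \<alpha> t) \<le> \<Lambda>" using lnE[of t] by simp
    then show "E \<alpha> t \<le> exp \<Lambda>" using E by (metis exp_le_cancel_iff exp_ln)
  qed
  have n: "0 < 1 + NN \<alpha> t * TT a x t" "1 + NN \<alpha> t * TT a x t \<le> 3/2" using assms(3) by linarith+
  have Z: "0 < Z" "Z \<le> exp \<Lambda> * (3/2)" unfolding Z_def using E n
    by (simp, intro mult_mono, auto)
  have "kk \<ge> 0" by (simp add: kk_def)
  then have "- (kk * \<Lambda>) \<le> kk * ln (E \<alpha> t)" using mult_left_mono[of "-\<Lambda>" "ln (E \<alpha> t)" kk] lnE[of t] by simp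
  moreover have "ln x \<le> ln X" using assms by simp
  ultimately have "(ln x - kk * ln (E \<alpha> t)) / g \<le> (ln X + kk * \<Lambda>) / g" using g by (intro divide_right_mono) auto
  then have "real e * ((ln x - kk * ln (E \<alpha> t)) / g) \<le> real e * ((ln X + kk * \<Lambda>) / g)" by (intro mult_left_mono) auto
  then have "rho \<alpha> x t ^ e \<le> exp (real e * ((ln X + kk * \<Lambda>) / g))"
    unfolding rho_def exp_of_nat_mult[symmetric] by (simp only: exp_le_cancel_iff)
  then have "rho \<alpha> x t ^ e * Z \<le> exp (real e * ((ln X + kk * \<Lambda>) / g)) * (exp \<Lambda> * (3/2))"
    using Z rho_pos[of \<alpha> x t] by (intro mult_mono) auto
  moreover have "rho \<alpha> x t ^ e * Z > 0" using Z rho_pos[of \<alpha> x t] by simp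
  ultimately have "1 / (exp (real e * ((ln X + kk * \<Lambda>) / g)) * (exp \<Lambda> * (3/2))) \<le> Dl t / (rho \<alpha> x t ^ e * Z)"
    using Dl_ge_1[of t] by (intro frac_le) auto
  then show ?thesis by (simp add: lam_def e_def Z_def)
qed

lemma lam_continuous:
  assumes "continuous_on S x" "\<And>t. t \<in> S \<Longrightarrow> x t > 0" "\<And>t. t \<in> S \<Longrightarrow> \<bar>NN \<alpha> t * TT a (x t) t\<bar> \<le> 1/2"
  shows "continuous_on S (\<lambda>t. lam a (x t) t)"
proof -
  have E: "E \<alpha> t \<noteq> 0" for t using E_pos[OF \<alpha>_pos, of t] by simp
  have cE: "continuous_on S (E \<alpha>)" unfolding E_def by (intro continuous_intros)
  have "1 + NN \<alpha> t * TT a (x t) t \<noteq> 0" if "t \<in> S" for t using assms(3)[OF that] by (auto simp: abs_le_iff)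
  note nz = this
  have x: "x t \<noteq> 0" if "t \<in> S" for t using assms(2)[OF that] by simp
  have cl: "continuous_on S (\<lambda>t. ln (E \<alpha> t))" using cE E by (intro continuous_on_ln) auto
  have cR: "continuous_on S (\<lambda>t. rho \<alpha> (x t) t)"
    unfolding rho_def using assms(1) x cE E g by (intro continuous_intros ballI) auto
  have cD: "continuous_on S Dl" unfolding Dl_def by (intro continuous_intros)
  have cN: "continuous_on S (NN \<alpha>)" unfolding NN_def using cE E by (intro continuous_intros ballI) auto
  have cT: "continuous_on S (\<lambda>t. TT a (x t) t)"
    unfolding TT_def om_def using assms(1) cE E by (intro continuous_intros ballI) auto
  show ?thesis
    unfolding lam_def using cD cR cE cN cT nz E rho_pos[of \<alpha>, THEN less_imp_neq]
    by (intro continuous_intros ballI) (auto simp: power_eq_0_iff)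
qed

lemma G_deriv_ug:
  assumes "(x has_real_derivative \<Xi> (x t) t) (at t within S)" "x t > 0" "\<bar>NN \<alpha> t * TT a (x t) t\<bar> \<le> 1/2"
  shows "((\<lambda>t. G \<alpha> (x t) t) has_vector_derivative lam a (x t) t *\<^sub>R f (G \<alpha> (x t) t)) (at t within S)"
  by (rule G_deriv) (use assms \<alpha>_pos in \<open>auto simp: \<Xi>_def abs_le_iff\<close>)

text \<open>The height at which the curve with \<open>u = s\<close> crosses the line
  \<open>x = 0\<close>. It is strictly increasing in \<open>s\<close>, so parameters can be compared
  through points of the plane.\<close>

definition Y :: "real \<Rightarrow> real" where "Y s = rho \<alpha> s 0 ^ (r2 + 1)"

lemma Y_pos: "Y s > 0" by (simp add: Y_def rho_pos)

lemma rho_strict_mono: "0 < x \<Longrightarrow> x < y \<Longrightarrow> rho \<alpha> x t < rho \<alpha> y t"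
  using g by (simp add: rho_def divide_strict_right_mono)

lemma Y_strict_mono: "0 < x \<Longrightarrow> x < y \<Longrightarrow> Y x < Y y"
  unfolding Y_def using rho_strict_mono[of x y 0] rho_pos[of \<alpha> x 0] by (intro power_strict_mono) auto

lemma Y_le_iff: "0 < x \<Longrightarrow> 0 < y \<Longrightarrow> Y x \<le> Y y \<longleftrightarrow> x \<le> y"
  using Y_strict_mono[of x y] Y_strict_mono[of y x] by (cases x y rule: linorder_cases) auto

lemma Y_onto:
  assumes "y > 0" shows "\<exists>s>0. Y s = y"
proof -
  define \<rho> where "\<rho> = root (r2 + 1) y"
  have \<rho>: "\<rho> > 0" "\<rho> ^ (r2 + 1) = y" using assms real_root_pow_pos[of "r2 + 1" y] by (auto simp: \<rho>_def)
  have "rho \<alpha> (exp (g * ln \<rho> + kk * ln (E \<alpha> 0))) 0 = \<rho>" using g \<rho> by (simp add: rho_def)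
  then have "Y (exp (g * ln \<rho> + kk * ln (E \<alpha> 0))) = y" using \<rho> by (simp add: Y_def)
  then show ?thesis by (metis exp_gt_zero)
qed

lemma G_0: "G \<alpha> s 0 = vector [0, - Y s]" and G_pi: "G \<alpha> s pi = vector [0, Y s]"
  using rho_pi[of \<alpha> s 0] by (simp_all add: G_def Y_def)

lemma half_solution:
  assumes s: "0 < s" "s < r"
  shows "\<exists>T>0. \<exists>\<psi>. (\<forall>t\<in>{0..T}. (\<psi> has_vector_derivative f (\<psi> t)) (at t within {0..T})) \<and>
     \<psi> 0 = vector [0, - Y s] \<and> \<psi> T = vector [0, Y (h s)]"
proof -
  \<comment> \<open>Clamping the angle extends the time factor from one half-turn to the whole
    line.\<close>
  define cl where "cl t = max 0 (min t pi)" for t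
  have cl: "cl t \<in> {0..pi}" "t \<in> {0..pi} \<Longrightarrow> cl t = t" for t by (auto simp: cl_def)
  have cu: "continuous_on {0..pi} (u s)"
    using u_deriv[OF s] DERIV_continuous continuous_on_eq_continuous_within by blast
  have cl_cont: "continuous_on UNIV cl" unfolding cl_def by (intro continuous_intros)
  define m where "m = 1 / (exp (real (r1 * r2 - 1) * ((ln (3 * s) + kk * \<Lambda>) / g)) * (exp \<Lambda> * (3/2)))"
  have m: "m > 0" by (simp add: m_def)
  have c0: "continuous_on {0..pi} (\<lambda>t. lam a (u s t) t)"
    by (rule lam_continuous[OF cu]) (use u_pos s NT_small in auto)
  have c1: "continuous_on UNIV (\<lambda>t. lam a (u s (cl t)) (cl t))"
    by (rule continuous_on_compose2[OF c0 cl_cont]) (use cl in auto)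
  have c2: "lam a (u s (cl t)) (cl t) \<ge> m" for t
    unfolding m_def using cl(1)[of t] s u_pos u_le NT_small by (intro lam_bound) auto
  have d: "((\<lambda>t. G \<alpha> (u s t) t) has_vector_derivative lam a (u s (cl t)) (cl t) *\<^sub>R f (G \<alpha> (u s t) t)) (at t within {0..pi})"
    if "t \<in> {0..pi}" for t
    using G_deriv_ug[OF u_deriv[OF s that]] u_pos[OF s(1)] NT_small[OF s that] cl(2)[OF that] by simp
  obtain \<tau> \<Theta> :: "real \<Rightarrow> real" where tc0: "\<tau> 0 = 0"
    "\<And>x. (\<tau> has_real_derivative lam a (u s (cl x)) (cl x)) (at x)" "strict_mono \<tau>"
    "\<And>x. \<Theta> (\<tau> x) = x" "\<And>t. \<tau> (\<Theta> t) = t" "strict_mono \<Theta>" "filterlim \<Theta> at_top at_top" "\<And>t. isCont \<Theta> t"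
    "\<And>t. \<Theta> t \<in> {0..pi} \<Longrightarrow> ((\<lambda>t. G \<alpha> (u s (\<Theta> t)) (\<Theta> t)) has_vector_derivative f (G \<alpha> (u s (\<Theta> t)) (\<Theta> t))) (at t within \<Theta> -` {0..pi})"
    by (rule reparametrize[where \<Gamma> = "\<lambda>t. G \<alpha> (u s t) t" and f = f and S = "{0..pi}", OF c1 m c2 d], assumption, rule that, assumption+)
  note tc = tc0(1,3,4,5,9)
  have vim: "\<Theta> -` {0..pi} = {0..\<tau> pi}"
  proof (intro equalityI subsetI)
    fix t assume "t \<in> \<Theta> -` {0..pi}"
    then have "\<tau> 0 \<le> \<tau> (\<Theta> t)" "\<tau> (\<Theta> t) \<le> \<tau> pi" using strict_mono_less_eq[OF tc(2)] by auto
    then show "t \<in> {0..\<tau> pi}" using tc by simp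
  next
    fix t assume "t \<in> {0..\<tau> pi}"
    then have "\<tau> 0 \<le> \<tau> (\<Theta> t)" "\<tau> (\<Theta> t) \<le> \<tau> pi" using tc by auto
    then show "t \<in> \<Theta> -` {0..pi}" using strict_mono_less_eq[OF tc(2)] by auto
  qed
  show ?thesis
  proof (rule exI[of _ "\<tau> pi"], rule conjI[OF _ exI[of _ "\<lambda>t. G \<alpha> (u s (\<Theta> t)) (\<Theta> t)"]], goal_cases)
    case 1
    show ?case using strict_mono_less[OF tc(2), of 0 pi] tc(1) by simp
  next
    case 2
    have "\<Theta> 0 = 0" using tc(3)[of 0] tc(1) by simp
    moreover have "((\<lambda>t. G \<alpha> (u s (\<Theta> t)) (\<Theta> t)) has_vector_derivative f (G \<alpha> (u s (\<Theta> t)) (\<Theta> t))) (at t within {0..\<tau> pi})"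
      if "t \<in> {0..\<tau> pi}" for t
      using tc(5)[of t] that unfolding vim[symmetric] by simp
    ultimately show ?case using tc(3)[of pi] u_0[OF s] by (simp add: G_0 G_pi h_def)
  qed
qed

lemma f_lip: "lip_bdd f" by (rule family_A_lip)

lemma f_0: "f 0 = 0"
proof -
  have "(\<Sum>i\<le>KK. a i * 0 ^ (i * q) * 0 ^ (r1 - i * p)) = (0::real)"
  proof (intro sum.neutral ballI)
    fix i show "a i * 0 ^ (i * q) * 0 ^ (r1 - i * p) = 0" using q_pos r1_pos by (cases "i = 0") auto
  qed
  then show ?thesis using r2_pos by (simp add: family_A_def vec2_cong_iff)
qed

lemma f_minus: "f (- z) = - f z"
proof -
  have "(- x) ^ (i * q) * (- y) ^ (r1 - i * p) = - (x ^ (i * q) * y ^ (r1 - i * p))" if "i \<le> KK" for x y :: real and i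
    using odd idx_le[OF that] by (cases "even i") auto
  then have "(\<Sum>i\<le>KK. a i * (- (z $ 1)) ^ (i * q) * (- (z $ 2)) ^ (r1 - i * p)) = - (\<Sum>i\<le>KK. a i * (z $ 1) ^ (i * q) * (z $ 2) ^ (r1 - i * p))"
    unfolding sum_negf[symmetric] by (intro sum.cong refl) (simp add: mult.assoc)
  then show ?thesis using odd by (simp add: family_A_def vec2_cong_iff)
qed

lemma f_snd: "f z $ 2 = (z $ 1) ^ r2" by (simp add: family_A_def)

lemma follow:
  assumes \<phi>: "\<And>t. (\<phi> has_vector_derivative f (\<phi> t)) (at t)"
    and \<psi>: "\<forall>t\<in>{0..T}. (\<psi> has_vector_derivative f (\<psi> t)) (at t within {0..T})"
    and eq: "t1 \<in> {0..T}" "\<phi> t0 = \<psi> t1" and t: "t \<in> {0..T}"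
  shows "\<phi> (t0 - t1 + t) = \<psi> t"
proof (rule solution_unique[OF f_lip, of 0 T "\<lambda>t. \<phi> (t0 - t1 + t)" \<psi> t1])
  fix t :: real
  have "((\<lambda>u. t0 - t1 + u) has_vector_derivative 1) (at t)" by (auto intro!: derivative_eq_intros)
  from vector_diff_chain_at[OF this \<phi>]
  show "((\<lambda>t. \<phi> (t0 - t1 + t)) has_vector_derivative f (\<phi> (t0 - t1 + t))) (at t within {0..T})"
    by (auto simp: o_def intro: has_vector_derivative_at_within)
qed (use \<psi> eq t in auto)

section \<open>Periodic orbits and fixed points of the half-return map\<close>

text \<open>An extremal crossing of the line \<open>x = 0\<close> is a fixed point of the half-return map: the
  solution through it can grow neither forwards nor backwards.\<close>

lemma extremal_crossing:
  fixes \<phi> :: "real \<Rightarrow> real^2"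
  assumes \<phi>: "\<And>t. (\<phi> has_vector_derivative f (\<phi> t)) (at t)"
    and s: "0 < s" "s < s0 / 3" "s0 < r/2" and t0: "\<phi> t0 = vector [0, - Y s]"
    and ext: "\<And>t. \<phi> t $ 1 = 0 \<Longrightarrow> \<bar>\<phi> t $ 2\<bar> \<le> Y s"
  shows "h s = s" "\<exists>t. \<phi> t = vector [0, Y s]"
proof -
  have sr: "s < r" using s r_pos by simp
  obtain T \<psi> where 1: "T > 0" "\<forall>t\<in>{0..T}. (\<psi> has_vector_derivative f (\<psi> t)) (at t within {0..T})"
     "\<psi> 0 = vector [0, - Y s]" "\<psi> T = vector [0, Y (h s)]"
    using half_solution[OF s(1) sr] by blast
  have "\<phi> (t0 - 0 + T) = \<psi> T" by (rule follow[OF \<phi> 1(2)]) (use 1 t0 in auto)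
  then have fT: "\<phi> (t0 + T) = vector [0, Y (h s)]" using 1 by simp
  \<comment> \<open>Forwards, the next crossing has height \<open>Y (h s)\<close>, which maximality
    bounds by \<open>Y s\<close>.\<close>
  then have "\<bar>Y (h s)\<bar> \<le> Y s" using ext[of "t0 + T"] by simp
  then have le1: "h s \<le> s" using Y_le_iff[OF h_pos[OF s(1)] s(1)] Y_pos[of "h s"] by simp
  \<comment> \<open>Backwards: the preceding half-turn starts at a parameter \<open>s'\<close> with
    \<open>h s' = s\<close>, available because \<open>s < s0 / 3\<close>. The reflected half-turn
    ends at the crossing, so maximality gives \<open>s' \<le> s\<close>, and monotonicity of
    \<open>h\<close> converts this into \<open>s \<le> h s\<close>.\<close>
  obtain s' where s': "0 < s'" "s' < s0" "u s' pi = s" using u_onto[of pi s s0] s r_pos by auto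
  then have hs': "h s' = s" by (simp add: h_def)
  have "s' < r" using s' s r_pos by simp
  then obtain T' \<psi>' where 2: "T' > 0" "\<forall>t\<in>{0..T'}. (\<psi>' has_vector_derivative f (\<psi>' t)) (at t within {0..T'})"
     "\<psi>' 0 = vector [0, - Y s']" "\<psi>' T' = vector [0, Y s]"
    using half_solution[OF s'(1)] hs' by metis
  have 3: "\<forall>t\<in>{0..T'}. ((\<lambda>t. - \<psi>' t) has_vector_derivative f (- \<psi>' t)) (at t within {0..T'})"
    using 2(2) by (auto simp: f_minus intro!: has_vector_derivative_minus)
  have eq: "\<phi> t0 = - \<psi>' T'" unfolding t0 2 by (simp add: vec2_cong_iff)
  have "\<phi> (t0 - T' + 0) = - \<psi>' 0" by (rule follow[OF \<phi> 3 _ eq]) (use 2 in auto)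
  then have "\<phi> (t0 - T') = vector [0, Y s']" using 2 by (simp add: vec2_cong_iff)
  then have "\<bar>Y s'\<bar> \<le> Y s" using ext[of "t0 - T'"] by simp
  then have le2: "s' \<le> s" using Y_le_iff[OF s'(1) s(1)] Y_pos[of s'] by simp
  have "h s' \<le> h s" using le2 h_strict_mono[of s' s] s s' by (cases "s' = s") auto
  then show hs: "h s = s" using le1 hs' by simp
  show "\<exists>t. \<phi> t = vector [0, Y s]" using fT hs by auto
qed

text \<open>The orbit meets \<open>x = 0\<close>, since otherwise \<open>y' = x ^ r2\<close> would
  never vanish although \<open>y\<close> is periodic. By compactness some crossing has largest
  height; if it lies on the positive half-axis, the reflected solution is used instead.\<close>

lemma periodic_orbit_fixed_point:
  assumes per: "periodic_orbit f \<gamma>" and s0: "0 < s0" "s0 < r/2"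
    and small: "\<And>z::real^2. z \<in> \<gamma> \<Longrightarrow> \<bar>z $ 2\<bar> < Y (s0 / 3)"
  shows "\<exists>s. 0 < s \<and> s < s0 \<and> V s = 0 \<and> vector [0, - Y s] \<in> \<gamma>"
proof -
  obtain \<phi> T where \<phi>: "T > 0" "\<And>t. (\<phi> has_vector_derivative f (\<phi> t)) (at t)" "\<And>t. \<phi> (t + T) = \<phi> t" "\<gamma> = range \<phi>"
    using per by (auto simp: periodic_orbit_def)
  have cont: "continuous_on S \<phi>" for S
    using \<phi>(2) has_vector_derivative_continuous by (intro continuous_at_imp_continuous_on) blast
  have "\<gamma> = \<phi> ` {0..T}"
  proof (intro equalityI subsetI)
    fix z assume "z \<in> \<gamma>"
    then obtain t where t: "z = \<phi> t" using \<phi> by auto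
    define k where "k = \<lfloor>t / T\<rfloor>"
    have "\<phi> (t + of_int (- k) * T) = \<phi> t" by (rule shift_int[where F = \<phi> and c = T, OF \<phi>(3)])
    moreover have "t + of_int (- k) * T \<in> {0..T}"
    proof -
      have "of_int \<lfloor>t / T\<rfloor> \<le> t / T" "t / T < of_int \<lfloor>t / T\<rfloor> + 1" by linarith+
      then have "of_int k * T \<le> t" "t < (of_int k + 1) * T"
        unfolding k_def by (simp_all only: pos_le_divide_eq[OF \<phi>(1)] pos_divide_less_eq[OF \<phi>(1)])
      then show ?thesis by (simp add: algebra_simps)
    qed
    ultimately show "z \<in> \<phi> ` {0..T}" using t by (metis imageI)
  qed (use \<phi> in auto)
  then have comp: "compact \<gamma>" using compact_continuous_image[OF cont] by simp
  define K where "K = \<gamma> \<inter> {z. z $ 1 = 0}"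
  have "closed {z::real^2. z $ 1 = 0}"
    by (rule closed_Collect_eq) (auto intro!: continuous_intros)
  then have "compact K" unfolding K_def by (rule compact_Int_closed[OF comp])
  have d1: "((\<lambda>t. \<phi> t $ 2) has_real_derivative (\<phi> t $ 1) ^ r2) (at t)" for t
    using has_vector_derivative_nth[OF \<phi>(2), of 2 t] f_snd by simp
  have "K \<noteq> {}"
  proof
    assume "K = {}"
    then have nz: "\<phi> t $ 1 \<noteq> 0" for t unfolding K_def \<phi>(4) by auto
    obtain z where z: "0 < z" "z < T" "\<phi> T $ 2 - \<phi> 0 $ 2 = (T - 0) * (\<phi> z $ 1) ^ r2"
      using MVT2[of 0 T "\<lambda>t. \<phi> t $ 2" "\<lambda>t. (\<phi> t $ 1) ^ r2"] d1 \<phi>(1) by auto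
    then have "\<phi> z $ 1 = 0" using \<phi>(3)[of 0] \<phi>(1) by simp
    then show False using nz by simp
  qed
  have "continuous_on K (\<lambda>z::real^2. \<bar>z $ 2\<bar>)" by (intro continuous_intros)
  then obtain z :: "real^2" where z: "z \<in> K" "\<And>w::real^2. w \<in> K \<Longrightarrow> \<bar>w $ 2\<bar> \<le> \<bar>z $ 2\<bar>"
    using continuous_attains_sup[OF \<open>compact K\<close> \<open>K \<noteq> {}\<close>] by blast
  have "0 \<notin> \<gamma>" by (rule zero_not_in_periodic_orbit[OF f_lip f_0 per])
  then have "z \<noteq> 0" using z(1) unfolding K_def by auto
  then have z2: "z $ 2 \<noteq> 0" "z $ 1 = 0" using z(1) vec2_cong_iff[of z 0] unfolding K_def by auto
  obtain s where s: "s > 0" "Y s = \<bar>z $ 2\<bar>" using Y_onto[of "\<bar>z $ 2\<bar>"] z2 by auto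
  have "Y s < Y (s0 / 3)" using small[of z] z(1) s by (auto simp: K_def)
  then have s3: "s < s0 / 3" using Y_le_iff[of "s0 / 3" s] s s0 by (auto simp: not_le[symmetric])
  obtain t0 where t0: "\<phi> t0 = z" using z(1) \<phi>(4) by (auto simp: K_def)
  have ext: "\<bar>\<phi> t $ 2\<bar> \<le> Y s" if "\<phi> t $ 1 = 0" for t
    using z(2)[of "\<phi> t"] that s \<phi>(4) by (auto simp: K_def)
  have "h s = s \<and> vector [0, - Y s] \<in> \<gamma>"
  proof (cases "z $ 2 < 0")
    case True
    then have "\<phi> t0 = vector [0, - Y s]" using t0 z2 s by (simp add: vec2_cong_iff)
    then show ?thesis using extremal_crossing(1)[OF \<phi>(2) s(1) s3 s0(2) _ ext] \<phi>(4) by (metis rangeI)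
  next
    case False
    then have e: "- \<phi> t0 = vector [0, - Y s]" using t0 z2 s by (simp add: vec2_cong_iff)
    have d: "((\<lambda>t. - \<phi> t) has_vector_derivative f (- \<phi> t)) (at t)" for t
      using has_vector_derivative_minus[OF \<phi>(2), of t] by (simp add: f_minus)
    have "h s = s" "\<exists>t. - \<phi> t = vector [0, Y s]"
      using extremal_crossing[where \<phi> = "\<lambda>t. - \<phi> t", OF d s(1) s3 s0(2) e] ext by auto
    moreover from this(2) obtain t where "- \<phi> t = vector [0, Y s]" by auto
    then have "\<phi> t = vector [0, - Y s]" by (simp add: vec2_cong_iff neg_equal_iff_equal minus_equation_iff) 
    ultimately show ?thesis using \<phi>(4) by (metis rangeI)
  qed
  then show ?thesis using s s3 s0 h_eq_iff[OF s(1)] by (intro exI[of _ s]) auto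
qed

lemma link_const: "0 < s \<Longrightarrow> s < r \<Longrightarrow> h s = s \<Longrightarrow> link (\<lambda>_. s) k"
  by (simp add: link_def)

lemma ug_const_pi: "ug (\<lambda>_. s) (t + pi) = ug (\<lambda>_. s) t"
proof -
  have "\<lfloor>(t + pi) / pi\<rfloor> = \<lfloor>t / pi\<rfloor> + 1" by (simp add: add_divide_distrib)
  then show ?thesis by (simp add: ug_def algebra_simps)
qed

lemma Gam_const_pi: "Gam (\<lambda>_. s) (t + pi) = - Gam (\<lambda>_. s) t"
  by (simp add: Gam_def ug_const_pi G_def rho_pi vec2_cong_iff)

text \<open>After half a turn the curve is at the opposite point, after a full turn it closes. The
  time factor is \<open>2 * pi\<close>-periodic as well, so \<open>\<tau> (2 * pi)\<close> is a
  period in time.\<close>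

lemma fixed_point_periodic_orbit:
  assumes s: "0 < s" "s < r" "h s = s"
  shows "periodic_orbit f (range (Gam (\<lambda>_. s)))"
proof -
  define U where "U = ug (\<lambda>_. s)"
  have link: "link (\<lambda>_. s) k" for k by (rule link_const[OF s])
  have dU: "(U has_real_derivative \<Xi> (U t) t) (at t)" for t
  proof -
    define k0 where "k0 = \<lfloor>t / pi\<rfloor> - 1"
    have lt: "of_int k0 * pi < t" using floor_mem[of t] by (auto simp: k0_def algebra_simps intro: less_le_trans[rotated])
    have "(U has_real_derivative \<Xi> (U t) t) (at t within {of_int k0 * pi..})"
      unfolding U_def by (rule ug_deriv) (use link lt in auto)
    moreover have "t \<in> interior {of_int k0 * pi..}" using lt by simp
    ultimately show ?thesis by (metis at_within_interior)
  qed
  have U: "0 < U t" "U t \<le> 3 * s" "\<bar>NN \<alpha> t * TT a (U t) t\<bar> \<le> 1/2" for t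
    using ug_props[OF link, of t] unfolding U_def by auto
  define L where "L t = lam a (U t) t" for t
  define m where "m = 1 / (exp (real (r1 * r2 - 1) * ((ln (3 * s) + kk * \<Lambda>) / g)) * (exp \<Lambda> * (3/2)))"
  have m: "m > 0" "\<And>t. L t \<ge> m" unfolding L_def m_def by (simp, rule lam_bound[OF U])
  have cU: "continuous_on UNIV U" using dU by (intro continuous_at_imp_continuous_on) (blast intro: DERIV_isCont)
  have cL: "continuous_on UNIV L" unfolding L_def by (rule lam_continuous[OF cU]) (use U in auto)
  have dG: "(Gam (\<lambda>_. s) has_vector_derivative L t *\<^sub>R f (Gam (\<lambda>_. s) t)) (at t within UNIV)" for t
    unfolding Gam_def L_def U_def[symmetric] by (rule G_deriv_ug) (use dU U in auto)
  obtain \<tau> \<Theta> :: "real \<Rightarrow> real" where tc0: "\<tau> 0 = 0" "\<And>x. (\<tau> has_real_derivative L x) (at x)" "strict_mono \<tau>"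
    "\<And>x. \<Theta> (\<tau> x) = x" "\<And>t. \<tau> (\<Theta> t) = t" "strict_mono \<Theta>" "filterlim \<Theta> at_top at_top" "\<And>t. isCont \<Theta> t"
    "\<And>t. \<Theta> t \<in> UNIV \<Longrightarrow> ((\<lambda>t. Gam (\<lambda>_. s) (\<Theta> t)) has_vector_derivative f (Gam (\<lambda>_. s) (\<Theta> t))) (at t within \<Theta> -` UNIV)"
    by (rule reparametrize[where \<Gamma> = "Gam (\<lambda>_. s)" and f = f and S = UNIV, OF cL m dG], rule that, assumption+)
  have "((\<lambda>t. Gam (\<lambda>_. s) (\<Theta> t)) has_vector_derivative f (Gam (\<lambda>_. s) (\<Theta> t))) (at t)" for t
    using tc0(9)[of t] by simp
  note tc = tc0(1-5) this
  have L_per: "L (t + 2 * pi) = L t" for t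
  proof -
    have e: "t + 2 * pi = t + pi + pi" by simp
    show ?thesis unfolding L_def U_def e lam_pi ug_const_pi ..
  qed
  have G_per: "Gam (\<lambda>_. s) (t + 2 * pi) = Gam (\<lambda>_. s) t" for t
  proof -
    have e: "t + 2 * pi = t + pi + pi" by simp
    show ?thesis unfolding e Gam_const_pi by simp
  qed
  have \<tau>_per: "\<tau> (x + 2 * pi) = \<tau> x + \<tau> (2 * pi)" for x
  proof -
    have "((\<lambda>x. \<tau> (x + 2 * pi) - \<tau> x) has_real_derivative 0) (at x)" for x
    proof -
      have "((\<lambda>x. x + 2 * pi) has_real_derivative 1) (at x)" by (auto intro!: derivative_eq_intros)
      from DERIV_diff[OF DERIV_chain'[OF this tc(2)] tc(2)[of x]] L_per[of x] show ?thesis by simp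
    qed
    then have "\<tau> (x + 2 * pi) - \<tau> x = \<tau> (0 + 2 * pi) - \<tau> 0"
      using DERIV_isconst_all[of "\<lambda>x. \<tau> (x + 2 * pi) - \<tau> x" x 0] by blast
    then show ?thesis using tc(1) by simp
  qed
  have \<Theta>_per: "\<Theta> (t + \<tau> (2 * pi)) = \<Theta> t + 2 * pi" for t
    using \<tau>_per[of "\<Theta> t"] tc(4)[of "\<Theta> t + 2 * pi"] tc(5)[of t] by simp
  show ?thesis
    unfolding periodic_orbit_def
  proof (rule exI[of _ "\<lambda>t. Gam (\<lambda>_. s) (\<Theta> t)"], rule exI[of _ "\<tau> (2 * pi)"], intro conjI allI tc(6))
    show "0 < \<tau> (2 * pi)" using strict_mono_less[OF tc(3), of 0 "2 * pi"] tc(1) by simp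
    show "Gam (\<lambda>_. s) (\<Theta> (t + \<tau> (2 * pi))) = Gam (\<lambda>_. s) (\<Theta> t)" for t by (simp add: \<Theta>_per G_per)
    have th0: "\<Theta> 0 = 0" using tc(4)[of 0] tc(1) by simp
    have "Gam (\<lambda>_. s) pi = - Gam (\<lambda>_. s) 0" using Gam_const_pi[of s 0] by simp
    moreover have "Gam (\<lambda>_. s) 0 $ 2 < 0" using G_0 Y_pos by (simp add: Gam_def)
    ultimately have "Gam (\<lambda>_. s) pi $ 2 \<noteq> Gam (\<lambda>_. s) 0 $ 2" by simp
    then have "Gam (\<lambda>_. s) (\<Theta> (\<tau> pi)) \<noteq> Gam (\<lambda>_. s) (\<Theta> 0)" unfolding tc(4) th0 by auto
    then show "\<exists>t. Gam (\<lambda>_. s) (\<Theta> t) \<noteq> Gam (\<lambda>_. s) (\<Theta> 0)" by blast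
    show "range (Gam (\<lambda>_. s)) = range (\<lambda>t. Gam (\<lambda>_. s) (\<Theta> t))"
      by (auto simp: image_iff) (metis tc(4))
  qed
qed

end

context qh
begin

section \<open>Size estimates independent of the coefficients\<close>

text \<open>\<open>Rb\<close> bounds \<open>rho\<close> from above for \<open>u \<le> 3 * s\<close>,
  and \<open>Yl\<close> bounds \<open>Y s\<close> from below. Both use \<Lambda> only, since
  neighbourhoods are fixed before the perturbed coefficients are known.\<close>

definition Rb :: "real \<Rightarrow> real \<Rightarrow> real" where "Rb \<Lambda> s = exp ((ln (3 * s) + kk * \<Lambda>) / g)"
definition Yl :: "real \<Rightarrow> real \<Rightarrow> real" where "Yl \<Lambda> s = exp ((ln s - kk * \<Lambda>) / g) ^ (r2 + 1)"

lemma Yl_pos: "Yl \<Lambda> s > 0" by (simp add: Yl_def)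

lemma Rb_small:
  assumes "\<epsilon> > 0"
  shows "\<exists>\<delta>>0. \<forall>s. 0 < s \<and> s < \<delta> \<longrightarrow> Rb \<Lambda> s ^ (r1 + 1) + Rb \<Lambda> s ^ (r2 + 1) < \<epsilon>"
proof -
  define \<eta> where "\<eta> = min 1 (\<epsilon> / 2)"
  have \<eta>: "0 < \<eta>" "\<eta> \<le> 1" "2 * \<eta> \<le> \<epsilon>" using assms by (auto simp: \<eta>_def)
  show ?thesis
  proof (intro exI[of _ "exp (g * ln \<eta> - kk * \<Lambda>) / 3"] conjI allI impI)
    fix s assume s: "0 < s \<and> s < exp (g * ln \<eta> - kk * \<Lambda>) / 3"
    then have "ln (3 * s) < ln (exp (g * ln \<eta> - kk * \<Lambda>))" by (subst ln_less_cancel_iff) auto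
    then have "(ln (3 * s) + kk * \<Lambda>) / g < ln \<eta>" using g by (simp add: field_simps)
    then have R: "Rb \<Lambda> s < \<eta>" unfolding Rb_def using \<eta> by (metis exp_less_cancel_iff exp_ln)
    have "Rb \<Lambda> s ^ (n + 1) < \<eta>" for n
    proof -
      have "0 \<le> Rb \<Lambda> s" by (simp add: Rb_def)
      moreover have "Rb \<Lambda> s \<le> 1" using R \<eta> by linarith
      ultimately have "Rb \<Lambda> s ^ (n + 1) \<le> Rb \<Lambda> s ^ 1" by (intro power_decreasing) simp_all
      then show ?thesis using R by simp
    qed
    from this[of r1] this[of r2] show "Rb \<Lambda> s ^ (r1 + 1) + Rb \<Lambda> s ^ (r2 + 1) < \<epsilon>" using \<eta> by linarith
  qed simp
qed

text \<open>Radius of a disc about the origin whose nonzero points all belong to half-turns with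
  parameter below \<open>s\<close>. The division by 3 allows for the change of \<open>u\<close>
  along a half-turn.\<close>

definition cov :: "real \<Rightarrow> real \<Rightarrow> real" where
  "cov \<Lambda> s = min (exp ((ln (s / 3) - kk * \<Lambda>) / g) ^ (r1 + 1)) (exp ((ln (s / 3) - kk * \<Lambda>) / g) ^ (r2 + 1))"

lemma cov_pos: "cov \<Lambda> s > 0" by (simp add: cov_def)

end

context qh_sys
begin

lemma kk_lnE: "- (kk * \<Lambda>) \<le> kk * ln (E \<alpha> t)" "kk * ln (E \<alpha> t) \<le> kk * \<Lambda>"
proof -
  have "kk \<ge> 0" by (simp add: kk_def)
  then show "- (kk * \<Lambda>) \<le> kk * ln (E \<alpha> t)" "kk * ln (E \<alpha> t) \<le> kk * \<Lambda>"
    using mult_left_mono[of "-\<Lambda>" "ln (E \<alpha> t)" kk] mult_left_mono[of "ln (E \<alpha> t)" \<Lambda> kk] lnE[of t] by auto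
qed

lemma rho_le_Rb: "0 < x \<Longrightarrow> x \<le> 3 * s \<Longrightarrow> rho \<alpha> x t \<le> Rb \<Lambda> s"
proof -
  assume x: "0 < x" "x \<le> 3 * s"
  then have "ln x \<le> ln (3 * s)" by simp
  then have "(ln x - kk * ln (E \<alpha> t)) / g \<le> (ln (3 * s) + kk * \<Lambda>) / g"
    using kk_lnE[of t] g by (intro divide_right_mono) auto
  then show ?thesis by (simp add: rho_def Rb_def)
qed

lemma norm_G_le:
  assumes "0 < x" "x \<le> 3 * s"
  shows "norm (G \<alpha> x t) \<le> Rb \<Lambda> s ^ (r1 + 1) + Rb \<Lambda> s ^ (r2 + 1)"
proof -
  have le: "rho \<alpha> x t ^ n * \<bar>y\<bar> \<le> Rb \<Lambda> s ^ n" if "\<bar>y\<bar> \<le> 1" for n y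
  proof -
    have "rho \<alpha> x t ^ n * \<bar>y\<bar> \<le> Rb \<Lambda> s ^ n * 1"
      using rho_le_Rb[OF assms] rho_pos[of \<alpha> x t] that by (intro mult_mono power_mono) (auto simp: Rb_def)
    then show ?thesis by simp
  qed
  have "norm (G \<alpha> x t) \<le> \<bar>rho \<alpha> x t ^ (r1 + 1) * sin t\<bar> + \<bar>- (rho \<alpha> x t ^ (r2 + 1) * cos t)\<bar>"
    using norm_vec2_le[of "G \<alpha> x t"] by (simp only: G_def vector_2)
  also have "\<dots> = rho \<alpha> x t ^ (r1 + 1) * \<bar>sin t\<bar> + rho \<alpha> x t ^ (r2 + 1) * \<bar>cos t\<bar>"
    using rho_pos[of \<alpha> x t] by (simp only: abs_minus_cancel abs_mult power_abs abs_of_pos)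
  also have "\<dots> \<le> Rb \<Lambda> s ^ (r1 + 1) + Rb \<Lambda> s ^ (r2 + 1)" by (intro add_mono le) auto
  finally show ?thesis .
qed

lemma norm_Gam_le:
  assumes "link s \<lfloor>t / pi\<rfloor>"
  shows "norm (Gam s t) \<le> Rb \<Lambda> (s \<lfloor>t / pi\<rfloor>) ^ (r1 + 1) + Rb \<Lambda> (s \<lfloor>t / pi\<rfloor>) ^ (r2 + 1)"
  unfolding Gam_def by (rule norm_G_le) (use ug_props[OF assms] in auto)

lemma Yl_le_Y: "0 < s \<Longrightarrow> Yl \<Lambda> s \<le> Y s"
  unfolding Yl_def Y_def rho_def using kk_lnE[of 0] g by (intro power_mono) (auto intro: divide_right_mono)

lemma polar_cover:
  assumes s1: "0 < s1" "s1 < r" and z: "z \<noteq> 0" "norm z < cov \<Lambda> s1"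
  shows "\<exists>s t. 0 < s \<and> s < s1 \<and> 0 \<le> t \<and> z = G \<alpha> (u s (t - of_int \<lfloor>t / pi\<rfloor> * pi)) t"
proof -
  have "z $ 1 \<noteq> 0 \<or> z $ 2 \<noteq> 0" using z vec2_cong_iff[of z 0] by auto
  then obtain \<rho> t where \<rho>: "\<rho> > 0" and t: "0 \<le> t" "t < 2 * pi" "z $ 1 = \<rho> ^ (r1 + 1) * sin t" "z $ 2 = - (\<rho> ^ (r2 + 1) * cos t)"
    using ex_gauge_root[of "r1 + 1" "r2 + 1" "z $ 1" "z $ 2"] by auto
  define \<rho>1 where "\<rho>1 = exp ((ln (s1 / 3) - kk * \<Lambda>) / g)"
  define x where "x = exp (g * ln \<rho> + kk * ln (E \<alpha> t))"
  have "rho \<alpha> x t = \<rho>" using g \<rho> by (simp add: rho_def x_def)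
  then have zG: "z = G \<alpha> x t" using t by (simp add: G_def vec2_cong_iff)
  \<comment> \<open>Otherwise both weighted radii would be at least \<open>cov \<Lambda> s1\<close>,
    and so would the norm of \<open>z\<close>.\<close>
  have "\<rho> < \<rho>1"
  proof (rule ccontr)
    assume "\<not> \<rho> < \<rho>1"
    then have ge: "\<rho>1 ^ n \<le> \<rho> ^ n" for n by (intro power_mono) (auto simp: \<rho>1_def)
    define c where "c = cov \<Lambda> s1"
    have c: "c > 0" "c \<le> \<rho> ^ (r1 + 1)" "c \<le> \<rho> ^ (r2 + 1)"
    proof -
      show "c > 0" by (simp add: c_def cov_pos)
      have "c \<le> \<rho>1 ^ (r1 + 1)" "c \<le> \<rho>1 ^ (r2 + 1)" unfolding c_def cov_def \<rho>1_def by (rule min.cobounded1, rule min.cobounded2)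
      then show "c \<le> \<rho> ^ (r1 + 1)" "c \<le> \<rho> ^ (r2 + 1)" using ge[of "r1 + 1"] ge[of "r2 + 1"] by linarith+
    qed
    have "c\<^sup>2 = c\<^sup>2 * (sin t)\<^sup>2 + c\<^sup>2 * (cos t)\<^sup>2" by (simp flip: distrib_left)
    also have "\<dots> \<le> (\<rho> ^ (r1 + 1))\<^sup>2 * (sin t)\<^sup>2 + (\<rho> ^ (r2 + 1))\<^sup>2 * (cos t)\<^sup>2"
      using c by (intro add_mono mult_right_mono power_mono) auto
    also have "\<dots> = (norm z)\<^sup>2" unfolding norm_vec2 t(3,4) by (simp add: power_mult_distrib)
    finally have "c\<^sup>2 \<le> (norm z)\<^sup>2" .
    then have "c \<le> norm z" by (rule power2_le_imp_le) simp
    then show False using z by (simp add: c_def)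
  qed
  moreover have "\<rho>1 > 0" by (simp add: \<rho>1_def)
  ultimately have "ln \<rho> < ln \<rho>1" using \<rho> by (metis ln_less_cancel_iff)
  then have "g * ln \<rho> < ln (s1 / 3) - kk * \<Lambda>" using g by (simp add: \<rho>1_def field_simps)
  then have "g * ln \<rho> + kk * ln (E \<alpha> t) < ln (s1 / 3)" using kk_lnE[of t] by linarith
  then have "x < s1 / 3" unfolding x_def using s1 by (metis exp_less_cancel_iff exp_ln divide_pos_pos zero_less_numeral)
  moreover have "t - of_int \<lfloor>t / pi\<rfloor> * pi \<in> {0..pi}" using floor_mem[of t] by (auto simp: algebra_simps)
  ultimately obtain s where "0 < s" "s < s1" "u s (t - of_int \<lfloor>t / pi\<rfloor> * pi) = x"
    using u_onto[of "t - of_int \<lfloor>t / pi\<rfloor> * pi" x s1] s1 by (auto simp: x_def)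
  then show ?thesis using zG t by blast
qed

lemma u_continuous:
  assumes "0 < s1" "s2 < r"
  shows "continuous_on ({s1..s2} \<times> {0..pi}) (\<lambda>(s, t). u s t)"
proof -
  have "(\<lambda>(s, t). (complex_of_real s, t)) ` ({s1..s2} \<times> {0..pi}) \<subseteq> ball 0 r \<times> {0..pi}" using assms by auto
  moreover have "continuous_on ({s1..s2} \<times> {0..pi}) (\<lambda>(s, t). (complex_of_real s, t))"
    unfolding case_prod_unfold by (intro continuous_intros)
  ultimately have "continuous_on ({s1..s2} \<times> {0..pi}) (\<lambda>x. (\<lambda>(s, t). S.sol a s t) ((\<lambda>(s, t). (complex_of_real s, t)) x))"
    by (intro continuous_on_compose2[OF S.sol_continuous[OF ok']])
  then show ?thesis unfolding u_def S.v_def case_prod_unfold by (intro continuous_intros) (simp_all add: case_prod_unfold)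
qed

lemma G_u_continuous:
  assumes "0 < s1" "s2 < r"
  shows "continuous_on ({s1..s2} \<times> {0..pi}) (\<lambda>(s, t). G \<alpha> (u s t) t)"
proof -
  define D where "D = {s1..s2} \<times> {0..pi}"
  have cu: "continuous_on D (\<lambda>x. u (fst x) (snd x))"
    using u_continuous[OF assms] by (simp add: D_def case_prod_unfold)
  have cE: "continuous_on D (\<lambda>x. E \<alpha> (snd x))" unfolding E_def by (intro continuous_intros)
  have nz: "u (fst x) (snd x) \<noteq> 0" "E \<alpha> (snd x) \<noteq> 0" if "x \<in> D" for x
    using that u_pos[of "fst x" "snd x"] E_pos[OF \<alpha>_pos, of "snd x"] assms by (auto simp: D_def)
  have cR: "continuous_on D (\<lambda>x. rho \<alpha> (u (fst x) (snd x)) (snd x))"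
    unfolding rho_def using cu cE nz g by (intro continuous_intros ballI) auto
  have "continuous_on D (\<lambda>x. G \<alpha> (u (fst x) (snd x)) (snd x))"
    unfolding G_def vec2_eq by (intro continuous_intros cR)
  then show ?thesis by (simp add: D_def case_prod_unfold)
qed

lemma Gam_const_eq:
  assumes "0 < s" "s < r" "h s = s"
  shows "range (Gam (\<lambda>_. s)) = {z. \<exists>t\<in>{0..pi}. z = G \<alpha> (u s t) t \<or> z = - G \<alpha> (u s t) t}"
proof -
  have base: "Gam (\<lambda>_. s) t = G \<alpha> (u s t) t" if "t \<in> {0..pi}" for t
    using ug_on[where s = "\<lambda>_. s" and k = 0 and t = t, OF link_const[OF assms]] that by (simp add: Gam_def)
  have "\<exists>t'\<in>{0..pi}. Gam (\<lambda>_. s) t = Gam (\<lambda>_. s) t' \<or> Gam (\<lambda>_. s) t = - Gam (\<lambda>_. s) t'" for t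
  proof -
    have sh: "Gam (\<lambda>_. s) (t + of_int k * pi) = Gam (\<lambda>_. s) t \<or> Gam (\<lambda>_. s) (t + of_int k * pi) = - Gam (\<lambda>_. s) t" for k :: int and t :: real
    proof (induction k rule: int_induct[of _ 0])
      case (step1 i)
      have e: "t + of_int (i + 1) * pi = (t + of_int i * pi) + pi" by (simp add: algebra_simps)
      show ?case unfolding e Gam_const_pi using step1(2) by auto
    next
      case (step2 i)
      have e: "t + of_int i * pi = (t + of_int (i - 1) * pi) + pi" by (simp add: algebra_simps)
      show ?case using step2(2) unfolding e Gam_const_pi by (auto simp: minus_equation_iff)
    qed simp
    have "t - of_int \<lfloor>t / pi\<rfloor> * pi \<in> {0..pi}" using floor_mem[of t] by (auto simp: algebra_simps)
    then show ?thesis using sh[where t = "t - of_int \<lfloor>t / pi\<rfloor> * pi" and k = "\<lfloor>t / pi\<rfloor>"] by (intro bexI[of _ "t - of_int \<lfloor>t / pi\<rfloor> * pi"]) auto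
  qed
  then show ?thesis using base Gam_const_pi[of s] by (auto simp: image_iff) (metis base atLeastAtMost_iff)+
qed

lemma Gam_const_0: "0 < s \<Longrightarrow> s < r \<Longrightarrow> Gam (\<lambda>_. s) 0 = vector [0, - Y s]"
  by (simp add: Gam_def ug_def u_0 G_0)

lemma Gam_const_axis:
  fixes z :: "real^2"
  assumes "0 < s" "s < r" "h s = s" "z \<in> range (Gam (\<lambda>_. s))" "z $ 1 = 0"
  shows "\<bar>z $ 2\<bar> = Y s"
proof -
  obtain t where t: "t \<in> {0..pi}" "z = G \<alpha> (u s t) t \<or> z = - G \<alpha> (u s t) t"
    using assms(4) unfolding Gam_const_eq[OF assms(1-3)] by auto
  then have "rho \<alpha> (u s t) t ^ (r1 + 1) * sin t = 0" using assms(5) by (auto simp: G_def)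
  then have "sin t = 0" using rho_pos[of \<alpha> "u s t" t] by simp
  then have "t = 0 \<or> t = pi" using t(1) sin_gt_zero[of t] by force
  then have "G \<alpha> (u s t) t = vector [0, - Y s] \<or> G \<alpha> (u s t) t = vector [0, Y s]"
    using assms(3) u_0[OF assms(1,2)] G_0[of s] G_pi[of s] by (auto simp: h_def)
  then show ?thesis using t(2) Y_pos[of s] by auto
qed

text \<open>Loops that meet coincide, and a loop determines its parameter because it meets the line
  \<open>x = 0\<close> only at heights of modulus \<open>Y s\<close>.\<close>

lemma loops_inj:
  assumes "0 < s" "s < r" "h s = s" "0 < s'" "s' < r" "h s' = s'"
    and "z \<in> range (Gam (\<lambda>_. s))" "z \<in> range (Gam (\<lambda>_. s'))"
  shows "s = s'"
proof -
  have "range (Gam (\<lambda>_. s)) = range (Gam (\<lambda>_. s'))"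
    using periodic_orbits_disjoint[OF f_lip fixed_point_periodic_orbit[OF assms(1-3)] fixed_point_periodic_orbit[OF assms(4-6)] assms(7,8)] .
  moreover have "vector [0, - Y s] \<in> range (Gam (\<lambda>_. s))" using Gam_const_0[OF assms(1,2)] by (metis rangeI)
  ultimately have "\<bar>(vector [0, - Y s] :: real^2) $ 2\<bar> = Y s'"
    by (intro Gam_const_axis[OF assms(4-6)]) auto
  then have "Y s = Y s'" using Y_pos[of s] by simp
  then show ?thesis using Y_le_iff[OF assms(1,4)] Y_le_iff[OF assms(4,1)] by simp
qed

section \<open>Centers, foci and limit cycles\<close>

text \<open>A disc need not be a union of orbits. Removing the compact ring swept by the loops with
  parameter in \<open>{s3..s2}\<close> leaves an open set whose nonzero points lie on loops with
  parameter below \<open>s3\<close>, and these loops lie entirely in the disc.\<close>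

lemma center_of_zero:
  assumes s1: "0 < s1" "s1 < r" and V0: "\<And>s. 0 < s \<Longrightarrow> s < s1 \<Longrightarrow> V s = 0"
  shows "is_center f 0"
proof -
  have h: "h s = s" if "0 < s" "s < s1" for s using V0[OF that] h_eq_iff[OF that(1)] by simp
  define s2 where "s2 = s1 / 2"
  have s2: "0 < s2" "s2 < s1" "s2 < r" using s1 by (auto simp: s2_def)
  obtain \<delta> where \<delta>: "\<delta> > 0" "\<And>s. 0 < s \<Longrightarrow> s < \<delta> \<Longrightarrow> Rb \<Lambda> s ^ (r1 + 1) + Rb \<Lambda> s ^ (r2 + 1) < cov \<Lambda> s2"
    using Rb_small[OF cov_pos[of \<Lambda> s2], of \<Lambda>] by blast
  define s3 where "s3 = min \<delta> s2"
  have s3: "0 < s3" "s3 \<le> \<delta>" "s3 \<le> s2" using \<delta> s2 by (auto simp: s3_def)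
  define I where "I = (\<lambda>(s, t). G \<alpha> (u s t) t) ` ({s3..s2} \<times> {0..pi})"
  have "compact I" unfolding I_def
    by (intro compact_continuous_image G_u_continuous compact_Times) (use s3 s2 in auto)
  moreover have "compact (uminus ` I)" using \<open>compact I\<close> by (intro compact_continuous_image) (auto intro!: continuous_intros)
  ultimately have cl: "closed (I \<union> uminus ` I)" by (simp add: compact_Un compact_imp_closed)
  define U where "U = ball 0 (cov \<Lambda> s2) - (I \<union> uminus ` I)"
  define Gs where "Gs = {range (Gam (\<lambda>_. s)) | s. 0 < s \<and> s < s3}"
  have I_iff: "z \<in> I \<union> uminus ` I \<longleftrightarrow> (\<exists>s\<in>{s3..s2}. z \<in> range (Gam (\<lambda>_. s)))" for z
  proof -
    have "z \<in> range (Gam (\<lambda>_. s)) \<longleftrightarrow> (\<exists>t\<in>{0..pi}. z = G \<alpha> (u s t) t \<or> z = - G \<alpha> (u s t) t)" if "s \<in> {s3..s2}" for s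
      using Gam_const_eq[of s] h[of s] that s3 s2 by auto
    then show ?thesis by (auto simp: I_def image_iff)
  qed
  have Gs_per: "periodic_orbit f \<gamma>" if "\<gamma> \<in> Gs" for \<gamma>
    using that s3 s2 h by (auto simp: Gs_def intro!: fixed_point_periodic_orbit)
  have "U - {0} = \<Union>Gs"
  proof (intro equalityI subsetI)
    fix z assume z: "z \<in> U - {0}"
    then obtain s t where s: "0 < s" "s < s2" "z = G \<alpha> (u s (t - of_int \<lfloor>t / pi\<rfloor> * pi)) t"
      using polar_cover[OF s2(1,3), of z] by (auto simp: U_def)
    then have zG: "z \<in> range (Gam (\<lambda>_. s))" by (auto simp: Gam_def ug_def)
    then have "s < s3" using z s I_iff[of z] by (force simp: U_def not_le[symmetric])
    then show "z \<in> \<Union>Gs" using zG s by (auto simp: Gs_def)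
  next
    fix z assume "z \<in> \<Union>Gs"
    then obtain s where s: "0 < s" "s < s3" "z \<in> range (Gam (\<lambda>_. s))" by (auto simp: Gs_def)
    have hs: "h s = s" "s < r" using h s s3 s2 by auto
    obtain t where t: "z = Gam (\<lambda>_. s) t" using s by auto
    have "norm z < cov \<Lambda> s2"
      using norm_Gam_le[OF link_const[OF s(1) hs(2,1)], of t] \<delta>(2)[of s] s s3 t by auto
    moreover have "z \<notin> I \<union> uminus ` I"
    proof
      assume "z \<in> I \<union> uminus ` I"
      then obtain s' where s': "s' \<in> {s3..s2}" "z \<in> range (Gam (\<lambda>_. s'))" using I_iff by auto
      have "s = s'" by (rule loops_inj[OF s(1) hs(2,1) _ _ _ s(3) s'(2)]) (use s' s3 s2 h in auto)
      then show False using s s' by auto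
    qed
    moreover have "z \<noteq> 0"
      using zero_not_in_periodic_orbit[OF f_lip f_0 fixed_point_periodic_orbit[OF s(1) hs(2,1)]] s(3) by auto
    ultimately show "z \<in> U - {0}" by (auto simp: U_def)
  qed
  moreover have "0 \<in> U"
  proof -
    have "0 \<notin> I \<union> uminus ` I"
    proof
      assume "0 \<in> I \<union> uminus ` I"
      then obtain s' where s': "s' \<in> {s3..s2}" "0 \<in> range (Gam (\<lambda>_. s'))" using I_iff by auto
      then show False using zero_not_in_periodic_orbit[OF f_lip f_0 fixed_point_periodic_orbit[of s']] s3 s2 h by auto
    qed
    then show ?thesis using cov_pos by (simp add: U_def)
  qed
  moreover have "open U" unfolding U_def using cl by (intro open_Diff) auto
  ultimately show ?thesis unfolding is_center_def using f_0 Gs_per by blast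
qed

text \<open>Any neighbourhood of the loop also contains the loop of a slightly larger parameter, by
  uniform continuity of the half-turns on a compact set.\<close>

lemma no_limit_cycle_of_zero:
  assumes s1: "s1 < r" and V0: "\<And>s. 0 < s \<Longrightarrow> s < s1 \<Longrightarrow> V s = 0" and s: "0 < s" "s < s1"
  shows "\<not> limit_cycle f (range (Gam (\<lambda>_. s)))"
proof
  assume "limit_cycle f (range (Gam (\<lambda>_. s)))"
  then obtain W where W: "open W" "range (Gam (\<lambda>_. s)) \<subseteq> W"
      "\<forall>\<gamma>. periodic_orbit f \<gamma> \<and> \<gamma> \<subseteq> W \<longrightarrow> \<gamma> = range (Gam (\<lambda>_. s))"
    unfolding limit_cycle_def by (elim conjE exE) (rule that)
  have h: "h s = s" if "0 < s" "s < s1" for s using V0[OF that] h_eq_iff[OF that(1)] by simp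
  define s2 where "s2 = (s + s1) / 2"
  have s2: "s < s2" "s2 < s1" using s by (auto simp: s2_def)
  \<comment> \<open>A loop consists of a half-turn and its point reflection; for the symmetric set
    only the half-turn has to be controlled.\<close>
  define W' where "W' = W \<inter> uminus ` W"
  have "uminus ` W = uminus -` W" by (auto simp: image_iff) (metis minus_minus)
  moreover have "open (uminus -` W)" using W(1) by (intro open_vimage) (auto intro!: continuous_intros)
  ultimately have W': "open W'" using W(1) by (auto simp: W'_def)
  define P where "P = (\<lambda>(x, t). G \<alpha> (u x t) t)"
  have cP: "continuous_on ({s..s2} \<times> {0..pi}) P" unfolding P_def by (rule G_u_continuous) (use s s2 s1 in auto)
  have ss: "P (s, t) \<in> W'" if "t \<in> {0..pi}" for t
  proof -
    have "P (s, t) \<in> range (Gam (\<lambda>_. s))" "- P (s, t) \<in> range (Gam (\<lambda>_. s))"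
      using that Gam_const_eq[of s] h s s1 by (auto simp: P_def)
    then have "P (s, t) \<in> W" "- P (s, t) \<in> W" using subsetD[OF W(2)] by simp_all
    then show ?thesis unfolding W'_def by (intro IntI image_eqI[of _ _ "- P (s, t)"]) simp_all
  qed
  have comp: "compact (P ` ({s} \<times> {0..pi}))"
    by (rule compact_continuous_image[OF continuous_on_subset[OF cP]]) (use s2 in \<open>auto simp: compact_Times\<close>)
  obtain e where e: "e > 0" "\<And>x. x \<in> P ` ({s} \<times> {0..pi}) \<Longrightarrow> ball x e \<subseteq> W'"
  proof -
    have "P ` ({s} \<times> {0..pi}) \<subseteq> W'" using ss by auto
    then obtain e where "e > 0" "(\<Union>x\<in>P ` ({s} \<times> {0..pi}). cball x e) \<subseteq> W'"
      using compact_subset_open_imp_cball_epsilon_subset[OF comp W'] by blast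
    then show ?thesis using that[of e] ball_subset_cball by blast
  qed
  have "uniformly_continuous_on ({s..s2} \<times> {0..pi}) P"
    by (rule compact_uniformly_continuous[OF cP]) (simp add: compact_Times)
  then obtain d where d: "d > 0" "\<And>x y. x \<in> {s..s2} \<times> {0..pi} \<Longrightarrow> y \<in> {s..s2} \<times> {0..pi} \<Longrightarrow> dist y x < d \<Longrightarrow> dist (P y) (P x) < e"
    using e(1) unfolding uniformly_continuous_on_def by metis
  define x where "x = min s2 (s + d / 2)"
  have x: "s < x" "x \<le> s2" "x - s < d" using s2 d by (auto simp: x_def)
  have near: "P (x, t) \<in> W'" if "t \<in> {0..pi}" for t
  proof -
    have "dist (P (x, t)) (P (s, t)) < e" by (rule d(2)) (use that x s2 in \<open>auto simp: dist_Pair_Pair dist_real_def\<close>)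
    then show ?thesis using e(2)[of "P (s, t)"] that by (auto simp: dist_commute)
  qed
  have xh: "0 < x" "x < r" "h x = x" using x s s2 s1 h[of x] by auto
  have "range (Gam (\<lambda>_. x)) \<subseteq> W"
  proof
    fix z assume "z \<in> range (Gam (\<lambda>_. x))"
    then obtain t where "t \<in> {0..pi}" "z = P (x, t) \<or> z = - P (x, t)"
      unfolding Gam_const_eq[OF xh] P_def by auto
    then show "z \<in> W" using near[of t] by (auto simp: W'_def)
  qed
  then have "range (Gam (\<lambda>_. x)) = range (Gam (\<lambda>_. s))" using W(3) fixed_point_periodic_orbit[OF xh] by blast
  then have "x = s" using loops_inj[OF xh, of s] s s1 h by (metis less_trans rangeI)
  then show False using x by simp
qed

text \<open>The iterates decrease and stay positive, and a positive limit would be a fixed point of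
  \<open>h\<close>, which \<open>V < 0\<close> excludes.\<close>

lemma h_iterates_tendsto_0:
  assumes s1: "s1 \<le> r" and V: "\<And>s. 0 < s \<Longrightarrow> s < s1 \<Longrightarrow> V s < 0" and s: "0 < s" "s < s1"
  shows "(\<lambda>n. (h ^^ n) s) \<longlonglongrightarrow> 0" "0 < (h ^^ n) s" "(h ^^ n) s \<le> s"
proof -
  have pos: "0 < (h ^^ n) s \<and> (h ^^ n) s \<le> s" for n
  proof (induction n)
    case (Suc n)
    then have "h ((h ^^ n) s) < (h ^^ n) s" using V[of "(h ^^ n) s"] h_less_iff s by auto
    then show ?case using Suc h_pos[of "(h ^^ n) s"] by auto
  qed (use s in auto)
  then show "0 < (h ^^ n) s" "(h ^^ n) s \<le> s" by auto
  have dec: "decseq (\<lambda>n. (h ^^ n) s)"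
  proof (rule decseq_SucI)
    fix n show "(h ^^ Suc n) s \<le> (h ^^ n) s"
      using V[of "(h ^^ n) s"] h_less_iff[of "(h ^^ n) s"] pos[of n] s by auto
  qed
  then obtain L where L: "(\<lambda>n. (h ^^ n) s) \<longlonglongrightarrow> L" "\<And>n. L \<le> (h ^^ n) s"
    using decseq_convergent[OF dec, of 0] pos by (metis less_imp_le)
  have "L \<ge> 0" by (rule LIMSEQ_le_const[OF L(1)]) (use pos less_imp_le in blast)
  moreover have "\<not> L > 0"
  proof
    assume "L > 0"
    have Ls: "L \<le> s" using L(2)[of 0] by simp
    have "continuous_on {-r<..<r} h" unfolding h_def u_def
      by (intro continuous_intros S.v_continuous_s[OF ok']) auto
    then have "isCont h L" using \<open>L > 0\<close> Ls s s1 by (auto simp: continuous_on_eq_continuous_at)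
    then have "(\<lambda>n. h ((h ^^ n) s)) \<longlonglongrightarrow> h L" using L(1) by (rule isCont_tendsto_compose)
    moreover have "(\<lambda>n. (h ^^ Suc n) s) \<longlonglongrightarrow> L" using L(1) by (rule LIMSEQ_Suc)
    ultimately have "h L = L" using LIMSEQ_unique by (simp add: LIMSEQ_unique)
    then show False using V[of L] h_less_iff[of L] \<open>L > 0\<close> Ls s by auto
  qed
  ultimately show "(\<lambda>n. (h ^^ n) s) \<longlonglongrightarrow> 0" using L(1) by (cases "L = 0") auto
qed

text \<open>Consecutive half-turns start at the iterates of \<open>h\<close>, so the curve shrinks
  to the origin, while the change of time makes the angle run through all larger values.\<close>

lemma stable_focus_of_negative:
  assumes s1: "0 < s1" "s1 < r" and V: "\<And>s. 0 < s \<Longrightarrow> s < s1 \<Longrightarrow> V s < 0"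
  shows "stable_focus f 0"
  unfolding stable_focus_def
proof (intro conjI f_0 exI[of _ "ball 0 (cov \<Lambda> s1)"] ballI)
  show "open (ball 0 (cov \<Lambda> s1))" "0 \<in> ball 0 (cov \<Lambda> s1)" using cov_pos by auto
  fix z :: "real^2" assume "z \<in> ball 0 (cov \<Lambda> s1) - {0}"
  then obtain s t where s: "0 < s" "s < s1" and z: "z = G \<alpha> (u s (t - of_int \<lfloor>t / pi\<rfloor> * pi)) t"
    using polar_cover[OF s1, of z] by auto
  define k0 where "k0 = \<lfloor>t / pi\<rfloor>"
  \<comment> \<open>\<open>k0\<close> is the half-turn that contains the starting angle;
    \<open>s\<close> is the parameter at its beginning, not at the starting point itself.\<close>
  define sq where "sq k = (h ^^ nat (k - k0)) s" for k
  note it = h_iterates_tendsto_0[OF less_imp_le[OF s1(2)] V s]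
  have link: "link sq k" if "k \<ge> k0" for k
  proof -
    have "nat (k + 1 - k0) = Suc (nat (k - k0))" using that by simp
    then have e: "sq (k + 1) = h (sq k)" by (simp add: sq_def)
    have p: "0 < sq k" "sq k < r" for k
      using it(2)[of "nat (k - k0)"] it(3)[of "nat (k - k0)"] s s1 by (simp_all add: sq_def)
    show ?thesis unfolding link_def using p[of k] p[of "k + 1"] e by simp
  qed
  have tk: "t \<ge> of_int k0 * pi" using floor_mem[of t] by (auto simp: k0_def)
  have kge: "\<lfloor>x / pi\<rfloor> \<ge> k0" if "x \<ge> t" for x
    using that by (simp add: k0_def floor_mono divide_right_mono)
  have U: "0 < ug sq x" "ug sq x \<le> 3 * s" "\<bar>NN \<alpha> x * TT a (ug sq x) x\<bar> \<le> 1/2" if "x \<ge> t" for x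
    using ug_props[OF link[OF kge[OF that]]] it(3)[of "nat (\<lfloor>x / pi\<rfloor> - k0)"] by (auto simp: sq_def)
  have dU: "(ug sq has_real_derivative \<Xi> (ug sq x) x) (at x within {t..})" if "x \<ge> t" for x
    by (rule has_field_derivative_subset[OF ug_deriv[OF link, of k0]]) (use that tk in auto)
  have cU: "continuous_on {t..} (ug sq)"
    using dU DERIV_continuous continuous_on_eq_continuous_within by (metis atLeast_iff)
  have dG: "(Gam sq has_vector_derivative lam a (ug sq x) x *\<^sub>R f (Gam sq x)) (at x within {t..})" if "x \<ge> t" for x
    unfolding Gam_def[abs_def] by (rule G_deriv_ug[OF dU[OF that]]) (use U[OF that] in auto)
  define \<Gamma> where "\<Gamma> x = Gam sq (x + t)" for x
  define L where "L x = lam a (ug sq (max x 0 + t)) (max x 0 + t)" for x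
  define m where "m = 1 / (exp (real (r1 * r2 - 1) * ((ln (3 * s) + kk * \<Lambda>) / g)) * (exp \<Lambda> * (3/2)))"
  have m: "m > 0" by (simp add: m_def)
  have mL: "L x \<ge> m" for x unfolding L_def m_def by (rule lam_bound) (use U[of "max x 0 + t"] in auto)
  have cl: "continuous_on {t..} (\<lambda>x. lam a (ug sq x) x)" by (rule lam_continuous[OF cU]) (use U in auto)
  have cL: "continuous_on UNIV L" unfolding L_def
    by (rule continuous_on_compose2[OF cl]) (auto intro!: continuous_intros)
  have d\<Gamma>: "(\<Gamma> has_vector_derivative L x *\<^sub>R f (\<Gamma> x)) (at x within {0..})" if "x \<in> {0..}" for x
  proof -
    have "((\<lambda>x. x + t) has_vector_derivative 1) (at x within {0..})" by (auto intro!: derivative_eq_intros)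
    moreover have "(Gam sq has_vector_derivative L x *\<^sub>R f (\<Gamma> x)) (at (x + t) within (\<lambda>x. x + t) ` {0..})"
      unfolding L_def \<Gamma>_def using dG[of "x + t"] that
      by (auto intro!: has_vector_derivative_within_subset[of _ _ _ "{t..}"])
    ultimately have "((Gam sq \<circ> (\<lambda>x. x + t)) has_vector_derivative 1 *\<^sub>R (L x *\<^sub>R f (\<Gamma> x))) (at x within {0..})"
      by (rule vector_diff_chain_within)
    then show ?thesis by (simp add: o_def \<Gamma>_def[abs_def])
  qed
  obtain \<tau> \<Theta> :: "real \<Rightarrow> real" where tc: "\<tau> 0 = 0" "\<And>x. (\<tau> has_real_derivative L x) (at x)" "strict_mono \<tau>"
    "\<And>x. \<Theta> (\<tau> x) = x" "\<And>t. \<tau> (\<Theta> t) = t" "strict_mono \<Theta>" "filterlim \<Theta> at_top at_top" "\<And>t. isCont \<Theta> t"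
    "\<And>t. \<Theta> t \<in> {0..} \<Longrightarrow> ((\<lambda>t. \<Gamma> (\<Theta> t)) has_vector_derivative f (\<Gamma> (\<Theta> t))) (at t within \<Theta> -` {0..})"
    by (rule reparametrize[where \<Gamma> = \<Gamma> and f = f and S = "{0..}", OF cL m mL d\<Gamma>], assumption, rule that, assumption+)
  have T0: "\<Theta> 0 = 0" using tc(4)[of 0] tc(1) by simp
  have Tnn: "\<Theta> x \<ge> 0 \<longleftrightarrow> x \<ge> 0" for x using strict_mono_less_eq[OF tc(6), of 0 x] T0 by simp
  then have vim: "\<Theta> -` {0..} = {0..}" by auto
  define \<phi> where "\<phi> x = \<Gamma> (\<Theta> x)" for x
  have \<phi>d: "(\<phi> has_vector_derivative f (\<phi> x)) (at x within {0..})" if "x \<ge> 0" for x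
    unfolding \<phi>_def[abs_def] using tc(9)[of x] that Tnn by (simp add: vim)
  define R where "R x = rho \<alpha> (ug sq x) x" for x
  have Rpos: "R x > 0" for x by (simp add: R_def rho_pos)
  have \<phi>xy: "\<phi> x = vector [R (\<Theta> x + t) ^ (r1 + 1) * sin (\<Theta> x + t), - (R (\<Theta> x + t) ^ (r2 + 1) * cos (\<Theta> x + t))]" for x
    by (simp add: \<phi>_def \<Gamma>_def Gam_def G_def R_def)
  \<comment> \<open>The angle of the vector with components sine and minus cosine. The unequal
    powers of \<rho> tilt the true direction by less than a quarter turn, which the arctangent
    accounts for.\<close>
  define \<psi> where "\<psi> x = \<Theta> x + t - pi / 2" for x
  have cs: "cos (\<psi> x) = sin (\<Theta> x + t)" "sin (\<psi> x) = - cos (\<Theta> x + t)" for x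
    by (simp_all add: \<psi>_def cos_diff sin_diff)
  define w where "w x = (\<phi> x $ 2 * cos (\<psi> x) - \<phi> x $ 1 * sin (\<psi> x)) / (\<phi> x $ 1 * cos (\<psi> x) + \<phi> x $ 2 * sin (\<psi> x))" for x
  have pos: "\<phi> x $ 1 * cos (\<psi> x) + \<phi> x $ 2 * sin (\<psi> x) > 0" for x
  proof -
    define y where "y = \<Theta> x + t"
    have "\<phi> x $ 1 * cos (\<psi> x) + \<phi> x $ 2 * sin (\<psi> x) = R y ^ (r1 + 1) * (sin y)\<^sup>2 + R y ^ (r2 + 1) * (cos y)\<^sup>2"
      unfolding \<phi>xy cs y_def[symmetric] by (simp add: power2_eq_square)
    moreover have "sin y \<noteq> 0 \<or> cos y \<noteq> 0" by (metis sin_cos_squared_add power_zero_numeral add_0 zero_neq_one)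
    moreover have "R y ^ (r1 + 1) > 0" "R y ^ (r2 + 1) > 0" using Rpos by simp_all
    ultimately show ?thesis
      by (metis add_nonneg_pos add_pos_nonneg less_imp_le mult_nonneg_nonneg mult_pos_pos zero_le_power2 zero_less_power2)
  qed
  have "spirals_towards f 0 \<phi>"
    unfolding spirals_towards_def
  proof (intro conjI allI impI exI[of _ "\<lambda>x. \<psi> x + arctan (w x)"] \<phi>d)
    show "\<phi> x \<noteq> 0" for x using pos[of x] by auto
    show "\<phi> x - 0 = norm (\<phi> x - 0) *\<^sub>R vector [cos (\<psi> x + arctan (w x)), sin (\<psi> x + arctan (w x))]" for x
    proof -
      have "\<phi> x = vector [\<phi> x $ 1, \<phi> x $ 2]" by (simp add: vec2_cong_iff)
      then show ?thesis using polar_lift[OF pos[of x]] unfolding w_def by simp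
    qed
    have c\<psi>: "continuous_on {0..} \<psi>" unfolding \<psi>_def[abs_def] using tc(8)
      by (intro continuous_intros continuous_at_imp_continuous_on) auto
    have c\<phi>: "continuous_on {0..} \<phi>"
      using \<phi>d has_vector_derivative_continuous continuous_on_eq_continuous_within by (metis atLeast_iff)
    have "continuous_on {0..} w"
    proof -
      have nz: "\<phi> x $ 1 * cos (\<psi> x) + \<phi> x $ 2 * sin (\<psi> x) \<noteq> 0" for x using pos[of x] by simp
      show ?thesis unfolding w_def[abs_def] by (intro continuous_on_divide continuous_intros c\<psi> c\<phi> ballI nz)
    qed
    then show "continuous_on {0..} (\<lambda>x. \<psi> x + arctan (w x))" by (intro continuous_intros c\<psi>)
    have "filterlim (\<lambda>x. \<Theta> x + (t - pi)) at_top at_top"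
      using filterlim_tendsto_add_at_top[OF tendsto_const[of "t - pi"] tc(7)] by (simp add: add.commute)
    moreover have "\<forall>\<^sub>F x in at_top. \<Theta> x + (t - pi) \<le> \<psi> x + arctan (w x)"
    proof (rule always_eventually, rule allI)
      fix x show "\<Theta> x + (t - pi) \<le> \<psi> x + arctan (w x)"
        using arctan_lbound[of "w x"] by (simp add: \<psi>_def)
    qed
    ultimately have "filterlim (\<lambda>x. \<psi> x + arctan (w x)) at_top at_top" by (rule filterlim_at_top_mono)
    then show "filterlim (\<lambda>x. \<psi> x + arctan (w x)) at_infinity at_top" by (rule filterlim_at_top_imp_at_infinity)
    show "(\<phi> \<longlongrightarrow> 0) at_top"
    proof (rule tendstoI)
      fix e :: real assume "e > 0"
      then obtain \<delta> where \<delta>: "\<delta> > 0" "\<And>s. 0 < s \<Longrightarrow> s < \<delta> \<Longrightarrow> Rb \<Lambda> s ^ (r1 + 1) + Rb \<Lambda> s ^ (r2 + 1) < e"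
        using Rb_small[of e \<Lambda>] by blast
      obtain n0 where n0: "\<And>n. n \<ge> n0 \<Longrightarrow> (h ^^ n) s < \<delta>"
        using order_tendstoD(2)[OF it(1) \<delta>(1)] by (auto simp: eventually_sequentially)
      have "\<forall>\<^sub>F x in at_top. \<Theta> x \<ge> max 0 (of_int (k0 + int n0) * pi - t)"
        using tc(7) by (simp only: filterlim_at_top)
      then show "\<forall>\<^sub>F x in at_top. dist (\<phi> x) 0 < e"
      proof eventually_elim
        case (elim x)
        define y where "y = \<Theta> x + t"
        have y: "y \<ge> t" "y \<ge> of_int (k0 + int n0) * pi" using elim by (auto simp: y_def)
        have "\<lfloor>y / pi\<rfloor> \<ge> k0 + int n0" using y(2) by (simp only: le_floor_iff pos_le_divide_eq[OF pi_gt_zero])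
        then have "nat (\<lfloor>y / pi\<rfloor> - k0) \<ge> n0" by simp
        then have "sq \<lfloor>y / pi\<rfloor> < \<delta>" unfolding sq_def by (rule n0)
        moreover have "0 < sq \<lfloor>y / pi\<rfloor>" unfolding sq_def by (rule it(2))
        ultimately have "norm (Gam sq y) < e" using norm_Gam_le[OF link[OF kge[OF y(1)]]] \<delta>(2) by force
        then show ?case by (simp add: \<phi>_def \<Gamma>_def y_def)
      qed
    qed
  qed
  moreover have "\<phi> 0 = z" using z by (simp add: \<phi>_def \<Gamma>_def T0 Gam_def ug_def sq_def k0_def)
  ultimately show "\<exists>\<phi>. \<phi> 0 = z \<and> spirals_towards f 0 \<phi>" by blast
qed

end

text \<open>Indices below \<open>k\<close> drop out, and those above carry at least one extra factor
  \<open>s\<close>, which makes them small uniformly in the factors \<phi>.\<close>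

lemma leading_sign:
  fixes \<alpha> :: "nat \<Rightarrow> real"
  assumes k: "k \<le> N" and zero: "\<And>l. l < k \<Longrightarrow> \<alpha> l = 0" and nz: "\<alpha> k \<noteq> 0" and c: "c > 0"
  shows "\<exists>\<delta>>0. \<forall>\<phi> s. 0 < s \<and> s < \<delta> \<and> (\<forall>l\<le>N. c \<le> \<phi> l \<and> \<phi> l \<le> P) \<longrightarrow>
     \<alpha> k * (\<Sum>l\<le>N. \<alpha> l * s ^ (2*l+1) * \<phi> l) > 0"
proof -
  define D where "D = (\<Sum>l\<le>N. \<bar>\<alpha> l\<bar>) * (\<bar>P\<bar> + 1) + 1"
  have D: "D > 0" by (auto simp: D_def intro!: add_nonneg_pos mult_nonneg_nonneg sum_nonneg)
  define \<delta> where "\<delta> = min 1 (\<bar>\<alpha> k\<bar> * c / D)"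
  show ?thesis
  proof (intro exI[of _ \<delta>] conjI allI impI)
    show "\<delta> > 0" using D nz c by (simp add: \<delta>_def)
    fix \<phi> s assume asm: "0 < s \<and> s < \<delta> \<and> (\<forall>l\<le>N. c \<le> \<phi> l \<and> \<phi> l \<le> P)"
    then have s: "0 < s" "s < 1" "s < \<bar>\<alpha> k\<bar> * c / D" by (auto simp: \<delta>_def)
    have sD: "s * D < \<bar>\<alpha> k\<bar> * c" using s(3) D by (simp add: pos_less_divide_eq)
    have ph: "c \<le> \<phi> l" "\<bar>\<phi> l\<bar> \<le> \<bar>P\<bar> + 1" if "l \<le> N" for l
    proof -
      have *: "c \<le> \<phi> l" "\<phi> l \<le> P" using asm that by auto
      show "c \<le> \<phi> l" by (rule *)
      show "\<bar>\<phi> l\<bar> \<le> \<bar>P\<bar> + 1" using * c by linarith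
    qed
    define R where "R = (\<Sum>l\<in>{..N} - {k}. \<alpha> l * s ^ (2*l+1) * \<phi> l)"
    have "\<bar>R\<bar> \<le> (\<Sum>l\<in>{..N} - {k}. \<bar>\<alpha> l\<bar> * (s ^ (2*k+1) * s) * (\<bar>P\<bar> + 1))"
      unfolding R_def
    proof (rule order_trans[OF sum_abs sum_mono])
      fix l assume l: "l \<in> {..N} - {k}"
      show "\<bar>\<alpha> l * s ^ (2*l+1) * \<phi> l\<bar> \<le> \<bar>\<alpha> l\<bar> * (s ^ (2*k+1) * s) * (\<bar>P\<bar> + 1)"
      proof (cases "l < k")
        case True
        then show ?thesis using zero by simp
      next
        case False
        then have "s ^ (2*l+1) \<le> s ^ (2*k+2)" using l s by (intro power_decreasing) auto
        then have "s ^ (2*l+1) \<le> s ^ (2*k+1) * s" by (simp add: mult_ac)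
        then show ?thesis unfolding abs_mult using ph(2)[of l] l s
          by (intro mult_mono) (auto simp: power_abs)
      qed
    qed
    also have "\<dots> \<le> (\<Sum>l\<le>N. \<bar>\<alpha> l\<bar> * (s ^ (2*k+1) * s) * (\<bar>P\<bar> + 1))"
      using s by (intro sum_mono2) (auto intro!: mult_nonneg_nonneg)
    also have "\<dots> = s ^ (2*k+1) * (s * ((\<Sum>l\<le>N. \<bar>\<alpha> l\<bar>) * (\<bar>P\<bar> + 1)))"
      by (simp only: sum_distrib_left sum_distrib_right mult_ac)
    also have "\<dots> \<le> s ^ (2*k+1) * (s * D)" using s by (intro mult_left_mono) (auto simp: D_def)
    also have "\<dots> < s ^ (2*k+1) * (\<bar>\<alpha> k\<bar> * c)" using sD s by (intro mult_strict_left_mono) auto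
    finally have R: "\<bar>R\<bar> < s ^ (2*k+1) * (\<bar>\<alpha> k\<bar> * c)" .
    have "(\<Sum>l\<le>N. \<alpha> l * s ^ (2*l+1) * \<phi> l) = \<alpha> k * s ^ (2*k+1) * \<phi> k + R"
      unfolding R_def using k by (intro sum.remove) auto
    then have "\<alpha> k * (\<Sum>l\<le>N. \<alpha> l * s ^ (2*l+1) * \<phi> l) = \<alpha> k * \<alpha> k * s ^ (2*k+1) * \<phi> k + \<alpha> k * R"
      by (simp add: algebra_simps)
    moreover have "\<alpha> k * \<alpha> k * s ^ (2*k+1) * \<phi> k \<ge> \<bar>\<alpha> k\<bar> * (s ^ (2*k+1) * (\<bar>\<alpha> k\<bar> * c))"
    proof -
      have "\<bar>\<alpha> k\<bar> * (s ^ (2*k+1) * (\<bar>\<alpha> k\<bar> * c)) = \<alpha> k * \<alpha> k * s ^ (2*k+1) * c"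
        by (simp add: abs_mult_self_eq mult_ac flip: abs_mult)
      also have "\<dots> \<le> \<alpha> k * \<alpha> k * s ^ (2*k+1) * \<phi> k"
        using ph(1)[OF k] s by (intro mult_left_mono) auto
      finally show ?thesis .
    qed
    moreover have "\<bar>\<alpha> k * R\<bar> < \<bar>\<alpha> k\<bar> * (s ^ (2*k+1) * (\<bar>\<alpha> k\<bar> * c))"
      unfolding abs_mult[of "\<alpha> k" R] using R nz by (intro mult_strict_left_mono) auto
    ultimately show "\<alpha> k * (\<Sum>l\<le>N. \<alpha> l * s ^ (2*l+1) * \<phi> l) > 0" by linarith
  qed
qed

context qh_sys
begin

text \<open>The reflected function \<open>x (pi - t)\<close> solves the same equation and agrees
  with \<open>x\<close> at \<open>pi / 2\<close>; by uniqueness the values at \<open>pi\<close> and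
  0 coincide.\<close>

lemma sol_even_zero:
  assumes a': "S.ok a'" "\<forall>i\<in>{1..KK}. odd i \<longrightarrow> a' i = 0" and s: "norm s < r"
  shows "S.sol a' s pi = 0"
proof -
  have T: "S.T a' s v (pi - t) = - S.T a' s v t" for v t
    unfolding S.T_def sum_negf[symmetric]
  proof (intro sum.cong refl)
    fix i assume i: "i \<in> {1..KK}"
    show "of_real (a' i) * s ^ i * exp (of_nat i * v) * of_real (om \<alpha> i (pi - t)) =
      - (of_real (a' i) * s ^ i * exp (of_nat i * v) * complex_of_real (om \<alpha> i t))"
      using a'(2) i om_reflect_even[of i \<alpha> t] by (cases "even i") auto
  qed
  have F: "S.F a' s v (pi - t) = - S.F a' s v t" for v t
    unfolding S.F_def T MM_reflect NN_reflect by simp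
  define x where "x = S.sol a' s"
  have dx: "(x has_vector_derivative S.F a' s (x t) t) (at t within {0..pi})" if "t \<in> {0..pi}" for t
    unfolding x_def by (rule S.sol_derivative[OF a'(1) s that])
  have dy: "((\<lambda>t. x (pi - t)) has_vector_derivative S.F a' s (x (pi - t)) t) (at t within {0..pi})" if "t \<in> {0..pi}" for t
  proof -
    have img: "(\<lambda>t. pi - t) ` {0..pi} = {0..pi}" by (auto simp: image_iff intro!: bexI[of _ "pi - _"])
    have "((\<lambda>t. pi - t) has_vector_derivative -1) (at t within {0..pi})" by (auto intro!: derivative_eq_intros)
    moreover have "(x has_vector_derivative S.F a' s (x (pi - t)) (pi - t)) (at (pi - t) within (\<lambda>t. pi - t) ` {0..pi})"
      unfolding img by (rule dx) (use that in auto)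
    ultimately have "((x \<circ> (\<lambda>t. pi - t)) has_vector_derivative (-1) *\<^sub>R S.F a' s (x (pi - t)) (pi - t)) (at t within {0..pi})"
      by (rule vector_diff_chain_within)
    then show ?thesis by (simp add: o_def F)
  qed
  have "x pi = x (pi - pi)"
  proof (rule ode_unique[OF dx dy, where ?t0.0 = "pi / 2" and L = "4 * C * S.Q * norm s"])
    fix t :: real assume t: "t \<in> {0..pi}"
    then have "pi - t \<in> {0..pi}" by auto
    then show "norm (S.F a' s (x t) t - S.F a' s (x (pi - t)) t) \<le> 4 * C * S.Q * norm s * norm (x t - x (pi - t))"
      unfolding x_def using t s by (intro S.F_lip a' S.sol_le_1) auto
  qed auto
  then show ?thesis using S.sol_0[OF a'(1) s] by (simp add: x_def)
qed

end

context qh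
begin

section \<open>Uniform constants for neighbouring coefficient vectors\<close>

lemma wallis_pos:
  assumes "even m"
  shows "integral {0..pi} (\<lambda>t. sin t ^ n * cos t ^ m) > 0"
proof -
  have cont: "continuous_on {0..pi} (\<lambda>t::real. sin t ^ n * cos t ^ m)" by (intro continuous_intros)
  have nn: "sin t ^ n * cos t ^ m \<ge> 0" if "t \<in> {0..pi}" for t :: real
    using that assms sin_ge_zero[of t] by (intro mult_nonneg_nonneg zero_le_power zero_le_even_power) auto
  have "integral {0..pi} (\<lambda>t. sin t ^ n * cos t ^ m) \<noteq> 0"
  proof
    assume "integral {0..pi} (\<lambda>t. sin t ^ n * cos t ^ m) = 0"
    then have "sin (pi/4) ^ n * cos (pi/4) ^ m = (0::real)"
      using integral_eq_0_iff[OF cont pi_gt_zero nn] by simp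
    then show False by (simp add: sin_45 cos_45)
  qed
  moreover have "integral {0..pi} (\<lambda>t. sin t ^ n * cos t ^ m) \<ge> 0"
    by (rule integral_nonneg) (use cont nn in \<open>auto intro: integrable_continuous_interval\<close>)
  ultimately show ?thesis by simp
qed

text \<open>The range of \<open>-a 0\<close> and a bound on the other coefficients control
  everything. The lower bound \<open>c\<close> keeps the first-order effects of all odd coefficients
  away from zero simultaneously.\<close>

lemma uniform_constants:
  assumes \<alpha>: "0 < \<alpha>1" "\<alpha>1 \<le> \<alpha>2"
  obtains \<Lambda> C c where "c > 0" "C \<ge> 1"
    "\<And>a. - a 0 \<in> {\<alpha>1..\<alpha>2} \<Longrightarrow> (\<And>i. i \<in> {1..KK} \<Longrightarrow> \<bar>a i\<bar> \<le> B) \<Longrightarrow>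
       qh_sys p q r1 r2 g a \<Lambda> C \<and>
       (\<forall>j\<in>{1..KK}. odd j \<longrightarrow> c \<le> scalar_ode.cj (MM (- a 0)) (om (- a 0)) pi j)"
proof -
  obtain \<Lambda> where \<Lambda>: "\<Lambda> \<ge> 0" "\<And>\<alpha> t. \<alpha> \<in> {\<alpha>1..\<alpha>2} \<Longrightarrow> \<bar>ln (E \<alpha> t)\<bar> \<le> \<Lambda>" using E_bounds[OF \<alpha>] by blast
  define C where "C = 1 + \<bar>B\<bar> + exp (kk * KK * \<Lambda>) + real g * real (r1 + r2 + 2) * exp (2 * \<Lambda>) + real (r2 + 1) * exp \<Lambda>"
  have pos: "exp (kk * KK * \<Lambda>) \<ge> 0" "real g * real (r1 + r2 + 2) * exp (2 * \<Lambda>) \<ge> 0" "real (r2 + 1) * exp \<Lambda> \<ge> 0" by auto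
  have C: "C \<ge> 1" "B \<le> C" "exp (kk * KK * \<Lambda>) \<le> C" "real g * real (r1 + r2 + 2) * exp (2 * \<Lambda>) \<le> C" "real (r2 + 1) * exp \<Lambda> \<le> C"
    using pos unfolding C_def by linarith+
  \<comment> \<open>Bounds below what remains of \<open>MM * om\<close> after the powers of sine and
    cosine: \<open>g\<close>, the inverse square of \<open>E\<close>, a further negative power of
    \<open>E\<close>, and \<open>Dl \<ge> 1\<close>.\<close>
  define c0 where "c0 = real g * exp (- 2 * \<Lambda>) * exp (- (kk * KK * \<Lambda>))"
  have c0: "c0 > 0" using g by (simp add: c0_def)
  define J where "J j = c0 * integral {0..pi} (\<lambda>t. sin t ^ (r2 + j * q) * cos t ^ (r1 - j * p))" for j
  \<comment> \<open>The element 1 keeps the minimum meaningful when no odd index is in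
    range.\<close>
  define c where "c = Min (insert 1 (J ` {j\<in>{1..KK}. odd j}))"
  have ev: "even (r1 - j * p)" if "j \<le> KK" "odd j" for j using that odd idx_le[OF that(1)] by simp
  have "c > 0" unfolding c_def
    using wallis_pos ev c0 by (subst Min_gr_iff) (auto simp: J_def)
  have kk0: "kk \<ge> 0" by (simp add: kk_def)
  have main: "qh_sys p q r1 r2 g a \<Lambda> C \<and>
       (\<forall>j\<in>{1..KK}. odd j \<longrightarrow> c \<le> scalar_ode.cj (MM (- a 0)) (om (- a 0)) pi j)"
    if a0: "- a 0 \<in> {\<alpha>1..\<alpha>2}" and ai: "\<And>i. i \<in> {1..KK} \<Longrightarrow> \<bar>a i\<bar> \<le> B" for a
  proof -
    define \<alpha> where "\<alpha> = - a 0"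
    have \<alpha>p: "\<alpha> > 0" using a0 \<alpha> by (auto simp: \<alpha>_def)
    have Ep: "E \<alpha> t > 0" for t by (rule E_pos[OF \<alpha>p])
    have lnE: "\<bar>ln (E \<alpha> t)\<bar> \<le> \<Lambda>" for t using \<Lambda>(2) a0 by (simp add: \<alpha>_def)
    have Einv: "inverse (E \<alpha> t) = exp (- ln (E \<alpha> t))" for t using Ep[of t] by (simp add: exp_minus)
    have Ei: "inverse (E \<alpha> t) \<le> exp \<Lambda>" "exp (- \<Lambda>) \<le> inverse (E \<alpha> t)" for t
      unfolding Einv using lnE[of t] by (auto simp: abs_le_iff)
    have klow: "- (kk * KK * \<Lambda>) \<le> - (kk * i) * ln (E \<alpha> t)" "- (kk * i) * ln (E \<alpha> t) \<le> kk * KK * \<Lambda>" if "i \<le> KK" for i t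
    proof -
      have "\<bar>(kk * i) * ln (E \<alpha> t)\<bar> \<le> (kk * KK) * \<Lambda>"
        unfolding abs_mult using kk0 lnE[of t] that by (intro mult_mono) (auto intro: mult_left_mono)
      then show "- (kk * KK * \<Lambda>) \<le> - (kk * i) * ln (E \<alpha> t)" "- (kk * i) * ln (E \<alpha> t) \<le> kk * KK * \<Lambda>" by auto
    qed
    have cE: "continuous_on S (E \<alpha>)" for S unfolding E_def by (intro continuous_intros)
    have Enz: "E \<alpha> t \<noteq> 0" for t using Ep[of t] by simp
    have sc: "scalar_ode (MM \<alpha>) (NN \<alpha>) (om \<alpha>) KK pi C"
    proof
      show "continuous_on {0..pi} (MM \<alpha>)" unfolding MM_def Dl_def using cE Enz by (intro continuous_intros ballI) auto
      show "continuous_on {0..pi} (NN \<alpha>)" unfolding NN_def using cE Enz by (intro continuous_intros ballI) auto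
      show "continuous_on {0..pi} (om \<alpha> i)" for i unfolding om_def using cE Enz by (intro continuous_intros ballI) auto
      show "\<bar>MM \<alpha> t\<bar> \<le> C" for t
      proof -
        have "\<bar>MM \<alpha> t\<bar> = real g * \<bar>sin t\<bar> ^ r2 * Dl t * (inverse (E \<alpha> t))\<^sup>2"
          using Dl_ge_1[of t] by (simp add: MM_def abs_mult power_abs divide_inverse power_inverse abs_of_pos)
        also have "\<dots> \<le> real g * 1 * real (r1 + r2 + 2) * (exp \<Lambda>)\<^sup>2"
          using Dl_le[of t] Dl_ge_1[of t] Ei[of t] Ep[of t] by (intro mult_mono power_mono) (auto intro: power_le_one)
        also have "\<dots> = real g * real (r1 + r2 + 2) * exp (2 * \<Lambda>)" by (simp add: exp_double)
        finally show ?thesis using C by simp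
      qed
      show "\<bar>NN \<alpha> t\<bar> \<le> C" for t
      proof -
        have "\<bar>NN \<alpha> t\<bar> = real (r2 + 1) * \<bar>cos t\<bar> * inverse (E \<alpha> t)"
          using Ep[of t] by (simp add: NN_def abs_mult divide_inverse)
        also have "\<dots> \<le> real (r2 + 1) * 1 * exp \<Lambda>" using Ei[of t] Ep[of t] by (intro mult_mono) auto
        finally show ?thesis using C by simp
      qed
      show "\<bar>om \<alpha> i t\<bar> \<le> C" if "i \<in> {1..KK}" for i t
      proof -
        have "\<bar>om \<alpha> i t\<bar> = \<bar>sin t\<bar> ^ (i * q) * \<bar>cos t\<bar> ^ (r1 - i * p) * exp (- (kk * i) * ln (E \<alpha> t))"
          by (simp add: om_def abs_mult power_abs)
        also have "\<dots> \<le> 1 * 1 * exp (kk * KK * \<Lambda>)"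
          using klow(2)[of i t] that by (intro mult_mono) (auto intro: power_le_one)
        finally show ?thesis using C by simp
      qed
    qed (use C in auto)
    interpret X: scalar_ode "MM \<alpha>" "NN \<alpha>" "om \<alpha>" KK pi C by (rule sc)
    have "qh_sys p q r1 r2 g a \<Lambda> C"
      unfolding qh_sys_def qh_sys_axioms_def
    proof (intro conjI allI qh_axioms)
      show "a 0 < 0" using \<alpha>p by (simp add: \<alpha>_def)
      show "\<bar>ln (E (- a 0) t)\<bar> \<le> \<Lambda>" for t using lnE by (simp add: \<alpha>_def)
      show "scalar_ode (MM (- a 0)) (NN (- a 0)) (om (- a 0)) KK pi C" using sc by (simp add: \<alpha>_def)
      show "scalar_ode.ok KK C a" unfolding X.ok_def using ai C by (meson order_trans)
    qed
    moreover have "c \<le> X.cj j" if j: "j \<in> {1..KK}" "odd j" for j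
    proof -
      have "c \<le> J j" unfolding c_def using j by (intro Min_le) auto
      also have "J j = integral {0..pi} (\<lambda>t. c0 * (sin t ^ (r2 + j * q) * cos t ^ (r1 - j * p)))"
        by (simp add: J_def)
      also have "\<dots> \<le> integral {0..pi} (\<lambda>t. MM \<alpha> t * om \<alpha> j t)"
      proof (rule integral_le)
        show "(\<lambda>t. c0 * (sin t ^ (r2 + j * q) * cos t ^ (r1 - j * p))) integrable_on {0..pi}"
          by (intro integrable_continuous_interval continuous_intros)
        show "(\<lambda>t. MM \<alpha> t * om \<alpha> j t) integrable_on {0..pi}"
          by (intro integrable_continuous_interval continuous_intros X.contM X.contw)
        fix t :: real assume t: "t \<in> {0..pi}"
        define W where "W = sin t ^ (r2 + j * q) * cos t ^ (r1 - j * p)"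
        have W: "W \<ge> 0" unfolding W_def using t j ev[of j] sin_ge_zero[of t]
          by (intro mult_nonneg_nonneg zero_le_power zero_le_even_power) auto
        have "MM \<alpha> t * om \<alpha> j t = real g * (inverse (E \<alpha> t))\<^sup>2 * exp (- (kk * j) * ln (E \<alpha> t)) * Dl t * W"
          using ev[of j] j by (simp add: MM_def om_def W_def power_add divide_inverse power_inverse mult_ac)
        also have "\<dots> \<ge> real g * (exp (- \<Lambda>))\<^sup>2 * exp (- (kk * KK * \<Lambda>)) * 1 * W"
          using Ei(2)[of t] klow(1)[of j t] j W Dl_ge_1[of t]
          by (intro mult_right_mono mult_mono power_mono) auto
        also have "real g * (exp (- \<Lambda>))\<^sup>2 * exp (- (kk * KK * \<Lambda>)) * 1 * W = c0 * W"
          by (simp add: c0_def flip: exp_double)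
        finally show "c0 * (sin t ^ (r2 + j * q) * cos t ^ (r1 - j * p)) \<le> MM \<alpha> t * om \<alpha> j t" by (simp add: W_def)
      qed
      finally show ?thesis by (simp add: X.cj_def)
    qed
    ultimately show ?thesis by (simp add: \<alpha>_def)
  qed
  show ?thesis by (rule that[OF \<open>c > 0\<close> C(1) main])
qed

abbreviation "fld a \<equiv> family_A p q r1 r2 a 1"

definition near :: "(nat \<Rightarrow> real) \<Rightarrow> real \<Rightarrow> (nat \<Rightarrow> real) \<Rightarrow> bool" where
  "near a \<epsilon> a' \<longleftrightarrow> (\<forall>i\<le>KK. \<bar>a' i - a i\<bar> < \<epsilon>)"

lemma near_constants:
  assumes "a 0 < 0"
  obtains \<epsilon> \<Lambda> C c where "\<epsilon> > 0" "c > 0" "C \<ge> 1"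
    "\<And>a'. near a \<epsilon> a' \<Longrightarrow> qh_sys p q r1 r2 g a' \<Lambda> C"
    "\<And>a' j. near a \<epsilon> a' \<Longrightarrow> j \<in> {1..KK} \<Longrightarrow> odd j \<Longrightarrow> c \<le> scalar_ode.cj (MM (- a' 0)) (om (- a' 0)) pi j"
proof -
  \<comment> \<open>Half of \<open>\<bar>a 0\<bar>\<close>, so that \<open>-a' 0\<close> stays
    between \<open>\<epsilon>\<close> and \<open>3 * \<epsilon>\<close> for all nearby
    vectors.\<close>
  define \<epsilon> where "\<epsilon> = - a 0 / 2"
  have \<epsilon>: "\<epsilon> > 0" using assms by (simp add: \<epsilon>_def)
  define B where "B = (\<Sum>i\<le>KK. \<bar>a i\<bar>) + \<epsilon>"
  obtain \<Lambda> C c where cst: "c > 0" "C \<ge> 1"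
    "\<And>a'. - a' 0 \<in> {\<epsilon>..3 * \<epsilon>} \<Longrightarrow> (\<And>i. i \<in> {1..KK} \<Longrightarrow> \<bar>a' i\<bar> \<le> B) \<Longrightarrow>
       qh_sys p q r1 r2 g a' \<Lambda> C \<and> (\<forall>j\<in>{1..KK}. odd j \<longrightarrow> c \<le> scalar_ode.cj (MM (- a' 0)) (om (- a' 0)) pi j)"
  proof -
    have e3: "\<epsilon> \<le> 3 * \<epsilon>" using \<epsilon> by simp
    show ?thesis
    proof (rule uniform_constants[OF \<epsilon> e3, where B = B], goal_cases)
      case (1 \<Lambda> C c)
      show ?case by (rule that[where \<Lambda> = \<Lambda> and C = C and c = c, OF 1(1,2)]) (rule 1(3))
    qed
  qed
  have "- a' 0 \<in> {\<epsilon>..3 * \<epsilon>}" "\<bar>a' i\<bar> \<le> B" if "near a \<epsilon> a'" "i \<in> {1..KK}" for a' i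
  proof -
    have "\<bar>a' 0 - a 0\<bar> < \<epsilon>" "\<bar>a' i - a i\<bar> < \<epsilon>" using that by (auto simp: near_def)
    moreover have "\<bar>a i\<bar> \<le> (\<Sum>i\<le>KK. \<bar>a i\<bar>)" using that by (intro member_le_sum) auto
    ultimately show "- a' 0 \<in> {\<epsilon>..3 * \<epsilon>}" "\<bar>a' i\<bar> \<le> B" by (auto simp: \<epsilon>_def B_def)
  qed
  moreover have "- a' 0 \<in> {\<epsilon>..3 * \<epsilon>}" if "near a \<epsilon> a'" for a'
  proof -
    have "\<bar>a' 0 - a 0\<bar> < \<epsilon>" using that by (auto simp: near_def)
    then show ?thesis by (auto simp: \<epsilon>_def)
  qed
  ultimately show ?thesis using that[OF \<epsilon> cst(1,2)] cst(3) by blast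
qed

lemma near_self: "\<epsilon> > 0 \<Longrightarrow> near a \<epsilon> a" by (simp add: near_def)

lemma near_mono: "near a \<epsilon> a' \<Longrightarrow> \<epsilon> \<le> \<epsilon>' \<Longrightarrow> near a \<epsilon>' a'" by (auto simp: near_def intro: less_le_trans)

text \<open>One disc for all nearby vectors. Small periodic orbits inject into the zeros of
  \<open>V\<close>, which are few if some odd coefficient is nonzero. If all odd coefficients
  vanish, every small parameter yields a loop and no orbit is isolated.\<close>

lemma orbit_bound:
  assumes "a 0 < 0"
  shows "\<exists>\<epsilon>>0. \<exists>\<delta>>0. \<forall>a'. near a \<epsilon> a' \<longrightarrow>
     ((\<exists>i\<in>{1..KK}. odd i \<and> a' i \<noteq> 0) \<longrightarrow>
        finite {\<gamma>. periodic_orbit (fld a') \<gamma> \<and> \<gamma> \<subseteq> ball 0 \<delta>} \<and>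
        card {\<gamma>. periodic_orbit (fld a') \<gamma> \<and> \<gamma> \<subseteq> ball 0 \<delta>} \<le> (KK - 1) div 2) \<and>
     ((\<forall>i\<in>{1..KK}. odd i \<longrightarrow> a' i = 0) \<longrightarrow> (\<forall>\<gamma>. limit_cycle (fld a') \<gamma> \<longrightarrow> \<not> \<gamma> \<subseteq> ball 0 \<delta>))"
proof -
  obtain \<epsilon> \<Lambda> C c where cst: "\<epsilon> > 0" "c > 0" "C \<ge> 1"
    "\<And>a'. near a \<epsilon> a' \<Longrightarrow> qh_sys p q r1 r2 g a' \<Lambda> C"
    "\<And>a' j. near a \<epsilon> a' \<Longrightarrow> j \<in> {1..KK} \<Longrightarrow> odd j \<Longrightarrow> c \<le> scalar_ode.cj (MM (- a' 0)) (om (- a' 0)) pi j"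
    by (rule near_constants[where a = a, OF assms], rule that, assumption+)
  obtain s1 where s1: "0 < s1" "s1 \<le> rad KK pi C" and cnt: "\<forall>M N w a Z. scalar_ode M N w KK pi C \<longrightarrow>
     (\<forall>a s. scalar_ode.ok KK C a \<longrightarrow> (\<forall>i\<in>{1..KK}. odd i \<longrightarrow> a i = 0) \<longrightarrow> norm s < rad KK pi C \<longrightarrow> scalar_ode.sol M N w KK a s pi = 0) \<longrightarrow>
     (\<forall>j\<in>{1..KK}. odd j \<longrightarrow> c \<le> scalar_ode.cj M w pi j) \<longrightarrow>
     scalar_ode.ok KK C a \<longrightarrow> (\<exists>i\<in>{1..KK}. odd i \<and> a i \<noteq> 0) \<longrightarrow>
     finite Z \<longrightarrow> Z \<subseteq> {0<..<s1} \<longrightarrow> (\<forall>s\<in>Z. scalar_ode.v M N w KK a s pi = 0) \<longrightarrow> card Z \<le> (KK - 1) div 2"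
    using scalar_ode_zero_count[OF pi_gt_zero cst(3,2), of KK] by (elim exE conjE) (rule that)
  \<comment> \<open>A third of \<open>s1\<close> lies below half of the radius, where
    \<open>h\<close> is known to be monotone.\<close>
  define s0 where "s0 = s1 / 3"
  define \<delta> where "\<delta> = Yl \<Lambda> (s0 / 3)"
  have "((\<exists>i\<in>{1..KK}. odd i \<and> a' i \<noteq> 0) \<longrightarrow>
        finite {\<gamma>. periodic_orbit (fld a') \<gamma> \<and> \<gamma> \<subseteq> ball 0 \<delta>} \<and>
        card {\<gamma>. periodic_orbit (fld a') \<gamma> \<and> \<gamma> \<subseteq> ball 0 \<delta>} \<le> (KK - 1) div 2) \<and>
     ((\<forall>i\<in>{1..KK}. odd i \<longrightarrow> a' i = 0) \<longrightarrow> (\<forall>\<gamma>. limit_cycle (fld a') \<gamma> \<longrightarrow> \<not> \<gamma> \<subseteq> ball 0 \<delta>))"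
    if nr: "near a \<epsilon> a'" for a'
  proof -
    interpret Q: qh_sys p q r1 r2 g a' \<Lambda> C by (rule cst(4)[OF nr])
    have s0: "0 < s0" "s0 < Q.r / 2" "s0 < s1" "s0 < Q.r" using s1 by (auto simp: s0_def)
    have fp: "\<exists>s. 0 < s \<and> s < s0 \<and> Q.V s = 0 \<and> vector [0, - Q.Y s] \<in> \<gamma>"
      if "periodic_orbit (fld a') \<gamma>" "\<gamma> \<subseteq> ball 0 \<delta>" for \<gamma>
    proof (rule Q.periodic_orbit_fixed_point[OF that(1) s0(1,2)])
      fix z assume "z \<in> \<gamma>"
      then have "norm z < \<delta>" using that(2) by auto
      then show "\<bar>z $ 2\<bar> < Q.Y (s0 / 3)"
        using component_le_norm_cart[of z 2] Q.Yl_le_Y[of "s0 / 3"] s0 by (simp add: \<delta>_def)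
    qed
    have A: "finite {\<gamma>. periodic_orbit (fld a') \<gamma> \<and> \<gamma> \<subseteq> ball 0 \<delta>} \<and>
        card {\<gamma>. periodic_orbit (fld a') \<gamma> \<and> \<gamma> \<subseteq> ball 0 \<delta>} \<le> (KK - 1) div 2"
      if ex: "\<exists>i\<in>{1..KK}. odd i \<and> a' i \<noteq> 0"
    proof -
      define P where "P = {\<gamma>. periodic_orbit (fld a') \<gamma> \<and> \<gamma> \<subseteq> ball 0 \<delta>}"
      define Zs where "Zs = {s. 0 < s \<and> s < s0 \<and> Q.V s = 0}"
      have card: "card Z \<le> (KK - 1) div 2" if "finite Z" "Z \<subseteq> Zs" for Z
      proof (rule cnt[rule_format, OF Q.sc _ _ Q.ok' ex that(1)])
        show "Z \<subseteq> {0<..<s1}" using that(2) s0 by (auto simp: Zs_def)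
        show "Q.S.v a' s pi = 0" if "s \<in> Z" for s using that \<open>Z \<subseteq> Zs\<close> by (auto simp: Zs_def Q.V_def)
        show "Q.S.sol b s pi = 0"
          if "Q.S.ok b" "\<And>i. i \<in> {1..KK} \<Longrightarrow> odd i \<Longrightarrow> b i = 0" "norm s < rad KK pi C" for b s
          using Q.sol_even_zero[of b s] that by blast
        show "c \<le> Q.S.cj j" if "j \<in> {1..KK}" "odd j" for j by (rule cst(5)[OF nr that])
      qed
      \<comment> \<open>The zero count speaks about finite sets; applied to arbitrary finite subsets
        it also yields finiteness.\<close>
      have finZ: "finite Zs"
      proof (rule ccontr)
        assume "infinite Zs"
        then obtain Z where "Z \<subseteq> Zs" "finite Z" "card Z = Suc ((KK - 1) div 2)"
          using infinite_arbitrarily_large by blast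
        then show False using card[of Z] by simp
      qed
      have "\<forall>\<gamma>\<in>P. \<exists>s. s \<in> Zs \<and> vector [0, - Q.Y s] \<in> \<gamma>" using fp by (auto simp: P_def Zs_def)
      then obtain \<sigma> where \<sigma>: "\<And>\<gamma>. \<gamma> \<in> P \<Longrightarrow> \<sigma> \<gamma> \<in> Zs \<and> vector [0, - Q.Y (\<sigma> \<gamma>)] \<in> \<gamma>" by metis
      have inj: "inj_on \<sigma> P"
      proof (rule inj_onI)
        fix \<gamma> \<gamma>' assume "\<gamma> \<in> P" "\<gamma>' \<in> P" "\<sigma> \<gamma> = \<sigma> \<gamma>'"
        then show "\<gamma> = \<gamma>'" using \<sigma>[of \<gamma>] \<sigma>[of \<gamma>'] periodic_orbits_disjoint[OF Q.f_lip, of \<gamma> \<gamma>'] by (auto simp: P_def)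
      qed
      have img: "\<sigma> ` P \<subseteq> Zs" using \<sigma> by auto
      have "finite P" using inj img finZ by (meson finite_imageD finite_subset)
      moreover have "card P \<le> card Zs" by (rule card_inj_on_le[OF inj img finZ])
      ultimately show ?thesis using card[OF finZ] by (auto simp: P_def[symmetric])
    qed
    have B: "\<not> \<gamma> \<subseteq> ball 0 \<delta>"
      if ev: "\<forall>i\<in>{1..KK}. odd i \<longrightarrow> a' i = 0" and lc: "limit_cycle (fld a') \<gamma>" for \<gamma>
    proof
        assume "\<gamma> \<subseteq> ball 0 \<delta>"
        moreover have per: "periodic_orbit (fld a') \<gamma>" using lc by (simp add: limit_cycle_def)
        ultimately obtain s where s: "0 < s" "s < s0" "vector [0, - Q.Y s] \<in> \<gamma>" using fp by blast
        have V0: "Q.V s = 0" if "0 < s" "s < s0" for s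
          using Q.sol_even_zero[OF Q.ok' ev, of "of_real s"] that s0 by (simp add: Q.V_def Q.S.v_def)
        have hs: "Q.h s = s" "s < Q.r" using V0[OF s(1,2)] Q.h_eq_iff s s0 by auto
        have "range (Q.Gam (\<lambda>_. s)) = \<gamma>"
          by (rule periodic_orbits_disjoint[OF Q.f_lip Q.fixed_point_periodic_orbit[OF s(1) hs(2,1)] per _ s(3)])
             (use Q.Gam_const_0[OF s(1) hs(2)] in \<open>metis rangeI\<close>)
        then show False using Q.no_limit_cycle_of_zero[OF s0(4) V0 s(1,2)] lc by simp
    qed
    show ?thesis using A B by simp
  qed
  moreover have "\<delta> > 0" by (simp add: \<delta>_def Yl_pos)
  ultimately show ?thesis using cst(1) by (intro exI[of _ \<epsilon>] conjI exI[of _ \<delta>]) simp_all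
qed

lemma center_if:
  assumes "a 0 < 0" and ev: "\<forall>i\<in>{1..KK}. odd i \<longrightarrow> a i = 0"
  shows "is_center (fld a) 0"
proof -
  obtain \<epsilon> \<Lambda> C c where cst: "\<epsilon> > 0" "c > 0" "C \<ge> 1"
    "\<And>a'. near a \<epsilon> a' \<Longrightarrow> qh_sys p q r1 r2 g a' \<Lambda> C"
    "\<And>a' j. near a \<epsilon> a' \<Longrightarrow> j \<in> {1..KK} \<Longrightarrow> odd j \<Longrightarrow> c \<le> scalar_ode.cj (MM (- a' 0)) (om (- a' 0)) pi j"
    by (rule near_constants[where a = a, OF assms(1)], rule that, assumption+)
  interpret Q: qh_sys p q r1 r2 g a \<Lambda> C by (rule cst(4)[OF near_self[OF cst(1)]])
  show ?thesis
  proof (rule Q.center_of_zero[of "Q.r / 2"])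
    show "Q.V s = 0" if "0 < s" "s < Q.r / 2" for s
      using Q.sol_even_zero[OF Q.ok' ev, of "of_real s"] that Q.r_pos by (simp add: Q.V_def Q.S.v_def)
  qed (use Q.r_pos in auto)
qed

lemma V_expansion:
  assumes q: "qh_sys p q r1 r2 g a \<Lambda> C" and K: "KK \<ge> 1" and c: "c > 0"
    "\<And>j. j \<in> {1..KK} \<Longrightarrow> odd j \<Longrightarrow> c \<le> scalar_ode.cj (MM (- a 0)) (om (- a 0)) pi j"
  shows "\<exists>\<phi>. (\<forall>l\<le>(KK-1) div 2. \<forall>s. 0 < s \<and> s < rad KK pi C * c / (4 * lipc KK pi C) \<longrightarrow> c / 2 \<le> \<phi> l s \<and> \<phi> l s \<le> lipc KK pi C) \<and>
     (\<forall>s. 0 < s \<and> s < rad KK pi C * c / (4 * lipc KK pi C) \<longrightarrow>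
        qh_sys.V p q r1 r2 g a s = (\<Sum>l\<le>(KK-1) div 2. a (2*l+1) * s ^ (2*l+1) * \<phi> l s))"
proof -
  interpret Q: qh_sys p q r1 r2 g a \<Lambda> C by (rule q)
  show ?thesis unfolding Q.V_def
    by (rule Q.S.v_odd_expansion[OF Q.ok' K Q.sol_even_zero c(2,1)])
qed

lemma stable_focus_if:
  assumes a0: "a 0 < 0" and k: "2*k+1 \<le> KK" and zero: "\<And>l. l < k \<Longrightarrow> a (2*l+1) = 0" and neg: "a (2*k+1) < 0"
  shows "stable_focus (fld a) 0"
proof -
  obtain \<epsilon> \<Lambda> C c where cst: "\<epsilon> > 0" "c > 0" "C \<ge> 1"
    "\<And>a'. near a \<epsilon> a' \<Longrightarrow> qh_sys p q r1 r2 g a' \<Lambda> C"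
    "\<And>a' j. near a \<epsilon> a' \<Longrightarrow> j \<in> {1..KK} \<Longrightarrow> odd j \<Longrightarrow> c \<le> scalar_ode.cj (MM (- a' 0)) (om (- a' 0)) pi j"
    by (rule near_constants[where a = a, OF a0], rule that, assumption+)
  note nr = near_self[OF cst(1), of a]
  interpret Q: qh_sys p q r1 r2 g a \<Lambda> C by (rule cst(4)[OF nr])
  define P where "P = lipc KK pi C"
  define d where "d = Q.r * c / (4 * P)"
  have P: "P > 0" using cst(3) by (auto simp: P_def lipc_def)
  have d: "d > 0" using Q.r_pos cst P by (simp add: d_def)
  have K1: "KK \<ge> 1" using k by simp
  from V_expansion[OF cst(4)[OF nr] K1 cst(2) cst(5)[OF nr]]
  obtain \<phi> where \<phi>: "\<And>l s. l \<le> (KK-1) div 2 \<Longrightarrow> 0 < s \<Longrightarrow> s < d \<Longrightarrow> c / 2 \<le> \<phi> l s \<and> \<phi> l s \<le> P"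
     "\<And>s. 0 < s \<Longrightarrow> s < d \<Longrightarrow> Q.V s = (\<Sum>l\<le>(KK-1) div 2. a (2*l+1) * s ^ (2*l+1) * \<phi> l s)"
    unfolding d_def P_def by blast
  have kN: "k \<le> (KK-1) div 2" using k by simp
  obtain \<delta> where \<delta>: "\<delta> > 0" "\<forall>\<phi> s. 0 < s \<and> s < \<delta> \<and> (\<forall>l\<le>(KK-1) div 2. c / 2 \<le> \<phi> l \<and> \<phi> l \<le> P) \<longrightarrow>
     a (2*k+1) * (\<Sum>l\<le>(KK-1) div 2. a (2*l+1) * s ^ (2*l+1) * \<phi> l) > 0"
    using leading_sign[OF kN, of "\<lambda>l. a (2*l+1)" "c / 2" P] zero neg cst(2) by auto
  define s1 where "s1 = min (min \<delta> d) (Q.r / 2)"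
  show ?thesis
  proof (rule Q.stable_focus_of_negative[of s1])
    show "0 < s1" "s1 < Q.r" using \<delta> d Q.r_pos by (auto simp: s1_def)
    fix s assume s: "0 < s" "s < s1"
    then have "a (2*k+1) * Q.V s > 0"
      using \<delta>(2)[rule_format, of s "\<lambda>l. \<phi> l s"] \<phi>(1)[of _ s] \<phi>(2)[of s] by (simp add: s1_def)
    then show "Q.V s < 0" using neg by (simp add: zero_less_mult_iff)
  qed
qed

lemma focus_if:
  assumes a0: "a 0 < 0" and k: "2*k+1 \<le> KK" and zero: "\<And>l. l < k \<Longrightarrow> a (2*l+1) = 0" and nz: "a (2*k+1) \<noteq> 0"
  shows "is_focus (fld a) 0"
proof (cases "a (2*k+1) < 0")
  case True
  then show ?thesis using stable_focus_if[OF a0 k zero] by (simp add: is_focus_def)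
next
  case False
  \<comment> \<open>Reflecting the first coordinate and reversing time changes the sign of exactly
    the odd coefficients, so a positive leading coefficient becomes negative.\<close>
  define b where "b i = (-1) ^ i * a i" for i
  have "stable_focus (fld b) 0"
    by (rule stable_focus_if[of b k]) (use a0 k zero nz False in \<open>auto simp: b_def\<close>)
  then have "stable_focus (\<lambda>z. - fld a z) 0"
  proof (rule stable_focus_reflect)
    fix z :: "real^2"
    have "(\<Sum>i\<le>KK. b i * (- (z $ 1)) ^ (i * q) * (z $ 2) ^ (r1 - i * p)) = (\<Sum>i\<le>KK. a i * (z $ 1) ^ (i * q) * (z $ 2) ^ (r1 - i * p))"
    proof (intro sum.cong refl)
      fix i
      have "b i * (- (z $ 1)) ^ (i * q) = a i * (z $ 1) ^ (i * q)" using odd by (cases "even i") (auto simp: b_def)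
      then show "b i * (- (z $ 1)) ^ (i * q) * (z $ 2) ^ (r1 - i * p) = a i * (z $ 1) ^ (i * q) * (z $ 2) ^ (r1 - i * p)" by simp
    qed
    then show "- fld a z = vector [- fld b (vector [- (z $ 1), z $ 2]) $ 1, fld b (vector [- (z $ 1), z $ 2]) $ 2]"
      using odd by (simp add: family_A_def vec2_cong_iff)
  qed
  then show ?thesis by (simp add: is_focus_def)
qed

text \<open>Changing odd coefficients below \<open>2*k+1\<close> makes \<open>V\<close> alternate in
  sign at \<open>k+1\<close> points, which gives \<open>k\<close> zeros and \<open>k\<close> loops.
  They are limit cycles because, by \<open>orbit_bound\<close>, only finitely many periodic orbits
  lie in the disc.\<close>

lemma produce:
  assumes a0: "a 0 < 0" and k: "2*k+1 \<le> KK" and zero: "\<And>l. l < k \<Longrightarrow> a (2*l+1) = 0" and nz: "a (2*k+1) \<noteq> 0"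
    and U: "open U" "0 \<in> U" and e: "e > 0"
  shows "\<exists>a'. near a e a' \<and> (\<exists>L. finite L \<and> card L = k \<and> (\<forall>\<gamma>\<in>L. limit_cycle (fld a') \<gamma> \<and> \<gamma> \<subseteq> U))"
proof -
  obtain \<epsilon> \<Lambda> C c where cst: "\<epsilon> > 0" "c > 0" "C \<ge> 1"
    "\<And>a'. near a \<epsilon> a' \<Longrightarrow> qh_sys p q r1 r2 g a' \<Lambda> C"
    "\<And>a' j. near a \<epsilon> a' \<Longrightarrow> j \<in> {1..KK} \<Longrightarrow> odd j \<Longrightarrow> c \<le> scalar_ode.cj (MM (- a' 0)) (om (- a' 0)) pi j"
    by (rule near_constants[where a = a, OF a0], rule that, assumption+)
  from orbit_bound[where a = a, OF a0] obtain \<epsilon>1 \<delta>1 where ob0: "\<epsilon>1 > 0" "\<delta>1 > 0" "\<forall>a'. near a \<epsilon>1 a' \<longrightarrow>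
     ((\<exists>i\<in>{1..KK}. odd i \<and> a' i \<noteq> 0) \<longrightarrow>
        finite {\<gamma>. periodic_orbit (fld a') \<gamma> \<and> \<gamma> \<subseteq> ball 0 \<delta>1} \<and>
        card {\<gamma>. periodic_orbit (fld a') \<gamma> \<and> \<gamma> \<subseteq> ball 0 \<delta>1} \<le> (KK - 1) div 2) \<and>
     ((\<forall>i\<in>{1..KK}. odd i \<longrightarrow> a' i = 0) \<longrightarrow> (\<forall>\<gamma>. limit_cycle (fld a') \<gamma> \<longrightarrow> \<not> \<gamma> \<subseteq> ball 0 \<delta>1))"
    by (elim exE conjE) (rule that)
  have ob: "\<epsilon>1 > 0" "\<delta>1 > 0"
    "\<And>a'. near a \<epsilon>1 a' \<Longrightarrow> \<exists>i\<in>{1..KK}. odd i \<and> a' i \<noteq> 0 \<Longrightarrow> finite {\<gamma>. periodic_orbit (fld a') \<gamma> \<and> \<gamma> \<subseteq> ball 0 \<delta>1}"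
    using ob0 by simp_all
  obtain e0 where e0: "e0 > 0" "ball 0 e0 \<subseteq> U" using U open_contains_ball by blast
  define e1 where "e1 = min e0 \<delta>1"
  have e1: "e1 > 0" "ball 0 e1 \<subseteq> U" "ball (0::real^2) e1 \<subseteq> ball 0 \<delta>1" using e0 ob by (auto simp: e1_def)
  obtain \<delta>2 where \<delta>2: "\<delta>2 > 0" "\<And>s. 0 < s \<Longrightarrow> s < \<delta>2 \<Longrightarrow> Rb \<Lambda> s ^ (r1 + 1) + Rb \<Lambda> s ^ (r2 + 1) < e1"
    using Rb_small[OF e1(1), of \<Lambda>] by blast
  define P where "P = lipc KK pi C"
  define d where "d = rad KK pi C * c / (4 * P)"
  have P: "P > 0" using cst(3) by (auto simp: P_def lipc_def)
  interpret Q0: qh_sys p q r1 r2 g a \<Lambda> C by (rule cst(4)[OF near_self[OF cst(1)]])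
  have d: "d > 0" using Q0.r_pos cst P by (simp add: d_def)
  \<comment> \<open>One bound for two purposes: the size of the coefficient changes and the range of
    parameters in which the zeros are produced.\<close>
  define \<delta> where "\<delta> = Min {e, \<epsilon>, \<epsilon>1, \<delta>2, d, rad KK pi C}"
  have \<delta>: "\<delta> > 0" using e cst ob \<delta>2 d Q0.r_pos by (simp add: \<delta>_def)
  have \<delta>le: "\<delta> \<le> e" "\<delta> \<le> \<epsilon>" "\<delta> \<le> \<epsilon>1" "\<delta> \<le> \<delta>2" "\<delta> \<le> d" "\<delta> \<le> rad KK pi C"
    unfolding \<delta>_def by (intro Min_le; simp)+
  define N where "N = (KK - 1) div 2"
  have kN: "k \<le> N" using k by (simp add: N_def)
  have c2: "c / 2 > 0" using cst by simp
  have "\<exists>\<alpha>' x. (\<forall>l. \<bar>\<alpha>' l - a (2*l+1)\<bar> < \<delta>) \<and> (\<forall>l\<ge>k. \<alpha>' l = a (2*l+1)) \<and>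
     (\<forall>d\<le>k. 0 < x d \<and> x d < \<delta>) \<and> (\<forall>d<k. x (Suc d) < x d) \<and>
     (\<forall>\<phi>. (\<forall>l\<le>N. \<forall>s. 0 < s \<and> s < \<delta> \<longrightarrow> c / 2 \<le> \<phi> l s \<and> \<phi> l s \<le> P) \<longrightarrow>
        (\<forall>d\<le>k. (-1) ^ d * a (2*k+1) * (\<Sum>l\<le>N. \<alpha>' l * x d ^ (2*l+1) * \<phi> l (x d)) > 0))"
    by (rule alternating_perturbation[where \<alpha> = "\<lambda>l. a (2*l+1)", OF kN _ nz \<delta> c2]) (rule zero)
  then obtain \<alpha>' x where al0: "\<forall>l. \<bar>\<alpha>' l - a (2*l+1)\<bar> < \<delta>" "\<forall>l\<ge>k. \<alpha>' l = a (2*l+1)"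
     "\<forall>d\<le>k. 0 < x d \<and> x d < \<delta>" "\<forall>d<k. x (Suc d) < x d"
     "\<forall>\<phi>. (\<forall>l\<le>N. \<forall>s. 0 < s \<and> s < \<delta> \<longrightarrow> c / 2 \<le> \<phi> l s \<and> \<phi> l s \<le> P) \<longrightarrow>
        (\<forall>d\<le>k. (-1) ^ d * a (2*k+1) * (\<Sum>l\<le>N. \<alpha>' l * x d ^ (2*l+1) * \<phi> l (x d)) > 0)"
    by (elim exE conjE) (rule that)
  have al: "\<And>l. \<bar>\<alpha>' l - a (2*l+1)\<bar> < \<delta>" "\<And>l. l \<ge> k \<Longrightarrow> \<alpha>' l = a (2*l+1)"
     "\<And>d. d \<le> k \<Longrightarrow> 0 < x d \<and> x d < \<delta>" "\<And>d. d < k \<Longrightarrow> x (Suc d) < x d"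
    using al0(1-4) by simp_all
  note al = al al0(5)
  define a' where "a' i = (if odd i then \<alpha>' (i div 2) else a i)" for i
  have a'odd: "a' (2*l+1) = \<alpha>' l" for l by (simp add: a'_def)
  have "near a \<delta> a'"
    unfolding near_def
  proof (intro allI impI)
    fix i show "\<bar>a' i - a i\<bar> < \<delta>"
      using al(1)[of "i div 2"] \<delta> by (cases "odd i") (auto simp: a'_def)
  qed
  then have nr: "near a e a'" "near a \<epsilon> a'" "near a \<epsilon>1 a'" using \<delta>le near_mono by blast+
  interpret Q: qh_sys p q r1 r2 g a' \<Lambda> C by (rule cst(4)[OF nr(2)])
  have K1: "KK \<ge> 1" using k by simp
  from V_expansion[OF cst(4)[OF nr(2)] K1 cst(2) cst(5)[OF nr(2)]]
  obtain \<phi> where \<phi>: "\<And>l s. l \<le> N \<Longrightarrow> 0 < s \<Longrightarrow> s < d \<Longrightarrow> c / 2 \<le> \<phi> l s \<and> \<phi> l s \<le> P"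
     "\<And>s. 0 < s \<Longrightarrow> s < d \<Longrightarrow> Q.V s = (\<Sum>l\<le>N. a' (2*l+1) * s ^ (2*l+1) * \<phi> l s)"
    unfolding d_def P_def N_def by blast
  have sg: "(-1) ^ j * a (2*k+1) * Q.V (x j) > 0" if "j \<le> k" for j
  proof -
    have "x j < d" "0 < x j" using al(3)[OF that] \<delta>le by auto
    then have "Q.V (x j) = (\<Sum>l\<le>N. \<alpha>' l * x j ^ (2*l+1) * \<phi> l (x j))" using \<phi>(2)[of "x j"] by (simp only: a'odd)
    moreover have "\<forall>l\<le>N. \<forall>s. 0 < s \<and> s < \<delta> \<longrightarrow> c / 2 \<le> \<phi> l s \<and> \<phi> l s \<le> P" using \<phi>(1) \<delta>le by auto
    ultimately show ?thesis using al(5) that by simp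
  qed
  have contV: "continuous_on {0<..<\<delta>} Q.V"
    unfolding Q.V_def[abs_def] by (rule continuous_on_subset[OF Q.S.v_continuous_s[OF Q.ok']]) (use \<delta>le in auto)
  obtain Z where Z: "finite Z" "card Z = k" "Z \<subseteq> {0<..<\<delta>}" "\<forall>z\<in>Z. Q.V z = 0"
    using zeros_from_sign_changes[OF contV al(3,4) sg] by blast
  have Zp: "0 < s" "s < Q.r" "Q.h s = s" "s < \<delta>2" if "s \<in> Z" for s
    using Z(3,4) that \<delta>le Q.h_eq_iff[of s] by auto
  define L where "L = (\<lambda>s. range (Q.Gam (\<lambda>_. s))) ` Z"
  have sub: "range (Q.Gam (\<lambda>_. s)) \<subseteq> ball 0 e1" if "s \<in> Z" for s
  proof
    fix z assume "z \<in> range (Q.Gam (\<lambda>_. s))"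
    then obtain t where "z = Q.Gam (\<lambda>_. s) t" by auto
    then show "z \<in> ball 0 e1"
      using Q.norm_Gam_le[OF Q.link_const[OF Zp(1-3)[OF that]], of t] \<delta>2(2)[OF Zp(1,4)[OF that]] by simp
  qed
  have "inj_on (\<lambda>s. range (Q.Gam (\<lambda>_. s))) Z"
  proof (rule inj_onI)
    fix s s' assume *: "s \<in> Z" "s' \<in> Z" "range (Q.Gam (\<lambda>_. s)) = range (Q.Gam (\<lambda>_. s'))"
    have "Q.Gam (\<lambda>_. s) 0 \<in> range (Q.Gam (\<lambda>_. s))" "Q.Gam (\<lambda>_. s) 0 \<in> range (Q.Gam (\<lambda>_. s'))" using *(3) by blast+
    then show "s = s'" by (rule Q.loops_inj[OF Zp(1-3)[OF *(1)] Zp(1-3)[OF *(2)]])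
  qed
  then have "card L = k" using Z(2) by (simp add: L_def card_image)
  moreover have "finite L" using Z(1) by (simp add: L_def)
  moreover have "limit_cycle (fld a') \<gamma> \<and> \<gamma> \<subseteq> U" if \<gamma>: "\<gamma> \<in> L" for \<gamma>
  proof -
    obtain s where s: "s \<in> Z" "\<gamma> = range (Q.Gam (\<lambda>_. s))" using \<gamma> by (auto simp: L_def)
    have "\<exists>i\<in>{1..KK}. odd i \<and> a' i \<noteq> 0"
      using k nz al(2)[of k] a'odd[of k] by (intro bexI[of _ "2*k+1"]) auto
    from ob(3)[OF nr(3) this] have fin: "finite {\<gamma>. periodic_orbit (fld a') \<gamma> \<and> \<gamma> \<subseteq> ball 0 \<delta>1}" .
    have "limit_cycle (fld a') \<gamma>"
      by (rule limit_cycle_of_finite[OF Q.f_lip open_ball fin])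
         (use s sub[OF s(1)] e1 Q.fixed_point_periodic_orbit[OF Zp(1-3)[OF s(1)]] in auto)
    then show ?thesis using s sub[OF s(1)] e1 by auto
  qed
  ultimately show ?thesis using nr(1) by blast
qed

end

section \<open>Perturbations inside the family\<close>

lemma family_A_rescale:
  assumes "b0 \<noteq> 0"
  shows "family_A p q r1 r2 a b0 = (\<lambda>z. b0 *\<^sub>R family_A p q r1 r2 (\<lambda>i. a i / b0) 1 z)"
  using assms by (simp add: fun_eq_iff family_A_def vec2_cong_iff sum_distrib_left)

text \<open>Normalizing \<open>b0\<close> to 1 replaces coefficients by their ratios to
  \<open>b0\<close>; perturbations of both have to be transferred to these ratios.\<close>

lemma coefficient_ratio_near:
  fixes x x' b b' :: real
  assumes "b \<noteq> 0" "\<bar>x\<bar> \<le> A" "\<bar>x' - x\<bar> < e" "\<bar>b' - b\<bar> < e" "e \<le> \<bar>b\<bar> / 2" "e * (2 / \<bar>b\<bar> + 2 * A / \<bar>b\<bar>\<^sup>2) \<le> \<eta>"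
  shows "\<bar>x' / b' - x / b\<bar> < \<eta>"
proof -
  have b: "\<bar>b\<bar> > 0" using assms(1) by simp
  have b': "\<bar>b'\<bar> > \<bar>b\<bar> / 2" using assms(4,5) by linarith
  then have b'0: "b' \<noteq> 0" using b by auto
  have e: "e > 0" using assms(3) by linarith
  have "A \<ge> 0" using assms(2) by linarith
  have inv: "1 / \<bar>b'\<bar> \<le> 2 / \<bar>b\<bar>" using frac_le[of 1 1 "\<bar>b\<bar> / 2" "\<bar>b'\<bar>"] b b' by simp
  have "x' / b' - x / b = (x' - x) / b' + x * (b - b') / (b * b')"
    using assms(1) b'0 by (simp add: field_simps)
  then have "\<bar>x' / b' - x / b\<bar> \<le> \<bar>x' - x\<bar> * (1 / \<bar>b'\<bar>) + \<bar>x\<bar> * \<bar>b' - b\<bar> * (1 / \<bar>b\<bar>) * (1 / \<bar>b'\<bar>)"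
    using abs_triangle_ineq[of "(x' - x) / b'" "x * (b - b') / (b * b')"]
    by (simp add: abs_mult abs_divide abs_minus_commute)
  also have "\<dots> \<le> \<bar>x' - x\<bar> * (2 / \<bar>b\<bar>) + A * e * (1 / \<bar>b\<bar>) * (2 / \<bar>b\<bar>)"
    using inv assms(2,4) b e \<open>A \<ge> 0\<close> by (intro add_mono mult_mono mult_left_mono) auto
  also have "\<dots> < e * (2 / \<bar>b\<bar>) + A * e * (1 / \<bar>b\<bar>) * (2 / \<bar>b\<bar>)"
    using assms(3) b by (intro add_strict_right_mono mult_strict_right_mono) auto
  also have "\<dots> = e * (2 / \<bar>b\<bar> + 2 * A / \<bar>b\<bar>\<^sup>2)" by (simp add: power2_eq_square distrib_left)
  finally show ?thesis using assms(6) by linarith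
qed

context qh
begin

text \<open>Index 0 could only give \<open>y\<close>, which \<open>r2 < r1\<close> excludes. A
  larger index could only give \<open>x\<close>, with \<open>i = q = 1\<close> and
  \<open>r1 = p\<close>; then \<open>weights\<close> would read
  \<open>r1 + 1 = r1 * (r2 + 1) + g\<close>, which is too large.\<close>

lemma no_linear_term:
  assumes "i \<le> KK" "r2 < r1"
  shows "i * q + (r1 - i * p) \<noteq> 1"
proof
  assume 1: "i * q + (r1 - i * p) = 1"
  show False
  proof (cases "i = 0")
    case True
    then have "r1 = 1" using 1 by simp
    then show False using assms(2) r2_pos by simp
  next
    case False
    have "i * q \<ge> 1" using False q_pos by simp
    then have iq1: "i * q = 1" and z: "r1 - i * p = 0" using 1 by linarith+
    from iq1 have iq: "i = 1" "q = 1" by auto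
    then have "r1 = p" using z idx_le[OF assms(1)] by simp
    then have "r1 + 1 = r1 * (r2 + 1) + g" using weights unfolding iq(2) by (metis mult_1)
    moreover have "r1 * (r2 + 1) \<ge> r1 * 2" using r2_pos by (intro mult_le_mono) auto
    ultimately show False using g r1_pos by linarith
  qed
qed

lemma family_A_derivative_0:
  assumes "r2 < r1"
  shows "(family_A p q r1 r2 a b0 has_derivative (\<lambda>h. vector [0, (if r2 = 1 then b0 else 0) * (h $ 1)])) (at 0)"
proof -
  have mono: "((\<lambda>z::real^2. c * (z $ 1) ^ m * (z $ 2) ^ n) has_derivative (\<lambda>h. 0)) (at 0)" if mn: "m + n \<noteq> 1" for c :: real and m n
  proof (cases "m + n = 0")
    case True
    then show ?thesis by simp
  next
    case False
    have "((\<lambda>z::real^2. c * (z $ 1) ^ m * (z $ 2) ^ n) has_derivative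
       (\<lambda>h. c * (0 ^ m * (of_nat n * (h $ 2) * 0 ^ (n - 1)) + of_nat m * (h $ 1) * 0 ^ (m - 1) * 0 ^ n))) (at 0)"
      by (auto intro!: derivative_eq_intros bounded_linear.has_derivative[OF bounded_linear_vec_nth] simp: algebra_simps)
    moreover have z: "c * (0 ^ m * (of_nat n * y * 0 ^ (n - 1)) + of_nat m * x * 0 ^ (m - 1) * 0 ^ n) = 0" for x y :: real
    proof -
      consider "m \<ge> 1" "n \<ge> 1" | "m = 0" "n \<ge> 2" | "n = 0" "m \<ge> 2" using mn False by linarith
      then show ?thesis by cases (auto simp: power_0_left)
    qed
    ultimately show ?thesis by (simp only: z)
  qed
  have X: "((\<lambda>z::real^2. \<Sum>i\<le>KK. a i * (z $ 1) ^ (i * q) * (z $ 2) ^ (r1 - i * p)) has_derivative (\<lambda>h. \<Sum>i\<le>KK. 0)) (at 0)"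
    by (intro has_derivative_sum mono) (use no_linear_term[OF _ assms] in auto)
  have Y: "((\<lambda>z::real^2. b0 * (z $ 1) ^ r2) has_derivative (\<lambda>h. (if r2 = 1 then b0 else 0) * (h $ 1))) (at 0)"
  proof (cases "r2 = 1")
    case True
    then show ?thesis by (auto intro!: derivative_eq_intros bounded_linear.has_derivative[OF bounded_linear_vec_nth])
  next
    case False
    then show ?thesis using mono[of r2 0 b0] by simp
  qed
  have "((\<lambda>z::real^2. (\<Sum>i\<le>KK. a i * (z $ 1) ^ (i * q) * (z $ 2) ^ (r1 - i * p)) *\<^sub>R axis 1 1 + (b0 * (z $ 1) ^ r2) *\<^sub>R (axis 2 1 :: real^2))
     has_derivative (\<lambda>h. (\<Sum>i\<le>KK. 0) *\<^sub>R axis 1 1 + ((if r2 = 1 then b0 else 0) * (h $ 1)) *\<^sub>R (axis 2 1 :: real^2))) (at 0)"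
    by (intro has_derivative_add bounded_linear.has_derivative[OF bounded_linear_scaleR_left] X Y)
  then show ?thesis by (simp only: family_A_def[abs_def] vec2_eq sum.neutral_const)
qed

text \<open>The only entry of the Jacobian that can be nonzero stands below the diagonal (it is
  \<open>b0\<close> when \<open>r2 = 1\<close>), so 0 is the only eigenvalue.\<close>

lemma nilpotent_linearization:
  assumes "r2 < r1" "complex_eigenvalue (jacobian (family_A p q r1 r2 a b0) (at 0)) \<mu>"
  shows "Re \<mu> = 0"
proof -
  define k where "k = (if r2 = 1 then b0 else 0)"
  define J where "J = jacobian (family_A p q r1 r2 a b0) (at 0)"
  have fd: "frechet_derivative (family_A p q r1 r2 a b0) (at 0) = (\<lambda>h. vector [0, k * (h $ 1)])"
    using frechet_derivative_at[OF family_A_derivative_0[OF assms(1)]] by (simp add: k_def)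
  have J: "J $ 1 $ 1 = 0" "J $ 1 $ 2 = 0" "J $ 2 $ 1 = k" "J $ 2 $ 2 = 0"
    unfolding J_def jacobian_def fd matrix_def by (simp_all add: axis_def)
  obtain v :: "complex^2" where v: "v \<noteq> 0" "map_matrix complex_of_real J *v v = \<mu> *s v"
    using assms(2) unfolding complex_eigenvalue_def J_def by blast
  have "(map_matrix complex_of_real J *v v) $ 1 = \<mu> * v $ 1" "(map_matrix complex_of_real J *v v) $ 2 = \<mu> * v $ 2"
    using v(2) by simp_all
  then have e: "0 = \<mu> * v $ 1" "of_real k * v $ 1 = \<mu> * v $ 2"
    by (simp_all add: matrix_vector_mult_def sum_2 J map_matrix_def)
  have "\<mu> = 0"
  proof (rule ccontr)
    assume "\<mu> \<noteq> 0"
    then have "v $ 1 = 0" "v $ 2 = 0" using e by auto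
    then show False using v(1) by (simp add: vec_eq_iff forall_2)
  qed
  then show ?thesis by simp
qed

context
  fixes a :: "nat \<Rightarrow> real" and b0 :: real
  assumes sgn: "a 0 * b0 < 0"
begin

lemma b0_nz: "b0 \<noteq> 0" using sgn by auto

lemma ratio_neg: "a 0 / b0 < 0" using sgn by (simp add: mult_less_0_iff divide_less_0_iff)

lemma focus_nonzero:
  assumes "2*k+1 \<le> KK" "\<And>l. l < k \<Longrightarrow> a (2*l+1) = 0" "a (2*k+1) \<noteq> 0"
  shows "is_focus (family_A p q r1 r2 a b0) 0"
proof -
  have "is_focus (fld (\<lambda>i. a i / b0)) 0"
    by (rule focus_if[of "\<lambda>i. a i / b0" k]) (use ratio_neg b0_nz assms in auto)
  then show ?thesis unfolding family_A_rescale[OF b0_nz, of p q r1 r2 a] by (rule is_focus_scale[OF _ b0_nz])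
qed

lemma center_iff:
  "is_center (family_A p q r1 r2 a b0) 0 \<longleftrightarrow> (\<forall>i\<in>{1..KK}. odd i \<longrightarrow> a i = 0)"
proof
  assume "\<forall>i\<in>{1..KK}. odd i \<longrightarrow> a i = 0"
  then have "is_center (fld (\<lambda>i. a i / b0)) 0" using ratio_neg by (intro center_if) auto
  then show "is_center (family_A p q r1 r2 a b0) 0"
    unfolding family_A_rescale[OF b0_nz, of p q r1 r2 a] using is_center_scale_iff[OF b0_nz] by blast
next
  assume cen: "is_center (family_A p q r1 r2 a b0) 0"
  show "\<forall>i\<in>{1..KK}. odd i \<longrightarrow> a i = 0"
  proof (rule ccontr)
    assume "\<not> (\<forall>i\<in>{1..KK}. odd i \<longrightarrow> a i = 0)"
    then obtain i where "i \<in> {1..KK}" "odd i" "a i \<noteq> 0" by blast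
    then have ex: "\<exists>l. 2*l+1 \<le> KK \<and> a (2*l+1) \<noteq> 0" by (intro exI[of _ "i div 2"]) auto
    \<comment> \<open>The least odd index with nonzero coefficient makes the origin a focus, which
      excludes a center.\<close>
    define k where "k = (LEAST l. 2*l+1 \<le> KK \<and> a (2*l+1) \<noteq> 0)"
    have k: "2*k+1 \<le> KK" "a (2*k+1) \<noteq> 0" using LeastI_ex[OF ex] by (auto simp: k_def)
    have "a (2*l+1) = 0" if "l < k" for l
      using not_less_Least[of l "\<lambda>l. 2*l+1 \<le> KK \<and> a (2*l+1) \<noteq> 0", folded k_def] that k(1) by auto
    then have "is_focus (family_A p q r1 r2 a b0) 0" using focus_nonzero k by blast
    then show False using focus_not_center[OF family_A_lip] cen by blast
  qed
qed

lemma can_produce_nonzero: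
  assumes k: "2*k+1 \<le> KK" and zero: "\<And>l. l < k \<Longrightarrow> a (2*l+1) = 0" and nz: "a (2*k+1) \<noteq> 0"
  shows "can_produce_limit_cycles p q r1 r2 a b0 k"
  unfolding can_produce_limit_cycles_def
proof (intro allI impI)
  fix U :: "(real^2) set" and \<epsilon> :: real assume U: "open U \<and> 0 \<in> U \<and> \<epsilon> > 0"
  have "\<exists>a'. near (\<lambda>i. a i / b0) (\<epsilon> / \<bar>b0\<bar>) a' \<and> (\<exists>L. finite L \<and> card L = k \<and> (\<forall>\<gamma>\<in>L. limit_cycle (fld a') \<gamma> \<and> \<gamma> \<subseteq> U))"
    by (rule produce[where a = "\<lambda>i. a i / b0"]) (use U ratio_neg b0_nz k zero nz in auto)
  then obtain a' L where a': "near (\<lambda>i. a i / b0) (\<epsilon> / \<bar>b0\<bar>) a'"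
    and L: "finite L" "card L = k" "\<forall>\<gamma>\<in>L. limit_cycle (fld a') \<gamma> \<and> \<gamma> \<subseteq> U" by blast
  show "\<exists>a' b0'. (\<forall>i\<le>KK. \<bar>a' i - a i\<bar> < \<epsilon>) \<and> \<bar>b0' - b0\<bar> < \<epsilon> \<and>
    (\<exists>L. finite L \<and> card L = k \<and> (\<forall>\<gamma>\<in>L. limit_cycle (family_A p q r1 r2 a' b0') \<gamma> \<and> \<gamma> \<subseteq> U))"
  \<comment> \<open>Only the \<open>a i\<close> are perturbed; multiplication by the fixed
    \<open>b0\<close> undoes the normalization.\<close>
  proof (intro exI[of _ "\<lambda>i. b0 * a' i"] exI[of _ b0] conjI exI[of _ L] L(1,2) allI impI ballI)
    fix i assume "i \<le> KK"
    then have "\<bar>a' i - a i / b0\<bar> < \<epsilon> / \<bar>b0\<bar>" using a' by (simp add: near_def)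
    then have "\<bar>b0\<bar> * \<bar>a' i - a i / b0\<bar> < \<epsilon>" using b0_nz by (simp add: field_simps)
    moreover have "\<bar>b0\<bar> * \<bar>a' i - a i / b0\<bar> = \<bar>b0 * a' i - a i\<bar>"
      unfolding abs_mult[symmetric] using b0_nz by (simp add: right_diff_distrib)
    ultimately show "\<bar>b0 * a' i - a i\<bar> < \<epsilon>" by simp
  next
    show "\<bar>b0 - b0\<bar> < \<epsilon>" using U by simp
  next
    fix \<gamma> assume "\<gamma> \<in> L"
    then have "limit_cycle (fld a') \<gamma>" "\<gamma> \<subseteq> U" using L by auto
    moreover have "family_A p q r1 r2 (\<lambda>i. b0 * a' i) b0 = (\<lambda>z. b0 *\<^sub>R fld a' z)"
      using family_A_rescale[OF b0_nz, of p q r1 r2 "\<lambda>i. b0 * a' i"] b0_nz by simp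
    ultimately show "limit_cycle (family_A p q r1 r2 (\<lambda>i. b0 * a' i) b0) \<gamma>" "\<gamma> \<subseteq> U"
      using limit_cycle_scale_iff[OF b0_nz] by auto
  qed
qed

text \<open>Since \<open>b0\<close> varies too, closeness first passes to the ratios. Then either
  the limit cycles are among few periodic orbits or there are none, according to the two cases of
  \<open>orbit_bound\<close>.\<close>

lemma can_produce_le:
  assumes "can_produce_limit_cycles p q r1 r2 a b0 k"
  shows "k \<le> (KK - 1) div 2"
proof -
  from orbit_bound[where a = "\<lambda>i. a i / b0", OF ratio_neg] obtain \<eta> \<delta> where ob: "\<eta> > 0" "\<delta> > 0"
    "\<forall>a'. near (\<lambda>i. a i / b0) \<eta> a' \<longrightarrow>
     ((\<exists>i\<in>{1..KK}. odd i \<and> a' i \<noteq> 0) \<longrightarrow>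
        finite {\<gamma>. periodic_orbit (fld a') \<gamma> \<and> \<gamma> \<subseteq> ball 0 \<delta>} \<and>
        card {\<gamma>. periodic_orbit (fld a') \<gamma> \<and> \<gamma> \<subseteq> ball 0 \<delta>} \<le> (KK - 1) div 2) \<and>
     ((\<forall>i\<in>{1..KK}. odd i \<longrightarrow> a' i = 0) \<longrightarrow> (\<forall>\<gamma>. limit_cycle (fld a') \<gamma> \<longrightarrow> \<not> \<gamma> \<subseteq> ball 0 \<delta>))"
    by (elim exE conjE) (rule that)
  define A where "A = (\<Sum>i\<le>KK. \<bar>a i\<bar>)"
  have A: "\<bar>a i\<bar> \<le> A" if "i \<le> KK" for i unfolding A_def using that by (intro member_le_sum) auto
  define D where "D = 2 / \<bar>b0\<bar> + 2 * A / \<bar>b0\<bar>\<^sup>2"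
  have "A \<ge> 0" by (simp add: A_def sum_nonneg)
  then have D: "D > 0" using b0_nz by (auto simp: D_def intro!: add_pos_nonneg)
  define \<epsilon> where "\<epsilon> = min (\<bar>b0\<bar> / 2) (\<eta> / D)"
  have \<epsilon>: "\<epsilon> > 0" using b0_nz ob(1) D by (simp add: \<epsilon>_def)
  have \<epsilon>2: "\<epsilon> \<le> \<bar>b0\<bar> / 2" unfolding \<epsilon>_def by (rule min.cobounded1)
  have "\<epsilon> \<le> \<eta> / D" by (simp add: \<epsilon>_def)
  then have \<epsilon>D: "\<epsilon> * D \<le> \<eta>" using D by (simp add: pos_le_divide_eq)
  have "open (ball (0::real^2) \<delta>) \<and> 0 \<in> ball (0::real^2) \<delta> \<and> \<epsilon> > 0" using ob(2) \<epsilon> by simp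
  then obtain a' b0' L where pr: "\<forall>i\<le>KK. \<bar>a' i - a i\<bar> < \<epsilon>" "\<bar>b0' - b0\<bar> < \<epsilon>" "finite L" "card L = k"
     "\<forall>\<gamma>\<in>L. limit_cycle (family_A p q r1 r2 a' b0') \<gamma> \<and> \<gamma> \<subseteq> ball 0 \<delta>"
    using assms[unfolded can_produce_limit_cycles_def, rule_format, of "ball 0 \<delta>" \<epsilon>] by blast
  have b': "b0' \<noteq> 0" using pr(2) \<epsilon>2 b0_nz by auto
  define b where "b i = a' i / b0'" for i
  have nb: "near (\<lambda>i. a i / b0) \<eta> b"
    unfolding near_def b_def
  proof (intro allI impI)
    fix i assume "i \<le> KK"
    then show "\<bar>a' i / b0' - a i / b0\<bar> < \<eta>"
      using coefficient_ratio_near[OF b0_nz A _ pr(2) \<epsilon>2 \<epsilon>D[unfolded D_def]] pr(1) by simp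
  qed
  note ob' = ob(3)[THEN spec[where x = b], THEN mp, OF nb]
  have lc: "limit_cycle (fld b) \<gamma>" "\<gamma> \<subseteq> ball 0 \<delta>" if "\<gamma> \<in> L" for \<gamma>
    using pr(5) that unfolding family_A_rescale[OF b', of p q r1 r2 a'] b_def limit_cycle_scale_iff[OF b'] by auto
  show ?thesis
  proof (cases "\<exists>i\<in>{1..KK}. odd i \<and> b i \<noteq> 0")
    case True
    define P where "P = {\<gamma>. periodic_orbit (fld b) \<gamma> \<and> \<gamma> \<subseteq> ball 0 \<delta>}"
    have P: "finite P" "card P \<le> (KK - 1) div 2" using conjunct1[OF ob'] True by (simp_all add: P_def)
    have "L \<subseteq> P" unfolding P_def
      using lc[unfolded limit_cycle_def] by blast
    then have "card L \<le> card P" by (rule card_mono[OF P(1)])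
    then show ?thesis using P pr(4) by simp
  next
    case False
    then have ev: "\<forall>i\<in>{1..KK}. odd i \<longrightarrow> b i = 0" by auto
    have "L = {}"
    proof (rule equals0I)
      fix \<gamma> assume "\<gamma> \<in> L"
      then show False using conjunct2[OF ob'] ev lc by simp
    qed
    then show ?thesis using pr(4) by simp
  qed
qed

end

text \<open>Half of the tolerance leads to a nearby vector, the other half to its own perturbation.
  In this way a center inherits what foci arbitrarily close to it produce.\<close>

lemma can_produce_mono_coeff:
  assumes "\<And>\<epsilon>. \<epsilon> > 0 \<Longrightarrow> \<exists>a'. (\<forall>i\<le>KK. \<bar>a' i - a i\<bar> < \<epsilon>) \<and> can_produce_limit_cycles p q r1 r2 a' b0 k"
  shows "can_produce_limit_cycles p q r1 r2 a b0 k"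
  unfolding can_produce_limit_cycles_def
proof (intro allI impI)
  fix U :: "(real^2) set" and \<epsilon> :: real assume U: "open U \<and> 0 \<in> U \<and> \<epsilon> > 0"
  then have "\<epsilon> / 2 > 0" by simp
  then obtain a1 where a1: "\<forall>i\<le>KK. \<bar>a1 i - a i\<bar> < \<epsilon> / 2" "can_produce_limit_cycles p q r1 r2 a1 b0 k" using assms by blast
  have "open U \<and> 0 \<in> U \<and> \<epsilon> / 2 > 0" using U by simp
  then obtain a' b0' where *: "\<forall>i\<le>KK. \<bar>a' i - a1 i\<bar> < \<epsilon> / 2" "\<bar>b0' - b0\<bar> < \<epsilon> / 2"
    "\<exists>L. finite L \<and> card L = k \<and> (\<forall>\<gamma>\<in>L. limit_cycle (family_A p q r1 r2 a' b0') \<gamma> \<and> \<gamma> \<subseteq> U)"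
    using a1(2)[unfolded can_produce_limit_cycles_def, rule_format, of U "\<epsilon> / 2"] by blast
  have "\<bar>a' i - a i\<bar> < \<epsilon>" if "i \<le> KK" for i
  proof -
    have "\<bar>a' i - a1 i\<bar> < \<epsilon> / 2" "\<bar>a1 i - a i\<bar> < \<epsilon> / 2" using *(1) a1(1) that by auto
    then show ?thesis by linarith
  qed
  moreover have "\<bar>b0' - b0\<bar> < \<epsilon>" using *(2) by linarith
  ultimately show "\<exists>a' b0'. (\<forall>i\<le>KK. \<bar>a' i - a i\<bar> < \<epsilon>) \<and> \<bar>b0' - b0\<bar> < \<epsilon> \<and>
    (\<exists>L. finite L \<and> card L = k \<and> (\<forall>\<gamma>\<in>L. limit_cycle (family_A p q r1 r2 a' b0') \<gamma> \<and> \<gamma> \<subseteq> U))"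
    using *(3) by blast
qed

text \<open>An arbitrarily small last odd coefficient turns the center into a focus of the highest
  possible order.\<close>

lemma can_produce_center:
  fixes a :: "nat \<Rightarrow> real"
  assumes sgn: "a 0 * b0 < 0" and ev: "\<forall>i\<in>{1..KK}. odd i \<longrightarrow> a i = 0"
  shows "can_produce_limit_cycles p q r1 r2 a b0 ((KK - 1) div 2)"
proof (cases "KK = 0")
  case True
  then show ?thesis unfolding can_produce_limit_cycles_def
    by (intro allI impI exI[of _ a] exI[of _ b0] conjI exI[of _ "{}"]) auto
next
  case False
  define k where "k = (KK - 1) div 2"
  have k: "2*k+1 \<le> KK" using False by (simp add: k_def)
  show ?thesis unfolding k_def[symmetric]
  proof (rule can_produce_mono_coeff)
    fix \<epsilon> :: real assume \<epsilon>: "\<epsilon> > 0"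
    define a' where "a' = a(2*k+1 := \<epsilon> / 2)"
    have "can_produce_limit_cycles p q r1 r2 a' b0 k"
    proof (rule can_produce_nonzero[OF _ k])
      show "a' 0 * b0 < 0" using sgn by (simp add: a'_def)
      show "a' (2*k+1) \<noteq> 0" using \<epsilon> by (simp add: a'_def)
      show "a' (2*l+1) = 0" if "l < k" for l using ev that k by (simp add: a'_def)
    qed
    moreover have "\<forall>i\<le>KK. \<bar>a' i - a i\<bar> < \<epsilon>" using ev k \<epsilon> by (auto simp: a'_def)
    ultimately show "\<exists>a'. (\<forall>i\<le>KK. \<bar>a' i - a i\<bar> < \<epsilon>) \<and> can_produce_limit_cycles p q r1 r2 a' b0 k" by blast
  qed
qed

lemma cyclicity_center:
  fixes a :: "nat \<Rightarrow> real"
  assumes sgn: "a 0 * b0 < 0" and ev: "\<forall>i\<in>{1..KK}. odd i \<longrightarrow> a i = 0"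
  shows "cyclicity p q r1 r2 a b0 = enat ((KK - 1) div 2)"
  unfolding cyclicity_def
proof (rule antisym)
  show "Sup (enat ` {k. can_produce_limit_cycles p q r1 r2 a b0 k}) \<le> enat ((KK - 1) div 2)"
    using can_produce_le[of a b0, OF sgn] by (auto intro!: Sup_least)
  show "enat ((KK - 1) div 2) \<le> Sup (enat ` {k. can_produce_limit_cycles p q r1 r2 a b0 k})"
    using can_produce_center[of a b0, OF sgn ev] by (intro Sup_upper) auto
qed

end

theorem theorem3:
  fixes p q m n r1 r2 \<kappa> :: nat and a :: "nat \<Rightarrow> real" and b0 :: real
  assumes "odd p" "odd q" "odd m" "odd n"
    and "coprime p q"
    and "q dvd p + m - 1" "p dvd q + n - 1"
    and "r1 = (p + m - 1) div q" "r2 = (q + n - 1) div p"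
    and "odd r1" "odd r2"
    and "r1 > r2" "m > n"
    and "a 0 * b0 < 0"
    and "\<kappa> = kappa (r1 div p)"
  shows
    "(is_center (family_A p q r1 r2 a b0) 0 \<longleftrightarrow> (\<forall>j. odd j \<and> j \<le> \<kappa> \<longrightarrow> a j = 0)) \<and>
     (\<forall>i. 1 \<le> i \<and> 2 * i - 1 \<le> \<kappa> \<and>
          (\<forall>j. 1 \<le> j \<and> j < i \<longrightarrow> a (2 * j - 1) = 0) \<and> a (2 * i - 1) \<noteq> 0 \<longrightarrow>
        weak_focus (family_A p q r1 r2 a b0) 0 \<and>
        can_produce_limit_cycles p q r1 r2 a b0 (i - 1)) \<and>
     (is_center (family_A p q r1 r2 a b0) 0 \<longrightarrow>
        cyclicity p q r1 r2 a b0 = enat ((\<kappa> - 1) div 2) \<and>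
        (\<kappa> - 1) div 2 = (r1 div p - 1) div 2)"
proof -
  define K where "K = r1 div p"
  have "q > 0" "p > 0" "m > 0" "n > 0" using assms(1-4) odd_pos by auto
  have w1: "q * r1 = p + m - 1" and w2: "p * r2 = q + n - 1" using assms(6-9) by auto
  \<comment> \<open>Both sides of the two divisibility relations are added up; \<open>m > n\<close>
    makes the subtraction exact and \<open>g\<close> positive.\<close>
  have weights: "q * (r1 + 1) = p * (r2 + 1) + (m - n)"
    using w1 w2 \<open>q > 0\<close> \<open>p > 0\<close> \<open>m > 0\<close> \<open>n > 0\<close> assms(13) by (simp add: distrib_left)
  interpret qh p q r1 r2 "m - n"
    by unfold_locales (use assms(1,2,10,11,13) weights in auto)
  note sgn = assms(14)
  \<comment> \<open>\<kappa> is the largest odd number not exceeding \<open>K\<close>, and 0 for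
    \<open>K = 0\<close> by truncation, so both bound the same odd indices.\<close>
  have odd_le: "j \<le> \<kappa> \<longleftrightarrow> j \<le> K" if "odd j" for j
  proof (cases "odd K")
    case True
    then show ?thesis using assms(15) by (simp add: kappa_def K_def)
  next
    case False
    then have "j \<noteq> K" using that by auto
    moreover have "\<kappa> = K - 1" using False assms(15) by (simp add: kappa_def K_def)
    ultimately show ?thesis using odd_pos[OF that] by linarith
  qed
  have ev: "(\<forall>j. odd j \<and> j \<le> \<kappa> \<longrightarrow> a j = 0) \<longleftrightarrow> (\<forall>i\<in>{1..K}. odd i \<longrightarrow> a i = 0)"
    using odd_le odd_pos by (metis One_nat_def Suc_leI atLeastAtMost_iff)
  have half: "(\<kappa> - 1) div 2 = (K - 1) div 2"
  proof (cases "odd K")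
    case True
    then show ?thesis using assms(15) by (simp add: kappa_def K_def)
  next
    case False
    then have "\<kappa> = K - 1" "even K" using assms(15) by (simp_all add: kappa_def K_def)
    then show ?thesis by presburger
  qed
  have cen: "is_center (family_A p q r1 r2 a b0) 0 \<longleftrightarrow> (\<forall>j. odd j \<and> j \<le> \<kappa> \<longrightarrow> a j = 0)"
    unfolding ev K_def by (rule center_iff[of a b0, OF sgn])
  have focus: "weak_focus (family_A p q r1 r2 a b0) 0 \<and> can_produce_limit_cycles p q r1 r2 a b0 (i - 1)"
    if i: "1 \<le> i" "2 * i - 1 \<le> \<kappa>" "\<forall>j. 1 \<le> j \<and> j < i \<longrightarrow> a (2 * j - 1) = 0" "a (2 * i - 1) \<noteq> 0" for i
  proof -
    \<comment> \<open>The odd indices are counted from zero in the lemmas, hence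
      \<open>k = i - 1\<close>.\<close>
    have e: "2 * (i - 1) + 1 = 2 * i - 1" using i(1) by simp
    have k: "2 * (i - 1) + 1 \<le> r1 div p"
      using odd_le[of "2 * i - 1"] i(1,2) unfolding e K_def by simp
    have z: "a (2 * l + 1) = 0" if "l < i - 1" for l
      using i(3)[rule_format, of "l + 1"] that by simp
    have nz: "a (2 * (i - 1) + 1) \<noteq> 0" using i(4) e by simp
    show ?thesis unfolding weak_focus_def
      using focus_nonzero[of a b0, OF sgn k z nz] can_produce_nonzero[of a b0, OF sgn k z nz]
        nilpotent_linearization[OF assms(12)] by blast
  qed
  have "cyclicity p q r1 r2 a b0 = enat ((\<kappa> - 1) div 2)" if "is_center (family_A p q r1 r2 a b0) 0"
    using cyclicity_center[of a b0, OF sgn] that cen ev half by (simp add: K_def)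
  then show ?thesis unfolding K_def[symmetric] using cen focus half by (intro conjI allI impI) blast+
qed

end
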